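(* Let $\Omega\subset\mathbb{R}^N$ be a bounded domain with Lipschitz boundary, let $\Phi:\mathbb{R}^N\to\mathbb{R}$ and $\vec q=\nabla\Phi$ satisfy assumptions (SH) (listed in the context), and let $u_0\in BV(\Omega)\cap L^\infty(\Omega)$ have zero trace on $\partial\Omega$. Let $T>0$. If $(u_1,\lambda_1)$ and $(u_2,\lambda_2)$ are both generalized Young measure solutions (defined in the context) of the problem $$\partial_t u=\operatorname{div}\,\vec q(\nabla u)\ \text{in }\Omega\times(0,T),\qquad u=0\ \text{on }\partial\Omega\times(0,T),\qquad u(\cdot,0)=u_0\ \text{in }\Omega ,$$ then $u_1=u_2$ a.e. in $\Omega\times(0,T)$.
   Context: Notation. $\Omega_T=\Omega\times(0,T)$; $\mathcal{L}^N$ is Lebesgue measure, $\mathcal{H}^{N-1}$ is Hausdorff measure; $\mathbb{B}^N$ is the open unit ball of $\mathbb{R}^N$ and $\partial\mathbb{B}^N$ the unit sphere; $\vec n$ is the outer unit normal on $\partial\Omega$; $I$ is the identity map of $\mathbb{R}^N$ and $(\vec q\cdot I)(A)=\vec q(A)\cdot A$; $\mathcal{M}(X)$ denotes finite (possibly vector-valued) Radon measures on $X$, $\mathcal{M}_+(X)$ the positive ones, $\mathcal{M}_1^+(X)$ the probability measures; $\mu_1\ge\mu_2$ in $\mathcal{M}(X)$ means $\mu_1-\mu_2\in\mathcal{M}_+(X)$; $\langle\mu,f\rangle=\int f\,d\mu$; $s_+=\max\{s,0\}$. $\Phi^{**}$ is the convexification of $\Phi$, i.e. the supremum of all convex $f\le\Phi$.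 For $u\in BV(\Omega)$, $u^\Omega$ is the trace of $u$ on $\partial\Omega$. $\tilde\Omega$ is a fixed bounded smooth domain with $\Omega\subset\subset\tilde\Omega$, and $\tilde u$ is the extension of $u$ by $0$ to $\tilde\Omega$. Integrands. $\mathcal{E}(\Omega;\mathbb{R}^N)$ is the set of $f\in C(\overline\Omega\times\mathbb{R}^N)$ such that $(Tf)(x,\hat A)=(1-|\hat A|)f\big(x,\frac{\hat A}{1-|\hat A|}\big)$, $x\in\overline\Omega$, $\hat A\in\mathbb{B}^N$, extends to a continuous function on $\overline{\Omega\times\mathbb{B}^N}$. Its recession function is $f^\infty(x,A)=\lim_{x'\to x,\,A'\to A,\,t\to\infty}f(x',tA')/t$. Functions of $A$ only are regarded as functions constant in $x$. Assumptions (SH). (SH1) $\Phi\in C^1(\mathbb{R}^N)$, $\Phi(0)=\inf_{\mathbb{R}^N}\Phi$, and $\Phi\in\mathcal{E}(\Omega;\mathbb{R}^N)$. (SH2) For some $0<\lambda_0\le\Lambda$ and all $A\in\mathbb{R}^N$: $(\lambda_0|A|-1)_+\le\Phi(A)\le\Lambda|A|+1$ and $|\vec q(A)|\le\Lambda$. (SH3) $\vec q\cdot I\in\mathcal{E}(\Omega;\mathbb{R}^N)$ and $(\vec q\cdot I)^\infty=\Phi^\infty=(\Phi^{**})^\infty$. (SH4) For all $\eta\in\partial\mathbb{B}^N$ and all $\xi$ with $\Phi^{**}(\xi)=\Phi(\xi)$: $\vec q(\xi)\cdot\eta\le(\vec q\cdot I)^\infty(\eta)$. Generalized Young measures. $Y(\Omega;\mathbb{R}^N)$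 is the set of triples $\lambda=(\nu_x,\lambda_\nu,\nu_x^\infty)$ where $(\nu_x)_{x\in\Omega}\subset\mathcal{M}_1^+(\mathbb{R}^N)$ is weakly* measurable with respect to $\mathcal{L}^N$ (i.e. $x\mapsto\langle\nu_x,f(x,\cdot)\rangle$ is $\mathcal L^N$-measurable for bounded Borel $f$), $\lambda_\nu\in\mathcal{M}_+(\overline\Omega)$, $(\nu_x^\infty)_{x\in\overline\Omega}\subset\mathcal{M}_1^+(\partial\mathbb{B}^N)$ is weakly* measurable with respect to $\lambda_\nu$, and $x\mapsto\langle\nu_x,|\cdot|\rangle\in L^1(\Omega)$. The duality pairing with $f\in\mathcal{E}(\Omega;\mathbb{R}^N)$ is $\langle\langle\lambda,f\rangle\rangle=\int_\Omega\langle\nu_x,f(x,\cdot)\rangle dx+\int_{\overline\Omega}\langle\nu_x^\infty,f^\infty(x,\cdot)\rangle d\lambda_\nu(x)$. Generalized Young measure solution. A pair $(u,\lambda)$ with $u\in L^\infty(0,T;BV(\Omega)\cap L^2(\Omega))$, $\partial_tu\in L^2(\Omega_T)$, $\lambda=(\nu_{x,t},\lambda_\nu,\nu^\infty_{x,t})$ with $\lambda=\lambda(t)\in Y(\Omega;\mathbb{R}^N)$ for a.e. $t\in(0,T)$ (each component may depend on $t$), $t\mapsto\langle\langle\lambda,|\cdot|\rangle\rangle\in L^\infty(0,T)$, $u(\cdot,0)=u_0$ in $\Omega$, and such that for a.e. $t\in(0,T)$: (1) $u_t=\operatorname{div}\langle\nu,\vec q\rangle$ in $\mathcal{D}'(\Omega)$;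 (2) $Du=\langle\nu,I\rangle\mathcal{L}^N\llcorner\Omega+\langle\nu^\infty,I\rangle\lambda_\nu\llcorner\Omega$ in $\mathcal{M}(\Omega)$; (3) $\langle\nu^\infty,I\rangle\lambda_\nu\llcorner\partial\Omega=-u^\Omega\,\vec n\,\mathcal{H}^{N-1}\llcorner\partial\Omega$ in $\mathcal{M}(\overline\Omega)$; (4) $\operatorname{supp}\nu_{x,t}\subseteq\{A:\Phi(A)=\Phi^{**}(A)\}$ for a.e. $x\in\Omega$; (5) (JF inequality) in $\mathcal{M}(\overline\Omega)$, $$\langle\nu,\vec q\rangle\cdot\big(\langle\nu,I\rangle\mathcal{L}^N\llcorner\Omega+\langle\nu^\infty,I\rangle\lambda_\nu\llcorner\overline\Omega\big)\ \ge\ \langle\nu,\vec q\cdot I\rangle\mathcal{L}^N\llcorner\Omega+\langle\nu^\infty,(\vec q\cdot I)^\infty\rangle\lambda_\nu\llcorner\overline\Omega .$$ By (2)-(3) the measure in parentheses on the left is $D\tilde u$ restricted to $\overline\Omega$. With $z=\langle\nu,\vec q\rangle\in L^\infty(\Omega;\mathbb{R}^N)$, $\operatorname{div}z=u_t\in L^2(\Omega)$, the left-hand side is understood as the Anzellotti pairing measure $(z,D\tilde u)$, given by $\int\varphi\,d(z,D\tilde u)=-\int_\Omega u\varphi\operatorname{div}z\,dx-\int_\Omega u\,z\cdot\nabla\varphi\,dx$ for $\varphi\in C_c^\infty(\tilde\Omega)$. *)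

theory Defs
  imports "HOL-Probability.Probability_Measure"
begin

section \<open>Smooth functions, test functions, function spaces\<close>

text \<open>\<open>Ck k f\<close>: \<open>f\<close> is of class \<open>C\<^sup>k\<close> on the whole space.\<close>

primrec Ck :: "nat \<Rightarrow> ('a::euclidean_space \<Rightarrow> real) \<Rightarrow> bool" where
  "Ck 0 f \<longleftrightarrow> continuous_on UNIV f"
| "Ck (Suc k) f \<longleftrightarrow> (\<forall>x. f differentiable (at x)) \<and>
     (\<forall>i\<in>Basis. Ck k (\<lambda>x. frechet_derivative f (at x) i))"

definition smooth :: "('a::euclidean_space \<Rightarrow> real) \<Rightarrow> bool" where
  "smooth f \<longleftrightarrow> (\<forall>k. Ck k f)"

definition grad :: "('a::euclidean_space \<Rightarrow> real) \<Rightarrow> 'a \<Rightarrow> 'a" where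
  "grad f x = (\<Sum>i\<in>Basis. frechet_derivative f (at x) i *\<^sub>R i)"

definition test_functions :: "'a::euclidean_space set \<Rightarrow> ('a \<Rightarrow> real) set" where
  "test_functions U = {\<phi>. smooth \<phi> \<and> compact (closure {x. \<phi> x \<noteq> 0}) \<and> closure {x. \<phi> x \<noteq> 0} \<subseteq> U}"

definition L2 :: "'a::euclidean_space set \<Rightarrow> ('a \<Rightarrow> real) set" where
  "L2 S = {f. f \<in> borel_measurable (lebesgue_on S) \<and> integrable (lebesgue_on S) (\<lambda>x. (f x)\<^sup>2)}"

definition Linf :: "'a::euclidean_space set \<Rightarrow> ('a \<Rightarrow> real) set" where
  "Linf S = {f. f \<in> borel_measurable (lebesgue_on S) \<and>
     (\<exists>C. AE x in lebesgue_on S. \<bar>f x\<bar> \<le> C)}"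


section \<open>Domains, outer unit normal, Hausdorff measure\<close>

definition bounded_domain :: "'a::euclidean_space set \<Rightarrow> bool" where
  "bounded_domain \<Omega> \<longleftrightarrow> open \<Omega> \<and> connected \<Omega> \<and> \<Omega> \<noteq> {} \<and> bounded \<Omega>"

text \<open>Near \<open>x\<close>, the set \<open>\<Omega>\<close> is the region above the graph of \<open>\<gamma>\<close> in direction \<open>e\<close>. Only the
  values of \<open>\<gamma>\<close> on the hyperplane orthogonal to \<open>e\<close> matter.\<close>

definition graph_fun :: "'a::euclidean_space \<Rightarrow> ('a \<Rightarrow> real) \<Rightarrow> 'a \<Rightarrow> real" where
  "graph_fun e \<gamma> y = \<gamma> (y - (y \<bullet> e) *\<^sub>R e) - y \<bullet> e"

definition local_epigraph ::
  "'a::euclidean_space set \<Rightarrow> 'a \<Rightarrow> 'a \<Rightarrow> ('a \<Rightarrow> real) \<Rightarrow> bool" where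
  "local_epigraph \<Omega> x e \<gamma> \<longleftrightarrow> norm e = 1 \<and> (\<exists>r>0. \<forall>y\<in>ball x r. y \<in> \<Omega> \<longleftrightarrow> graph_fun e \<gamma> y < 0)"

definition lipschitz_boundary :: "'a::euclidean_space set \<Rightarrow> bool" where
  "lipschitz_boundary \<Omega> \<longleftrightarrow>
     (\<forall>x\<in>frontier \<Omega>. \<exists>e \<gamma> L. L-lipschitz_on UNIV \<gamma> \<and> local_epigraph \<Omega> x e \<gamma>)"

definition smooth_boundary :: "'a::euclidean_space set \<Rightarrow> bool" where
  "smooth_boundary \<Omega> \<longleftrightarrow> (\<forall>x\<in>frontier \<Omega>. \<exists>e \<gamma>. smooth \<gamma> \<and> local_epigraph \<Omega> x e \<gamma>)"

text \<open>The outer unit normal exists at the boundary points where the graph is differentiable,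
  hence almost everywhere on a Lipschitz boundary (Rademacher).\<close>

definition outer_normal :: "'a::euclidean_space set \<Rightarrow> 'a \<Rightarrow> 'a" where
  "outer_normal \<Omega> x = (THE n. \<exists>e \<gamma> w. local_epigraph \<Omega> x e \<gamma> \<and>
     GDERIV (graph_fun e \<gamma>) x :> w \<and> n = w /\<^sub>R norm w)"

text \<open>The \<open>k\<close>-dimensional Hausdorff measure, normalised by the volume of the \<open>k\<close>-dimensional unit
  ball. Empty covering sets get weight 0 explicitly because \<open>0 ^ 0 = 1\<close>.\<close>

definition hausdorff_delta :: "nat \<Rightarrow> real \<Rightarrow> 'a::euclidean_space set \<Rightarrow> ennreal" where
  "hausdorff_delta k \<delta> A =
     (INF C\<in>{C :: nat \<Rightarrow> 'a set. A \<subseteq> (\<Union>i. C i) \<and> (\<forall>i. bounded (C i) \<and> diameter (C i) \<le> \<delta>)}.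
        \<Sum>i. if C i = {} then 0 else ennreal (unit_ball_vol (real k) * (diameter (C i) / 2) ^ k))"

definition hausdorff_measure :: "nat \<Rightarrow> 'a::euclidean_space measure" where
  "hausdorff_measure k =
     measure_of UNIV (sets borel) (\<lambda>A. SUP \<delta>\<in>{0<..}. hausdorff_delta k \<delta> A)"


section \<open>Finite vector-valued measures\<close>

text \<open>A finite \<open>'b\<close>-valued Radon measure on a Borel set \<open>X\<close> is a function \<open>m\<close> on the Borel subsets of
  \<open>X\<close> (its values elsewhere are irrelevant) of the form \<open>m = \<sigma> \<mu>\<close> with \<open>\<mu>\<close> a positive finite measure
  and \<open>\<sigma>\<close> a \<open>\<mu>\<close>-integrable density; every countably additive \<open>m\<close> has this form, with \<open>\<mu> = |m|\<close>.\<close>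

definition vmeasure_rep ::
  "'a::euclidean_space set \<Rightarrow> ('a set \<Rightarrow> 'b::euclidean_space) \<Rightarrow> 'a measure \<Rightarrow> ('a \<Rightarrow> 'b) \<Rightarrow> bool" where
  "vmeasure_rep X m \<mu> \<sigma> \<longleftrightarrow> finite_measure \<mu> \<and> sets \<mu> = sets borel \<and> integrable \<mu> \<sigma> \<and>
     (\<forall>A\<in>sets borel. A \<subseteq> X \<longrightarrow> m A = (LINT x:A|\<mu>. \<sigma> x))"

definition vmeasure :: "'a::euclidean_space set \<Rightarrow> ('a set \<Rightarrow> 'b::euclidean_space) \<Rightarrow> bool" where
  "vmeasure X m \<longleftrightarrow> (\<exists>\<mu> \<sigma>. vmeasure_rep X m \<mu> \<sigma>)"

text \<open>The integral of a bounded Borel function over \<open>X\<close>; it does not depend on the representation.\<close>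

definition vintegral ::
  "'a::euclidean_space set \<Rightarrow> ('a set \<Rightarrow> 'b::euclidean_space) \<Rightarrow> ('a \<Rightarrow> real) \<Rightarrow> 'b" where
  "vintegral X m \<phi> = (THE I. \<exists>\<mu> \<sigma>. vmeasure_rep X m \<mu> \<sigma> \<and> I = (LINT x:X|\<mu>. \<phi> x *\<^sub>R \<sigma> x))"

definition total_variation ::
  "'a::euclidean_space set \<Rightarrow> ('a set \<Rightarrow> 'b::euclidean_space) \<Rightarrow> ennreal" where
  "total_variation X m =
     (SUP P\<in>{P. finite P \<and> disjoint P \<and> (\<forall>A\<in>P. A \<in> sets borel \<and> A \<subseteq> X)}. \<Sum>A\<in>P. ennreal (norm (m A)))"


section \<open>Functions of bounded variation\<close>

definition has_BV_deriv ::
  "'a::euclidean_space set \<Rightarrow> ('a \<Rightarrow> real) \<Rightarrow> ('a set \<Rightarrow> 'a) \<Rightarrow> bool" where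
  "has_BV_deriv \<Omega> u m \<longleftrightarrow> vmeasure \<Omega> m \<and>
     (\<forall>\<phi>\<in>test_functions \<Omega>. (LINT x:\<Omega>|lebesgue. u x *\<^sub>R grad \<phi> x) = - vintegral \<Omega> m \<phi>)"

definition BV :: "'a::euclidean_space set \<Rightarrow> ('a \<Rightarrow> real) set" where
  "BV \<Omega> = {u. integrable (lebesgue_on \<Omega>) u \<and> (\<exists>m. has_BV_deriv \<Omega> u m)}"

text \<open>The measure \<open>Du\<close>; it is determined on the Borel subsets of \<open>\<Omega>\<close>.\<close>

definition BV_deriv :: "'a::euclidean_space set \<Rightarrow> ('a \<Rightarrow> real) \<Rightarrow> 'a set \<Rightarrow> 'a" where
  "BV_deriv \<Omega> u = (SOME m. has_BV_deriv \<Omega> u m)"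

definition BV_norm :: "'a::euclidean_space set \<Rightarrow> ('a \<Rightarrow> real) \<Rightarrow> ennreal" where
  "BV_norm \<Omega> u = (\<integral>\<^sup>+x. ennreal \<bar>u x\<bar> \<partial>lebesgue_on \<Omega>) + total_variation \<Omega> (BV_deriv \<Omega> u)"

text \<open>\<open>g\<close> is (a representative of) the trace of \<open>u\<close> on the boundary, i.e. the
  integrable function on the boundary determined by the Gauss--Green formula.
  Testing componentwise with scalar functions is the same as testing with vector fields.\<close>

definition is_trace ::
  "'a::euclidean_space set \<Rightarrow> ('a \<Rightarrow> real) \<Rightarrow> ('a \<Rightarrow> real) \<Rightarrow> bool" where
  "is_trace \<Omega> u g \<longleftrightarrow>
     set_integrable (hausdorff_measure (DIM('a) - 1)) (frontier \<Omega>) g \<and>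
     (\<forall>\<phi>. Ck 1 \<phi> \<longrightarrow>
        (LINT x:\<Omega>|lebesgue. u x *\<^sub>R grad \<phi> x) = - vintegral \<Omega> (BV_deriv \<Omega> u) \<phi> +
          (LINT x:frontier \<Omega>|hausdorff_measure (DIM('a) - 1). (\<phi> x * g x) *\<^sub>R outer_normal \<Omega> x))"


section \<open>Integrands\<close>

definition integrands :: "'a::euclidean_space set \<Rightarrow> ('a \<Rightarrow> 'a \<Rightarrow> real) set" where
  "integrands \<Omega> = {f. continuous_on (closure \<Omega> \<times> UNIV) (\<lambda>(x, A). f x A) \<and>
     (\<exists>g. continuous_on (closure (\<Omega> \<times> ball 0 1)) g \<and>
        (\<forall>x\<in>closure \<Omega>. \<forall>A\<in>ball 0 1. g (x, A) = (1 - norm A) * f x (A /\<^sub>R (1 - norm A))))}"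

definition recession ::
  "'a::euclidean_space set \<Rightarrow> ('a \<Rightarrow> 'a \<Rightarrow> real) \<Rightarrow> 'a \<Rightarrow> 'a \<Rightarrow> real" where
  "recession \<Omega> f x A =
     Lim (inf (nhds x) (principal (closure \<Omega>)) \<times>\<^sub>F (nhds A \<times>\<^sub>F at_top))
       (\<lambda>(x', A', t). f x' (t *\<^sub>R A') / t)"

definition convexification :: "('a::euclidean_space \<Rightarrow> real) \<Rightarrow> 'a \<Rightarrow> real" where
  "convexification \<Phi> A = (SUP f\<in>{f. convex_on UNIV f \<and> (\<forall>B. f B \<le> \<Phi> B)}. f A)"


section \<open>Generalized Young measures\<close>

text \<open>Measures on \<open>closure \<Omega>\<close> and on the unit sphere are modelled as Borel measures on the whole space
  that are concentrated there.\<close>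

type_synonym 'a gym = "('a \<Rightarrow> 'a measure) \<times> 'a measure \<times> ('a \<Rightarrow> 'a measure)"

definition young_measures :: "'a::euclidean_space set \<Rightarrow> 'a gym set" where
  "young_measures \<Omega> = {(\<nu>, \<kappa>, \<nu>').
     (\<forall>x\<in>\<Omega>. prob_space (\<nu> x) \<and> sets (\<nu> x) = sets borel) \<and>
     (\<forall>f::'a \<times> 'a \<Rightarrow> real. f \<in> borel_measurable borel \<longrightarrow> bounded (range f) \<longrightarrow>
        (\<lambda>x. LINT A|\<nu> x. f (x, A)) \<in> borel_measurable (lebesgue_on \<Omega>)) \<and>
     finite_measure \<kappa> \<and> sets \<kappa> = sets borel \<and> emeasure \<kappa> (- closure \<Omega>) = 0 \<and>
     (\<forall>x\<in>closure \<Omega>. prob_space (\<nu>' x) \<and> sets (\<nu>' x) = sets borel \<and> emeasure (\<nu>' x) (- sphere 0 1) = 0) \<and>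
     (\<forall>f::'a \<times> 'a \<Rightarrow> real. f \<in> borel_measurable borel \<longrightarrow> bounded (range f) \<longrightarrow>
        (\<lambda>x. LINT A|\<nu>' x. f (x, A)) \<in> borel_measurable (completion \<kappa>)) \<and>
     (\<integral>\<^sup>+x. (\<integral>\<^sup>+A. ennreal (norm A) \<partial>\<nu> x) \<partial>lebesgue_on \<Omega>) < \<infinity>}"

definition young_pairing :: "'a::euclidean_space set \<Rightarrow> 'a gym \<Rightarrow> ('a \<Rightarrow> 'a \<Rightarrow> real) \<Rightarrow> real" where
  "young_pairing \<Omega> = (\<lambda>(\<nu>, \<kappa>, \<nu>') f.
     (LINT x:\<Omega>|lebesgue. LINT A|\<nu> x. f x A) +
     (LINT x:closure \<Omega>|completion \<kappa>. LINT A|\<nu>' x. recession \<Omega> f x A))"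

definition msupport :: "'a::topological_space measure \<Rightarrow> 'a set" where
  "msupport \<mu> = {A. \<forall>U. open U \<longrightarrow> A \<in> U \<longrightarrow> emeasure \<mu> U > 0}"


section \<open>Generalized Young measure solutions\<close>

text \<open>\<open>m\<close> is the Anzellotti pairing measure \<open>(z, Du~)\<close> on \<open>\<Omega>'\<close>, where \<open>d = div z\<close> and
  \<open>u~\<close> is the extension of \<open>u\<close> by 0 from \<open>\<Omega>\<close> to \<open>\<Omega>'\<close>.\<close>

definition is_pairing_measure ::
  "'a::euclidean_space set \<Rightarrow> 'a set \<Rightarrow> ('a \<Rightarrow> 'a) \<Rightarrow> ('a \<Rightarrow> real) \<Rightarrow> ('a \<Rightarrow> real) \<Rightarrow> ('a set \<Rightarrow> real) \<Rightarrow> bool" where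
  "is_pairing_measure \<Omega> \<Omega>' z d u m \<longleftrightarrow> vmeasure \<Omega>' m \<and>
     (\<forall>\<phi>\<in>test_functions \<Omega>'. vintegral \<Omega>' m \<phi> =
        - (LINT x:\<Omega>|lebesgue. u x * \<phi> x * d x) - (LINT x:\<Omega>|lebesgue. u x * (z x \<bullet> grad \<phi> x)))"

text \<open>\<open>v\<close> is the weak derivative of \<open>u\<close> with respect to time on \<open>\<Omega> \<times> (0, T)\<close>.\<close>

definition weak_time_deriv ::
  "'a::euclidean_space set \<Rightarrow> real \<Rightarrow> ('a \<times> real \<Rightarrow> real) \<Rightarrow> ('a \<times> real \<Rightarrow> real) \<Rightarrow> bool" where
  "weak_time_deriv \<Omega> T u v \<longleftrightarrow>
     (\<forall>\<phi>\<in>test_functions (\<Omega> \<times> {0<..<T}).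
        (LINT p:\<Omega> \<times> {0<..<T}|lebesgue. u p * frechet_derivative \<phi> (at p) (0, 1)) =
        - (LINT p:\<Omega> \<times> {0<..<T}|lebesgue. v p * \<phi> p))"

text \<open>\<open>u(\<cdot>, 0) = u\<^sub>0\<close> in the sense of the representative of \<open>u\<close> in \<open>C([0, T]; L\<^sup>2(\<Omega>))\<close>.\<close>

definition has_initial_value ::
  "'a::euclidean_space set \<Rightarrow> real \<Rightarrow> ('a \<times> real \<Rightarrow> real) \<Rightarrow> ('a \<Rightarrow> real) \<Rightarrow> bool" where
  "has_initial_value \<Omega> T u u\<^sub>0 \<longleftrightarrow> (\<exists>w :: real \<Rightarrow> 'a \<Rightarrow> real.
     (\<forall>t\<in>{0..T}. w t \<in> L2 \<Omega>) \<and>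
     (\<forall>s\<in>{0..T}. ((\<lambda>t. LINT x:\<Omega>|lebesgue. (w t x - w s x)\<^sup>2) \<longlongrightarrow> 0) (at s within {0..T})) \<and>
     (AE t in lebesgue_on {0<..<T}. AE x in lebesgue_on \<Omega>. w t x = u (x, t)) \<and>
     (AE x in lebesgue_on \<Omega>. w 0 x = u\<^sub>0 x))"

text \<open>The conditions imposed at almost every time \<open>t\<close>, with \<open>u = u(t)\<close>, \<open>v = \<partial>\<^sub>t u(t)\<close> and
  \<open>Y(t) = (\<nu>, \<kappa>, \<nu>')\<close>. Equalities and inequalities between measures are stated on all Borel subsets.\<close>

definition young_conditions ::
  "'a::euclidean_space set \<Rightarrow> 'a set \<Rightarrow> ('a \<Rightarrow> real) \<Rightarrow> ('a \<Rightarrow> 'a) \<Rightarrow> ('a \<Rightarrow> real) \<Rightarrow> ('a \<Rightarrow> real) \<Rightarrow> 'a gym \<Rightarrow> bool" where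
  "young_conditions \<Omega> \<Omega>' \<Phi> q u v = (\<lambda>(\<nu>, \<kappa>, \<nu>').
     \<comment> \<open>\<open>u\<^sub>t = div \<langle>\<nu>, q\<rangle>\<close> in the sense of distributions\<close>
     (\<forall>\<phi>\<in>test_functions \<Omega>.
        (LINT x:\<Omega>|lebesgue. v x * \<phi> x) = - (LINT x:\<Omega>|lebesgue. (LINT A|\<nu> x. q A) \<bullet> grad \<phi> x)) \<and>
     \<comment> \<open>\<open>Du = \<langle>\<nu>, I\<rangle> dx + \<langle>\<nu>', I\<rangle> \<kappa>\<close> on \<open>\<Omega>\<close>\<close>
     (\<forall>B\<in>sets borel. B \<subseteq> \<Omega> \<longrightarrow> BV_deriv \<Omega> u B =
        (LINT x:B|lebesgue. LINT A|\<nu> x. A) + (LINT x:B|completion \<kappa>. LINT A|\<nu>' x. A)) \<and>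
     \<comment> \<open>\<open>\<langle>\<nu>', I\<rangle> \<kappa> = - u n H\<close> on the boundary, with \<open>u\<close> the trace, \<open>n\<close> the outer normal, \<open>H\<close> the Hausdorff measure\<close>
     (\<exists>g. is_trace \<Omega> u g \<and>
        (\<forall>B\<in>sets borel. B \<subseteq> closure \<Omega> \<longrightarrow>
           (LINT x:B \<inter> frontier \<Omega>|completion \<kappa>. LINT A|\<nu>' x. A) =
           - (LINT x:B \<inter> frontier \<Omega>|hausdorff_measure (DIM('a) - 1). g x *\<^sub>R outer_normal \<Omega> x))) \<and>
     (AE x in lebesgue_on \<Omega>. msupport (\<nu> x) \<subseteq> {A. \<Phi> A = convexification \<Phi> A}) \<and>
     \<comment> \<open>\<open>(z, Du~) \<ge> \<langle>\<nu>, q \<cdot> I\<rangle> dx + \<langle>\<nu>', (q \<cdot> I)\<^sup>\<infinity>\<rangle> \<kappa>\<close> with \<open>z = \<langle>\<nu>, q\<rangle>\<close> and \<open>div z = v\<close>\<close>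
     (\<exists>m. is_pairing_measure \<Omega> \<Omega>' (\<lambda>x. LINT A|\<nu> x. q A) v u m \<and>
        (\<forall>B\<in>sets borel. B \<subseteq> closure \<Omega> \<longrightarrow> m B \<ge>
           (LINT x:B \<inter> \<Omega>|lebesgue. LINT A|\<nu> x. q A \<bullet> A) +
           (LINT x:B|completion \<kappa>. LINT A|\<nu>' x. recession \<Omega> (\<lambda>x A. q A \<bullet> A) x A))))"

text \<open>\<open>\<Omega>'\<close> is the larger smooth domain on which the pairing measure is tested.\<close>

definition young_solution ::
  "'a::euclidean_space set \<Rightarrow> 'a set \<Rightarrow> real \<Rightarrow> ('a \<Rightarrow> real) \<Rightarrow> ('a \<Rightarrow> 'a) \<Rightarrow> ('a \<Rightarrow> real) \<Rightarrow>
     ('a \<times> real \<Rightarrow> real) \<Rightarrow> (real \<Rightarrow> 'a gym) \<Rightarrow> bool" where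
  "young_solution \<Omega> \<Omega>' T \<Phi> q u\<^sub>0 u Y \<longleftrightarrow>
     u \<in> borel_measurable (lebesgue_on (\<Omega> \<times> {0<..<T})) \<and>
     (\<exists>C::real. AE t in lebesgue_on {0<..<T}. (\<lambda>x. u (x, t)) \<in> BV \<Omega> \<inter> L2 \<Omega> \<and>
        BV_norm \<Omega> (\<lambda>x. u (x, t)) \<le> ennreal C \<and> (LINT x:\<Omega>|lebesgue. (u (x, t))\<^sup>2) \<le> C) \<and>
     has_initial_value \<Omega> T u u\<^sub>0 \<and>
     (AE t in lebesgue_on {0<..<T}. Y t \<in> young_measures \<Omega>) \<and>
     (\<lambda>t. young_pairing \<Omega> (Y t) (\<lambda>x A. norm A)) \<in> Linf {0<..<T} \<and>
     (\<exists>v\<in>L2 (\<Omega> \<times> {0<..<T}). weak_time_deriv \<Omega> T u v \<and>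
        (AE t in lebesgue_on {0<..<T}.
           young_conditions \<Omega> \<Omega>' \<Phi> q (\<lambda>x. u (x, t)) (\<lambda>x. v (x, t)) (Y t)))"

end

theory Submission
  imports Defs "HOL-Probability.Giry_Monad"
begin

text \<open>The difference of two solutions decreases in \<open>L\<^sup>2\<close>. For almost every time,
  \<open>- \<integral> (u\<^sub>1 - u\<^sub>2) (v\<^sub>1 - v\<^sub>2)\<close> splits into four pairings, where \<open>v\<^sub>j = div z\<^sub>j\<close> is the time derivative.
  The two diagonal ones are bounded below by the JF inequality on \<open>closure \<Omega>\<close>. For the mixed ones,
  the support condition and (SH4) give \<open>z\<^sub>2(x) \<bullet> \<eta> \<le> \<psi>(\<eta>)\<close> for all unit vectors \<open>\<eta>\<close>, where \<open>\<psi>\<close> is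
  the recession function of \<open>q \<bullet> I\<close>, so that the concentration parts of \<open>(z\<^sub>2, Du\<^sub>1)\<close> are dominated by
  those of the JF inequality for \<open>u\<^sub>1\<close>. What remains is
  \<open>\<integral>\<integral>\<integral> (q A - q B) \<bullet> (A - B) d\<nu>\<^sub>1 d\<nu>\<^sub>2 dx \<ge> 0\<close>, because \<open>q A\<close> is a subgradient of \<open>\<Phi>\<^sup>*\<^sup>*\<close> wherever
  \<open>\<Phi>(A) = \<Phi>\<^sup>*\<^sup>*(A)\<close>. The bound on the mixed pairings is obtained by testing \<open>div z\<^sub>2\<close> with mollifications
  of \<open>u\<^sub>1\<close> that are shifted into \<open>\<Omega>\<close> locally at the Lipschitz boundary; condition (3) replaces
  the boundary term of the Gauss--Green formula by \<open>\<langle>\<nu>\<^sup>\<infinity>, I\<rangle> \<lambda>\<close>, so Hausdorff measure and the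
  outer normal disappear from the argument.\<close>

section \<open>Calculus of \<open>C\<^sup>k\<close> functions and smooth cutoffs\<close>

text \<open>The obstacle is that a BV function is not an admissible test function for
  \<open>div z\<close>, and that no limit of the mixed pairing can be identified on the
  concentration set: the bounded field z2 has no values there. Only an upper bound is needed, and it
  survives mollification: the kernel spreads the concentration measure over points x of \<Omega>,
  where z2(x) exists, and there the product with the concentration density at y is bounded for
  almost every x and all y at once. The bound is additive in a cutoff, so it can be proved near one
  boundary point with its own inward direction and then summed. In time, the chain rule for the
  squared norm is replaced by an increment estimate: dissipation bounds the growth over [s, t] by t
  - s times the integral of the squared norm of the time derivative, and cutting [s, t] into n equal
  pieces puts a factor 1/n in front.\<close>

lemma Ck_SucI:
  assumes "\<And>x. (f has_derivative f' x) (at x)" "\<And>i. i \<in> Basis \<Longrightarrow> Ck k (\<lambda>x. f' x i)"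
  shows "Ck (Suc k) f"
proof -
  have "frechet_derivative f (at x) = f' x" for x
    using assms(1) frechet_derivative_at by metis
  then show ?thesis using assms by (auto simp: differentiable_def)
qed

lemma Ck_Suc_has_derivative:
  "Ck (Suc k) f \<Longrightarrow> (f has_derivative frechet_derivative f (at x)) (at x)"
  by (simp add: frechet_derivative_works)

lemma Ck_continuous: "Ck k f \<Longrightarrow> continuous_on UNIV f"
proof (cases k)
  case (Suc j)
  assume "Ck k f"
  then have "f differentiable (at x)" for x using Suc by simp
  then have "isCont f x" for x using differentiable_imp_continuous_within by blast
  then show ?thesis by (simp add: continuous_on_eq_continuous_at)
qed simp

lemma Ck_SucD: "Ck (Suc k) f \<Longrightarrow> Ck k f"
proof (induction k arbitrary: f)
  case 0
  show ?case unfolding Ck.simps(1) by (rule Ck_continuous[OF 0])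
next
  case (Suc k)
  then show ?case by (metis Ck.simps(2))
qed

lemma Ck_const: "Ck k (\<lambda>x. c)"
proof (induction k arbitrary: c)
  case (Suc k)
  show ?case by (rule Ck_SucI[where f'="\<lambda>x h. 0"]) (use Suc in auto)
qed auto

lemma Ck_add: "Ck k f \<Longrightarrow> Ck k g \<Longrightarrow> Ck k (\<lambda>x. f x + g x)"
proof (induction k arbitrary: f g)
  case 0
  then show ?case by (auto intro: continuous_intros)
next
  case (Suc k)
  show ?case
    by (rule Ck_SucI[OF has_derivative_add[OF Suc.prems[THEN Ck_Suc_has_derivative]]])
      (use Suc in auto)
qed

lemma Ck_mult: "Ck k f \<Longrightarrow> Ck k g \<Longrightarrow> Ck k (\<lambda>x. f x * g x)"
proof (induction k arbitrary: f g)
  case 0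
  then show ?case by (auto intro: continuous_intros)
next
  case (Suc k)
  show ?case
    by (rule Ck_SucI[OF has_derivative_mult[OF Suc.prems[THEN Ck_Suc_has_derivative]]])
      (use Suc Suc.prems[THEN Ck_SucD] in \<open>auto intro!: Ck_add Suc.IH\<close>)
qed

lemma Ck_sum: "(\<And>i. i \<in> I \<Longrightarrow> Ck k (f i)) \<Longrightarrow> Ck k (\<lambda>x. \<Sum>i\<in>I. f i x)"
  by (induction I rule: infinite_finite_induct) (auto intro: Ck_const Ck_add)

lemma Ck_cmult: "Ck k f \<Longrightarrow> Ck k (\<lambda>x. c * f x)"
  by (intro Ck_mult Ck_const)

lemma Ck_diff: "Ck k f \<Longrightarrow> Ck k g \<Longrightarrow> Ck k (\<lambda>x. f x - g x)"
  using Ck_add[OF _ Ck_cmult[of k g "-1"], of f] by simp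

lemma Ck_linear: "bounded_linear f \<Longrightarrow> Ck k f"
proof (induction k)
  case 0
  then show ?case by (simp add: linear_continuous_on)
next
  case (Suc k)
  show ?case
    by (rule Ck_SucI[OF bounded_linear_imp_has_derivative[OF Suc.prems]]) (rule Ck_const)
qed

lemma Ck_affine: 
  fixes g :: "'b::euclidean_space \<Rightarrow> 'a::euclidean_space"
  assumes g: "bounded_linear g" and "Ck k f"
  shows "Ck k (\<lambda>x. f (g x + c))"
  using assms(2)
proof (induction k arbitrary: f)
  case 0
  have "continuous_on UNIV (\<lambda>x. g x + c)" using g by (auto intro: continuous_intros linear_continuous_on)
  then show ?case using 0 by (auto intro: continuous_on_compose2[where t=UNIV])
next
  case (Suc k)
  have g': "((\<lambda>x. g x + c) has_derivative g) (at x)" for x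
    using has_derivative_add[OF bounded_linear_imp_has_derivative[OF g] has_derivative_const[of c]] by simp
  \<comment> \<open>Expanding \<open>g i\<close> in the basis writes the partial derivatives of the
    composition as combinations, with constant coefficients, of partial derivatives of
    \<open>f\<close> along the same affine map; to these the induction hypothesis applies.\<close>
  have eq: "frechet_derivative f (at y) (g i) = (\<Sum>j\<in>Basis. (g i \<bullet> j) * frechet_derivative f (at y) j)" for y i
  proof -
    interpret linear "frechet_derivative f (at y)"
      using Suc.prems Ck_Suc_has_derivative has_derivative_linear by blast
    show ?thesis
      by (subst euclidean_representation[symmetric]) (simp add: sum scale)
  qed
  show ?case
  proof (rule Ck_SucI[where f'="\<lambda>x h. frechet_derivative f (at (g x + c)) (g h)"])
    show "((\<lambda>x. f (g x + c)) has_derivative (\<lambda>h. frechet_derivative f (at (g x + c)) (g h))) (at x)" for x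
      using has_derivative_compose[OF g' Ck_Suc_has_derivative[OF Suc.prems]] by simp
    show "Ck k (\<lambda>x. frechet_derivative f (at (g x + c)) (g i))" if "i \<in> Basis" for i
      unfolding eq using Suc by (intro Ck_sum Ck_cmult) auto
  qed
qed

lemma Ck_comp_real:
  fixes f :: "real \<Rightarrow> real"
  assumes "Ck k f" "Ck k g"
  shows "Ck k (\<lambda>x. f (g x))"
  using assms
proof (induction k arbitrary: f)
  case 0
  then show ?case by (auto intro: continuous_on_compose2[where t=UNIV])
next
  case (Suc k)
  have eq: "frechet_derivative f (at y) c = c * frechet_derivative f (at y) 1" for y c
  proof -
    interpret linear "frechet_derivative f (at y)"
      using Suc.prems Ck_Suc_has_derivative has_derivative_linear by blast
    show ?thesis using scale[of c 1] by simp
  qed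
  have "Ck k (\<lambda>x. frechet_derivative f (at (g x)) 1)"
    using Suc Ck_SucD[of k g] by (auto simp: Basis_real_def)
  then have "Ck k (\<lambda>x. frechet_derivative f (at (g x)) (frechet_derivative g (at x) i))" if "i \<in> Basis" for i
    unfolding eq[of _ "frechet_derivative g _ _"] using Suc.prems that by (intro Ck_mult) auto
  then show ?case
    by (intro Ck_SucI[OF has_derivative_compose[OF Ck_Suc_has_derivative[OF Suc.prems(2)] 
        Ck_Suc_has_derivative[OF Suc.prems(1)]]])
qed

lemma Ck_real_SucI:
  fixes f :: "real \<Rightarrow> real"
  assumes "\<And>x. (f has_real_derivative f' x) (at x)" "Ck k f'"
  shows "Ck (Suc k) f"
  by (rule Ck_SucI[OF assms(1)[unfolded has_field_derivative_def]]) (use assms(2) in auto)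

section \<open>Flat functions, smooth steps and cutoffs\<close>

definition flat_exp :: "real poly \<Rightarrow> real \<Rightarrow> real" where
  "flat_exp p x = (if x > 0 then poly p (1/x) * exp (- 1/x) else 0)"

lemma poly_exp_decay: "((\<lambda>y. poly p y * exp (- y)) \<longlongrightarrow> (0::real)) at_top"
proof (induction p)
  case (pCons a p)
  have 1: "((\<lambda>y. exp (- y)) \<longlongrightarrow> (0::real)) at_top"
    using tendsto_compose_filtermap exp_at_bot filterlim_uminus_at_bot_at_top filterlim_compose by blast
  \<comment> \<open>Coefficient by coefficient this is the decay of y^n / exp y.\<close>
  have mon: "((\<lambda>y. y ^ k * poly p y * exp (- y)) \<longlongrightarrow> (0::real)) at_top" for k and p :: "real poly"
  proof -
    have "((\<lambda>y. \<Sum>i\<le>degree p. coeff p i * (y ^ (k + i) / exp y)) \<longlongrightarrow> (\<Sum>i\<le>degree p. coeff p i * 0)) at_top"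
      by (intro tendsto_intros tendsto_power_div_exp_0)
    moreover have "(\<lambda>y. \<Sum>i\<le>degree p. coeff p i * (y ^ (k + i) / exp y)) = (\<lambda>y. y ^ k * poly p y * exp (- y))"
      by (auto simp: poly_altdef fun_eq_iff sum_distrib_left sum_distrib_right exp_minus field_simps power_add intro!: sum.cong)
    ultimately show ?thesis by simp
  qed
  show ?case using mon[of 0 "pCons a p"] by simp
qed simp

text \<open>With y = 1/x the derivative of p(y) exp(-y) in x is y^2 (p - p')(y) exp(-y). The family
  indexed by polynomials is therefore closed under differentiation, and smoothness follows by
  induction on the order with p arbitrary.\<close>

lemma flat_exp_has_derivative:
  "(flat_exp p has_real_derivative flat_exp ([:0,0,1:] * (p - pderiv p)) x) (at x)"
proof (cases x "0::real" rule: linorder_cases)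
  case less
  have "((\<lambda>x. 0) has_real_derivative 0) (at x)" by simp
  then have "(flat_exp p has_real_derivative 0) (at x)"
    by (rule has_field_derivative_transform_within_open[of _ _ _ "{..<0}"]) (use less in \<open>auto simp: flat_exp_def\<close>)
  then show ?thesis using less by (simp add: flat_exp_def)
next
  case greater
  have "((\<lambda>x. poly p (1/x) * exp (- 1/x)) has_real_derivative 
     poly ([:0,0,1:] * (p - pderiv p)) (1/x) * exp (- 1/x)) (at x)"
    using greater by (auto intro!: derivative_eq_intros simp: field_simps power2_eq_square)
  then have "(flat_exp p has_real_derivative poly ([:0,0,1:] * (p - pderiv p)) (1/x) * exp (- 1/x)) (at x)"
    by (rule has_field_derivative_transform_within_open[of _ _ _ "{0<..}"]) (use greater in \<open>auto simp: flat_exp_def\<close>)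
  then show ?thesis using greater by (simp add: flat_exp_def)
next
  case equal
  \<comment> \<open>The difference quotient at 0 is y p(y) exp(-y) with y = 1/h, and y p(y) is the
    polynomial \<open>pCons 0 p\<close>.\<close>
  have "((\<lambda>h. poly (pCons 0 p) (inverse h) * exp (- inverse h)) \<longlongrightarrow> 0) (at_right (0::real))"
    by (rule filterlim_compose[OF poly_exp_decay filterlim_inverse_at_top_right])
  moreover have "\<forall>\<^sub>F h in at_right 0. poly (pCons 0 p) (inverse h) * exp (- inverse h) = flat_exp p h / h"
    using eventually_at_right_less[of "0::real"] 
    by eventually_elim (auto simp: flat_exp_def field_simps)
  ultimately have "((\<lambda>h. flat_exp p h / h) \<longlongrightarrow> 0) (at_right 0)"
    by (rule Lim_transform_eventually)
  moreover have "((\<lambda>h. flat_exp p h / h) \<longlongrightarrow> 0) (at_left 0)"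
    by (rule Lim_transform_eventually[OF tendsto_const])
      (auto simp: eventually_at_filter flat_exp_def)
  ultimately have "((\<lambda>h. flat_exp p h / h) \<longlongrightarrow> 0) (at 0)"
    by (simp add: filterlim_at_split)
  then show ?thesis using equal by (simp add: DERIV_def flat_exp_def)
qed

lemma Ck_flat_exp: "Ck k (flat_exp p)"
proof (induction k arbitrary: p)
  case 0
  have "isCont (flat_exp p) x" for x
    using flat_exp_has_derivative DERIV_isCont by blast
  then show ?case by (simp add: continuous_on_eq_continuous_at)
next
  case (Suc k)
  show ?case by (rule Ck_real_SucI[OF flat_exp_has_derivative Suc])
qed

text \<open>S is the normalised primitive of a bump on [0, 1]. Its derivative s is part of the
  result because rescaled copies of it serve later as kernels in time.\<close>

lemma smooth_step_exists:
  obtains S s :: "real \<Rightarrow> real" where "smooth S" "smooth s" "\<And>x. (S has_real_derivative s x) (at x)"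
    "\<And>x. 0 \<le> s x" "\<And>x. x \<le> 0 \<Longrightarrow> S x = 0" "\<And>x. 1 \<le> x \<Longrightarrow> S x = 1" "\<And>x. 0 \<le> S x" "\<And>x. S x \<le> 1"
    "\<And>x. x \<le> 0 \<or> 1 \<le> x \<Longrightarrow> s x = 0"
proof -
  define b where "b = (\<lambda>x. flat_exp 1 x * flat_exp 1 (1 - x))"
  have Ckb: "Ck k b" for k
    unfolding b_def using Ck_affine[of uminus k "flat_exp 1" 1] 
    by (intro Ck_mult Ck_flat_exp) (simp add: bounded_linear_minus[OF bounded_linear_ident] Ck_flat_exp)
  then have cont: "continuous_on A b" for A
    using Ck_continuous continuous_on_subset by blast
  have b0: "b x \<ge> 0" for x by (simp add: b_def flat_exp_def)
  have bz: "b x = 0" if "x \<le> 0 \<or> 1 \<le> x" for x using that by (auto simp: b_def flat_exp_def)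
  \<comment> \<open>Starting the integral at -1 puts every x >= 0 into the interior of [-1, x + 1],
    so that the derivative within this interval is a full derivative.\<close>
  define R where "R = (\<lambda>x. integral {-1..x} b)"
  have Rz: "R x = 0" if "x \<le> 0" for x
    unfolding R_def by (subst integral_cong[where g="\<lambda>x. 0"]) (use that bz in auto)
  have int: "b integrable_on {a..c}" for a c
    by (rule integrable_continuous_real[OF cont])
  have mono: "R x \<le> R y" if "x \<le> y" for x y
    unfolding R_def using that b0 by (intro integral_subset_le int) auto
  have R1: "R x = R 1" if "1 \<le> x" for x
  proof -
    have "R 1 + integral {1..x} b = R x"
      unfolding R_def using that by (intro Henstock_Kurzweil_Integration.integral_combine int) auto
    moreover have "integral {1..x} b = 0" 
      by (subst integral_cong[where g="\<lambda>x. 0"]) (use bz in auto)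
    ultimately show ?thesis by simp
  qed
  have der: "(R has_real_derivative b x) (at x)" for x
  proof (cases "x < 0")
    case True
    have "((\<lambda>x. 0) has_real_derivative 0) (at x)" by simp
    then have "(R has_real_derivative 0) (at x)"
      by (rule has_field_derivative_transform_within_open[of _ _ _ "{..<0}"]) (use True Rz in auto)
    then show ?thesis using bz True by simp
  next
    case False
    have "(R has_real_derivative b x) (at x within {-1..x+1})"
      unfolding R_def using False by (intro integral_has_real_derivative cont) auto
    moreover have "at x within {-1..x+1} = at x"
      using False by (intro at_within_interior) auto
    ultimately show ?thesis by simp
  qed
  \<comment> \<open>Without mass, R would vanish identically and so would its derivative b, although
    b(1/2) > 0.\<close>
  have R1pos: "R 1 > 0"
  proof (rule ccontr)
    assume "\<not> R 1 > 0"
    then have "R x = 0" for x 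
      using mono[of 0 x] mono[of x 0] mono[of x 1] mono[of 1 x] Rz[of 0] Rz[of x] R1[of x] by (cases "x \<le> 0"; cases "x \<le> 1") auto
    then have "R = (\<lambda>x. 0)" by auto
    then have "b (1/2) = 0" using der[of "1/2"] DERIV_unique[OF _ DERIV_const[of 0]] by metis
    then show False by (simp add: b_def flat_exp_def)
  qed
  have Rk: "Ck k R" for k
  proof -
    have "Ck (Suc k) R" by (rule Ck_real_SucI[OF der Ckb])
    then show ?thesis by (rule Ck_SucD)
  qed
  show thesis
  proof (rule that[of "\<lambda>x. inverse (R 1) * R x" "\<lambda>x. inverse (R 1) * b x"])
    show "smooth (\<lambda>x. inverse (R 1) * R x)" "smooth (\<lambda>x. inverse (R 1) * b x)"
      by (auto simp: smooth_def intro: Ck_cmult Rk Ckb)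
    show "((\<lambda>x. inverse (R 1) * R x) has_real_derivative inverse (R 1) * b x) (at x)" for x
      using DERIV_cmult[OF der] .
    show "inverse (R 1) * R x \<le> 1" for x
      using mono[of x 1] R1[of x] R1pos by (cases "x \<le> 1") (auto simp: field_simps)
    show "0 \<le> inverse (R 1) * R x" for x
      using mono[of 0 x] Rz[of x] Rz[of 0] R1pos by (cases "x \<le> 0") (auto simp: field_simps)
    show "inverse (R 1) * R x = 1" if "1 \<le> x" for x
      using R1[OF that] R1pos by simp
  qed (use b0 bz Rz R1pos in \<open>simp_all\<close>)
qed

lemma Ck_norm_square: "Ck k (\<lambda>x::'a::euclidean_space. (norm (x - a))\<^sup>2)"
proof -
  have "(norm (x - a))\<^sup>2 = (\<Sum>i\<in>Basis. ((x + - a) \<bullet> i) * ((x + - a) \<bullet> i))" for x :: 'a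
    unfolding diff_conv_add_uminus[symmetric] power2_norm_eq_inner by (rule euclidean_inner)
  moreover have "Ck k (\<lambda>x::'a. (x + - a) \<bullet> i)" for i
    by (rule Ck_affine[of "\<lambda>x. x" k "\<lambda>x. x \<bullet> i"]) (auto intro: Ck_linear bounded_linear_inner_left bounded_linear_ident)
  ultimately show ?thesis by (auto intro!: Ck_sum Ck_mult)
qed

lemma bump_exists:
  fixes a :: "'a::euclidean_space"
  assumes "r > 0"
  obtains \<beta> where "smooth \<beta>" "\<And>x. 0 \<le> \<beta> x" "\<And>x. \<beta> x \<le> (1::real)"
    "\<And>x. x \<in> cball a (r/2) \<Longrightarrow> \<beta> x = 1" "\<And>x. x \<notin> ball a r \<Longrightarrow> \<beta> x = 0"
proof -
  obtain S s :: "real \<Rightarrow> real" where S: "smooth S" "\<And>x. x \<le> 0 \<Longrightarrow> S x = 0" "\<And>x. 1 \<le> x \<Longrightarrow> S x = 1" 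
     "\<And>x. 0 \<le> S x" "\<And>x. S x \<le> 1" by (metis smooth_step_exists)
  \<comment> \<open>The squared norm is smooth at the centre, unlike the norm. The affine function
    of it is fixed by the value 1 at distance r/2 and 0 at distance r.\<close>
  define g where "g = (\<lambda>x. 4/3 + (- 4 / (3 * r\<^sup>2)) * (norm (x - a))\<^sup>2)"
  have g: "smooth g" unfolding g_def smooth_def by (intro allI Ck_add Ck_const Ck_cmult Ck_norm_square)
  show thesis
  proof (rule that[of "\<lambda>x. S (g x)"])
    show "smooth (\<lambda>x. S (g x))" using g S(1) by (simp add: smooth_def Ck_comp_real)
    show "S (g x) = 1" if "x \<in> cball a (r/2)" for x
    proof -
      have "norm (x - a) \<le> r/2" using that by (simp add: dist_norm norm_minus_commute)
      then have "(norm (x - a))\<^sup>2 \<le> (r/2)\<^sup>2" by (intro power_mono) auto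
      then have "1 \<le> g x" using assms by (simp add: g_def field_simps)
      then show ?thesis by (rule S)
    qed
    show "S (g x) = 0" if "x \<notin> ball a r" for x
    proof -
      have "r \<le> norm (x - a)" using that by (simp add: dist_norm norm_minus_commute)
      then have "r\<^sup>2 \<le> (norm (x - a))\<^sup>2" using assms by (intro power_mono) auto
      then have "g x \<le> 0" using assms by (simp add: g_def field_simps)
      then show ?thesis by (rule S)
    qed
  qed (auto intro: S)
qed

lemma smooth_const: "smooth (\<lambda>x. c)" 
  and smooth_mult: "smooth f \<Longrightarrow> smooth g \<Longrightarrow> smooth (\<lambda>x. f x * g x)"
  and smooth_diff: "smooth f \<Longrightarrow> smooth g \<Longrightarrow> smooth (\<lambda>x. f x - g x)"
  by (auto simp: smooth_def intro: Ck_const Ck_mult Ck_diff)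

lemma cutoff_exists:
  fixes K U :: "'a::euclidean_space set"
  assumes "compact K" "open U" "K \<subseteq> U"
  obtains \<phi> where "\<phi> \<in> test_functions U" "\<And>x. 0 \<le> \<phi> x" "\<And>x. \<phi> x \<le> 1" "\<And>x. x \<in> K \<Longrightarrow> \<phi> x = 1"
proof -
  have "\<forall>a\<in>K. \<exists>r>0. cball a r \<subseteq> U" using assms open_contains_cball by blast
  then obtain r where r: "\<And>a. a \<in> K \<Longrightarrow> r a > 0" "\<And>a. a \<in> K \<Longrightarrow> cball a (r a) \<subseteq> U" by metis
  have "\<forall>a\<in>K. \<exists>\<beta>. smooth \<beta> \<and> (\<forall>x. 0 \<le> \<beta> x \<and> \<beta> x \<le> (1::real)) \<and> (\<forall>x\<in>cball a (r a/2). \<beta> x = 1) \<and> (\<forall>x. x \<notin> ball a (r a) \<longrightarrow> \<beta> x = 0)"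
    using bump_exists r(1) by metis
  then obtain \<beta> where \<beta>: "\<And>a. a \<in> K \<Longrightarrow> smooth (\<beta> a)" "\<And>a x. a \<in> K \<Longrightarrow> 0 \<le> \<beta> a x \<and> \<beta> a x \<le> (1::real)"
     "\<And>a x. a \<in> K \<Longrightarrow> x\<in>cball a (r a/2) \<Longrightarrow> \<beta> a x = 1" "\<And>a x. a \<in> K \<Longrightarrow> x \<notin> ball a (r a) \<Longrightarrow> \<beta> a x = 0"
    by metis
  obtain F where F: "F \<subseteq> K" "finite F" "K \<subseteq> (\<Union>a\<in>F. ball a (r a/2))"
    using compactE_image[OF assms(1), of K "\<lambda>a. ball a (r a / 2)"] r(1) 
    by (metis (no_types, lifting) UN_I centre_in_ball half_gt_zero open_ball subsetI)
  \<comment> \<open>The product form stays in [0, 1] without dividing by a sum of bumps, and it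
    gives the value 1 as soon as one bump equals 1.\<close>
  define \<phi> where "\<phi> = (\<lambda>x. 1 - (\<Prod>a\<in>F. 1 - \<beta> a x))"
  have "smooth (\<lambda>x. \<Prod>a\<in>F. 1 - \<beta> a x)" using F(2,1)
    by (induction F rule: finite_induct) (auto intro!: smooth_const smooth_mult smooth_diff intro: \<beta>)
  then have sm: "smooth \<phi>" unfolding \<phi>_def by (intro smooth_const smooth_diff)
  have supp: "{x. \<phi> x \<noteq> 0} \<subseteq> (\<Union>a\<in>F. cball a (r a))"
  proof
    fix x assume "x \<in> {x. \<phi> x \<noteq> 0}"
    then have "(\<Prod>a\<in>F. 1 - \<beta> a x) \<noteq> 1" by (auto simp: \<phi>_def)
    then obtain a where "a \<in> F" "\<beta> a x \<noteq> 0"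
      using prod.neutral[of F "\<lambda>a. 1 - \<beta> a x"] by fastforce
    then show "x \<in> (\<Union>a\<in>F. cball a (r a))" using \<beta>(4)[of a x] F(1) by force
  qed
  have comp: "compact (\<Union>a\<in>F. cball a (r a))" using F(2) by (intro compact_UN) auto
  then have cl: "closure {x. \<phi> x \<noteq> 0} \<subseteq> (\<Union>a\<in>F. cball a (r a))"
    using supp by (simp add: closure_minimal compact_imp_closed)
  have "compact (closure {x. \<phi> x \<noteq> 0})"
    using comp cl by (meson bounded_subset closed_closure compact_eq_bounded_closed)
  moreover have "(\<Union>a\<in>F. cball a (r a)) \<subseteq> U" using F(1) r(2) by blast
  ultimately have "\<phi> \<in> test_functions U" using sm cl by (auto simp: test_functions_def)
  moreover have "0 \<le> (\<Prod>a\<in>F. 1 - \<beta> a x)" "(\<Prod>a\<in>F. 1 - \<beta> a x) \<le> 1" for x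
    using \<beta>(2) F(1) by (auto intro!: prod_nonneg prod_le_1)
  moreover have "(\<Prod>a\<in>F. 1 - \<beta> a x) = 0" if x: "x \<in> K" for x
  proof -
    obtain a where "a \<in> F" "x \<in> ball a (r a / 2)" using F(3) x by auto
    then show ?thesis using \<beta>(3)[of a x] F(1,2) by (auto simp: prod_zero_iff intro!: bexI[of _ a])
  qed
  ultimately show thesis by (intro that[of \<phi>]) (auto simp: \<phi>_def)
qed

section \<open>Gradients and uniform estimates for compactly supported functions\<close>

lemma grad_inner: "i \<in> Basis \<Longrightarrow> grad f x \<bullet> i = frechet_derivative f (at x) i"
  by (simp add: grad_def inner_sum_left inner_Basis if_distrib cong: if_cong)

lemma grad_mult:
  assumes "f differentiable (at x)" "g differentiable (at x)"
  shows "grad (\<lambda>x. f x * g x) x = f x *\<^sub>R grad g x + g x *\<^sub>R grad f x"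
proof -
  have "frechet_derivative (\<lambda>x. f x * g x) (at x) = (\<lambda>h. f x * frechet_derivative g (at x) h + frechet_derivative f (at x) h * g x)"
    by (rule frechet_derivative_at[OF has_derivative_mult[OF assms[unfolded frechet_derivative_works]], symmetric])
  then show ?thesis
    by (simp add: grad_def sum.distrib scaleR_sum_right algebra_simps)
qed

lemma smooth_Ck: "smooth f \<Longrightarrow> Ck k f" by (simp add: smooth_def)

lemma smooth_differentiable: "smooth f \<Longrightarrow> f differentiable (at x)"
  using Ck.simps(2) smooth_def by blast

lemma smooth_partial: "smooth f \<Longrightarrow> i \<in> Basis \<Longrightarrow> smooth (\<lambda>x. frechet_derivative f (at x) i)"
  unfolding smooth_def by (metis Ck.simps(2))

lemma continuous_grad: "Ck 1 f \<Longrightarrow> continuous_on UNIV (grad f)"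
  unfolding grad_def by (intro continuous_intros) (simp add: One_nat_def)

lemma grad_zero:
  assumes "open U" "x \<in> U" "\<And>y. y \<in> U \<Longrightarrow> f y = c"
  shows "grad f x = 0"
proof -
  have "(f has_derivative (\<lambda>h. 0)) (at x)"
    by (rule has_derivative_transform_within_open[of "\<lambda>x. c" _ _ _ U]) (use assms in auto)
  then have "frechet_derivative f (at x) = (\<lambda>h. 0)" using frechet_derivative_at by metis
  then show ?thesis by (simp add: grad_def)
qed

lemma bounded_of_support:
  fixes K :: "'a::euclidean_space \<Rightarrow> real"
  assumes "continuous_on UNIV K" "bounded {x. K x \<noteq> 0}"
  obtains B where "B > 0" "\<And>x. \<bar>K x\<bar> \<le> B"
proof -
  have "compact (K ` closure {x. K x \<noteq> 0})"
    using assms by (intro compact_continuous_image continuous_on_subset[OF assms(1)]) auto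
  then obtain B where B: "\<And>x. x \<in> closure {x. K x \<noteq> 0} \<Longrightarrow> \<bar>K x\<bar> \<le> B" "B > 0"
    using bounded_pos[of "K ` closure {x. K x \<noteq> 0}"] compact_imp_bounded by (metis image_eqI real_norm_def)
  have "\<bar>K x\<bar> \<le> B" for x
    using B closure_subset[of "{x. K x \<noteq> 0}"] by (cases "K x = 0") auto
  then show thesis using B(2) that by blast
qed

lemma uniformly_continuous_of_support:
  fixes K :: "'a::euclidean_space \<Rightarrow> real"
  assumes K: "continuous_on UNIV K" "bounded {x. K x \<noteq> 0}" and e: "e > 0"
  obtains d where "d > 0" "\<And>x y. dist x y < d \<Longrightarrow> \<bar>K x - K y\<bar> < e"
proof -
  obtain R where R: "R > 0" "{x. K x \<noteq> 0} \<subseteq> cball 0 R"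
    using bounded_subset_ballD[OF K(2), of 0] ball_subset_cball by blast
  \<comment> \<open>The extra 1 in the radius catches the second of two points at distance below 1
    when only the first lies in the support.\<close>
  have "uniformly_continuous_on (cball 0 (R + 1)) K"
    by (rule compact_uniformly_continuous[OF continuous_on_subset[OF K(1)]]) auto
  then obtain d where d: "d > 0" "\<And>x y. x \<in> cball 0 (R+1) \<Longrightarrow> y \<in> cball 0 (R+1) \<Longrightarrow> dist y x < d \<Longrightarrow> dist (K y) (K x) < e"
    using e unfolding uniformly_continuous_on_def by metis
  show thesis
  proof (rule that[of "min d 1"])
    show "min d 1 > 0" using d by simp
    fix x y :: 'a assume xy: "dist x y < min d 1"
    show "\<bar>K x - K y\<bar> < e"
    proof (cases "K x = 0 \<and> K y = 0")
      case False
      then have "norm x \<le> R \<or> norm y \<le> R" using R(2) by auto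
      then have "norm x \<le> R + 1" "norm y \<le> R + 1"
        using xy norm_triangle_sub[of x y] norm_triangle_sub[of y x] 
        by (auto simp: dist_norm norm_minus_commute)
      then show ?thesis using d(2)[of y x] xy by (simp add: dist_real_def)
    qed (use e in auto)
  qed
qed

lemma support_partial:
  "{x. frechet_derivative K (at x) i \<noteq> 0} \<subseteq> closure {x. K x \<noteq> (0::real)}"
proof
  fix x assume "x \<in> {x. frechet_derivative K (at x) i \<noteq> 0}"
  moreover have "frechet_derivative K (at x) i = 0" if x: "x \<in> - closure {x. K x \<noteq> 0}"
  proof -
    have "(K has_derivative (\<lambda>h. 0)) (at x)"
    proof (rule has_derivative_transform_within_open[of "\<lambda>x. 0" _ _ _ "- closure {x. K x \<noteq> 0}"])
      show "0 = K y" if "y \<in> - closure {x. K x \<noteq> 0}" for y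
        using that closure_subset[of "{x. K x \<noteq> 0}"] by auto
    qed (use x in auto)
    then have "frechet_derivative K (at x) = (\<lambda>h. 0)" using frechet_derivative_at by metis
    then show ?thesis by simp
  qed
  ultimately show "x \<in> closure {x. K x \<noteq> 0}" by auto
qed

lemma bounded_support_partial:
  "bounded {x. K x \<noteq> (0::real)} \<Longrightarrow> bounded {x. frechet_derivative K (at x) i \<noteq> 0}"
  by (rule bounded_subset[OF bounded_closure support_partial])

text \<open>Compact support makes the first-order remainder small uniformly in the base point. This
  is what allows differentiation under the integral sign against a density that is merely
  integrable.\<close>

lemma uniform_linearization:
  fixes K :: "'a::euclidean_space \<Rightarrow> real"
  assumes K: "Ck 1 K" "bounded {x. K x \<noteq> 0}" and e: "e > 0"
  obtains d where "d > 0"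
    "\<And>x h. norm h < d \<Longrightarrow> \<bar>K (x + h) - K x - frechet_derivative K (at x) h\<bar> \<le> e * norm h"
proof -
  have K1: "Ck (Suc 0) K" using K(1) unfolding One_nat_def .
  let ?D = "\<lambda>i x. frechet_derivative K (at x) i"
  \<comment> \<open>The operator norm of the difference of two derivatives is at most the sum of the
    differences of the partial derivatives, one term e' for each basis vector.\<close>
  define e' where "e' = e / DIM('a)"
  have e': "e' > 0" using e by (simp add: e'_def)
  have "\<exists>d>0. \<forall>x y. dist x y < d \<longrightarrow> \<bar>?D i x - ?D i y\<bar> < e'" if "i \<in> Basis" for i
  proof -
    have "continuous_on UNIV (?D i)" using K1 that by simp
    from uniformly_continuous_of_support[OF this bounded_support_partial[OF K(2)] e'] show ?thesis by metis
  qed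
  then obtain d where d: "\<And>i. i \<in> Basis \<Longrightarrow> d i > 0"
    "\<And>i x y. i \<in> Basis \<Longrightarrow> dist x y < d i \<Longrightarrow> \<bar>?D i x - ?D i y\<bar> < e'" by metis
  define d' where "d' = Min (d ` Basis)"
  have d': "d' > 0" "\<And>i. i \<in> Basis \<Longrightarrow> d' \<le> d i" using d(1) by (auto simp: d'_def)
  have D: "(K has_derivative frechet_derivative K (at x)) (at x)" for x
    by (rule Ck_Suc_has_derivative[OF K1])
  show thesis
  proof (rule that[OF d'(1)])
    fix x h :: 'a assume h: "norm h < d'"
    have rep: "frechet_derivative K (at y) h = (\<Sum>i\<in>Basis. (h \<bullet> i) * ?D i y)" for y h
    proof -
      interpret linear "frechet_derivative K (at y)" using D has_derivative_linear by blast
      show ?thesis by (subst euclidean_representation[symmetric]) (simp add: sum scale)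
    qed
    have "norm (K (x + h) - K x - frechet_derivative K (at x) (x + h - x)) \<le> norm (x + h - x) * e"
    proof (rule differentiable_bound_linearization[where S="ball x d'"])
      show "x + t *\<^sub>R (x + h - x) \<in> ball x d'" if "t \<in> {0..1}" for t
        using that h mult_left_le_one_le[of "norm h" t] by (auto simp: dist_norm)
      show "(K has_derivative frechet_derivative K (at y)) (at y within ball x d')" for y
        by (rule has_derivative_at_withinI[OF D])
      show "x \<in> ball x d'" using d' by simp
      show "onorm (frechet_derivative K (at y) - frechet_derivative K (at x)) \<le> e" if y: "y \<in> ball x d'" for y
        unfolding fun_diff_def
      proof (rule onorm_le)
        fix v
        have "norm (frechet_derivative K (at y) v - frechet_derivative K (at x) v) 
            = \<bar>\<Sum>i\<in>Basis. (v \<bullet> i) * (?D i y - ?D i x)\<bar>"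
          by (simp add: rep[where h=v] sum_subtractf right_diff_distrib)
        also have "\<dots> \<le> (\<Sum>i\<in>Basis. \<bar>v \<bullet> i\<bar> * \<bar>?D i y - ?D i x\<bar>)"
          by (rule order_trans[OF sum_abs]) (simp add: abs_mult)
        also have "\<dots> \<le> (\<Sum>i\<in>(Basis::'a set). norm v * e')"
        proof (intro sum_mono mult_mono)
          fix i :: 'a assume i: "i \<in> Basis"
          show "\<bar>?D i y - ?D i x\<bar> \<le> e'"
            using d(2)[of i y x] y i d'(2)[of i] by (auto simp: dist_commute less_imp_le)
        qed (auto simp: Basis_le_norm)
        also have "\<dots> = e * norm v" by (simp add: e'_def)
        finally show "norm (frechet_derivative K (at y) v - frechet_derivative K (at x) v) \<le> e * norm v" .
      qed
    qed
    then show "\<bar>K (x + h) - K x - frechet_derivative K (at x) h\<bar> \<le> e * norm h"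
      by (simp add: mult.commute)
  qed
qed

section \<open>Convolution with smooth compactly supported kernels\<close>

lemma convolution_integrable:
  fixes K :: "'a::euclidean_space \<Rightarrow> real"
  assumes M: "(\<lambda>y. y) \<in> M \<rightarrow>\<^sub>M borel" and g: "integrable M g"
    and K: "continuous_on UNIV K" "bounded {x. K x \<noteq> 0}"
  shows "integrable M (\<lambda>y. K (x - y) * (g y::real))"
proof -
  obtain B where B: "\<And>x. \<bar>K x\<bar> \<le> B" using bounded_of_support[OF K] by metis
  have [measurable]: "(\<lambda>y. y) \<in> M \<rightarrow>\<^sub>M borel" "K \<in> borel_measurable borel" "g \<in> borel_measurable M"
    using M K g by (auto intro: borel_measurable_continuous_onI)
  show ?thesis
    by (rule Bochner_Integration.integrable_bound[of M "\<lambda>y. B * g y"])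
      (use g B in \<open>auto simp: abs_mult intro!: AE_I2 mult_right_mono order_trans[OF B]\<close>)
qed

text \<open>The remainder of the convolution is the integral of the remainder of K against g, and
  the latter is uniformly o(|h|); so it is o(|h|) times the L1 norm of g.\<close>

lemma convolution_has_derivative:
  fixes K :: "'a::euclidean_space \<Rightarrow> real"
  assumes M: "(\<lambda>y. y) \<in> M \<rightarrow>\<^sub>M borel" and g: "integrable M g"
    and K: "Ck 1 K" "bounded {x. K x \<noteq> 0}"
  shows "((\<lambda>x. LINT y|M. K (x - y) * (g y::real)) has_derivative 
    (\<lambda>h. \<Sum>i\<in>Basis. (h \<bullet> i) * (LINT y|M. frechet_derivative K (at (x - y)) i * g y))) (at x)"
proof -
  have K1: "Ck (Suc 0) K" using K(1) unfolding One_nat_def .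
  let ?D = "\<lambda>i x. frechet_derivative K (at x) i"
  have D: "(K has_derivative frechet_derivative K (at x)) (at x)" for x
    by (rule Ck_Suc_has_derivative[OF K1])
  have rep: "frechet_derivative K (at y) h = (\<Sum>i\<in>Basis. (h \<bullet> i) * ?D i y)" for y h
  proof -
    interpret linear "frechet_derivative K (at y)" using D has_derivative_linear by blast
    show ?thesis by (subst euclidean_representation[symmetric]) (simp add: sum scale)
  qed
  have Kc: "continuous_on UNIV K" using K(1) Ck_continuous by blast
  have I1: "integrable M (\<lambda>y. K (x - y) * g y)" for x 
    by (rule convolution_integrable[OF M g Kc K(2)])
  have I2: "integrable M (\<lambda>y. ?D i (x - y) * g y)" if "i \<in> Basis" for i x
    using K1 that by (intro convolution_integrable[OF M g _ bounded_support_partial[OF K(2)]]) auto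
  \<comment> \<open>Adding 1 keeps the constant positive when g vanishes almost everywhere.\<close>
  define G where "G = (\<integral>y. \<bar>g y\<bar> \<partial>M) + 1"
  have G: "G > 0" unfolding G_def by (simp add: add_nonneg_pos)
  show ?thesis
    unfolding has_derivative_at2
  proof (intro conjI)
    show "bounded_linear (\<lambda>h. \<Sum>i\<in>Basis. h \<bullet> i * (LINT y|M. ?D i (x - y) * g y))"
      by (intro bounded_linear_sum bounded_linear_mult_left[THEN bounded_linear_compose] bounded_linear_inner_left)
    show "((\<lambda>y. (1 / norm (y - x)) *\<^sub>R ((LINT u|M. K (y - u) * g u) - ((LINT u|M. K (x - u) * g u) +
         (\<Sum>i\<in>Basis. (y - x) \<bullet> i * (LINT u|M. ?D i (x - u) * g u))))) \<longlongrightarrow> 0) (at x)"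
    proof (rule tendstoI)
      fix e :: real assume e: "e > 0"
      obtain d where d: "d > 0" "\<And>x h. norm h < d \<Longrightarrow> \<bar>K (x + h) - K x - frechet_derivative K (at x) h\<bar> \<le> (e / (2 * G)) * norm h"
        using uniform_linearization[OF K, of "e / (2 * G)"] e G by auto
      have "dist ((1 / norm (y - x)) *\<^sub>R ((LINT u|M. K (y - u) * g u) - ((LINT u|M. K (x - u) * g u) +
         (\<Sum>i\<in>Basis. (y - x) \<bullet> i * (LINT u|M. ?D i (x - u) * g u))))) 0 < e" if y: "y \<noteq> x" "dist y x < d" for y
      proof -
        let ?h = "y - x"
        have "(LINT u|M. K (y - u) * g u) - ((LINT u|M. K (x - u) * g u) +
         (\<Sum>i\<in>Basis. (y - x) \<bullet> i * (LINT u|M. ?D i (x - u) * g u)))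
          = (LINT u|M. K (y - u) * g u - (K (x - u) * g u + (\<Sum>i\<in>Basis. (y - x) \<bullet> i * (?D i (x - u) * g u))))"
          using I1 I2 by (subst Bochner_Integration.integral_diff) (auto simp: Bochner_Integration.integral_sum)
        also have "\<dots> = (LINT u|M. (K ((x - u) + ?h) - K (x - u) - frechet_derivative K (at (x - u)) ?h) * g u)"
          by (intro Bochner_Integration.integral_cong refl) (simp add: rep[where h="y - x"] sum_distrib_left sum_distrib_right algebra_simps)
        finally have eq: "(LINT u|M. K (y - u) * g u) - ((LINT u|M. K (x - u) * g u) +
         (\<Sum>i\<in>Basis. (y - x) \<bullet> i * (LINT u|M. ?D i (x - u) * g u))) = \<dots>" .
        have "\<bar>LINT u|M. (K ((x - u) + ?h) - K (x - u) - frechet_derivative K (at (x - u)) ?h) * g u\<bar> 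
             \<le> (LINT u|M. (e / (2 * G)) * norm ?h * \<bar>g u\<bar>)"
        proof (rule integral_abs_bound[THEN order_trans], rule integral_mono')
          show "integrable M (\<lambda>u. e / (2 * G) * norm ?h * \<bar>g u\<bar>)" using g by simp
          show "\<bar>(K (x - u + ?h) - K (x - u) - frechet_derivative K (at (x - u)) ?h) * g u\<bar>
             \<le> e / (2 * G) * norm ?h * \<bar>g u\<bar>" for u
            using mult_right_mono[OF d(2)[of ?h "x - u"], of "\<bar>g u\<bar>"] y by (simp add: abs_mult dist_norm)
        qed (use e G in auto)
        also have "\<dots> = (e / (2 * G)) * norm ?h * (\<integral>y. \<bar>g y\<bar> \<partial>M)" by simp
        also have "\<dots> \<le> (e / (2 * G)) * norm ?h * G"
          using e G by (intro mult_left_mono) (auto simp: G_def)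
        also have "\<dots> < e * norm ?h" using e G y by (simp add: field_simps)
        finally show ?thesis unfolding eq using y by (simp add: divide_simps mult.commute)
      qed
      then show "\<forall>\<^sub>F y in at x. dist ((1 / norm (y - x)) *\<^sub>R ((LINT u|M. K (y - u) * g u) - ((LINT u|M. K (x - u) * g u) +
         (\<Sum>i\<in>Basis. (y - x) \<bullet> i * (LINT u|M. ?D i (x - u) * g u))))) 0 < e"
        unfolding eventually_at using d(1) by auto
    qed
  qed
qed

text \<open>The induction runs over all kernels at once: the partial derivatives of the convolution
  are convolutions with the partial derivatives of K, which again are smooth with bounded
  support.\<close>

lemma smooth_convolution:
  fixes K :: "'a::euclidean_space \<Rightarrow> real"
  assumes M: "(\<lambda>y. y) \<in> M \<rightarrow>\<^sub>M borel" and g: "integrable M g"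
    and K: "smooth K" "bounded {x. K x \<noteq> 0}"
  shows "smooth (\<lambda>x. LINT y|M. K (x - y) * (g y::real))"
proof -
  have "Ck k (\<lambda>x. LINT y|M. K (x - y) * (g y::real))" for k
    using K
  proof (induction k arbitrary: K)
    case 0
    have "Ck 1 K" by (rule smooth_Ck[OF 0(1)])
    from convolution_has_derivative[OF M g this 0(2)] 
    show ?case by (auto simp: continuous_on_eq_continuous_at intro: has_derivative_continuous)
  next
    case (Suc k)
    have "Ck 1 K" by (rule smooth_Ck[OF Suc.prems(1)])
    note der = convolution_has_derivative[OF M g this Suc.prems(2)]
    show ?case
      by (rule Ck_SucI[OF der])
        (auto intro!: Ck_sum Ck_cmult Suc.IH smooth_partial[OF Suc.prems(1)] bounded_support_partial[OF Suc.prems(2)])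
  qed
  then show ?thesis by (simp add: smooth_def)
qed

lemma grad_convolution_inner:
  fixes K :: "'a::euclidean_space \<Rightarrow> real"
  assumes M: "(\<lambda>y. y) \<in> M \<rightarrow>\<^sub>M borel" and g: "integrable M g"
    and K: "Ck 1 K" "bounded {x. K x \<noteq> 0}" and i: "i \<in> Basis"
  shows "grad (\<lambda>x. LINT y|M. K (x - y) * (g y::real)) x \<bullet> i = (LINT y|M. (grad K (x - y) \<bullet> i) * g y)"
proof -
  have "frechet_derivative (\<lambda>x. LINT y|M. K (x - y) * (g y::real)) (at x) =
      (\<lambda>h. \<Sum>i\<in>Basis. (h \<bullet> i) * (LINT y|M. frechet_derivative K (at (x - y)) i * g y))"
    by (rule frechet_derivative_at[OF convolution_has_derivative[OF M g K], symmetric])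
  then have "grad (\<lambda>x. LINT y|M. K (x - y) * (g y::real)) x \<bullet> i = 
      (LINT y|M. frechet_derivative K (at (x - y)) i * g y)"
    using i by (simp add: grad_inner inner_Basis if_distrib if_distribR cong: if_cong)
  then show ?thesis using i by (simp add: grad_inner)
qed

section \<open>Continuity of translations and mollification\<close>

text \<open>An identity between vector measures, known on Borel sets, extends to bounded Borel
  integrands through simple functions and dominated convergence. The right side has two terms to
  match the splitting of Du. The maps into the Borel space allow measures with different sigma
  algebras, such as completions.\<close>

lemma integral_scaleR_eqI:
  fixes f :: "'m \<Rightarrow> 'b::euclidean_space" and \<phi> :: "'a::topological_space \<Rightarrow> real"
  assumes M: "X \<in> M \<rightarrow>\<^sub>M borel" "X1 \<in> M1 \<rightarrow>\<^sub>M borel" "X2 \<in> M2 \<rightarrow>\<^sub>M borel"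
    and f: "integrable M f" "integrable M1 f1" "integrable M2 f2"
    and eq: "\<And>A. A \<in> sets borel \<Longrightarrow> (LINT x|M. indicator A (X x) *\<^sub>R f x) = 
      (LINT x|M1. indicator A (X1 x) *\<^sub>R f1 x) + (LINT x|M2. indicator A (X2 x) *\<^sub>R f2 x)"
    and \<phi>: "\<phi> \<in> borel_measurable borel" "\<And>x. \<bar>\<phi> x\<bar> \<le> C"
  shows "(LINT x|M. \<phi> (X x) *\<^sub>R f x) = (LINT x|M1. \<phi> (X1 x) *\<^sub>R f1 x) + (LINT x|M2. \<phi> (X2 x) *\<^sub>R f2 x)"
proof -
  \<comment> \<open>The bound by 2 |\<phi>| is what dominates the simple approximations later, with
    majorant 2 C |f|.\<close>
  obtain s where s: "\<And>i. simple_function borel (s i)" "\<And>x. (\<lambda>i. s i x) \<longlonglongrightarrow> \<phi> x" "\<And>i x. \<bar>s i x\<bar> \<le> 2 * \<bar>\<phi> x\<bar>"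
    using borel_measurable_implies_sequence_metric[OF \<phi>(1), of 0] by auto
  have sm: "s i \<in> borel_measurable borel" for i using s(1) by (rule borel_measurable_simple_function)
  have sC: "\<bar>s i x\<bar> \<le> 2 * C" for i x using s(3)[of i x] \<phi>(2)[of x] by linarith
  have simple: "(LINT x|N. s i (Z x) *\<^sub>R g x) = (\<Sum>c\<in>range (s i). c *\<^sub>R (LINT x|N. indicator (s i -` {c}) (Z x) *\<^sub>R g x))"
    if [measurable]: "Z \<in> N \<rightarrow>\<^sub>M borel" and g: "integrable N g" for N and Z :: "'n \<Rightarrow> 'a" and g :: "'n \<Rightarrow> 'b" and i
  proof -
    have fin: "finite (range (s i))" using s(1)[of i] by (simp add: simple_function_def)
    have meas: "s i -` {c} \<in> sets borel" for c using s(1)[of i] sm[of i] by (auto intro: measurable_sets_borel)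
    have "s i (Z x) *\<^sub>R g x = (\<Sum>c\<in>range (s i). c *\<^sub>R (indicator (s i -` {c}) (Z x) *\<^sub>R g x))" for x
    proof -
      have "(\<Sum>c\<in>range (s i). c *\<^sub>R (indicator (s i -` {c}) (Z x) *\<^sub>R g x)) 
        = (\<Sum>c\<in>range (s i). if c = s i (Z x) then c *\<^sub>R g x else 0)"
        by (intro sum.cong refl) (auto simp: indicator_def)
      then show ?thesis using fin by simp
    qed
    then have "(LINT x|N. s i (Z x) *\<^sub>R g x) = (LINT x|N. (\<Sum>c\<in>range (s i). c *\<^sub>R (indicator (s i -` {c}) (Z x) *\<^sub>R g x)))" by simp
    also have "\<dots> = (\<Sum>c\<in>range (s i). LINT x|N. c *\<^sub>R (indicator (s i -` {c}) (Z x) *\<^sub>R g x))"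
    proof (rule Bochner_Integration.integral_sum)
      fix c
      have [measurable]: "g \<in> borel_measurable N" using g by auto
      have [measurable]: "s i -` {c} \<in> sets borel" by (rule meas)
      have "integrable N (\<lambda>x. indicator (s i -` {c}) (Z x) *\<^sub>R g x)"
      proof (rule Bochner_Integration.integrable_bound[OF g])
        show "AE x in N. norm (indicator (s i -` {c}) (Z x) *\<^sub>R g x) \<le> norm (g x)" by (auto simp: indicator_def)
      qed measurable
      then show "integrable N (\<lambda>x. c *\<^sub>R (indicator (s i -` {c}) (Z x) *\<^sub>R g x))" by (rule integrable_scaleR_right)
    qed
    also have "\<dots> = (\<Sum>c\<in>range (s i). c *\<^sub>R (LINT x|N. indicator (s i -` {c}) (Z x) *\<^sub>R g x))"
      by (intro sum.cong refl integral_scaleR_right)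
    finally show ?thesis .
  qed
  have lim: "(\<lambda>i. LINT x|N. s i (Z x) *\<^sub>R g x) \<longlonglongrightarrow> (LINT x|N. \<phi> (Z x) *\<^sub>R g x)" 
    if [measurable]: "Z \<in> N \<rightarrow>\<^sub>M borel" and g: "integrable N g" for N and Z :: "'n \<Rightarrow> 'a" and g :: "'n \<Rightarrow> 'b"
  proof (rule integral_dominated_convergence[where w="\<lambda>x. 2 * C * norm (g x)"])
    have [measurable]: "g \<in> borel_measurable N" "\<phi> \<in> borel_measurable borel" "\<And>i. s i \<in> borel_measurable borel" 
      using g \<phi> sm by auto
    show "(\<lambda>x. \<phi> (Z x) *\<^sub>R g x) \<in> borel_measurable N" "\<And>i. (\<lambda>x. s i (Z x) *\<^sub>R g x) \<in> borel_measurable N" by measurable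
    show "integrable N (\<lambda>x. 2 * C * norm (g x))" using g by simp
    show "AE x in N. (\<lambda>i. s i (Z x) *\<^sub>R g x) \<longlonglongrightarrow> \<phi> (Z x) *\<^sub>R g x" using s(2) by (auto intro!: tendsto_intros)
    show "AE x in N. norm (s i (Z x) *\<^sub>R g x) \<le> 2 * C * norm (g x)" for i
      using sC by (auto intro!: mult_right_mono)
  qed
  have "(LINT x|M. s i (X x) *\<^sub>R f x) = (LINT x|M1. s i (X1 x) *\<^sub>R f1 x) + (LINT x|M2. s i (X2 x) *\<^sub>R f2 x)" for i
  proof -
    have "s i -` {c} \<in> sets borel" for c using sm[of i] by (auto intro: measurable_sets_borel)
    then show ?thesis
      unfolding simple[OF M(1) f(1)] simple[OF M(2) f(2)] simple[OF M(3) f(3)]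
      by (subst eq) (auto simp: scaleR_add_right sum.distrib)
  qed
  then have "(\<lambda>i. LINT x|M. s i (X x) *\<^sub>R f x) \<longlonglongrightarrow> (LINT x|M1. \<phi> (X1 x) *\<^sub>R f1 x) + (LINT x|M2. \<phi> (X2 x) *\<^sub>R f2 x)"
    using tendsto_add[OF lim[OF M(2) f(2)] lim[OF M(3) f(3)]] by simp
  with lim[OF M(1) f(1)] show ?thesis by (rule LIMSEQ_unique)
qed

text \<open>The value demanded by the definite description is unique because any representing pair
  agrees with the given densities on all Borel subsets of X, hence also for bounded
  integrands.\<close>

lemma vintegral_eqI:
  fixes m :: "'a::euclidean_space set \<Rightarrow> 'b::euclidean_space" 
  assumes m: "vmeasure X m" and X: "X \<in> sets borel"
    and M: "(\<lambda>x. x) \<in> M1 \<rightarrow>\<^sub>M borel" "(\<lambda>x. x) \<in> M2 \<rightarrow>\<^sub>M borel"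
    and f: "set_integrable M1 X f1" "set_integrable M2 X f2"
    and eq: "\<And>B. B \<in> sets borel \<Longrightarrow> B \<subseteq> X \<Longrightarrow> m B = (LINT x:B|M1. f1 x) + (LINT x:B|M2. f2 x)"
    and \<phi>: "\<phi> \<in> borel_measurable borel" "\<And>x. x \<in> X \<Longrightarrow> \<bar>\<phi> x\<bar> \<le> C"
  shows "vintegral X m \<phi> = (LINT x:X|M1. \<phi> x *\<^sub>R f1 x) + (LINT x:X|M2. \<phi> x *\<^sub>R f2 x)"
proof -
  have *: "(LINT x:X|\<mu>. \<phi> x *\<^sub>R \<sigma> x) = (LINT x:X|M1. \<phi> x *\<^sub>R f1 x) + (LINT x:X|M2. \<phi> x *\<^sub>R f2 x)"
    if "vmeasure_rep X m \<mu> \<sigma>" for \<mu> \<sigma>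
  proof -
    from that have \<mu>: "sets \<mu> = sets borel" "integrable \<mu> \<sigma>" "\<And>A. A \<in> sets borel \<Longrightarrow> A \<subseteq> X \<Longrightarrow> m A = (LINT x:A|\<mu>. \<sigma> x)"
      by (auto simp: vmeasure_rep_def)
    have id: "(\<lambda>x. x) \<in> \<mu> \<rightarrow>\<^sub>M borel" using \<mu>(1) by (simp add: measurable_def sets_eq_imp_space_eq[OF \<mu>(1)])
    have ind: "indicator A x *\<^sub>R indicator X x *\<^sub>R y = indicator (A \<inter> X) x *\<^sub>R y" for A x and y :: 'b
      by (auto simp: indicator_def)
    \<comment> \<open>The indicator is attached to both factors: it makes the integrand bounded on
      the whole space and the density integrable there. Being idempotent, it changes no
      value.\<close>
    have "(LINT x|\<mu>. (indicator X x * \<phi> x) *\<^sub>R (indicator X x *\<^sub>R \<sigma> x)) = 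
      (LINT x|M1. (indicator X x * \<phi> x) *\<^sub>R (indicator X x *\<^sub>R f1 x)) + (LINT x|M2. (indicator X x * \<phi> x) *\<^sub>R (indicator X x *\<^sub>R f2 x))"
    proof (rule integral_scaleR_eqI[OF id M])
      show "(\<lambda>x. indicator X x * \<phi> x) \<in> borel_measurable borel" using \<phi>(1) X by measurable
      show "\<bar>indicator X x * \<phi> x\<bar> \<le> \<bar>C\<bar>" for x
        using \<phi>(2)[of x] by (cases "x \<in> X") (auto intro: order_trans[OF _ abs_ge_self])
      show "integrable \<mu> (\<lambda>x. indicator X x *\<^sub>R \<sigma> x)"
        using \<mu> X by (intro integrable_mult_indicator) auto
      show "integrable M1 (\<lambda>x. indicator X x *\<^sub>R f1 x)" "integrable M2 (\<lambda>x. indicator X x *\<^sub>R f2 x)"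
        using f by (auto simp: set_integrable_def)
      fix A :: "'a set" assume "A \<in> sets borel"
      then show "(LINT x|\<mu>. indicator A x *\<^sub>R indicator X x *\<^sub>R \<sigma> x) = 
        (LINT x|M1. indicator A x *\<^sub>R indicator X x *\<^sub>R f1 x) + (LINT x|M2. indicator A x *\<^sub>R indicator X x *\<^sub>R f2 x)"
        unfolding ind using \<mu>(3)[of "A \<inter> X"] eq[of "A \<inter> X"] X by (simp add: set_lebesgue_integral_def)
    qed
    moreover have "(indicator X x * \<phi> x) *\<^sub>R (indicator X x *\<^sub>R w) = indicator X x *\<^sub>R \<phi> x *\<^sub>R w" for x and w :: 'b
      by (auto simp: indicator_def)
    ultimately show ?thesis by (simp only: set_lebesgue_integral_def)
  qed
  obtain \<mu> \<sigma> where rep: "vmeasure_rep X m \<mu> \<sigma>" using m by (auto simp: vmeasure_def)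
  show ?thesis
    unfolding vintegral_def
  proof (rule the_equality)
    show "\<exists>\<mu> \<sigma>. vmeasure_rep X m \<mu> \<sigma> \<and> (LINT x:X|M1. \<phi> x *\<^sub>R f1 x) + (LINT x:X|M2. \<phi> x *\<^sub>R f2 x) = (LINT x:X|\<mu>. \<phi> x *\<^sub>R \<sigma> x)"
      using *[OF rep] rep by metis
  qed (use * in metis)
qed

text \<open>The polynomial s^2 A - 2 s I + B in s is the integral of (s |f| - |g|)^2 and hence
  nonnegative; its value at s = I/A is the claim for the absolute values.\<close>

lemma
  fixes f g :: "'a \<Rightarrow> real"
  assumes [measurable]: "f \<in> borel_measurable M" "g \<in> borel_measurable M"
    and f: "integrable M (\<lambda>x. (f x)\<^sup>2)" and g: "integrable M (\<lambda>x. (g x)\<^sup>2)"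
  shows integrable_mult_L2: "integrable M (\<lambda>x. f x * g x)"
    and Cauchy_Schwarz_integral_abs: "(LINT x|M. \<bar>f x * g x\<bar>)\<^sup>2 \<le> (LINT x|M. (f x)\<^sup>2) * (LINT x|M. (g x)\<^sup>2)"
    and Cauchy_Schwarz_integral: "(LINT x|M. f x * g x)\<^sup>2 \<le> (LINT x|M. (f x)\<^sup>2) * (LINT x|M. (g x)\<^sup>2)"
proof -
  show int: "integrable M (\<lambda>x. f x * g x)"
  proof (rule Bochner_Integration.integrable_bound)
    show "integrable M (\<lambda>x. (f x)\<^sup>2 + (g x)\<^sup>2)" using f g by simp
    have "\<bar>f x * g x\<bar> \<le> (f x)\<^sup>2 + (g x)\<^sup>2" for x
    proof -
      have "0 \<le> \<bar>f x\<bar> * \<bar>g x\<bar>" by simp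
      then show ?thesis
        using sum_squares_bound[of "\<bar>f x\<bar>" "\<bar>g x\<bar>"] unfolding abs_mult power2_abs by linarith
    qed
    then show "AE x in M. norm (f x * g x) \<le> norm ((f x)\<^sup>2 + (g x)\<^sup>2)" by (auto intro: order_trans[OF _ abs_ge_self])
  qed measurable
  define A B I where "A = (LINT x|M. (f x)\<^sup>2)" and "B = (LINT x|M. (g x)\<^sup>2)" and "I = (LINT x|M. \<bar>f x * g x\<bar>)"
  have q: "0 \<le> s\<^sup>2 * A - 2 * s * I + B" for s
  proof -
    have "0 \<le> (LINT x|M. (s * \<bar>f x\<bar> - \<bar>g x\<bar>)\<^sup>2)" by simp
    also have "\<dots> = (LINT x|M. s\<^sup>2 * (f x)\<^sup>2 - 2 * s * \<bar>f x * g x\<bar> + (g x)\<^sup>2)"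
      by (intro Bochner_Integration.integral_cong refl) (simp add: power2_diff power_mult_distrib abs_mult mult_ac)
    also have "\<dots> = s\<^sup>2 * A - 2 * s * I + B"
      using f g int by (simp add: A_def B_def I_def)
    finally show ?thesis .
  qed
  have A: "A \<ge> 0" unfolding A_def by simp
  have "I\<^sup>2 \<le> A * B"
  proof (cases "A = 0")
    case True
    have "I = 0"
    proof (rule ccontr)
      assume "I \<noteq> 0"
      \<comment> \<open>At s = (B + 1) / (2 I) the polynomial would equal -1.\<close>
      then show False using q[of "(B + 1) / (2 * I)"] True by simp
    qed
    then show ?thesis using True by simp
  next
    case False
    then have "0 \<le> A * ((I / A)\<^sup>2 * A - 2 * (I / A) * I + B)" using A q[of "I / A"] by simp
    also have "\<dots> = A * B - I\<^sup>2" using False by (simp add: power2_eq_square field_simps)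
    finally show ?thesis by simp
  qed
  then show abs: "(LINT x|M. \<bar>f x * g x\<bar>)\<^sup>2 \<le> (LINT x|M. (f x)\<^sup>2) * (LINT x|M. (g x)\<^sup>2)"
    by (simp add: A_def B_def I_def)
  have "(LINT x|M. f x * g x)\<^sup>2 \<le> (LINT x|M. \<bar>f x * g x\<bar>)\<^sup>2"
    using integral_abs_bound[of M "\<lambda>x. f x * g x"] by (simp flip: abs_le_square_iff)
  then show "(LINT x|M. f x * g x)\<^sup>2 \<le> (LINT x|M. (f x)\<^sup>2) * (LINT x|M. (g x)\<^sup>2)" using abs by simp
qed

text \<open>Two dominated limits: f is first cut off in height and in space, giving F; then the
  continuous functions that converge to f almost everywhere are cut off in the same way, so that a
  constant on a ball dominates the second limit.\<close>

lemma continuous_approx_power: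
  fixes f :: "'a::euclidean_space \<Rightarrow> real"
  assumes [measurable]: "f \<in> borel_measurable borel" and f: "integrable lborel (\<lambda>x. \<bar>f x\<bar> ^ p)" and p: "p \<ge> 1" and e: "e > 0"
  obtains g where "continuous_on UNIV g" "bounded {x. g x \<noteq> 0}" 
    "integrable lborel (\<lambda>x. \<bar>f x - g x\<bar> ^ p)" "(LINT x|lborel. \<bar>f x - g x\<bar> ^ p) < e"
proof -
  define cl where "cl = (\<lambda>(R::real) t. max (-R) (min R t))"
  define \<theta> where "\<theta> = (\<lambda>(R::real) (x::'a). max 0 (min 1 (R + 1 - norm x)))"
  have \<theta>: "0 \<le> \<theta> R x" "\<theta> R x \<le> 1" "norm x \<le> R \<Longrightarrow> \<theta> R x = 1" "\<theta> R x \<noteq> 0 \<Longrightarrow> norm x \<le> R + 1" for R :: real and x :: 'a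
    by (auto simp: \<theta>_def)
  have cl: "0 \<le> R \<Longrightarrow> \<bar>cl R t\<bar> \<le> R" "\<bar>t\<bar> \<le> R \<Longrightarrow> cl R t = t" "0 \<le> R \<Longrightarrow> \<bar>t - cl R t\<bar> \<le> \<bar>t\<bar>" "0 \<le> R \<Longrightarrow> \<bar>cl R t\<bar> \<le> \<bar>t\<bar>" 
    "0 \<le> R \<Longrightarrow> t * cl R t \<ge> 0" for R t :: real
    by (auto simp: cl_def zero_le_mult_iff)
  have \<theta>c: "continuous_on UNIV (\<theta> R)" for R unfolding \<theta>_def by (intro continuous_intros)
  have clc: "continuous_on UNIV (cl R)" for R unfolding cl_def by (intro continuous_intros)
  have [measurable]: "\<theta> R \<in> borel_measurable borel" "cl R \<in> borel_measurable borel" for R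
    using \<theta>c clc by (auto intro: borel_measurable_continuous_onI)
  define F where "F = (\<lambda>R x. \<theta> R x * cl R (f x))"
  have [measurable]: "F R \<in> borel_measurable borel" for R unfolding F_def by measurable
  have le: "\<bar>f x - F R x\<bar> \<le> \<bar>f x\<bar>" if "0 \<le> R" for R :: real and x
  proof -
    have "f x - F R x = (1 - \<theta> R x) * f x + \<theta> R x * (f x - cl R (f x))" by (simp add: F_def algebra_simps)
    also have "\<bar>\<dots>\<bar> \<le> (1 - \<theta> R x) * \<bar>f x\<bar> + \<theta> R x * \<bar>f x\<bar>"
      using \<theta>(1,2)[of R x] cl(3)[OF that, of "f x"] 
      by (intro order_trans[OF abs_triangle_ineq] add_mono) (auto simp: abs_mult intro: mult_left_mono)
    finally show ?thesis by (simp add: algebra_simps)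
  qed
  have "(\<lambda>n. LINT x|lborel. \<bar>f x - F (real n) x\<bar> ^ p) \<longlonglongrightarrow> (LINT x|(lborel::'a measure). 0)"
  proof (rule integral_dominated_convergence[OF _ _ f])
    show "AE x in lborel. (\<lambda>n. \<bar>f x - F (real n) x\<bar> ^ p) \<longlonglongrightarrow> 0"
    proof (rule AE_I2)
      fix x
      obtain N where N: "max \<bar>f x\<bar> (norm x) \<le> real N" using real_arch_simple by blast
      have "\<bar>f x - F (real n) x\<bar> ^ p = 0" if "n \<ge> N" for n
      proof -
        have "\<bar>f x\<bar> \<le> n" "norm x \<le> n" using N that by (auto intro: order_trans)
        then show ?thesis using p by (simp add: F_def cl \<theta>)
      qed
      then show "(\<lambda>n. \<bar>f x - F (real n) x\<bar> ^ p) \<longlonglongrightarrow> 0"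
        by (intro tendsto_eventually) (auto simp: eventually_sequentially)
    qed
    show "AE x in lborel. norm (\<bar>f x - F (real n) x\<bar> ^ p) \<le> \<bar>f x\<bar> ^ p" for n
      using le[of "real n"] by (auto intro!: power_mono)
  qed auto
  \<comment> \<open>The tolerance pays for (a + b)^p <= 2^p (a^p + b^p): each of the two errors then
    contributes e/2.\<close>
  then have "\<forall>\<^sub>F n in sequentially. (LINT x|lborel. \<bar>f x - F (real n) x\<bar> ^ p) < e / 2 ^ (p + 1)"
    using e by (auto intro!: order_tendstoD(2))
  then obtain n where n: "(LINT x|lborel. \<bar>f x - F (real n) x\<bar> ^ p) < e / 2 ^ (p + 1)"
    by (auto simp: eventually_sequentially)
  define R where "R = real n"
  have R: "R \<ge> 0" by (simp add: R_def)
  \<comment> \<open>Measurability in this sense supplies continuous functions converging to f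
    outside a negligible set, the raw material for the approximation.\<close>
  have "f measurable_on UNIV"
    using measurable_on_iff_borel_measurable[of UNIV f] by (simp add: measurable_completion lebesgue_on_UNIV_eq)
  then obtain N h where N: "negligible N" and h: "\<And>n. continuous_on UNIV (h n)" "\<And>x. x \<notin> N \<Longrightarrow> (\<lambda>n. h n x) \<longlonglongrightarrow> f x"
    by (auto simp: measurable_on_def)
  have [measurable]: "h n \<in> borel_measurable borel" for n using h(1) by (rule borel_measurable_continuous_onI)
  have "N \<in> null_sets lebesgue" using N negligible_iff_null_sets by blast
  then have aeN: "AE x in lborel. x \<notin> N" 
    using AE_not_in[of N lebesgue] by (simp add: AE_completion_iff)
  define g where "g = (\<lambda>k x. \<theta> R x * cl R (h k x))"
  have [measurable]: "g k \<in> borel_measurable borel" for k unfolding g_def by measurable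
  have dom: "integrable lborel (\<lambda>x::'a. indicator (cball 0 (R + 1)) x * (2 * R) ^ p)"
    by (auto intro!: integrable_mult_left integrable_real_indicator emeasure_lborel_cball_finite)
  have bd: "\<bar>F R x - g k x\<bar> ^ p \<le> indicator (cball 0 (R + 1)) x * (2 * R) ^ p" for k x
  proof (cases "\<theta> R x = 0")
    case True
    then show ?thesis using p R by (cases p) (auto simp: F_def g_def)
  next
    case False
    have "\<bar>F R x - g k x\<bar> = \<theta> R x * \<bar>cl R (f x) - cl R (h k x)\<bar>"
      using \<theta>(1) by (simp add: F_def g_def abs_mult flip: right_diff_distrib)
    also have "\<dots> \<le> 1 * (2 * R)"
      using \<theta> cl(1)[OF R, of "f x"] cl(1)[OF R, of "h k x"] by (intro mult_mono) auto
    finally have "\<bar>F R x - g k x\<bar> ^ p \<le> (2 * R) ^ p" by (intro power_mono) auto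
    then show ?thesis using \<theta>(4)[OF False] by simp
  qed
  have "(\<lambda>k. LINT x|lborel. \<bar>F R x - g k x\<bar> ^ p) \<longlonglongrightarrow> (LINT x|(lborel::'a measure). 0)"
  proof (rule integral_dominated_convergence[OF _ _ dom])
    show "AE x in lborel. (\<lambda>k. \<bar>F R x - g k x\<bar> ^ p) \<longlonglongrightarrow> 0"
      using aeN
    proof eventually_elim
      case (elim x)
      have "(\<lambda>k. cl R (h k x)) \<longlonglongrightarrow> cl R (f x)"
        by (rule continuous_on_tendsto_compose[OF clc h(2)[OF elim]]) auto
      then have "(\<lambda>k. \<bar>F R x - g k x\<bar> ^ p) \<longlonglongrightarrow> \<bar>F R x - \<theta> R x * cl R (f x)\<bar> ^ p"
        unfolding g_def by (intro tendsto_intros)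
      moreover have "\<bar>F R x - \<theta> R x * cl R (f x)\<bar> ^ p = 0" using p by (cases p) (auto simp: F_def)
      ultimately show ?case by (simp only:)
    qed
    show "AE x in lborel. norm (\<bar>F R x - g k x\<bar> ^ p) \<le> indicator (cball 0 (R + 1)) x * (2 * R) ^ p" for k
      using bd by auto
  qed auto
  then have "\<forall>\<^sub>F k in sequentially. (LINT x|lborel. \<bar>F R x - g k x\<bar> ^ p) < e / 2 ^ (p + 1)"
    using e by (auto intro!: order_tendstoD(2))
  then obtain k where k: "(LINT x|lborel. \<bar>F R x - g k x\<bar> ^ p) < e / 2 ^ (p + 1)"
    by (auto simp: eventually_sequentially)
  have i1: "integrable lborel (\<lambda>x. \<bar>f x - F R x\<bar> ^ p)"
    by (rule Bochner_Integration.integrable_bound[OF f]) (use le[OF R] in \<open>auto intro!: power_mono\<close>)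
  have i2: "integrable lborel (\<lambda>x. \<bar>F R x - g k x\<bar> ^ p)"
    by (rule Bochner_Integration.integrable_bound[OF dom]) 
      (use bd in \<open>auto intro!: order_trans[OF _ abs_ge_self]\<close>)
  have tri: "\<bar>f x - g k x\<bar> ^ p \<le> 2 ^ p * \<bar>f x - F R x\<bar> ^ p + 2 ^ p * \<bar>F R x - g k x\<bar> ^ p" for x
  proof -
    let ?a = "\<bar>f x - F R x\<bar>" and ?b = "\<bar>F R x - g k x\<bar>"
    have "\<bar>f x - g k x\<bar> ^ p \<le> (2 * max ?a ?b) ^ p" by (intro power_mono) (auto simp: max_def abs_if)
    also have "\<dots> = 2 ^ p * (max ?a ?b) ^ p" by (simp add: power_mult_distrib)
    also have "(max ?a ?b) ^ p \<le> ?a ^ p + ?b ^ p" by (auto simp: max_def)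
    finally show ?thesis by (simp add: distrib_left)
  qed
  have i3: "integrable lborel (\<lambda>x. \<bar>f x - g k x\<bar> ^ p)"
    by (rule Bochner_Integration.integrable_bound[of _ "\<lambda>x. 2 ^ p * \<bar>f x - F R x\<bar> ^ p + 2 ^ p * \<bar>F R x - g k x\<bar> ^ p"])
      (use tri i1 i2 in \<open>auto intro!: order_trans[OF _ abs_ge_self]\<close>)
  show thesis
  proof (rule that[of "g k"])
    show "continuous_on UNIV (g k)" unfolding g_def
      by (intro continuous_intros \<theta>c continuous_on_compose2[OF clc h(1)]) auto
    have "{x. g k x \<noteq> 0} \<subseteq> cball 0 (R + 1)" using \<theta>(4) by (auto simp: g_def)
    then show "bounded {x. g k x \<noteq> 0}" using bounded_cball bounded_subset by blast
    have "(LINT x|lborel. \<bar>f x - g k x\<bar> ^ p) \<le> (LINT x|lborel. 2 ^ p * \<bar>f x - F R x\<bar> ^ p + 2 ^ p * \<bar>F R x - g k x\<bar> ^ p)"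
      using tri i1 i2 i3 by (intro integral_mono) auto
    also have "\<dots> = 2 ^ p * (LINT x|lborel. \<bar>f x - F R x\<bar> ^ p) + 2 ^ p * (LINT x|lborel. \<bar>F R x - g k x\<bar> ^ p)"
      using i1 i2 by simp
    also have "\<dots> < 2 ^ p * (e / 2 ^ (p + 1)) + 2 ^ p * (e / 2 ^ (p + 1))"
      using n k by (intro add_strict_mono mult_strict_left_mono) (auto simp: R_def)
    also have "\<dots> = e" by (simp add: field_simps)
    finally show "(LINT x|lborel. \<bar>f x - g k x\<bar> ^ p) < e" .
  qed (rule i3)
qed

section \<open>Translations and mollifications paired with a fixed function\<close>

lemma integral_lborel_translation:
  fixes f :: "'a::euclidean_space \<Rightarrow> real"
  assumes [measurable]: "f \<in> borel_measurable borel"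
  shows "(LINT x|lborel. f (x + c)) = (LINT x|lborel. f x)" "integrable lborel (\<lambda>x. f (x + c)) \<longleftrightarrow> integrable lborel f"
proof -
  have eq: "lborel = distr lborel borel (\<lambda>x::'a. x + c)" 
    using lborel_distr_plus[of c] by (simp add: add.commute[of _ c])
  show "(LINT x|lborel. f (x + c)) = (LINT x|lborel. f x)"
    by (subst (2) eq) (simp add: integral_distr)
  show "integrable lborel (\<lambda>x. f (x + c)) \<longleftrightarrow> integrable lborel f"
    by (subst (2) eq) (simp add: integrable_distr_eq)
qed

text \<open>Continuity of translations, in the dual form that serves both for two functions in
  \<open>L\<^sup>2\<close> (\<open>p = 2\<close>) and for an integrable and a bounded function (\<open>p = 1\<close>).\<close>

lemma translation_pairing_tendsto:
  fixes f v :: "'a::euclidean_space \<Rightarrow> real"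
  assumes [measurable]: "f \<in> borel_measurable borel" "v \<in> borel_measurable borel" 
    and f: "integrable lborel (\<lambda>x. \<bar>f x\<bar> ^ p)" and p: "p \<ge> 1" and v: "integrable lborel v"
    and bnd: "\<And>g h. g \<in> borel_measurable borel \<Longrightarrow> integrable lborel (\<lambda>x. \<bar>g x\<bar> ^ p) \<Longrightarrow>
      integrable lborel (\<lambda>y. g y * v (y + h)) \<and> \<bar>LINT y|lborel. g y * v (y + h)\<bar> ^ p \<le> V * (LINT y|lborel. \<bar>g y\<bar> ^ p)"
    and e: "e > 0"
  obtains d where "d > 0" 
    "\<And>h. norm h < d \<Longrightarrow> \<bar>(LINT y|lborel. f y * v (y + h)) - (LINT y|lborel. f y * v y)\<bar> < e"
proof -
  define V' where "V' = \<bar>V\<bar> + 1"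
  have V': "V' > 0" "V \<le> V'" by (auto simp: V'_def)
  \<comment> \<open>Replacing f by g costs at most e/4, uniformly in the shift, by the bound
    \<open>bnd\<close>. It is paid twice, for the shift h and for the shift 0, and the continuity of
    g costs another e/4.\<close>
  obtain g where g: "continuous_on UNIV g" "bounded {x. g x \<noteq> 0}" 
    "integrable lborel (\<lambda>x. \<bar>f x - g x\<bar> ^ p)" "(LINT x|lborel. \<bar>f x - g x\<bar> ^ p) < (e/4) ^ p / V'"
    using continuous_approx_power[OF assms(1) f p, of "(e/4) ^ p / V'"] e V' by auto
  have [measurable]: "g \<in> borel_measurable borel" using g(1) by (rule borel_measurable_continuous_onI)
  obtain B where B: "B > 0" "\<And>x. \<bar>g x\<bar> \<le> B" using bounded_of_support[OF g(1,2)] by blast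
  have ig: "integrable lborel (\<lambda>y. g y * v (y + h))" for h
  proof (rule Bochner_Integration.integrable_bound)
    show "integrable lborel (\<lambda>y. B * v (y + h))"
      using integral_lborel_translation(2)[of v h] v by simp
  qed (auto simp: abs_mult intro!: mult_right_mono order_trans[OF B(2)])
  have ifv: "integrable lborel (\<lambda>y. f y * v (y + h))" for h
    using bnd[OF assms(1) f, of h] by auto
  have fg: "\<bar>(LINT y|lborel. f y * v (y + h)) - (LINT y|lborel. g y * v (y + h))\<bar> \<le> e/4" for h
  proof -
    have eq: "(LINT y|lborel. f y * v (y + h)) - (LINT y|lborel. g y * v (y + h)) = (LINT y|lborel. (f y - g y) * v (y + h))"
      using ig[of h] ifv[of h] by (subst Bochner_Integration.integral_diff[symmetric]) (auto simp: algebra_simps)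
    have "\<bar>LINT y|lborel. (f y - g y) * v (y + h)\<bar> ^ p \<le> V * (LINT x|lborel. \<bar>f x - g x\<bar> ^ p)"
      using bnd[of "\<lambda>y. f y - g y" h] g(3) by auto
    moreover have "V * (LINT x|lborel. \<bar>f x - g x\<bar> ^ p) \<le> V' * (LINT x|lborel. \<bar>f x - g x\<bar> ^ p)"
      using V' by (intro mult_right_mono) auto
    moreover have "V' * (LINT x|lborel. \<bar>f x - g x\<bar> ^ p) \<le> (e/4) ^ p"
      using g(4) V' by (simp add: field_simps)
    ultimately have "\<bar>(LINT y|lborel. f y * v (y + h)) - (LINT y|lborel. g y * v (y + h))\<bar> ^ p \<le> (e/4) ^ p"
      unfolding eq by linarith
    then show ?thesis using e p by (subst (asm) power_mono_iff) auto
  qed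
  define I where "I = (LINT y|lborel. \<bar>v y\<bar>) + 1"
  have I: "I > 0" unfolding I_def by (simp add: add_nonneg_pos)
  obtain d where d: "d > 0" "\<And>x y. dist x y < d \<Longrightarrow> \<bar>g x - g y\<bar> < e / (4 * I)"
    using uniformly_continuous_of_support[OF g(1,2), of "e / (4 * I)"] e I by auto
  have gg: "\<bar>(LINT y|lborel. g y * v (y + h)) - (LINT y|lborel. g y * v y)\<bar> \<le> e / 4" if h: "norm h < d" for h
  proof -
    have i': "integrable lborel (\<lambda>y. g (y - h) * v y)"
      using integral_lborel_translation(2)[of "\<lambda>y. g (y - h) * v y" h] ig[of h] by simp
    \<comment> \<open>By invariance the shift moves from v to g, which is uniformly continuous, so
      that only the L1 norm of v enters.\<close>
    have "(LINT y|lborel. g y * v (y + h)) = (LINT y|lborel. g (y - h) * v y)"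
      using integral_lborel_translation(1)[of "\<lambda>y. g (y - h) * v y" h] by simp
    then have "(LINT y|lborel. g y * v (y + h)) - (LINT y|lborel. g y * v y) = (LINT y|lborel. (g (y - h) - g y) * v y)"
      using i' ig[of 0] by (simp add: left_diff_distrib)
    also have "\<bar>\<dots>\<bar> \<le> (LINT y|lborel. e / (4 * I) * \<bar>v y\<bar>)"
    proof (rule integral_abs_bound[THEN order_trans], rule integral_mono')
      show "integrable lborel (\<lambda>y. e / (4 * I) * \<bar>v y\<bar>)" using v by simp
      show "\<bar>(g (y - h) - g y) * v y\<bar> \<le> e / (4 * I) * \<bar>v y\<bar>" for y
        using mult_right_mono[OF less_imp_le[OF d(2)[of "y - h" y]], of "\<bar>v y\<bar>"] h by (simp add: abs_mult dist_norm)
    qed (use e I in auto)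
    also have "\<dots> = e / (4 * I) * (LINT y|lborel. \<bar>v y\<bar>)" by simp
    also have "\<dots> \<le> e / (4 * I) * I" using e I by (intro mult_left_mono) (auto simp: I_def)
    also have "\<dots> = e / 4" using I by simp
    finally show ?thesis .
  qed
  show thesis
  proof (rule that[OF d(1)])
    fix h :: 'a assume "norm h < d"
    then show "\<bar>(LINT y|lborel. f y * v (y + h)) - (LINT y|lborel. f y * v y)\<bar> < e"
      using gg[of h] fg[of h] fg[of 0, unfolded add_0_right] e by linarith
  qed
qed

lemma translation_pairing_tendsto_L2:
  fixes f v :: "'a::euclidean_space \<Rightarrow> real"
  assumes [measurable]: "f \<in> borel_measurable borel" "v \<in> borel_measurable borel" 
    and f: "integrable lborel (\<lambda>x. (f x)\<^sup>2)" and v: "integrable lborel v" "integrable lborel (\<lambda>x. (v x)\<^sup>2)"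
    and e: "e > 0"
  obtains d where "d > 0" 
    "\<And>h. norm h < d \<Longrightarrow> \<bar>(LINT y|lborel. f y * v (y + h)) - (LINT y|lborel. f y * v y)\<bar> < e"
proof (rule translation_pairing_tendsto[OF assms(1,2), of 2 "LINT y|lborel. (v y)\<^sup>2" e])
  fix g :: "'a \<Rightarrow> real" and h 
  assume [measurable]: "g \<in> borel_measurable borel" and "integrable lborel (\<lambda>x. \<bar>g x\<bar> ^ 2)"
  then have g: "integrable lborel (\<lambda>x. (g x)\<^sup>2)" by simp
  have vh: "integrable lborel (\<lambda>x. (v (x + h))\<^sup>2)" "(LINT y|lborel. (v (y + h))\<^sup>2) = (LINT y|lborel. (v y)\<^sup>2)"
    using v(2) integral_lborel_translation[of "\<lambda>y. (v y)\<^sup>2" h] by auto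
  show "integrable lborel (\<lambda>y. g y * v (y + h)) \<and>
     \<bar>LINT y|lborel. g y * v (y + h)\<bar>\<^sup>2 \<le> (LINT y|lborel. (v y)\<^sup>2) * (LINT y|lborel. \<bar>g y\<bar>\<^sup>2)"
    using integrable_mult_L2[OF _ _ g vh(1)] Cauchy_Schwarz_integral[OF _ _ g vh(1)] by (simp add: vh(2) mult.commute)
qed (use assms in auto)

lemma translation_pairing_tendsto_L1:
  fixes f v :: "'a::euclidean_space \<Rightarrow> real"
  assumes [measurable]: "f \<in> borel_measurable borel" "v \<in> borel_measurable borel" 
    and f: "integrable lborel f" and v: "integrable lborel v" "\<And>x. \<bar>v x\<bar> \<le> C"
    and e: "e > 0"
  obtains d where "d > 0" 
    "\<And>h. norm h < d \<Longrightarrow> \<bar>(LINT y|lborel. f y * v (y + h)) - (LINT y|lborel. f y * v y)\<bar> < e"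
proof (rule translation_pairing_tendsto[OF assms(1,2), of 1 C e])
  fix g :: "'a \<Rightarrow> real" and h 
  assume [measurable]: "g \<in> borel_measurable borel" and "integrable lborel (\<lambda>x. \<bar>g x\<bar> ^ 1)"
  then have g: "integrable lborel g" by (simp add: integrable_abs_iff)
  have i: "integrable lborel (\<lambda>y. g y * v (y + h))"
  proof (rule Bochner_Integration.integrable_bound)
    show "integrable lborel (\<lambda>y. C * g y)" using g by simp
    have "\<bar>g y * v (y + h)\<bar> \<le> \<bar>C * g y\<bar>" for y
      using mult_left_mono[OF v(2)[of "y + h"], of "\<bar>g y\<bar>"] abs_ge_self[of C] mult_right_mono[OF abs_ge_self[of C], of "\<bar>g y\<bar>"] 
      by (simp add: abs_mult mult.commute)
    then show "AE y in lborel. norm (g y * v (y + h)) \<le> norm (C * g y)" by simp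
  qed measurable
  have "\<bar>LINT y|lborel. g y * v (y + h)\<bar> \<le> (LINT y|lborel. C * \<bar>g y\<bar>)"
  proof (rule integral_abs_bound[THEN order_trans], rule integral_mono)
    show "\<bar>g y * v (y + h)\<bar> \<le> C * \<bar>g y\<bar>" for y
      using mult_left_mono[OF v(2)[of "y + h"], of "\<bar>g y\<bar>"] by (simp add: abs_mult mult.commute)
  qed (use i g in auto)
  then show "integrable lborel (\<lambda>y. g y * v (y + h)) \<and>
     \<bar>LINT y|lborel. g y * v (y + h)\<bar> ^ 1 \<le> C * (LINT y|lborel. \<bar>g y\<bar> ^ 1)"
    using i by simp
qed (use assms in auto)

lemma integrable_pair_kernel:
  fixes f :: "'m \<Rightarrow> real" and g :: "'n \<Rightarrow> real"
  assumes "sigma_finite_measure M1" "sigma_finite_measure M2"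
    and f: "integrable M1 f" and g: "integrable M2 g"
    and w: "w \<in> borel_measurable (M1 \<Otimes>\<^sub>M M2)" "\<And>p. \<bar>w p\<bar> \<le> B"
  shows "integrable (M1 \<Otimes>\<^sub>M M2) (\<lambda>(x, y). f x * (w (x, y) * g y))"
proof -
  interpret M1: sigma_finite_measure M1 by fact
  interpret M2: sigma_finite_measure M2 by fact
  interpret pair_sigma_finite M1 M2 ..
  have [measurable]: "f \<in> borel_measurable M1" "g \<in> borel_measurable M2" "w \<in> borel_measurable (M1 \<Otimes>\<^sub>M M2)" 
    using f g w by auto
  have "integrable (M1 \<Otimes>\<^sub>M M2) (\<lambda>(x, y). f x * g y)"
  proof (rule Fubini_integrable)
    show "integrable M1 (\<lambda>x. LINT y|M2. norm (case (x, y) of (x, y) \<Rightarrow> f x * g y))"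
      using f g by (simp add: abs_mult)
  qed (use g in auto)
  then have i: "integrable (M1 \<Otimes>\<^sub>M M2) (\<lambda>p. B * (case p of (x, y) \<Rightarrow> f x * g y))" by simp
  show ?thesis
  proof (rule Bochner_Integration.integrable_bound[OF i])
    have "\<bar>f x * (w (x, y) * g y)\<bar> \<le> \<bar>B * (f x * g y)\<bar>" for x y
      using mult_right_mono[OF order_trans[OF w(2)[of "(x, y)"] abs_ge_self[of B]], of "\<bar>f x * g y\<bar>"]
      by (simp add: abs_mult mult_ac)
    then show "AE p in M1 \<Otimes>\<^sub>M M2. norm (case p of (x, y) \<Rightarrow> f x * (w (x, y) * g y)) 
      \<le> norm (B * (case p of (x, y) \<Rightarrow> f x * g y))" by auto
  qed measurable
qed

text \<open>By Fubini and the substitution x = y + h, pairing with a mollification is the kernel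
  average of the pairings with translates. Convergence of mollifications thus reduces to continuity
  of translations at 0.\<close>

lemma mollified_pairing:
  fixes f v k :: "'a::euclidean_space \<Rightarrow> real"
  assumes [measurable]: "f \<in> borel_measurable borel" "v \<in> borel_measurable borel" 
    and f: "integrable lborel f" and v: "integrable lborel v"
    and k: "continuous_on UNIV k" "bounded {x. k x \<noteq> 0}"
  shows "integrable lborel (\<lambda>x. v x * (LINT y|lborel. k (x - y) * f y))"
    and "(LINT x|lborel. v x * (LINT y|lborel. k (x - y) * f y)) = (LINT h|lborel. k h * (LINT y|lborel. f y * v (y + h)))"
    and "integrable lborel (\<lambda>h. k h * (LINT y|lborel. f y * v (y + h)))"
proof -
  obtain B where B: "B > 0" "\<And>x. \<bar>k x\<bar> \<le> B" using bounded_of_support[OF k] by blast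
  have [measurable]: "k \<in> borel_measurable borel" using k(1) by (rule borel_measurable_continuous_onI)
    define G where "G = (\<lambda>x y. v x * (k (x - y) * f y))"
  define H where "H = (\<lambda>y h. f y * (k h * v (y + h)))"
  have [measurable]: "(\<lambda>(x, y). G x y) \<in> borel_measurable (lborel \<Otimes>\<^sub>M lborel)"
    "(\<lambda>(x, y). H x y) \<in> borel_measurable (lborel \<Otimes>\<^sub>M lborel)"
    unfolding G_def H_def by measurable
  have iG: "integrable (lborel \<Otimes>\<^sub>M lborel) (\<lambda>(x, y). G x y)"
    using integrable_pair_kernel[OF lborel.sigma_finite_measure_axioms lborel.sigma_finite_measure_axioms v f, of "\<lambda>p. k (fst p - snd p)" B] B
    by (auto simp: G_def)
  show "integrable lborel (\<lambda>x. v x * (LINT y|lborel. k (x - y) * f y))"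
    using lborel_pair.integrable_fst'[OF iG] by (simp add: G_def)
  have tr: "(LINT h|lborel. H y h) = (LINT x|lborel. G x y)" "(LINT h|lborel. \<bar>H y h\<bar>) = (LINT x|lborel. \<bar>G x y\<bar>)" for y
    using integral_lborel_translation(1)[of "\<lambda>x. G x y" y] integral_lborel_translation(1)[of "\<lambda>x. \<bar>G x y\<bar>" y]
    by (simp_all add: G_def H_def mult_ac add.commute)
  \<comment> \<open>H is not a tensor product with a bounded kernel; its absolute integrability is
    carried over from G, slice by slice, by translation invariance.\<close>
  have iH: "integrable (lborel \<Otimes>\<^sub>M lborel) (\<lambda>(y, h). H y h)"
  proof (rule lborel_pair.Fubini_integrable)
    have "integrable (lborel \<Otimes>\<^sub>M lborel) (\<lambda>(x, y). \<bar>G x y\<bar>)"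
      using integrable_abs[OF iG] by (simp add: case_prod_beta')
    from lborel_pair.integrable_snd[OF this] 
    show "integrable lborel (\<lambda>y. LINT h|lborel. norm (case (y, h) of (y, h) \<Rightarrow> H y h))" by (simp add: tr)
    have "integrable lborel (\<lambda>h. H y h)" for y
      unfolding H_def
    proof (intro integrable_mult_right, rule Bochner_Integration.integrable_bound)
      show "integrable lborel (\<lambda>h. B * v (h + y))" using v integral_lborel_translation(2)[of v y] by simp
      show "AE h in lborel. norm (k h * v (y + h)) \<le> norm (B * v (h + y))"
        by (auto simp: abs_mult add.commute intro!: mult_right_mono order_trans[OF B(2)])
    qed measurable
    then show "AE y in lborel. integrable lborel (\<lambda>h. case (y, h) of (y, h) \<Rightarrow> H y h)" by simp
  qed measurable
  have HH: "(LINT y|lborel. H y h) = k h * (LINT y|lborel. f y * v (y + h))" for h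
    unfolding H_def mult.left_commute[of "f _"] by (rule integral_mult_right_zero)
  show "(LINT x|lborel. v x * (LINT y|lborel. k (x - y) * f y)) = (LINT h|lborel. k h * (LINT y|lborel. f y * v (y + h)))"
    using lborel_pair.Fubini_integral[OF iG] lborel_pair.Fubini_integral[OF iH] tr(1) HH by (simp add: G_def)
  show "integrable lborel (\<lambda>h. k h * (LINT y|lborel. f y * v (y + h)))"
    using lborel_pair.integrable_snd[OF iH] by (simp add: HH)
qed

text \<open>The kernel is a probability density on the ball of radius d, so an average of numbers
  within e of a stays within e of a. No symmetry of the kernel enters, which leaves room for kernels
  concentrated away from 0.\<close>

lemma mollified_pairing_diff:
  fixes f v k :: "'a::euclidean_space \<Rightarrow> real"
  assumes "f \<in> borel_measurable borel" "v \<in> borel_measurable borel" 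
    and f: "integrable lborel f" and v: "integrable lborel v"
    and k: "continuous_on UNIV k" "{x. k x \<noteq> 0} \<subseteq> ball 0 d" "\<And>x. 0 \<le> k x" "(LINT x|lborel. k x) = 1"
    and c: "\<And>h. norm h < d \<Longrightarrow> \<bar>(LINT y|lborel. f y * v (y + h)) - a\<bar> \<le> e"
  shows "\<bar>(LINT x|lborel. v x * (LINT y|lborel. k (x - y) * f y)) - a\<bar> \<le> e"
proof -
  \<comment> \<open>Integrability of k is read off from its integral: a function that is not
    integrable would have integral 0, not 1.\<close>
  have bk: "bounded {x. k x \<noteq> 0}" using k(2) bounded_ball bounded_subset by blast
  have ik: "integrable lborel k" using k(4) not_integrable_integral_eq by fastforce
  let ?c = "\<lambda>h. LINT y|lborel. f y * v (y + h)"
  have i: "integrable lborel (\<lambda>h. k h * ?c h)" by (rule mollified_pairing(3)[OF assms(1-4) k(1) bk])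
  have "(LINT x|lborel. v x * (LINT y|lborel. k (x - y) * f y)) - a = (LINT h|lborel. k h * ?c h) - (LINT h|lborel. k h * a)"
    using mollified_pairing(2)[OF assms(1-4) k(1) bk] k(4) by simp
  also have "\<dots> = (LINT h|lborel. k h * (?c h - a))"
    using i ik by (simp add: right_diff_distrib)
  also have "\<bar>\<dots>\<bar> \<le> (LINT h|lborel. k h * e)"
  proof (rule integral_abs_bound[THEN order_trans], rule integral_mono)
    show "integrable lborel (\<lambda>h. \<bar>k h * (?c h - a)\<bar>)" using i ik by (simp add: right_diff_distrib)
    show "\<bar>k h * (?c h - a)\<bar> \<le> k h * e" for h
      using k(2,3) c[of h] by (cases "k h = 0") (auto simp: abs_mult intro!: mult_left_mono)
  qed (use ik in auto)
  finally show ?thesis using k(4) by simp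
qed

text \<open>The case a = 0: each translated pairing obeys Cauchy-Schwarz with the same norms, so the
  bound does not depend on the kernel.\<close>

lemma mollified_pairing_bound:
  fixes f v k :: "'a::euclidean_space \<Rightarrow> real"
  assumes [measurable]: "f \<in> borel_measurable borel" "v \<in> borel_measurable borel" 
    and f: "integrable lborel f" "integrable lborel (\<lambda>x. (f x)\<^sup>2)" 
    and v: "integrable lborel v" "integrable lborel (\<lambda>x. (v x)\<^sup>2)"
    and k: "continuous_on UNIV k" "{x. k x \<noteq> 0} \<subseteq> ball 0 d" "\<And>x. 0 \<le> k x" "(LINT x|lborel. k x) = 1"
  shows "\<bar>LINT x|lborel. v x * (LINT y|lborel. k (x - y) * f y)\<bar> \<le> sqrt (LINT x|lborel. (f x)\<^sup>2) * sqrt (LINT x|lborel. (v x)\<^sup>2)"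
proof -
  have "\<bar>(LINT x|lborel. v x * (LINT y|lborel. k (x - y) * f y)) - 0\<bar> \<le> sqrt (LINT x|lborel. (f x)\<^sup>2) * sqrt (LINT x|lborel. (v x)\<^sup>2)"
  proof (rule mollified_pairing_diff[OF assms(1,2) f(1) v(1) k])
    fix h :: 'a
    have vh: "integrable lborel (\<lambda>x. (v (x + h))\<^sup>2)" "(LINT y|lborel. (v (y + h))\<^sup>2) = (LINT y|lborel. (v y)\<^sup>2)"
      using v(2) integral_lborel_translation[of "\<lambda>y. (v y)\<^sup>2" h] by auto
    have "(LINT y|lborel. f y * v (y + h))\<^sup>2 \<le> (LINT x|lborel. (f x)\<^sup>2) * (LINT x|lborel. (v x)\<^sup>2)"
      using Cauchy_Schwarz_integral[OF _ _ f(2) vh(1)] by (simp add: vh(2))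
    then show "\<bar>(LINT y|lborel. f y * v (y + h)) - 0\<bar> \<le> sqrt (LINT x|lborel. (f x)\<^sup>2) * sqrt (LINT x|lborel. (v x)\<^sup>2)"
      by (simp add: real_le_rsqrt flip: real_sqrt_mult)
  qed
  then show ?thesis by simp
qed

section \<open>Localisation at a Lipschitz boundary\<close>

lemma test_functionsD:
  assumes "\<phi> \<in> test_functions U"
  shows "smooth \<phi>" "bounded {x. \<phi> x \<noteq> 0}" "\<phi> x \<noteq> 0 \<Longrightarrow> x \<in> U"
proof -
  show "smooth \<phi>" using assms by (simp add: test_functions_def)
  have "compact (closure {x. \<phi> x \<noteq> 0})" using assms by (simp add: test_functions_def)
  then show "bounded {x. \<phi> x \<noteq> 0}" using bounded_subset[OF compact_imp_bounded closure_subset] by blast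
  show "\<phi> x \<noteq> 0 \<Longrightarrow> x \<in> U" using assms closure_subset[of "{x. \<phi> x \<noteq> 0}"] by (auto simp: test_functions_def)
qed

lemma test_functionsI:
  assumes "smooth \<phi>" "{x. \<phi> x \<noteq> 0} \<subseteq> C" "compact C" "C \<subseteq> U"
  shows "\<phi> \<in> test_functions U"
proof -
  have "closure {x. \<phi> x \<noteq> 0} \<subseteq> C" using assms(2,3) by (simp add: closure_minimal compact_imp_closed)
  moreover have "compact (closure {x. \<phi> x \<noteq> 0})"
    using calculation assms(3) by (meson bounded_subset closed_closure compact_eq_bounded_closed)
  ultimately show ?thesis using assms by (auto simp: test_functions_def)
qed

lemma smooth_add: "smooth f \<Longrightarrow> smooth g \<Longrightarrow> smooth (\<lambda>x. f x + g x)"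
  by (auto simp: smooth_def intro: Ck_add)

lemma smooth_borel: "smooth f \<Longrightarrow> f \<in> borel_measurable borel"
  using Ck_continuous smooth_Ck borel_measurable_continuous_onI by blast

lemma test_functions_add:
  assumes "\<phi> \<in> test_functions U" "\<psi> \<in> test_functions U"
  shows "(\<lambda>x. \<phi> x + \<psi> x) \<in> test_functions U"
proof (rule test_functionsI)
  show "smooth (\<lambda>x. \<phi> x + \<psi> x)" using assms by (intro smooth_add test_functionsD(1))
  show "{x. \<phi> x + \<psi> x \<noteq> 0} \<subseteq> closure {x. \<phi> x \<noteq> 0} \<union> closure {x. \<psi> x \<noteq> 0}"
    using closure_subset[of "{x. \<phi> x \<noteq> 0}"] closure_subset[of "{x. \<psi> x \<noteq> 0}"] by fastforce
qed (use assms in \<open>auto simp: test_functions_def intro!: compact_Un\<close>)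

lemma test_functions_bounded:
  assumes "\<phi> \<in> test_functions U"
  obtains B where "B > 0" "\<And>x. \<bar>\<phi> x\<bar> \<le> B"
  using bounded_of_support[OF Ck_continuous[OF smooth_Ck] test_functionsD(2)] test_functionsD(1) assms by metis

lemma integrable_bounded_mult:
  fixes f g :: "'m \<Rightarrow> real"
  assumes "integrable M f" "g \<in> borel_measurable M" "\<And>x. \<bar>g x\<bar> \<le> B"
  shows "integrable M (\<lambda>x. g x * f x)"
proof (rule Bochner_Integration.integrable_bound)
  show "integrable M (\<lambda>x. B * f x)" using assms by simp
  show "(\<lambda>x. g x * f x) \<in> borel_measurable M" using assms by measurable
  show "AE x in M. norm (g x * f x) \<le> norm (B * f x)"
    using mult_right_mono[OF order_trans[OF assms(3) abs_ge_self]] by (simp add: abs_mult)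
qed

text \<open>A partition of unity in the form of an induction: for a finite cover of C, one bump
  after another is split off from \<zeta>, and what is left at the end vanishes on C. This suits
  every property that is local and additive in a nonnegative cutoff.\<close>

lemma smooth_partition_induct:
  fixes P :: "('a::euclidean_space \<Rightarrow> real) \<Rightarrow> bool"
  assumes C: "compact C"
    and zero: "\<And>\<zeta>. smooth \<zeta> \<Longrightarrow> (\<And>x. 0 \<le> \<zeta> x) \<Longrightarrow> (\<And>x. x \<in> C \<Longrightarrow> \<zeta> x = 0) \<Longrightarrow> P \<zeta>"
    and add: "\<And>\<zeta> \<xi>. smooth \<zeta> \<Longrightarrow> smooth \<xi> \<Longrightarrow> (\<And>x. 0 \<le> \<zeta> x) \<Longrightarrow> (\<And>x. 0 \<le> \<xi> x) \<Longrightarrow> P \<zeta> \<Longrightarrow> P \<xi> \<Longrightarrow> P (\<lambda>x. \<zeta> x + \<xi> x)"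
    and loc: "\<And>x0. x0 \<in> C \<Longrightarrow> \<exists>r>0. \<forall>\<zeta>. smooth \<zeta> \<longrightarrow> (\<forall>x. 0 \<le> \<zeta> x) \<longrightarrow> closure {x. \<zeta> x \<noteq> 0} \<subseteq> ball x0 r \<longrightarrow> P \<zeta>"
    and \<zeta>: "smooth \<zeta>" "\<And>x. 0 \<le> \<zeta> x"
  shows "P \<zeta>"
proof -
  obtain r where r: "\<And>x. x \<in> C \<Longrightarrow> r x > 0" 
    "\<And>x \<zeta>. x \<in> C \<Longrightarrow> smooth \<zeta> \<Longrightarrow> (\<And>y. 0 \<le> \<zeta> y) \<Longrightarrow> closure {y. \<zeta> y \<noteq> 0} \<subseteq> ball x (r x) \<Longrightarrow> P \<zeta>"
    using loc by metis
  \<comment> \<open>A quarter of the radius for the cover: the bump is 1 on that ball, vanishes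
    outside half the radius, and the closed support then lies in the full open ball.\<close>
  obtain F where F: "F \<subseteq> C" "finite F" "C \<subseteq> (\<Union>x\<in>F. ball x (r x/4))"
    using compactE_image[OF C, of C "\<lambda>x. ball x (r x / 4)"] r(1) 
    by (metis (no_types, lifting) UN_I centre_in_ball divide_pos_pos open_ball subsetI zero_less_numeral)
  from F(2,1) have "\<forall>\<zeta>. smooth \<zeta> \<longrightarrow> (\<forall>x. 0 \<le> \<zeta> x) \<longrightarrow> (\<forall>y\<in>C. y \<notin> (\<Union>x\<in>F. ball x (r x/4)) \<longrightarrow> \<zeta> y = 0) \<longrightarrow> P \<zeta>"
  proof (induction F rule: finite_induct)
    case empty
    then show ?case using zero by auto
  next
    case (insert x F)
    show ?case
    proof (intro allI impI)
      fix \<zeta> assume \<zeta>: "smooth \<zeta>" "\<forall>x. 0 \<le> \<zeta> x" "\<forall>y\<in>C. y \<notin> (\<Union>x\<in>insert x F. ball x (r x/4)) \<longrightarrow> \<zeta> y = 0"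
      have x: "x \<in> C" using insert by auto
      then have "r x / 2 > 0" using r(1) by simp
      then obtain \<beta> where \<beta>: "smooth \<beta>" "\<And>y. 0 \<le> \<beta> y" "\<And>y. \<beta> y \<le> (1::real)"
        "\<And>y. y \<in> cball x (r x / 2 / 2) \<Longrightarrow> \<beta> y = 1" "\<And>y. y \<notin> ball x (r x / 2) \<Longrightarrow> \<beta> y = 0"
        using bump_exists[of "r x / 2" x] by metis
      have "P (\<lambda>y. \<zeta> y * \<beta> y)"
      proof (rule r(2)[OF x])
        show "smooth (\<lambda>y. \<zeta> y * \<beta> y)" using \<zeta> \<beta> by (intro smooth_mult)
        have "{y. \<zeta> y * \<beta> y \<noteq> 0} \<subseteq> cball x (r x / 2)" using \<beta>(5) by force
        then have "closure {y. \<zeta> y * \<beta> y \<noteq> 0} \<subseteq> cball x (r x / 2)" by (simp add: closure_minimal)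
        also have "\<dots> \<subseteq> ball x (r x)" using r(1)[OF x] by auto
        finally show "closure {y. \<zeta> y * \<beta> y \<noteq> 0} \<subseteq> ball x (r x)" .
      qed (use \<zeta> \<beta> in auto)
      moreover have "P (\<lambda>y. \<zeta> y * (1 - \<beta> y))"
      proof -
        \<comment> \<open>On the ball that has been treated the bump equals 1, so the rest of
          \<zeta> has to be covered by the remaining balls only.\<close>
        have "\<forall>y\<in>C. y \<notin> (\<Union>x\<in>F. ball x (r x/4)) \<longrightarrow> \<zeta> y * (1 - \<beta> y) = 0"
          using \<zeta>(3) \<beta>(4) by fastforce
        moreover have "smooth (\<lambda>y. \<zeta> y * (1 - \<beta> y))" using \<zeta> \<beta> by (intro smooth_mult smooth_diff smooth_const)
        moreover have "\<forall>y. 0 \<le> \<zeta> y * (1 - \<beta> y)" using \<zeta>(2) \<beta>(3) by simp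
        ultimately show ?thesis using insert.IH insert.prems by auto
      qed
      ultimately have "P (\<lambda>y. \<zeta> y * \<beta> y + \<zeta> y * (1 - \<beta> y))"
        using \<zeta> \<beta> by (intro add smooth_mult smooth_diff smooth_const) auto
      then show "P \<zeta>" by (simp add: algebra_simps)
    qed
  qed
  then show ?thesis using \<zeta> F(3) by blast
qed

text \<open>The cone condition of a Lipschitz boundary, in the form that lets a shifted mollifier map
  into functions with support in \<open>\<Omega>\<close>.\<close>

definition inward_shift :: "'a::euclidean_space set \<Rightarrow> 'a \<Rightarrow> real \<Rightarrow> 'a \<Rightarrow> real \<Rightarrow> bool" where
  "inward_shift \<Omega> x0 r c \<epsilon>0 \<longleftrightarrow> (\<forall>\<epsilon>. 0 < \<epsilon> \<longrightarrow> \<epsilon> < \<epsilon>0 \<longrightarrow> (\<forall>y \<in> closure \<Omega> \<inter> ball x0 r. cball (y + \<epsilon> *\<^sub>R c) \<epsilon> \<subseteq> \<Omega>))"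

lemma inward_shift_exists:
  assumes "open \<Omega>" "lipschitz_boundary \<Omega>" "x0 \<in> closure \<Omega>"
  obtains r c \<epsilon>0 where "r > 0" "\<epsilon>0 > 0" "inward_shift \<Omega> x0 r c \<epsilon>0"
proof (cases "x0 \<in> \<Omega>")
  case True
  then obtain r where r: "r > 0" "ball x0 r \<subseteq> \<Omega>" using assms(1) open_contains_ball by blast
  have "inward_shift \<Omega> x0 (r/2) 0 (r/2)"
    unfolding inward_shift_def
  proof (intro allI impI ballI)
    fix \<epsilon> y assume "0 < \<epsilon>" "\<epsilon> < r/2" "y \<in> closure \<Omega> \<inter> ball x0 (r/2)"
    then have "cball (y + \<epsilon> *\<^sub>R 0) \<epsilon> \<subseteq> ball x0 r"
      by (auto simp: cball_subset_ball_iff dist_commute)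
    then show "cball (y + \<epsilon> *\<^sub>R 0) \<epsilon> \<subseteq> \<Omega>" using r by blast
  qed
  then show thesis using that[of "r/2" "r/2" 0] r by auto
next
  case False
  then have "x0 \<in> frontier \<Omega>" using assms by (simp add: frontier_def interior_open)
  then obtain e \<gamma> L r where L: "L-lipschitz_on UNIV \<gamma>" and e: "norm e = 1" and r: "r > 0" 
    "\<And>y. y \<in> ball x0 r \<Longrightarrow> y \<in> \<Omega> \<longleftrightarrow> graph_fun e \<gamma> y < 0"
    using assms(2) unfolding lipschitz_boundary_def local_epigraph_def by metis
  have L0: "L \<ge> 0" using L lipschitz_on_nonneg by blast
  have lip: "\<bar>\<gamma> x - \<gamma> y\<bar> \<le> L * norm (x - y)" for x y
    using lipschitz_onD[OF L, of x y] by (simp add: dist_norm)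
  have contg: "continuous_on UNIV (graph_fun e \<gamma>)"
  proof -
    have "continuous_on UNIV (\<lambda>y. \<gamma> (y - (y \<bullet> e) *\<^sub>R e))"
      by (rule continuous_on_compose2[OF lipschitz_on_continuous_on[OF L]]) (auto intro!: continuous_intros)
    then show ?thesis
      unfolding graph_fun_def by (intro continuous_on_diff continuous_on_inner continuous_on_id continuous_on_const)
  qed
  \<comment> \<open>A point of the closure strictly below the graph would have a neighbourhood that
    misses \<Omega>.\<close>
  have cl: "graph_fun e \<gamma> y \<le> 0" if y: "y \<in> closure \<Omega>" "y \<in> ball x0 r" for y
  proof (rule ccontr)
    assume "\<not> graph_fun e \<gamma> y \<le> 0"
    then have "y \<in> ({y. graph_fun e \<gamma> y > 0} \<inter> ball x0 r) \<inter> closure \<Omega>" using y by auto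
    moreover have "open ({y. graph_fun e \<gamma> y > 0} \<inter> ball x0 r)"
      by (intro open_Int open_ball open_Collect_less contg continuous_on_const)
    ultimately have "({y. graph_fun e \<gamma> y > 0} \<inter> ball x0 r) \<inter> \<Omega> \<noteq> {}"
      using open_Int_closure_eq_empty[of "{y. graph_fun e \<gamma> y > 0} \<inter> ball x0 r" \<Omega>] by blast
    then show False using r(2) by force
  qed
  \<comment> \<open>The shift raises the height by \<epsilon> M. Moving inside the ball of radius
    \<epsilon> lowers it by at most \<epsilon> and raises the graph by at most L \<epsilon>; M = L +
    2 leaves a surplus of \<epsilon>. The choice of \<epsilon>0 keeps all points within r/2 of
    y.\<close>
  define M where "M = L + 2"
  define \<epsilon>0 where "\<epsilon>0 = r / (2 * (M + 1))"
  have M: "M \<ge> 2" using L0 by (simp add: M_def)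
  have e0: "\<epsilon>0 > 0" "\<epsilon>0 * (M + 1) = r / 2" using M r by (auto simp: \<epsilon>0_def field_simps)
  have "inward_shift \<Omega> x0 (r/2) (M *\<^sub>R e) \<epsilon>0"
    unfolding inward_shift_def
  proof (intro allI impI ballI subsetI)
    fix \<epsilon> y x assume \<epsilon>: "0 < \<epsilon>" "\<epsilon> < \<epsilon>0" and y: "y \<in> closure \<Omega> \<inter> ball x0 (r/2)" 
      and x: "x \<in> cball (y + \<epsilon> *\<^sub>R M *\<^sub>R e) \<epsilon>"
    define w where "w = x - y - (\<epsilon> * M) *\<^sub>R e"
    have w: "norm w \<le> \<epsilon>" using x by (simp add: w_def dist_norm norm_minus_commute algebra_simps)
    have xw: "x = y + (\<epsilon> * M) *\<^sub>R e + w" by (simp add: w_def)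
    have "dist y x \<le> \<epsilon> * M + \<epsilon>"
      unfolding dist_commute[of y] xw using w norm_triangle_ineq[of "(\<epsilon> * M) *\<^sub>R e" w] e \<epsilon> M
      by (simp add: dist_norm add.assoc)
    also have "\<epsilon> * M + \<epsilon> = \<epsilon> * (M + 1)" by (simp add: algebra_simps)
    also have "\<dots> < r / 2" using \<epsilon> M unfolding e0(2)[symmetric] by simp
    finally have xb: "x \<in> ball x0 r" using y dist_triangle[of x0 x y] by auto
    have ee: "e \<bullet> e = 1" using e by (simp add: dot_square_norm)
    let ?p = "\<lambda>y. y - (y \<bullet> e) *\<^sub>R e"
    have p: "?p x - ?p y = w - (w \<bullet> e) *\<^sub>R e"
      by (simp add: xw inner_add_left ee algebra_simps)
    have "(norm (w - (w \<bullet> e) *\<^sub>R e))\<^sup>2 = (norm w)\<^sup>2 - (w \<bullet> e)\<^sup>2"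
      unfolding power2_norm_eq_inner 
      by (simp add: inner_diff_left inner_diff_right ee power2_eq_square inner_commute algebra_simps)
    then have "(norm (?p x - ?p y))\<^sup>2 \<le> (norm w)\<^sup>2" unfolding p by simp
    then have "norm (?p x - ?p y) \<le> \<epsilon>" using w power2_le_imp_le[of _ "norm w"] by force
    then have g: "\<gamma> (?p x) \<le> \<gamma> (?p y) + L * \<epsilon>"
      using lip[of "?p x" "?p y"] mult_left_mono[OF _ L0, of "norm (?p x - ?p y)" \<epsilon>] by linarith
    have "\<bar>w \<bullet> e\<bar> \<le> \<epsilon>" using Cauchy_Schwarz_ineq2[of w e] w e by simp
    then have "x \<bullet> e \<ge> y \<bullet> e + \<epsilon> * M - \<epsilon>"
      unfolding xw by (simp add: inner_add_left ee)
    moreover have "\<gamma> (?p y) \<le> y \<bullet> e" using cl[of y] y r(1) by (auto simp: graph_fun_def)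
    moreover have "\<epsilon> * M = L * \<epsilon> + 2 * \<epsilon>" by (simp add: M_def algebra_simps)
    ultimately have "graph_fun e \<gamma> x < 0" using g \<epsilon>(1) unfolding graph_fun_def by linarith
    then show "x \<in> \<Omega>" using r(2)[OF xb] by simp
  qed
  then show thesis using that[of "r/2" \<epsilon>0] r e0 by auto
qed

section \<open>Shifted mollification kernels\<close>

lemma kernel_exists:
  fixes a :: "'a::euclidean_space"
  assumes "r > 0"
  obtains k where "smooth k" "\<And>x. 0 \<le> k x" "{x. k x \<noteq> 0} \<subseteq> ball a r" "(LINT x|lborel. k x) = (1::real)"
proof -
  obtain \<beta> where \<beta>: "smooth \<beta>" "\<And>x. 0 \<le> \<beta> x" "\<And>x. \<beta> x \<le> (1::real)"
    "\<And>x. x \<in> cball a (r/2) \<Longrightarrow> \<beta> x = 1" "\<And>x. x \<notin> ball a r \<Longrightarrow> \<beta> x = 0"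
    using bump_exists[OF assms] by metis
  have [measurable]: "\<beta> \<in> borel_measurable borel" using \<beta>(1) by (rule smooth_borel)
  have i: "integrable lborel \<beta>"
  proof (rule Bochner_Integration.integrable_bound)
    show "integrable lborel (indicator (cball a r) :: 'a \<Rightarrow> real)"
      by (auto intro!: integrable_real_indicator emeasure_lborel_cball_finite)
    show "AE x in lborel. norm (\<beta> x) \<le> norm (indicator (cball a r) x :: real)"
      using \<beta>(2,3,5) by (fastforce simp: indicator_def)
  qed measurable
  define c where "c = (LINT x|lborel. \<beta> x)"
  have "0 < measure lborel (cball a (r/2))" using assms by (simp add: content_cball_pos)
  also have "\<dots> = (LINT x|lborel. indicator (cball a (r/2)) x)" by simp
  also have "\<dots> \<le> c"
    unfolding c_def using \<beta>(2,4) 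
    by (intro integral_mono i integrable_real_indicator emeasure_lborel_cball_finite) (auto simp: indicator_def)
  finally have c: "c > 0" .
  show thesis
  proof (rule that[of "\<lambda>x. (1/c) * \<beta> x"])
    show "smooth (\<lambda>x. (1/c) * \<beta> x)" using \<beta>(1) by (intro smooth_mult smooth_const)
    show "{x. (1/c) * \<beta> x \<noteq> 0} \<subseteq> ball a r" using \<beta>(5) by fastforce
    show "(LINT x|lborel. (1/c) * \<beta> x) = 1" using c by (simp add: c_def)
  qed (use c \<beta> in auto)
qed

text \<open>The support lies in the sum of C and the closed ball around a, which is compact and, by
  assumption, contained in U.\<close>

lemma mollification_test_function:
  fixes f :: "'a::euclidean_space \<Rightarrow> real"
  assumes f: "integrable lborel f" and C: "compact C" "\<And>x. f x \<noteq> 0 \<Longrightarrow> x \<in> C"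
    and k: "smooth k" "{x. k x \<noteq> 0} \<subseteq> ball a \<epsilon>" and U: "\<And>y. y \<in> C \<Longrightarrow> cball (y + a) \<epsilon> \<subseteq> U"
  shows "(\<lambda>x. LINT y|lborel. k (x - y) * f y) \<in> test_functions U"
proof (rule test_functionsI)
  have "bounded {x. k x \<noteq> 0}" using k(2) bounded_ball bounded_subset by blast
  then show "smooth (\<lambda>x. LINT y|lborel. k (x - y) * f y)"
    by (intro smooth_convolution f k(1)) auto
  show "compact {y + w |y w. y \<in> C \<and> w \<in> cball a \<epsilon>}" by (rule compact_sums[OF C(1)]) simp
  show "{x. (LINT y|lborel. k (x - y) * f y) \<noteq> 0} \<subseteq> {y + w |y w. y \<in> C \<and> w \<in> cball a \<epsilon>}"
  proof
    fix x assume "x \<in> {x. (LINT y|lborel. k (x - y) * f y) \<noteq> 0}"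
    then have "(\<lambda>y. k (x - y) * f y) \<noteq> (\<lambda>y. 0)" by auto
    then obtain y where "k (x - y) \<noteq> 0" "f y \<noteq> 0" by (auto simp: fun_eq_iff)
    then have "y \<in> C" "x - y \<in> cball a \<epsilon>" using k(2) C(2) by force+
    moreover have "x = y + (x - y)" by simp
    ultimately show "x \<in> {y + w |y w. y \<in> C \<and> w \<in> cball a \<epsilon>}" by blast
  qed
  show "{y + w |y w. y \<in> C \<and> w \<in> cball a \<epsilon>} \<subseteq> U"
  proof clarify
    fix y w assume "y \<in> C" "w \<in> cball a \<epsilon>"
    then show "y + w \<in> U" using U[of y] by (auto simp: subset_iff dist_norm)
  qed
qed

text \<open>The kernel sits around \<epsilon> c instead of 0 and so pushes the mass of f inwards.
  The last conclusion says that for y in the closure, even on the boundary, all of the unit mass of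
  x -> k(x - y) falls into \<Omega>; without it, concentration on the boundary would be lost in the
  mollification.\<close>

lemma local_mollifier:
  fixes f :: "'a::euclidean_space \<Rightarrow> real"
  assumes shift: "inward_shift \<Omega> x0 r c \<epsilon>0" "\<epsilon>0 > 0" and \<Omega>: "bounded \<Omega>"
    and \<zeta>: "closure {x. \<zeta> x \<noteq> (0::real)} \<subseteq> ball x0 r"
    and f: "integrable lborel f" "\<And>x. f x \<noteq> 0 \<Longrightarrow> x \<in> \<Omega> \<and> \<zeta> x \<noteq> 0" and \<eta>: "\<eta> > 0"
  obtains k where "smooth k" "\<And>x. 0 \<le> k x" "{x. k x \<noteq> 0} \<subseteq> ball 0 \<eta>" "(LINT x|lborel. k x) = (1::real)"
    "(\<lambda>x. LINT y|lborel. k (x - y) * f y) \<in> test_functions \<Omega>"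
    "\<And>x y. y \<in> closure \<Omega> \<Longrightarrow> \<zeta> y \<noteq> 0 \<Longrightarrow> k (x - y) \<noteq> 0 \<Longrightarrow> x \<in> \<Omega>"
proof -
  \<comment> \<open>The second entry makes \<epsilon> |c| + \<epsilon> at most \<eta>, so that the
    shifted ball stays in the ball of radius \<eta> around 0.\<close>
  define \<epsilon> where "\<epsilon> = min (\<epsilon>0 / 2) (\<eta> / (norm c + 1))"
  have nc: "norm c + 1 > 0" using norm_ge_zero[of c] by linarith
  have \<epsilon>: "0 < \<epsilon>" "\<epsilon> < \<epsilon>0" using shift(2) \<eta> nc by (auto simp: \<epsilon>_def min_less_iff_disj)
  have "\<epsilon> \<le> \<eta> / (norm c + 1)" by (simp add: \<epsilon>_def)
  then have le: "\<epsilon> * norm c + \<epsilon> \<le> \<eta>" using nc by (simp add: field_simps)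
  obtain k where k: "smooth k" "\<And>x. 0 \<le> k x" "{x. k x \<noteq> 0} \<subseteq> ball (\<epsilon> *\<^sub>R c) \<epsilon>" "(LINT x|lborel. k x) = (1::real)"
    using kernel_exists[OF \<epsilon>(1)] by metis
  have sub: "cball (y + \<epsilon> *\<^sub>R c) \<epsilon> \<subseteq> \<Omega>" if "y \<in> closure \<Omega> \<inter> closure {x. \<zeta> x \<noteq> 0}" for y
    using shift(1) \<epsilon> that \<zeta> unfolding inward_shift_def by blast
  show thesis
  proof (rule that[OF k(1,2) _ k(4)])
    have "ball (\<epsilon> *\<^sub>R c) \<epsilon> \<subseteq> ball 0 \<eta>" using \<epsilon>(1) le by (simp add: ball_subset_ball_iff)
    then show "{x. k x \<noteq> 0} \<subseteq> ball 0 \<eta>" using k(3) by blast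
    show "(\<lambda>x. LINT y|lborel. k (x - y) * f y) \<in> test_functions \<Omega>"
    proof (rule mollification_test_function[OF f(1) _ _ k(1,3) sub])
      show "compact (closure \<Omega> \<inter> closure {x. \<zeta> x \<noteq> 0})" using \<Omega> by (auto intro!: compact_Int_closed)
      show "x \<in> closure \<Omega> \<inter> closure {x. \<zeta> x \<noteq> 0}" if "f x \<noteq> 0" for x
        using f(2)[OF that] closure_subset[of \<Omega>] closure_subset[of "{x. \<zeta> x \<noteq> 0}"] by auto
    qed
    fix x y assume "y \<in> closure \<Omega>" "\<zeta> y \<noteq> 0" "k (x - y) \<noteq> 0"
    then have "y \<in> closure \<Omega> \<inter> closure {x. \<zeta> x \<noteq> 0}" "x - y \<in> ball (\<epsilon> *\<^sub>R c) \<epsilon>"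
      using closure_subset[of "{x. \<zeta> x \<noteq> 0}"] k(3) by auto
    moreover have "dist (y + \<epsilon> *\<^sub>R c) x = dist (\<epsilon> *\<^sub>R c) (x - y)"
      by (simp add: dist_norm algebra_simps)
    ultimately show "x \<in> \<Omega>" using sub[of y] by auto
  qed
qed

lemma integrable_continuous_mult_left:
  fixes f :: "'a::euclidean_space \<Rightarrow> 'b::euclidean_space" and g :: "'a \<Rightarrow> real"
  assumes M: "(\<lambda>x. x) \<in> M \<rightarrow>\<^sub>M borel" and f: "integrable M f" "\<And>x. x \<notin> D \<Longrightarrow> f x = 0" and D: "compact D" 
    and g: "continuous_on UNIV g"
  shows "integrable M (\<lambda>x. g x *\<^sub>R f x)"
proof -
  have "bounded (g ` D)" using D g by (intro compact_imp_bounded compact_continuous_image) (auto intro: continuous_on_subset)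
  then obtain B where B: "\<And>x. x \<in> D \<Longrightarrow> \<bar>g x\<bar> \<le> B" unfolding bounded_iff by auto
  have [measurable]: "(\<lambda>x. x) \<in> M \<rightarrow>\<^sub>M borel" "g \<in> borel_measurable borel" "f \<in> borel_measurable M"
    using M f g by (auto intro: borel_measurable_continuous_onI)
  show ?thesis
  proof (rule Bochner_Integration.integrable_bound)
    show "integrable M (\<lambda>x. B *\<^sub>R f x)" using f by simp
    have "norm (g x *\<^sub>R f x) \<le> norm (B *\<^sub>R f x)" for x
      using mult_right_mono[OF order_trans[OF B[of x] abs_ge_self], of "norm (f x)"] f(2)[of x] by (cases "x \<in> D") auto
    then show "AE x in M. norm (g x *\<^sub>R f x) \<le> norm (B *\<^sub>R f x)" by simp
  qed measurable
qed

lemma integrable_continuous_mult_right: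
  fixes f :: "'a::euclidean_space \<Rightarrow> real" and g :: "'a \<Rightarrow> 'b::euclidean_space"
  assumes M: "(\<lambda>x. x) \<in> M \<rightarrow>\<^sub>M borel" and f: "integrable M f" "\<And>x. x \<notin> D \<Longrightarrow> f x = 0" and D: "compact D" 
    and g: "continuous_on UNIV g"
  shows "integrable M (\<lambda>x. f x *\<^sub>R g x)"
proof -
  have "bounded (g ` D)" using D g by (intro compact_imp_bounded compact_continuous_image) (auto intro: continuous_on_subset)
  then obtain B where B: "\<And>x. x \<in> D \<Longrightarrow> norm (g x) \<le> B" unfolding bounded_iff by auto
  have [measurable]: "(\<lambda>x. x) \<in> M \<rightarrow>\<^sub>M borel" "g \<in> borel_measurable borel" "f \<in> borel_measurable M"
    using M f g by (auto intro: borel_measurable_continuous_onI)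
  show ?thesis
  proof (rule Bochner_Integration.integrable_bound)
    show "integrable M (\<lambda>x. B * f x)" using f by simp
    have "norm (f x *\<^sub>R g x) \<le> norm (B * f x)" for x
      using mult_right_mono[OF order_trans[OF B[of x] abs_ge_self], of "\<bar>f x\<bar>"] f(2)[of x] 
      by (cases "x \<in> D") (auto simp: abs_mult mult.commute)
    then show "AE x in M. norm (f x *\<^sub>R g x) \<le> norm (B * f x)" by simp
  qed measurable
qed

lemma integrable_continuous_mult_square:
  fixes f :: "'a::euclidean_space \<Rightarrow> real"
  assumes "(\<lambda>x. x) \<in> M \<rightarrow>\<^sub>M borel" "integrable M (\<lambda>x. (f x)\<^sup>2)" "\<And>x. x \<notin> D \<Longrightarrow> f x = 0" "compact D" "continuous_on UNIV g"
  shows "integrable M (\<lambda>x. (g x * f x)\<^sup>2)"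
  using integrable_continuous_mult_left[of M "\<lambda>x. (f x)\<^sup>2" D "\<lambda>x. (g x)\<^sup>2"] assms
  by (auto simp: power_mult_distrib intro: continuous_intros)

text \<open>Weak convergence in L2 along one sequence that serves all w at once: later w runs
  through the time slices of the time derivative. The bound, uniform in n, then yields the majorant
  for a dominated limit in time.\<close>

definition weakly_approximable :: "'a::euclidean_space set \<Rightarrow> ('a \<Rightarrow> real) \<Rightarrow> bool" where
  "weakly_approximable \<Omega> f \<longleftrightarrow> (\<exists>\<phi> C. (\<forall>n. \<phi> n \<in> test_functions \<Omega>) \<and>
    (\<forall>w\<in>borel_measurable borel. integrable lborel w \<longrightarrow> integrable lborel (\<lambda>x. (w x)\<^sup>2) \<longrightarrow>
       (\<lambda>n. LINT x|lborel. w x * \<phi> n x) \<longlonglongrightarrow> (LINT x|lborel. w x * f x) \<and>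
       (\<forall>n. \<bar>LINT x|lborel. w x * \<phi> n x\<bar> \<le> C * sqrt (LINT x|lborel. (w x)\<^sup>2))))"

lemma weakly_approximable_zero: "weakly_approximable \<Omega> (\<lambda>x. 0)"
  unfolding weakly_approximable_def
  by (intro exI[of _ "\<lambda>n x. 0"] exI[of _ 0]) (auto simp: test_functions_def smooth_const)

lemma weakly_approximable_add:
  assumes "weakly_approximable \<Omega> f" "weakly_approximable \<Omega> g" "f \<in> borel_measurable borel" "g \<in> borel_measurable borel"
    and f: "integrable lborel (\<lambda>x. (f x)\<^sup>2)" and g: "integrable lborel (\<lambda>x. (g x)\<^sup>2)"
  shows "weakly_approximable \<Omega> (\<lambda>x. f x + g x)"
proof -
  obtain \<phi> C where 1: "\<And>n. \<phi> n \<in> test_functions \<Omega>" 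
    "\<And>w. w \<in> borel_measurable borel \<Longrightarrow> integrable lborel w \<Longrightarrow> integrable lborel (\<lambda>x. (w x)\<^sup>2) \<Longrightarrow>
       (\<lambda>n. LINT x|lborel. w x * \<phi> n x) \<longlonglongrightarrow> (LINT x|lborel. w x * f x) \<and>
       (\<forall>n. \<bar>LINT x|lborel. w x * \<phi> n x\<bar> \<le> C * sqrt (LINT x|lborel. (w x)\<^sup>2))"
    using assms(1) unfolding weakly_approximable_def by blast
  obtain \<psi> C' where 2: "\<And>n. \<psi> n \<in> test_functions \<Omega>" 
    "\<And>w. w \<in> borel_measurable borel \<Longrightarrow> integrable lborel w \<Longrightarrow> integrable lborel (\<lambda>x. (w x)\<^sup>2) \<Longrightarrow>
       (\<lambda>n. LINT x|lborel. w x * \<psi> n x) \<longlonglongrightarrow> (LINT x|lborel. w x * g x) \<and>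
       (\<forall>n. \<bar>LINT x|lborel. w x * \<psi> n x\<bar> \<le> C' * sqrt (LINT x|lborel. (w x)\<^sup>2))"
    using assms(2) unfolding weakly_approximable_def by blast
  show ?thesis
    unfolding weakly_approximable_def
  proof (intro exI[of _ "\<lambda>n x. \<phi> n x + \<psi> n x"] exI[of _ "C + C'"] conjI ballI impI allI)
    show "(\<lambda>x. \<phi> n x + \<psi> n x) \<in> test_functions \<Omega>" for n using 1 2 by (intro test_functions_add)
    fix w :: "'a \<Rightarrow> real" 
    assume w: "w \<in> borel_measurable borel" "integrable lborel w" "integrable lborel (\<lambda>x. (w x)\<^sup>2)"
    have i: "integrable lborel (\<lambda>x. w x * \<xi> x)" if \<xi>: "\<xi> \<in> test_functions \<Omega>" for \<xi>
    proof -
      obtain B where "\<And>x. \<bar>\<xi> x\<bar> \<le> B" using test_functions_bounded[OF \<xi>] by metis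
      then have "integrable lborel (\<lambda>x. \<xi> x * w x)" 
        using smooth_borel[OF test_functionsD(1)[OF \<xi>]] by (intro integrable_bounded_mult w(2)) auto
      then show ?thesis by (simp add: mult.commute)
    qed
    have eq: "(LINT x|lborel. w x * (\<phi> n x + \<psi> n x)) = (LINT x|lborel. w x * \<phi> n x) + (LINT x|lborel. w x * \<psi> n x)" for n
      using i[OF 1(1)] i[OF 2(1)] by (simp add: distrib_left)
    have "(LINT x|lborel. w x * (f x + g x)) = (LINT x|lborel. w x * f x) + (LINT x|lborel. w x * g x)"
      using integrable_mult_L2[OF _ _ w(3) f] integrable_mult_L2[OF _ _ w(3) g] w(1) assms(3,4) 
      by (simp add: distrib_left)
    then show "(\<lambda>n. LINT x|lborel. w x * (\<phi> n x + \<psi> n x)) \<longlonglongrightarrow> (LINT x|lborel. w x * (f x + g x))"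
      unfolding eq using 1(2)[OF w] 2(2)[OF w] by (auto intro: tendsto_add)
    show "\<bar>LINT x|lborel. w x * (\<phi> n x + \<psi> n x)\<bar> \<le> (C + C') * sqrt (LINT x|lborel. (w x)\<^sup>2)" for n
      unfolding eq using 1(2)[OF w] 2(2)[OF w] 
      by (auto simp: distrib_right intro!: order_trans[OF abs_triangle_ineq] add_mono)
  qed
qed

text \<open>Each localised piece \<zeta> u is mollified with kernels shifted into \<Omega> whose
  supports shrink to 0, and the pieces are added. The function u needs no boundary values for this,
  since only L2 convergence is asked for.\<close>

lemma mollification_weakly_approximable:
  assumes \<Omega>: "open \<Omega>" "bounded \<Omega>" "lipschitz_boundary \<Omega>"
    and u: "u \<in> borel_measurable borel" "\<And>x. x \<notin> \<Omega> \<Longrightarrow> u x = 0" "integrable lborel u" "integrable lborel (\<lambda>x. (u x)\<^sup>2)"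
  shows "weakly_approximable \<Omega> u"
proof -
  have C: "compact (closure \<Omega>)" using \<Omega>(2) by simp
  have u': "u x = 0" if "x \<notin> closure \<Omega>" for x using u(2) that closure_subset by blast
  have sm: "(\<lambda>x. \<zeta> x * u x) \<in> borel_measurable borel" "integrable lborel (\<lambda>x. \<zeta> x * u x)" "integrable lborel (\<lambda>x. (\<zeta> x * u x)\<^sup>2)" 
    if \<zeta>: "smooth \<zeta>" for \<zeta>
  proof -
    have c: "continuous_on UNIV \<zeta>" by (rule Ck_continuous[OF smooth_Ck[OF \<zeta>]])
    show "(\<lambda>x. \<zeta> x * u x) \<in> borel_measurable borel" using smooth_borel[OF \<zeta>] u(1) by measurable
    show "integrable lborel (\<lambda>x. \<zeta> x * u x)"
      using integrable_continuous_mult_left[of lborel u, OF _ u(3) u' C c] by simp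
    show "integrable lborel (\<lambda>x. (\<zeta> x * u x)\<^sup>2)"
      using integrable_continuous_mult_square[of lborel u, OF _ u(4) u' C c] by simp
  qed
  have "weakly_approximable \<Omega> (\<lambda>x. 1 * u x)"
  proof (rule smooth_partition_induct[where P="\<lambda>\<zeta>. weakly_approximable \<Omega> (\<lambda>x. \<zeta> x * u x)", OF C])
    fix \<zeta> :: "'a \<Rightarrow> real" assume "\<And>x. x \<in> closure \<Omega> \<Longrightarrow> \<zeta> x = 0"
    then have "(\<lambda>x. \<zeta> x * u x) = (\<lambda>x. 0)" using u' by fastforce
    then show "weakly_approximable \<Omega> (\<lambda>x. \<zeta> x * u x)" by (simp add: weakly_approximable_zero)
  next
    fix \<zeta> \<xi> :: "'a \<Rightarrow> real" 
    assume *: "smooth \<zeta>" "smooth \<xi>" "weakly_approximable \<Omega> (\<lambda>x. \<zeta> x * u x)" "weakly_approximable \<Omega> (\<lambda>x. \<xi> x * u x)"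
    show "weakly_approximable \<Omega> (\<lambda>x. (\<zeta> x + \<xi> x) * u x)"
      using weakly_approximable_add[OF *(3,4) sm(1)[OF *(1)] sm(1)[OF *(2)] sm(3)[OF *(1)] sm(3)[OF *(2)]] by (simp add: distrib_right)
  next
    fix x0 assume "x0 \<in> closure \<Omega>"
    then obtain r c \<epsilon>0 where r: "r > 0" "\<epsilon>0 > 0" "inward_shift \<Omega> x0 r c \<epsilon>0"
      using inward_shift_exists[OF \<Omega>(1,3)] by metis
    show "\<exists>r>0. \<forall>\<zeta>. smooth \<zeta> \<longrightarrow> (\<forall>x. 0 \<le> \<zeta> x) \<longrightarrow> closure {x. \<zeta> x \<noteq> 0} \<subseteq> ball x0 r \<longrightarrow> weakly_approximable \<Omega> (\<lambda>x. \<zeta> x * u x)"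
    proof (intro exI[of _ r] conjI allI impI r(1))
      fix \<zeta> :: "'a \<Rightarrow> real" assume \<zeta>: "smooth \<zeta>" "\<forall>x. 0 \<le> \<zeta> x" "closure {x. \<zeta> x \<noteq> 0} \<subseteq> ball x0 r"
      let ?f = "\<lambda>x. \<zeta> x * u x"
      define Q where "Q = (\<lambda>(n::nat) k. smooth k \<and> (\<forall>x. 0 \<le> k x) \<and> {x. k x \<noteq> 0} \<subseteq> ball 0 (1 / (real n + 1)) \<and> (LINT x|lborel. k x) = 1 \<and>
         (\<lambda>x. LINT y|lborel. k (x - y) * ?f y) \<in> test_functions \<Omega>)"
      have "\<exists>k. Q n k" for n :: nat
        unfolding Q_def
      proof (rule local_mollifier[OF r(3,2) \<Omega>(2) \<zeta>(3) sm(2)[OF \<zeta>(1)], of "1 / (real n + 1)"])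
        show "x \<in> \<Omega> \<and> \<zeta> x \<noteq> 0" if "\<zeta> x * u x \<noteq> 0" for x using that u(2) by auto
        show "0 < 1 / (real n + 1)" by simp
      qed blast
      then obtain k where "\<And>n. Q n (k n)" by metis
      then have k: "\<And>n. smooth (k n)" "\<And>n x. 0 \<le> k n x" "\<And>n. {x. k n x \<noteq> 0} \<subseteq> ball 0 (1 / (real n + 1))" 
        "\<And>n. (LINT x|lborel. k n x) = 1"
        "\<And>n. (\<lambda>x. LINT y|lborel. k n (x - y) * ?f y) \<in> test_functions \<Omega>" by (auto simp: Q_def)
      have kc: "continuous_on UNIV (k n)" for n by (rule Ck_continuous[OF smooth_Ck[OF k(1)]])
      show "weakly_approximable \<Omega> ?f"
        unfolding weakly_approximable_def
      proof (intro exI[of _ "\<lambda>n x. LINT y|lborel. k n (x - y) * ?f y"] exI[of _ "sqrt (LINT x|lborel. (?f x)\<^sup>2)"] conjI ballI impI allI k(5))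
        fix w :: "'a \<Rightarrow> real" 
        assume w: "w \<in> borel_measurable borel" "integrable lborel w" "integrable lborel (\<lambda>x. (w x)\<^sup>2)"
        show "\<bar>LINT x|lborel. w x * (LINT y|lborel. k n (x - y) * ?f y)\<bar> \<le> sqrt (LINT x|lborel. (?f x)\<^sup>2) * sqrt (LINT x|lborel. (w x)\<^sup>2)" for n
          by (rule mollified_pairing_bound[OF sm(1)[OF \<zeta>(1)] w(1) sm(2,3)[OF \<zeta>(1)] w(2,3) kc k(3,2,4)])
        show "(\<lambda>n. LINT x|lborel. w x * (LINT y|lborel. k n (x - y) * ?f y)) \<longlonglongrightarrow> (LINT x|lborel. w x * ?f x)"
        proof (rule LIMSEQ_I)
          fix e :: real assume "e > 0"
          then obtain d where d: "d > 0" 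
            "\<And>h. norm h < d \<Longrightarrow> \<bar>(LINT y|lborel. ?f y * w (y + h)) - (LINT y|lborel. ?f y * w y)\<bar> < e/2"
            using translation_pairing_tendsto_L2[OF sm(1)[OF \<zeta>(1)] w(1) sm(3)[OF \<zeta>(1)] w(2,3), of "e/2"] by auto
          obtain N where N: "1 / (real N + 1) < d" using d(1) by (metis nat_approx_posE of_nat_Suc add.commute)
          have "norm ((LINT x|lborel. w x * (LINT y|lborel. k n (x - y) * ?f y)) - (LINT x|lborel. w x * ?f x)) < e" if n: "n \<ge> N" for n
          proof -
            have "1 / (real n + 1) \<le> 1 / (real N + 1)" using n by (simp add: field_simps)
            then have kd: "{x. k n x \<noteq> 0} \<subseteq> ball 0 d" using k(3)[of n] N by (force simp: subset_iff)
            have "\<bar>(LINT x|lborel. w x * (LINT y|lborel. k n (x - y) * ?f y)) - (LINT y|lborel. ?f y * w y)\<bar> \<le> e/2"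
              by (rule mollified_pairing_diff[OF sm(1)[OF \<zeta>(1)] w(1) sm(2)[OF \<zeta>(1)] w(2) kc kd k(2,4)]) (use d(2) in force)
            then show ?thesis using \<open>e > 0\<close> by (simp add: mult.commute)
          qed
          then show "\<exists>N. \<forall>n\<ge>N. norm ((LINT x|lborel. w x * (LINT y|lborel. k n (x - y) * ?f y)) - (LINT x|lborel. w x * ?f x)) < e" by blast
        qed
      qed
    qed
  qed (auto simp: smooth_const)
  then show ?thesis by simp
qed

section \<open>Pairings of functions of bounded variation\<close>

text \<open>\<open>a\<close> and \<open>b\<close> times \<open>K\<close> are the absolutely
  continuous and the concentrated part of the derivative of u extended by 0. The second part may
  charge the boundary, where it carries the trace; therefore \<open>Gauss_Green\<close> has no
  boundary term and admits all C^1 functions. In the application \<open>z\<close> and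
  \<open>v\<close> come from the other solution. In \<open>dom\<close> the exceptional null set of x
  is common to all y, as it must be when K is singular.\<close>

locale bv_pairing =
  fixes \<Omega> :: "'a::euclidean_space set" and u v :: "'a \<Rightarrow> real" and a z b :: "'a \<Rightarrow> 'a" 
    and K :: "'a measure" and \<Psi> :: "'a \<Rightarrow> real" and C :: real
  assumes \<Omega>: "open \<Omega>" "bounded \<Omega>" "lipschitz_boundary \<Omega>"
    and u: "u \<in> borel_measurable borel" "\<And>x. x \<notin> \<Omega> \<Longrightarrow> u x = 0" "integrable lborel u" "integrable lborel (\<lambda>x. (u x)\<^sup>2)"
    and v: "v \<in> borel_measurable borel" "\<And>x. x \<notin> \<Omega> \<Longrightarrow> v x = 0" "integrable lborel v" "integrable lborel (\<lambda>x. (v x)\<^sup>2)"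
    and a: "a \<in> borel_measurable borel" "\<And>x. x \<notin> \<Omega> \<Longrightarrow> a x = 0" "integrable lborel a"
    and z: "z \<in> borel_measurable borel" "\<And>x. x \<notin> \<Omega> \<Longrightarrow> z x = 0" "integrable lborel z" "\<And>x. norm (z x) \<le> C"
    and K: "finite_measure K" "(\<lambda>x. x) \<in> K \<rightarrow>\<^sub>M borel"
    and b: "integrable K b" "\<And>x. x \<notin> closure \<Omega> \<Longrightarrow> b x = 0"
    and \<Psi>: "integrable K \<Psi>" "\<And>x. x \<notin> closure \<Omega> \<Longrightarrow> \<Psi> x = 0"
    and Gauss_Green: "\<And>\<phi>. Ck 1 \<phi> \<Longrightarrow> (LINT x|lborel. u x *\<^sub>R grad \<phi> x) = - (LINT x|lborel. \<phi> x *\<^sub>R a x) - (LINT x|K. \<phi> x *\<^sub>R b x)"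
    and div: "\<And>\<phi>. \<phi> \<in> test_functions \<Omega> \<Longrightarrow> (LINT x|lborel. v x * \<phi> x) = - (LINT x|lborel. z x \<bullet> grad \<phi> x)"
    and dom: "AE x in lborel. \<forall>y. x \<in> \<Omega> \<longrightarrow> z x \<bullet> b y \<le> \<Psi> y"
begin

lemma compact_cl: "compact (closure \<Omega>)" using \<Omega>(2) by simp

lemma off_closure: "x \<notin> closure \<Omega> \<Longrightarrow> x \<notin> \<Omega>" using closure_subset by blast

lemma id_lborel: "(\<lambda>x. x) \<in> lborel \<rightarrow>\<^sub>M borel" by simp

lemma integrable_weighted:
  assumes "smooth \<zeta>"
  shows "integrable lborel (\<lambda>x. \<zeta> x *\<^sub>R a x)" "integrable lborel (\<lambda>x. u x *\<^sub>R grad \<zeta> x)"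
    "integrable lborel (\<lambda>x. z x \<bullet> (\<zeta> x *\<^sub>R a x + u x *\<^sub>R grad \<zeta> x))" "integrable K (\<lambda>y. \<zeta> y * \<Psi> y)"
    "integrable lborel (\<lambda>x. \<zeta> x * u x)" "integrable lborel (\<lambda>x. (\<zeta> x * u x)\<^sup>2)" "integrable lborel (\<lambda>x. v x * (\<zeta> x * u x))"
proof -
  have c: "continuous_on UNIV \<zeta>" "continuous_on UNIV (grad \<zeta>)" 
    using assms Ck_continuous[OF smooth_Ck] continuous_grad[OF smooth_Ck] by auto
  show 1: "integrable lborel (\<lambda>x. \<zeta> x *\<^sub>R a x)"
    by (rule integrable_continuous_mult_left[OF id_lborel a(3) a(2)[OF off_closure] compact_cl c(1)])
  show 2: "integrable lborel (\<lambda>x. u x *\<^sub>R grad \<zeta> x)"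
    by (rule integrable_continuous_mult_right[OF id_lborel u(3) u(2)[OF off_closure] compact_cl c(2)])
  show "integrable lborel (\<lambda>x. z x \<bullet> (\<zeta> x *\<^sub>R a x + u x *\<^sub>R grad \<zeta> x))"
  proof (rule Bochner_Integration.integrable_bound)
    show "integrable lborel (\<lambda>x. C *\<^sub>R (\<zeta> x *\<^sub>R a x + u x *\<^sub>R grad \<zeta> x))" using 1 2 by simp
    show "(\<lambda>x. z x \<bullet> (\<zeta> x *\<^sub>R a x + u x *\<^sub>R grad \<zeta> x)) \<in> borel_measurable lborel" 
      using 1 2 z(1) by (intro borel_measurable_inner borel_measurable_add) auto
    have "norm (z x \<bullet> w) \<le> norm (C *\<^sub>R w)" for x w
      using Cauchy_Schwarz_ineq2[of "z x" w] mult_right_mono[OF order_trans[OF z(4) abs_ge_self], of "norm w" x] by simp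
    then show "AE x in lborel. norm (z x \<bullet> (\<zeta> x *\<^sub>R a x + u x *\<^sub>R grad \<zeta> x)) \<le> norm (C *\<^sub>R (\<zeta> x *\<^sub>R a x + u x *\<^sub>R grad \<zeta> x))"
      by (intro AE_I2)
  qed
  show "integrable K (\<lambda>y. \<zeta> y * \<Psi> y)"
    using integrable_continuous_mult_left[OF K(2) \<Psi> compact_cl c(1)] by simp
  show 3: "integrable lborel (\<lambda>x. \<zeta> x * u x)"
    using integrable_continuous_mult_left[OF id_lborel u(3) u(2)[OF off_closure] compact_cl c(1)] by simp
  show 4: "integrable lborel (\<lambda>x. (\<zeta> x * u x)\<^sup>2)"
    by (rule integrable_continuous_mult_square[OF id_lborel u(4) u(2)[OF off_closure] compact_cl c(1)])
  show "integrable lborel (\<lambda>x. v x * (\<zeta> x * u x))"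
    using v(1) u(1) smooth_borel[OF assms] by (intro integrable_mult_L2[OF _ _ v(4) 4]) auto
qed

text \<open>The localised form of the bound on the mixed pairing; it is additive in the cutoff \<open>\<zeta>\<close>.\<close>

definition pairing_bound :: "('a \<Rightarrow> real) \<Rightarrow> bool" where
  "pairing_bound \<zeta> \<longleftrightarrow> - (LINT x|lborel. v x * (\<zeta> x * u x)) \<le>
     (LINT x|lborel. z x \<bullet> (\<zeta> x *\<^sub>R a x + u x *\<^sub>R grad \<zeta> x)) + (LINT y|K. \<zeta> y * \<Psi> y)"

lemma pairing_bound_zero:
  assumes "\<And>x. x \<in> closure \<Omega> \<Longrightarrow> \<zeta> x = 0"
  shows "pairing_bound \<zeta>"
proof -
  have z0: "\<zeta> x = 0" if "x \<in> \<Omega>" for x using assms that closure_subset by blast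
  then have g0: "grad \<zeta> x = 0" if "x \<in> \<Omega>" for x using grad_zero[OF \<Omega>(1) that] by blast
  have "v x * (\<zeta> x * u x) = 0" for x
    using z0[of x] u(2)[of x] by (cases "x \<in> \<Omega>") auto
  moreover have "z x \<bullet> (\<zeta> x *\<^sub>R a x + u x *\<^sub>R grad \<zeta> x) = 0" for x
    using z0[of x] u(2)[of x] g0[of x] a(2)[of x] by (cases "x \<in> \<Omega>") auto
  moreover have "\<zeta> y * \<Psi> y = 0" for y
    using assms[of y] \<Psi>(2)[of y] by (cases "y \<in> closure \<Omega>") auto
  ultimately show ?thesis unfolding pairing_bound_def by (simp only: integral_zero)
qed

lemma pairing_bound_add:
  assumes "smooth \<zeta>" "smooth \<xi>" "pairing_bound \<zeta>" "pairing_bound \<xi>"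
  shows "pairing_bound (\<lambda>x. \<zeta> x + \<xi> x)"
proof -
  have g: "grad (\<lambda>x. \<zeta> x + \<xi> x) x = grad \<zeta> x + grad \<xi> x" for x
  proof -
    have "frechet_derivative (\<lambda>x. \<zeta> x + \<xi> x) (at x) = (\<lambda>h. frechet_derivative \<zeta> (at x) h + frechet_derivative \<xi> (at x) h)"
      by (rule frechet_derivative_at[OF has_derivative_add[OF smooth_differentiable[OF assms(1), unfolded frechet_derivative_works] 
          smooth_differentiable[OF assms(2), unfolded frechet_derivative_works]], symmetric])
    then show ?thesis by (simp add: grad_def scaleR_add_left sum.distrib)
  qed
  note i = integrable_weighted[OF assms(1)] and j = integrable_weighted[OF assms(2)]
  have "(LINT x|lborel. v x * ((\<zeta> x + \<xi> x) * u x)) = (LINT x|lborel. v x * (\<zeta> x * u x)) + (LINT x|lborel. v x * (\<xi> x * u x))"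
    using i(7) j(7) by (simp add: distrib_left distrib_right)
  moreover have "(LINT x|lborel. z x \<bullet> ((\<zeta> x + \<xi> x) *\<^sub>R a x + u x *\<^sub>R grad (\<lambda>x. \<zeta> x + \<xi> x) x)) =
     (LINT x|lborel. z x \<bullet> (\<zeta> x *\<^sub>R a x + u x *\<^sub>R grad \<zeta> x)) + (LINT x|lborel. z x \<bullet> (\<xi> x *\<^sub>R a x + u x *\<^sub>R grad \<xi> x))"
    unfolding g Bochner_Integration.integral_add[OF i(3) j(3), symmetric]
    by (intro Bochner_Integration.integral_cong refl) (simp add: scaleR_add_left scaleR_add_right inner_add_right)
  moreover have "(LINT y|K. (\<zeta> y + \<xi> y) * \<Psi> y) = (LINT y|K. \<zeta> y * \<Psi> y) + (LINT y|K. \<xi> y * \<Psi> y)"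
    using i(4) j(4) by (simp add: distrib_right)
  ultimately show ?thesis using assms(3,4) by (simp add: pairing_bound_def)
qed

text \<open>This is \<open>Gauss_Green\<close> for y -> k(x - y) \<zeta>(y): the gradient of the
  mollified \<zeta> u is the mollification of the measure \<zeta> Du + u grad \<zeta>, up to the
  boundary.\<close>

lemma grad_mollification:
  assumes k: "smooth k" "bounded {x. k x \<noteq> 0}" and \<zeta>: "smooth \<zeta>" and i: "i \<in> Basis"
  shows "grad (\<lambda>x. LINT y|lborel. k (x - y) * (\<zeta> y * u y)) x \<bullet> i =
    (LINT y|lborel. k (x - y) * ((\<zeta> y *\<^sub>R a y + u y *\<^sub>R grad \<zeta> y) \<bullet> i)) + (LINT y|K. k (x - y) * (\<zeta> y * (b y \<bullet> i)))"
proof -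
  define \<phi> where "\<phi> = (\<lambda>y. k (x - y) * \<zeta> y)"
  have sk: "smooth (\<lambda>y. k (x - y))" unfolding smooth_def
  proof
    fix j show "Ck j (\<lambda>y. k (x - y))"
      using Ck_affine[OF bounded_linear_minus[OF bounded_linear_ident] smooth_Ck[OF k(1)], of j x] by simp
  qed
  have s\<phi>: "smooth \<phi>" unfolding \<phi>_def by (intro smooth_mult sk \<zeta>)
  \<comment> \<open>The minus sign from differentiating k(x - y) in y cancels the one from
    integration by parts.\<close>
  have gk: "grad (\<lambda>y. k (x - y)) y = - grad k (x - y)" for y
  proof -
    have "((\<lambda>y. k (x - y)) has_derivative (\<lambda>h. frechet_derivative k (at (x - y)) (- h))) (at y)"
      by (rule has_derivative_compose[OF _ smooth_differentiable[OF k(1), unfolded frechet_derivative_works]])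
        (auto intro!: derivative_eq_intros)
    then have "frechet_derivative (\<lambda>y. k (x - y)) (at y) = (\<lambda>h. frechet_derivative k (at (x - y)) (- h))"
      using frechet_derivative_at by metis
    then show ?thesis
      using linear_neg[OF linear_frechet_derivative[OF smooth_differentiable[OF k(1)]]]
      by (simp add: grad_def sum_negf)
  qed
  have g\<phi>: "grad \<phi> y = k (x - y) *\<^sub>R grad \<zeta> y - \<zeta> y *\<^sub>R grad k (x - y)" for y
    unfolding \<phi>_def by (subst grad_mult) (auto simp: gk smooth_differentiable[OF sk] smooth_differentiable[OF \<zeta>])
  note w = integrable_weighted[OF s\<phi>] and w\<zeta> = integrable_weighted[OF \<zeta>]
  have c\<phi>: "continuous_on UNIV \<phi>" by (rule Ck_continuous[OF smooth_Ck[OF s\<phi>]])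
  have ib: "integrable K (\<lambda>y. \<phi> y *\<^sub>R b y)"
    by (rule integrable_continuous_mult_left[OF K(2) b compact_cl c\<phi>])
  have kc: "continuous_on UNIV (\<lambda>y. k (x - y))" by (rule Ck_continuous[OF smooth_Ck[OF sk]])
  have "(LINT y|lborel. u y *\<^sub>R grad \<phi> y) \<bullet> i = - ((LINT y|lborel. \<phi> y *\<^sub>R a y) \<bullet> i) - (LINT y|K. \<phi> y *\<^sub>R b y) \<bullet> i"
    using Gauss_Green[OF smooth_Ck[OF s\<phi>]] by (simp add: inner_diff_left)
  moreover have "(LINT y|lborel. (u y *\<^sub>R grad \<phi> y) \<bullet> i) = (LINT y|lborel. u y *\<^sub>R grad \<phi> y) \<bullet> i"
    by (rule integral_inner_left) (rule w(2))
  moreover have "(LINT y|lborel. (\<phi> y *\<^sub>R a y) \<bullet> i) = (LINT y|lborel. \<phi> y *\<^sub>R a y) \<bullet> i"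
    by (rule integral_inner_left) (rule w(1))
  moreover have "(LINT y|K. (\<phi> y *\<^sub>R b y) \<bullet> i) = (LINT y|K. \<phi> y *\<^sub>R b y) \<bullet> i"
    by (rule integral_inner_left) (rule ib)
  ultimately have GG: "(LINT y|lborel. (u y *\<^sub>R grad \<phi> y) \<bullet> i) = - (LINT y|lborel. (\<phi> y *\<^sub>R a y) \<bullet> i) - (LINT y|K. (\<phi> y *\<^sub>R b y) \<bullet> i)"
    by (simp only:)
  have i1: "integrable lborel (\<lambda>y. k (x - y) * ((\<zeta> y *\<^sub>R a y) \<bullet> i))" "integrable lborel (\<lambda>y. k (x - y) * ((u y *\<^sub>R grad \<zeta> y) \<bullet> i))"
  proof -
    have "integrable lborel (\<lambda>y. k (x - y) *\<^sub>R (\<zeta> y *\<^sub>R a y))"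
      by (rule integrable_continuous_mult_left[OF id_lborel w\<zeta>(1) _ compact_cl kc]) (simp add: a(2) off_closure)
    from integrable_inner_left[OF this, of i]
    show "integrable lborel (\<lambda>y. k (x - y) * ((\<zeta> y *\<^sub>R a y) \<bullet> i))" by (simp add: mult.assoc)
    have "integrable lborel (\<lambda>y. k (x - y) *\<^sub>R (u y *\<^sub>R grad \<zeta> y))"
      by (rule integrable_continuous_mult_left[OF id_lborel w\<zeta>(2) _ compact_cl kc]) (simp add: u(2) off_closure)
    from integrable_inner_left[OF this, of i]
    show "integrable lborel (\<lambda>y. k (x - y) * ((u y *\<^sub>R grad \<zeta> y) \<bullet> i))" by (simp add: mult.assoc)
  qed
  have i2: "integrable lborel (\<lambda>y. (grad k (x - y) \<bullet> i) * (\<zeta> y * u y))"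
  proof -
    have "continuous_on UNIV (\<lambda>y. grad k (x - y) \<bullet> i)"
      by (intro continuous_intros continuous_on_compose2[OF continuous_grad[OF smooth_Ck[OF k(1)]]]) auto
    from integrable_continuous_mult_left[OF id_lborel w\<zeta>(5) _ compact_cl this]
    show ?thesis by (simp add: u(2) off_closure)
  qed
  have "grad (\<lambda>x. LINT y|lborel. k (x - y) * (\<zeta> y * u y)) x \<bullet> i = (LINT y|lborel. (grad k (x - y) \<bullet> i) * (\<zeta> y * u y))"
    by (rule grad_convolution_inner[OF id_lborel w\<zeta>(5) smooth_Ck[OF k(1)] k(2) i])
  also have "\<dots> = (LINT y|lborel. k (x - y) * ((u y *\<^sub>R grad \<zeta> y) \<bullet> i) - (u y *\<^sub>R grad \<phi> y) \<bullet> i)"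
    by (intro Bochner_Integration.integral_cong refl) (simp add: g\<phi> inner_diff_left algebra_simps)
  also have "\<dots> = (LINT y|lborel. k (x - y) * ((u y *\<^sub>R grad \<zeta> y) \<bullet> i)) - (LINT y|lborel. (u y *\<^sub>R grad \<phi> y) \<bullet> i)"
    by (intro Bochner_Integration.integral_diff i1 integrable_inner_left w)
  also have "\<dots> = (LINT y|lborel. k (x - y) * ((u y *\<^sub>R grad \<zeta> y) \<bullet> i)) + (LINT y|lborel. k (x - y) * ((\<zeta> y *\<^sub>R a y) \<bullet> i)) + (LINT y|K. k (x - y) * (\<zeta> y * (b y \<bullet> i)))"
    unfolding GG by (simp add: \<phi>_def mult.assoc)
  also have "(LINT y|lborel. k (x - y) * ((u y *\<^sub>R grad \<zeta> y) \<bullet> i)) + (LINT y|lborel. k (x - y) * ((\<zeta> y *\<^sub>R a y) \<bullet> i))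
     = (LINT y|lborel. k (x - y) * ((\<zeta> y *\<^sub>R a y + u y *\<^sub>R grad \<zeta> y) \<bullet> i))"
    unfolding Bochner_Integration.integral_add[OF i1(2,1), symmetric]
    by (intro Bochner_Integration.integral_cong refl) (simp add: inner_add_left algebra_simps)
  finally show ?thesis .
qed

text \<open>The shifted mollification of \<zeta> u is a test function for \<open>div\<close>. In the
  limit the absolutely continuous part converges, because F is integrable and z bounded. The
  concentrated part is not passed to a limit at all: with the nonnegative weights k(x - y)
  \<zeta>(y) it is bounded through \<open>dom\<close>, and integration in x gives the integral of
  \<zeta> \<Psi> exactly.\<close>

lemma pairing_bound_local:
  assumes shift: "inward_shift \<Omega> x0 r c \<epsilon>0" "\<epsilon>0 > 0"
    and \<zeta>: "smooth \<zeta>" "\<And>x. 0 \<le> \<zeta> x" "closure {x. \<zeta> x \<noteq> 0} \<subseteq> ball x0 r"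
  shows "pairing_bound \<zeta>"
  unfolding pairing_bound_def
proof (rule field_le_epsilon)
  fix e :: real assume e: "e > 0"
  note w = integrable_weighted[OF \<zeta>(1)]
  let ?f = "\<lambda>x. \<zeta> x * u x"
  define F where "F = (\<lambda>x. \<zeta> x *\<^sub>R a x + u x *\<^sub>R grad \<zeta> x)"
  have F: "integrable lborel F" unfolding F_def using w(1,2) by simp
  have \<zeta>m [measurable]: "\<zeta> \<in> borel_measurable borel" by (rule smooth_borel[OF \<zeta>(1)])
  have fm: "?f \<in> borel_measurable borel" using u(1) by measurable
  have Fm: "(\<lambda>x. F x \<bullet> i) \<in> borel_measurable borel" "integrable lborel (\<lambda>x. F x \<bullet> i)" for i
    using F by auto
  have zi: "(\<lambda>x. z x \<bullet> i) \<in> borel_measurable borel" "integrable lborel (\<lambda>x. z x \<bullet> i)" for i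
    using z(1,3) by auto
  have zb: "\<bar>z x \<bullet> i\<bar> \<le> C" if "i \<in> Basis" for x i
    using Basis_le_norm[OF that, of "z x"] z(4)[of x] by linarith
  \<comment> \<open>Half of e is shared among the coordinates of z . F, the other half pays for the
    pairing with v.\<close>
  define e' where "e' = e / (2 * DIM('a))"
  have e': "e' > 0" using e by (simp add: e'_def)
  define D where "D = (\<lambda>i h. \<bar>(LINT y|lborel. (F y \<bullet> i) * (z (y + h) \<bullet> i)) - (LINT y|lborel. (F y \<bullet> i) * (z y \<bullet> i))\<bar>)"
  have "\<exists>d>0. \<forall>h. norm h < d \<longrightarrow> D i h < e'" if i: "i \<in> Basis" for i
    unfolding D_def by (rule translation_pairing_tendsto_L1[OF Fm(1)[of i] zi(1)[of i] Fm(2) zi(2) zb[OF i] e']) blast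
  then obtain d where D: "\<And>i. i \<in> Basis \<Longrightarrow> d i > 0" "\<And>i h. i \<in> Basis \<Longrightarrow> norm h < d i \<Longrightarrow> D i h < e'" by metis
  note d = D(1) D(2)[unfolded D_def]
  obtain d' where d': "d' > 0" 
    "\<And>h. norm h < d' \<Longrightarrow> \<bar>(LINT y|lborel. ?f y * v (y + h)) - (LINT y|lborel. ?f y * v y)\<bar> < e / 2"
    using translation_pairing_tendsto_L2[OF fm v(1) w(6) v(3,4), of "e/2"] e by auto
  \<comment> \<open>One kernel must be fine enough for the pairing with v and for every coordinate
    pairing.\<close>
  define \<eta> where "\<eta> = min d' (Min (d ` Basis))"
  have \<eta>: "\<eta> > 0" "\<eta> \<le> d'" "\<And>i. i \<in> Basis \<Longrightarrow> \<eta> \<le> d i" 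
    using d(1) d'(1) by (auto simp: \<eta>_def min.coboundedI2)
  obtain k where k: "smooth k" "\<And>x. 0 \<le> k x" "{x. k x \<noteq> 0} \<subseteq> ball 0 \<eta>" "(LINT x|lborel. k x) = (1::real)"
    "(\<lambda>x. LINT y|lborel. k (x - y) * ?f y) \<in> test_functions \<Omega>"
    "\<And>x y. y \<in> closure \<Omega> \<Longrightarrow> \<zeta> y \<noteq> 0 \<Longrightarrow> k (x - y) \<noteq> 0 \<Longrightarrow> x \<in> \<Omega>"
  proof (rule local_mollifier[OF shift \<Omega>(2) \<zeta>(3) w(5) _ \<eta>(1)])
    show "x \<in> \<Omega> \<and> \<zeta> x \<noteq> 0" if "\<zeta> x * u x \<noteq> 0" for x using that u(2) by auto
  qed blast
  define \<phi> where "\<phi> = (\<lambda>x. LINT y|lborel. k (x - y) * ?f y)"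
  have \<phi>: "\<phi> \<in> test_functions \<Omega>" using k(5) by (simp add: \<phi>_def)
  have kc: "continuous_on UNIV k" by (rule Ck_continuous[OF smooth_Ck[OF k(1)]])
  have km [measurable]: "k \<in> borel_measurable borel" by (rule smooth_borel[OF k(1)])
  have kb: "bounded {x. k x \<noteq> 0}" using k(3) bounded_ball bounded_subset by blast
  obtain B where B: "\<And>x. \<bar>k x\<bar> \<le> B" using bounded_of_support[OF kc kb] by metis
  interpret K: finite_measure K by (rule K(1))
  interpret P: pair_sigma_finite "lborel :: 'a measure" K ..
  have idK [measurable]: "(\<lambda>x. x) \<in> K \<rightarrow>\<^sub>M borel" by (rule K(2))
  have "\<bar>(LINT x|lborel. v x * \<phi> x) - (LINT y|lborel. ?f y * v y)\<bar> \<le> e / 2"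
    unfolding \<phi>_def
    by (rule mollified_pairing_diff[OF fm v(1) w(5) v(3) kc k(3,2,4)]) (rule less_imp_le[OF d'(2)], use \<eta>(2) in linarith)
  then have 1: "- (LINT x|lborel. v x * (\<zeta> x * u x)) \<le> (LINT x|lborel. z x \<bullet> grad \<phi> x) + e / 2"
    unfolding div[OF \<phi>] mult.commute[of "\<zeta> _ * u _" "v _"] by linarith
  \<comment> \<open>The indicator is there because \<open>dom\<close> speaks only about x in
    \<Omega>; outside, z vanishes and 0 is the right bound.\<close>
  define W where "W = (\<lambda>x. indicator \<Omega> x * (LINT y|K. k (x - y) * (\<zeta> y * \<Psi> y)))"
  have iG: "integrable (lborel \<Otimes>\<^sub>M K) (\<lambda>(x, y). indicator \<Omega> x * (k (x - y) * (\<zeta> y * \<Psi> y)))"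
  proof -
    have "integrable lborel (indicator \<Omega> :: 'a \<Rightarrow> real)"
      using emeasure_bounded_finite[OF \<Omega>(2)] \<Omega>(1) by (intro integrable_real_indicator) auto
    from integrable_pair_kernel[OF lborel.sigma_finite_measure_axioms K.sigma_finite_measure_axioms this w(4), of "\<lambda>p. k (fst p - snd p)" B]
    show ?thesis using B by simp
  qed
  have iW: "integrable lborel W"
    unfolding W_def using P.integrable_fst'[OF iG] by simp
  have W: "(LINT x|lborel. W x) = (LINT y|K. \<zeta> y * \<Psi> y)"
  proof -
    have "(LINT x|lborel. W x) = (LINT y|K. LINT x|lborel. indicator \<Omega> x * (k (x - y) * (\<zeta> y * \<Psi> y)))"
      using P.Fubini_integral[OF iG] by (simp add: W_def)
    also have "\<dots> = (LINT y|K. \<zeta> y * \<Psi> y)"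
    proof (intro Bochner_Integration.integral_cong refl)
      fix y
      \<comment> \<open>For y in the closure with \<zeta> y nonzero the inward shift puts the whole
        kernel into \<Omega>, so the indicator may be dropped and the mass in x is 1.\<close>
      have "indicator \<Omega> x * (k (x - y) * (\<zeta> y * \<Psi> y)) = k (x - y) * (\<zeta> y * \<Psi> y)" for x
        using k(6)[of y x] \<Psi>(2)[of y] by (auto simp: indicator_def)
      moreover have "(LINT x|lborel. k (x - y)) = 1"
        using integral_lborel_translation(1)[of k "- y"] k(4) by simp
      ultimately show "(LINT x|lborel. indicator \<Omega> x * (k (x - y) * (\<zeta> y * \<Psi> y))) = \<zeta> y * \<Psi> y"
        by (simp only: integral_mult_left_zero mult_1)
    qed
    finally show ?thesis .
  qed
  have ipart: "integrable lborel (\<lambda>x. (z x \<bullet> i) * (LINT y|lborel. k (x - y) * (F y \<bullet> i)))" for i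
    by (rule mollified_pairing(1)[OF Fm(1) zi(1) Fm(2) zi(2) kc kb])
  \<comment> \<open>The coordinates are treated separately only to use the formula for the gradient;
    in the concentrated part they are recombined to z(x) . b(y) before the bound is applied.\<close>
  have le: "AE x in lborel. z x \<bullet> grad \<phi> x \<le> (\<Sum>i\<in>Basis. (z x \<bullet> i) * (LINT y|lborel. k (x - y) * (F y \<bullet> i))) + W x"
    using dom
  proof eventually_elim
    case (elim x)
    have ck': "continuous_on UNIV (\<lambda>y. k (x - y))" 
      by (rule continuous_on_compose2[OF kc]) (auto intro!: continuous_intros)
    have ck: "continuous_on UNIV (\<lambda>y. k (x - y) * \<zeta> y)" 
      by (rule continuous_on_mult[OF ck' Ck_continuous[OF smooth_Ck[OF \<zeta>(1)]]])
    have "integrable K (\<lambda>y. (k (x - y) * \<zeta> y) *\<^sub>R b y)"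
      by (rule integrable_continuous_mult_left[OF K(2) b compact_cl ck])
    then have ib: "integrable K (\<lambda>y. k (x - y) * (\<zeta> y * (b y \<bullet> i)))" for i
      using integrable_inner_left[of i K "\<lambda>y. (k (x - y) * \<zeta> y) *\<^sub>R b y"] by (simp add: mult.assoc)
    have i\<Psi>: "integrable K (\<lambda>y. k (x - y) * (\<zeta> y * \<Psi> y))"
      using integrable_continuous_mult_left[OF K(2) w(4) _ compact_cl ck'] \<Psi>(2) by simp
    have "z x \<bullet> grad \<phi> x = (\<Sum>i\<in>Basis. (z x \<bullet> i) * (grad \<phi> x \<bullet> i))" by (rule euclidean_inner)
    also have "\<dots> = (\<Sum>i\<in>Basis. (z x \<bullet> i) * (LINT y|lborel. k (x - y) * (F y \<bullet> i))) 
       + (\<Sum>i\<in>Basis. (z x \<bullet> i) * (LINT y|K. k (x - y) * (\<zeta> y * (b y \<bullet> i))))"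
      unfolding \<phi>_def F_def sum.distrib[symmetric] 
      by (intro sum.cong refl) (simp only: grad_mollification[OF k(1) kb \<zeta>(1)] distrib_left)
    also have "(\<Sum>i\<in>Basis. (z x \<bullet> i) * (LINT y|K. k (x - y) * (\<zeta> y * (b y \<bullet> i)))) \<le> W x"
    proof (cases "x \<in> \<Omega>")
      case True
      have "(\<Sum>i\<in>Basis. (z x \<bullet> i) * (LINT y|K. k (x - y) * (\<zeta> y * (b y \<bullet> i)))) 
        = (LINT y|K. (\<Sum>i\<in>Basis. (z x \<bullet> i) * (k (x - y) * (\<zeta> y * (b y \<bullet> i)))))"
        using ib by (subst Bochner_Integration.integral_sum) auto
      also have "\<dots> \<le> (LINT y|K. k (x - y) * (\<zeta> y * \<Psi> y))"
      proof (rule integral_mono[OF _ i\<Psi>])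
        show "integrable K (\<lambda>y. \<Sum>i\<in>Basis. (z x \<bullet> i) * (k (x - y) * (\<zeta> y * (b y \<bullet> i))))" using ib by auto
        fix y
        have "(\<Sum>i\<in>Basis. (z x \<bullet> i) * (k (x - y) * (\<zeta> y * (b y \<bullet> i)))) = k (x - y) * (\<zeta> y * (z x \<bullet> b y))"
          by (subst (2) euclidean_inner) (simp add: sum_distrib_left algebra_simps)
        also have "\<dots> \<le> k (x - y) * (\<zeta> y * \<Psi> y)"
          using elim True k(2) \<zeta>(2) by (intro mult_left_mono) auto
        finally show "(\<Sum>i\<in>Basis. (z x \<bullet> i) * (k (x - y) * (\<zeta> y * (b y \<bullet> i)))) \<le> k (x - y) * (\<zeta> y * \<Psi> y)" .
      qed
      finally show ?thesis using True by (simp add: W_def)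
    qed (simp add: z(2) W_def)
    finally show ?case by simp
  qed
  have iz: "integrable lborel (\<lambda>x. z x \<bullet> grad \<phi> x)"
  proof -
    have "integrable lborel (\<lambda>x. (z x \<bullet> i) *\<^sub>R (grad \<phi> x \<bullet> i))" for i
      by (rule integrable_continuous_mult_right[OF id_lborel zi(2)[of i] _ compact_cl 
            continuous_on_inner[OF continuous_grad[OF smooth_Ck[OF test_functionsD(1)[OF \<phi>]]] continuous_on_const]])
        (simp add: z(2) off_closure)
    then show ?thesis by (subst euclidean_inner) auto
  qed
  have "(LINT x|lborel. z x \<bullet> grad \<phi> x) \<le> (LINT x|lborel. (\<Sum>i\<in>Basis. (z x \<bullet> i) * (LINT y|lborel. k (x - y) * (F y \<bullet> i))) + W x)"
    by (rule integral_mono_AE[OF iz _ le]) (use ipart iW in auto)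
  also have "\<dots> = (\<Sum>i\<in>Basis. (LINT x|lborel. (z x \<bullet> i) * (LINT y|lborel. k (x - y) * (F y \<bullet> i)))) + (LINT y|K. \<zeta> y * \<Psi> y)"
    unfolding W[symmetric] using ipart iW by (subst Bochner_Integration.integral_add) (auto simp: Bochner_Integration.integral_sum)
  also have "(\<Sum>i\<in>Basis. (LINT x|lborel. (z x \<bullet> i) * (LINT y|lborel. k (x - y) * (F y \<bullet> i)))) \<le> (\<Sum>i\<in>Basis. (LINT y|lborel. (F y \<bullet> i) * (z y \<bullet> i)) + e')"
  proof (rule sum_mono)
    fix i :: 'a assume i: "i \<in> Basis"
    have "\<bar>(LINT x|lborel. (z x \<bullet> i) * (LINT y|lborel. k (x - y) * (F y \<bullet> i))) - (LINT y|lborel. (F y \<bullet> i) * (z y \<bullet> i))\<bar> \<le> e'"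
      by (rule mollified_pairing_diff[OF Fm(1) zi(1) Fm(2) zi(2) kc k(3,2,4)]) (rule less_imp_le[OF d(2)[OF i]], use \<eta>(3)[OF i] in linarith)
    then show "(LINT x|lborel. (z x \<bullet> i) * (LINT y|lborel. k (x - y) * (F y \<bullet> i))) \<le> (LINT y|lborel. (F y \<bullet> i) * (z y \<bullet> i)) + e'" by linarith
  qed
  also have "\<dots> = (LINT x|lborel. z x \<bullet> F x) + e / 2"
  proof -
    have "integrable lborel (\<lambda>y. (z y \<bullet> i) * (F y \<bullet> i))" if "i \<in> Basis" for i
      by (rule integrable_bounded_mult[OF Fm(2) _ zb[OF that]]) (use zi(1) in auto)
    then have "(\<Sum>i\<in>Basis. (LINT y|lborel. (F y \<bullet> i) * (z y \<bullet> i))) = (LINT x|lborel. z x \<bullet> F x)"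
      by (subst euclidean_inner) (simp add: Bochner_Integration.integral_sum mult.commute)
    then show ?thesis by (simp add: sum.distrib e'_def)
  qed
  finally show "- (LINT x|lborel. v x * (\<zeta> x * u x)) \<le>
     (LINT x|lborel. z x \<bullet> (\<zeta> x *\<^sub>R a x + u x *\<^sub>R grad \<zeta> x)) + (LINT y|K. \<zeta> y * \<Psi> y) + e"
    using 1 by (simp add: F_def)
qed

lemma minus_pairing_le: "- (LINT x|lborel. v x * u x) \<le> (LINT x|lborel. z x \<bullet> a x) + (LINT y|K. \<Psi> y)"
proof -
  have "pairing_bound (\<lambda>x. 1)"
  proof (rule smooth_partition_induct[OF compact_cl])
    fix x0 assume "x0 \<in> closure \<Omega>"
    then obtain r c \<epsilon>0 where r: "r > 0" "\<epsilon>0 > 0" "inward_shift \<Omega> x0 r c \<epsilon>0"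
      using inward_shift_exists[OF \<Omega>(1,3)] by metis
    show "\<exists>r>0. \<forall>\<zeta>. smooth \<zeta> \<longrightarrow> (\<forall>x. 0 \<le> \<zeta> x) \<longrightarrow> closure {x. \<zeta> x \<noteq> 0} \<subseteq> ball x0 r \<longrightarrow> pairing_bound \<zeta>"
      using r pairing_bound_local[OF r(3,2)] by blast
  qed (auto simp: smooth_const intro: pairing_bound_zero pairing_bound_add)
  moreover have "grad (\<lambda>x::'a. 1) x = 0" for x by (rule grad_zero[of UNIV]) auto
  ultimately show ?thesis by (simp add: pairing_bound_def)
qed

end

section \<open>Measurable representatives and the boundary term\<close>

lemma borel_measurable_completion_AE:
  fixes f g :: "'m \<Rightarrow> 'b::second_countable_topology"
  assumes g: "g \<in> borel_measurable (completion M)" and ae: "AE x in M. f x = g x"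
  shows "f \<in> borel_measurable (completion M)"
proof (rule measurableI)
  fix A :: "'b set" assume A: "A \<in> sets borel"
  show "f -` A \<inter> space (completion M) \<in> sets (completion M)"
  proof (rule completion.in_sets_AE)
    show "g -` A \<inter> space (completion M) \<in> sets (completion M)" using g A by (rule measurable_sets)
    show "AE x in completion M. (x \<in> g -` A \<inter> space (completion M)) = (x \<in> f -` A \<inter> space (completion M))"
      using AE_completion[OF ae] by eventually_elim auto
  qed auto
qed auto

text \<open>With Borel functions that vanish outside S, every integral over S becomes an integral
  over \<open>lborel\<close> on the whole space, where Fubini and translation invariance apply
  without completions.\<close>

lemma borel_representative:
  fixes f :: "'a::euclidean_space \<Rightarrow> 'b::euclidean_space"
  assumes f: "f \<in> borel_measurable (lebesgue_on S)" and S: "S \<in> sets borel"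
  obtains f' where "f' \<in> borel_measurable borel" "\<And>x. x \<notin> S \<Longrightarrow> f' x = 0" "AE x in lborel. x \<in> S \<longrightarrow> f' x = f x"
proof -
  have S': "S \<in> sets lebesgue" using S by auto
  have m: "(\<lambda>x. indicator S x *\<^sub>R f x) \<in> borel_measurable lebesgue"
    using f S' by (subst (asm) borel_measurable_restrict_space_iff) auto
  have "\<exists>g\<in>borel_measurable lborel. AE x in lborel. (indicator S x *\<^sub>R f x) \<bullet> i = g x" for i
    by (rule completion_ex_borel_measurable_real[OF borel_measurable_inner[OF m borel_measurable_const]])
  then obtain g where g: "\<And>i. g i \<in> borel_measurable lborel" "\<And>i. AE x in lborel. (indicator S x *\<^sub>R f x) \<bullet> i = g i x" 
    by metis
  define f' where "f' = (\<lambda>x. indicator S x *\<^sub>R (\<Sum>i\<in>Basis. g i x *\<^sub>R i))"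
  show thesis
  proof (rule that[of f'])
    have [measurable]: "g i \<in> borel_measurable borel" for i using g(1)[of i] by simp
    show "f' \<in> borel_measurable borel" unfolding f'_def using S by measurable
    have "AE x in lborel. \<forall>i\<in>Basis. (indicator S x *\<^sub>R f x) \<bullet> i = g i x"
      using g(2) by (subst AE_finite_all) auto
    then show "AE x in lborel. x \<in> S \<longrightarrow> f' x = f x"
    proof eventually_elim
      case (elim x)
      show ?case
      proof
        assume x: "x \<in> S"
        have "f' x = (\<Sum>i\<in>Basis. (f x \<bullet> i) *\<^sub>R i)" unfolding f'_def using x elim by (simp cong: sum.cong)
        then show "f' x = f x" by (simp add: euclidean_representation)
      qed
    qed
  qed (simp add: f'_def)
qed

lemma
  fixes f g :: "'a::euclidean_space \<Rightarrow> 'b::euclidean_space"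
  assumes g: "g \<in> borel_measurable borel" "\<And>x. x \<notin> S \<Longrightarrow> g x = 0" and ae: "AE x in lborel. x \<in> S \<longrightarrow> g x = f x"
  shows set_integral_lebesgue_eq: "(LINT x:S|lebesgue. f x) = (LINT x|lborel. g x)"
    and set_integrable_lebesgue_iff: "set_integrable lebesgue S f \<longleftrightarrow> integrable lborel g"
    and integrable_lebesgue_on_iff: "S \<in> sets borel \<Longrightarrow> integrable (lebesgue_on S) f \<longleftrightarrow> integrable lborel g"
proof -
  have ae': "AE x in lborel. indicator S x *\<^sub>R f x = g x"
    using ae by eventually_elim (auto simp: indicator_def g(2))
  have m: "g \<in> borel_measurable lebesgue" using g(1) by (simp add: measurable_completion)
  have m': "(\<lambda>x. indicator S x *\<^sub>R f x) \<in> borel_measurable lebesgue"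
    by (rule borel_measurable_completion_AE[OF m ae'])
  show "(LINT x:S|lebesgue. f x) = (LINT x|lborel. g x)"
    unfolding set_lebesgue_integral_def using integral_cong_AE[OF m' m AE_completion[OF ae']] g(1) 
    by (simp add: integral_completion)
  show *: "set_integrable lebesgue S f \<longleftrightarrow> integrable lborel g"
    unfolding set_integrable_def using integrable_cong_AE[OF m' m AE_completion[OF ae']] g(1) 
    by (simp add: integrable_completion)
  show "integrable (lebesgue_on S) f \<longleftrightarrow> integrable lborel g" if "S \<in> sets borel"
    using * that by (subst integrable_restrict_space) (auto simp: set_integrable_def)
qed

lemma AE_lebesgue_on_iff:
  assumes "S \<in> sets borel"
  shows "(AE x in lebesgue_on S. P x) \<longleftrightarrow> (AE x in lborel. x \<in> S \<longrightarrow> P x)"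
  using assms by (subst AE_restrict_space_iff) (auto simp: AE_completion_iff)

text \<open>By second countability the complement of the support is covered by countably many basic
  open sets of measure 0. This turns the support condition into a statement about almost every
  A.\<close>

lemma AE_msupport:
  fixes \<mu> :: "'a::second_countable_topology measure"
  assumes "sets \<mu> = sets borel"
  shows "AE A in \<mu>. A \<in> msupport \<mu>"
proof -
  obtain B :: "'a set set" where B: "countable B" "topological_basis B" using ex_countable_basis by blast
  define N where "N = {U\<in>B. emeasure \<mu> U = 0}"
  have open_N: "open U" if "U \<in> N" for U using that B(2) topological_basis_open by (auto simp: N_def)
  have "(\<Union>U\<in>N. U) \<in> null_sets \<mu>"
  proof (rule null_sets_UN')
    show "countable N" using B(1) by (auto simp: N_def)
    show "U \<in> null_sets \<mu>" if "U \<in> N" for U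
      using that open_N[OF that] assms by (auto simp: N_def null_sets_def)
  qed
  then show ?thesis
  proof (rule AE_I')
    show "{A \<in> space \<mu>. A \<notin> msupport \<mu>} \<subseteq> (\<Union>U\<in>N. U)"
    proof clarify
      fix A assume "A \<notin> msupport \<mu>"
      then obtain V where V: "open V" "A \<in> V" "emeasure \<mu> V = 0" by (auto simp: msupport_def not_less)
      then obtain U where U: "U \<in> B" "A \<in> U" "U \<subseteq> V" using B(2) topological_basisE by metis
      have "emeasure \<mu> U \<le> emeasure \<mu> V" using U V assms by (intro emeasure_mono) auto
      then show "A \<in> (\<Union>U\<in>N. U)" using U V by (auto simp: N_def)
    qed
  qed
qed

text \<open>Measurability of bounded scalar integrals makes the kernel a measurable map into
  \<open>subprob_algebra\<close>. From there integrals of unbounded and of vector-valued Borel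
  functions are measurable as well.\<close>

lemma prob_kernel_measurable:
  assumes p: "\<And>x. x \<in> space M \<Longrightarrow> prob_space (\<nu> x) \<and> sets (\<nu> x) = sets borel"
    and m: "\<And>f::'a::euclidean_space \<Rightarrow> real. f \<in> borel_measurable borel \<Longrightarrow> bounded (range f) \<Longrightarrow> (\<lambda>x. LINT A|\<nu> x. f A) \<in> borel_measurable M"
  shows "\<nu> \<in> M \<rightarrow>\<^sub>M subprob_algebra borel"
proof (rule measurable_subprob_algebra)
  fix x assume x: "x \<in> space M"
  show "subprob_space (\<nu> x)" using p[OF x] by (simp add: prob_space_imp_subprob_space)
  show "sets (\<nu> x) = sets borel" using p[OF x] by simp
next
  fix B :: "'a set" assume B: "B \<in> sets borel"
  have "(\<lambda>x. LINT A|\<nu> x. indicator B A :: real) \<in> borel_measurable M"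
    by (rule m[of "indicator B"]) (use B in \<open>auto simp: bounded_iff indicator_def intro!: exI[of _ 1]\<close>)
  then have "(\<lambda>x. ennreal (LINT A|\<nu> x. indicator B A :: real)) \<in> borel_measurable M" by simp
  then show "(\<lambda>x. emeasure (\<nu> x) B) \<in> borel_measurable M"
  proof (rule measurable_cong[THEN iffD1, rotated])
    fix x assume x: "x \<in> space M"
    then interpret prob_space "\<nu> x" using p by auto
    show "ennreal (LINT A|\<nu> x. indicator B A) = emeasure (\<nu> x) B"
      using B p[OF x] by (simp add: emeasure_eq_measure)
  qed
qed

lemma not_set_integrable_integral: "\<not> set_integrable M A f \<Longrightarrow> (LINT x:A|M. f x) = 0"
  by (simp add: set_integrable_def set_lebesgue_integral_def not_integrable_integral_eq)

text \<open>If \<open>h\<close> is not measurable, its integral over \<open>X\<close> is 0 by convention; the hypothesis then forces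
  the measure on the left to vanish.\<close>

lemma integral_transfer_nonintegrable:
  fixes h b :: "'a::euclidean_space \<Rightarrow> 'b::euclidean_space"
  assumes X: "closed X" and K: "(\<lambda>x. x) \<in> K \<rightarrow>\<^sub>M borel" and M: "(\<lambda>x. x) \<in> M \<rightarrow>\<^sub>M borel"
    and b: "set_integrable K X b"
    and eq: "\<And>B. B \<in> sets borel \<Longrightarrow> B \<subseteq> X \<Longrightarrow> (LINT x:B|K. b x) = (LINT x:B|M. h x)"
    and \<phi>: "\<phi> \<in> borel_measurable borel" "\<And>x. \<bar>\<phi> x\<bar> \<le> (C::real)"
  shows "(LINT x:X|K. \<phi> x *\<^sub>R b x) = (LINT x:X|M. \<phi> x *\<^sub>R h x)"
proof -
  have Xb: "X \<in> sets borel" using X by simp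
  have swap: "(LINT x|N. \<phi> x *\<^sub>R indicator Y x *\<^sub>R f x) = (LINT x:Y|N. \<phi> x *\<^sub>R f x)" for N Y and f :: "'a \<Rightarrow> 'b"
    by (simp add: set_lebesgue_integral_def mult.commute)
  have ind: "indicator A x *\<^sub>R indicator Y x *\<^sub>R y = indicator (A \<inter> Y) x *\<^sub>R y" for A Y x and y :: 'b
    by (auto simp: indicator_def)
  have bi: "set_integrable K Y b" if "Y \<in> sets borel" "Y \<subseteq> X" for Y
  proof -
    have m: "(\<lambda>x. indicator Y x :: real) \<in> borel_measurable K" 
      using measurable_compose[OF K borel_measurable_indicator[OF that(1)]] .
    have i: "integrable K (\<lambda>x. indicator X x *\<^sub>R b x)" using b by (simp add: set_integrable_def)
    have "integrable K (\<lambda>x. indicator Y x *\<^sub>R (indicator X x *\<^sub>R b x))"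
    proof (rule Bochner_Integration.integrable_bound[OF i])
      show "(\<lambda>x. indicator Y x *\<^sub>R (indicator X x *\<^sub>R b x)) \<in> borel_measurable K"
        by (rule borel_measurable_scaleR[OF m borel_measurable_integrable[OF i]])
      show "AE x in K. norm (indicator Y x *\<^sub>R (indicator X x *\<^sub>R b x)) \<le> norm (indicator X x *\<^sub>R b x)"
        by (intro AE_I2) (simp add: indicator_def)
    qed
    then show ?thesis unfolding ind using that by (simp add: set_integrable_def inf.absorb1)
  qed
  have main: "(LINT x:Y|K. \<phi> x *\<^sub>R b x) = (LINT x:Y|M. \<phi> x *\<^sub>R h x)"
    if Y: "Y \<in> sets borel" "Y \<subseteq> X" and h: "set_integrable M Y h" for Y
  proof -
    have "(LINT x|K. \<phi> x *\<^sub>R indicator Y x *\<^sub>R b x) = (LINT x|M. \<phi> x *\<^sub>R indicator Y x *\<^sub>R h x) + (LINT x|M. \<phi> x *\<^sub>R 0)"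
    proof (rule integral_scaleR_eqI[OF K M M _ _ _ _ \<phi>])
      show "integrable K (\<lambda>x. indicator Y x *\<^sub>R b x)" using bi[OF Y] by (simp add: set_integrable_def)
      show "integrable M (\<lambda>x. indicator Y x *\<^sub>R h x)" using h by (simp add: set_integrable_def)
      fix A :: "'a set" assume "A \<in> sets borel"
      then show "(LINT x|K. indicator A x *\<^sub>R indicator Y x *\<^sub>R b x) = (LINT x|M. indicator A x *\<^sub>R indicator Y x *\<^sub>R h x) + (LINT x|M. indicator A x *\<^sub>R 0)"
        unfolding ind using eq[of "A \<inter> Y"] Y by (auto simp: set_lebesgue_integral_def)
    qed simp
    then show ?thesis unfolding swap by simp
  qed
  show ?thesis
  proof (cases "set_integrable M X h")
    case True
    then show ?thesis using main[OF Xb] by simp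
  next
    case False
    have h_Un: "set_integrable M (Y \<union> Z) h" if "set_integrable M Y h" "set_integrable M Z h" "Y \<inter> Z = {}" for Y Z
    proof -
      have "indicator (Y \<union> Z) x *\<^sub>R h x = indicator Y x *\<^sub>R h x + indicator Z x *\<^sub>R h x" for x
        using that(3) by (auto simp: indicator_def)
      then show ?thesis using that(1,2) by (simp add: set_integrable_def)
    qed
    have b_Un: "(LINT x:Y \<union> Z|K. b x) = (LINT x:Y|K. b x) + (LINT x:Z|K. b x)" 
      if "Y \<in> sets borel" "Z \<in> sets borel" "Y \<subseteq> X" "Z \<subseteq> X" "Y \<inter> Z = {}" for Y Z
    proof -
      have "indicator (Y \<union> Z) x *\<^sub>R b x = indicator Y x *\<^sub>R b x + indicator Z x *\<^sub>R b x" for x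
        using that(5) by (auto simp: indicator_def)
      then show ?thesis using bi[of Y] bi[of Z] that by (simp add: set_integrable_def set_lebesgue_integral_def)
    qed
    \<comment> \<open>If h is not integrable on Y, the hypothesis gives 0 by the default value. If
      it is, then it is not integrable on X - Y, so X and X - Y both get 0, and so does Y by
      additivity.\<close>
    have b0: "(LINT x:Y|K. b x) = 0" if Y: "Y \<in> sets borel" "Y \<subseteq> X" for Y
    proof (cases "set_integrable M Y h")
      case True
      have XY: "Y \<union> (X - Y) = X" "Y \<inter> (X - Y) = {}" using Y by auto
      then have "\<not> set_integrable M (X - Y) h" using h_Un[OF True, of "X - Y"] False by auto
      then have "(LINT x:X - Y|K. b x) = 0" using eq[of "X - Y"] Y Xb by (simp add: not_set_integrable_integral)
      moreover have "(LINT x:X|K. b x) = 0" using eq[of X] Xb False by (simp add: not_set_integrable_integral)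
      ultimately show ?thesis using b_Un[of Y "X - Y"] XY Y Xb by simp
    next
      case False
      then show ?thesis using eq[OF Y] by (simp add: not_set_integrable_integral)
    qed
    have "(LINT x|K. \<phi> x *\<^sub>R indicator X x *\<^sub>R b x) = (LINT x|K. \<phi> x *\<^sub>R 0) + (LINT x|K. \<phi> x *\<^sub>R 0)"
    proof (rule integral_scaleR_eqI[OF K K K _ _ _ _ \<phi>])
      show "integrable K (\<lambda>x. indicator X x *\<^sub>R b x)" using b by (simp add: set_integrable_def)
      fix A :: "'a set" assume "A \<in> sets borel"
      then show "(LINT x|K. indicator A x *\<^sub>R indicator X x *\<^sub>R b x) = (LINT x|K. indicator A x *\<^sub>R 0) + (LINT x|K. indicator A x *\<^sub>R 0)"
        unfolding ind using b0[of "A \<inter> X"] Xb by (auto simp: set_lebesgue_integral_def)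
    qed auto
    then have lhs: "(LINT x:X|K. \<phi> x *\<^sub>R b x) = 0" unfolding swap by simp
    \<comment> \<open>The product of \<phi> and h can be integrable although h is not; its integral
      then has to be shown to vanish.\<close>
    have "(LINT x:X|M. \<phi> x *\<^sub>R h x) = 0"
    proof (cases "set_integrable M X (\<lambda>x. \<phi> x *\<^sub>R h x)")
      case True
      have \<phi>M [measurable]: "\<phi> \<in> borel_measurable M" using measurable_compose[OF M \<phi>(1)] .
      have XM [measurable]: "(\<lambda>x. indicator X x :: real) \<in> borel_measurable M" 
        using measurable_compose[OF M borel_measurable_indicator[OF Xb]] .
      \<comment> \<open>Where |\<phi>| exceeds 1/(k+1), division by \<phi> is bounded and h itself
        is integrable. These sets exhaust the part of X on which \<phi> is nonzero.\<close>
      define Y where "Y = (\<lambda>k::nat. {x\<in>X. \<bar>\<phi> x\<bar> > 1 / (real k + 1)})"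
      have Yb: "Y k \<in> sets borel" "Y k \<subseteq> X" for k
      proof -
        have "Y k = X \<inter> {x\<in>space borel. \<bar>\<phi> x\<bar> > 1 / (real k + 1)}" by (auto simp: Y_def)
        also have "\<dots> \<in> sets borel" using Xb \<phi>(1) by measurable
        finally show "Y k \<in> sets borel" .
      qed (auto simp: Y_def)
      have YM [measurable]: "(\<lambda>x. indicator (Y k) x :: real) \<in> borel_measurable M" for k
        using measurable_compose[OF M borel_measurable_indicator[OF Yb(1)]] .
      have hk: "set_integrable M (Y k) h" for k
        unfolding set_integrable_def
      proof (rule Bochner_Integration.integrable_bound)
        show "integrable M (\<lambda>x. (real k + 1) *\<^sub>R (indicator X x *\<^sub>R \<phi> x *\<^sub>R h x))"
          using True unfolding set_integrable_def by (rule integrable_scaleR_right)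
        have eqh: "indicator (Y k) x *\<^sub>R h x = (indicator (Y k) x / \<phi> x) *\<^sub>R (indicator X x *\<^sub>R \<phi> x *\<^sub>R h x)" for x
          by (auto simp: indicator_def Y_def divide_simps)
        have "(\<lambda>x. indicator X x *\<^sub>R \<phi> x *\<^sub>R h x) \<in> borel_measurable M" using True unfolding set_integrable_def by (rule borel_measurable_integrable)
        then show "(\<lambda>x. indicator (Y k) x *\<^sub>R h x) \<in> borel_measurable M" unfolding eqh by measurable
        have "norm (indicator (Y k) x *\<^sub>R h x) \<le> norm ((real k + 1) *\<^sub>R (indicator X x *\<^sub>R \<phi> x *\<^sub>R h x))" for x
        proof (cases "x \<in> Y k")
          case True
          then have "1 \<le> (real k + 1) * \<bar>\<phi> x\<bar>" "x \<in> X" by (auto simp: Y_def field_simps)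
          then show ?thesis using True mult_right_mono[of 1 "(real k + 1) * \<bar>\<phi> x\<bar>" "norm (h x)"] by (simp add: mult.assoc abs_mult)
        qed simp
        then show "AE x in M. norm (indicator (Y k) x *\<^sub>R h x) \<le> norm ((real k + 1) *\<^sub>R (indicator X x *\<^sub>R \<phi> x *\<^sub>R h x))" by simp
      qed
      have zk: "(LINT x:Y k|M. \<phi> x *\<^sub>R h x) = 0" for k
      proof -
        have "(LINT x|M. \<phi> x *\<^sub>R indicator (Y k) x *\<^sub>R h x) = (LINT x|M. \<phi> x *\<^sub>R 0) + (LINT x|M. \<phi> x *\<^sub>R 0)"
        proof (rule integral_scaleR_eqI[OF M M M _ _ _ _ \<phi>])
          show "integrable M (\<lambda>x. indicator (Y k) x *\<^sub>R h x)" using hk by (simp add: set_integrable_def)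
          fix A :: "'a set" assume "A \<in> sets borel"
          then have "(LINT x:A \<inter> Y k|M. h x) = 0" using eq[of "A \<inter> Y k"] b0[of "A \<inter> Y k"] Yb[of k] by auto
          then show "(LINT x|M. indicator A x *\<^sub>R indicator (Y k) x *\<^sub>R h x) = (LINT x|M. indicator A x *\<^sub>R 0) + (LINT x|M. indicator A x *\<^sub>R 0)"
            unfolding ind by (simp add: set_lebesgue_integral_def)
        qed auto
        then show ?thesis unfolding swap by simp
      qed
      have "(\<lambda>k. LINT x:Y k|M. \<phi> x *\<^sub>R h x) \<longlonglongrightarrow> (LINT x:X|M. \<phi> x *\<^sub>R h x)"
        unfolding set_lebesgue_integral_def
      proof (rule integral_dominated_convergence[where w="\<lambda>x. norm (indicator X x *\<^sub>R \<phi> x *\<^sub>R h x)"])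
        show 1: "(\<lambda>x. indicator X x *\<^sub>R \<phi> x *\<^sub>R h x) \<in> borel_measurable M"
          using True unfolding set_integrable_def by (rule borel_measurable_integrable)
        show "(\<lambda>x. indicator (Y k) x *\<^sub>R \<phi> x *\<^sub>R h x) \<in> borel_measurable M" for k
        proof -
          have *: "indicator (Y k) x *\<^sub>R \<phi> x *\<^sub>R h x = indicator (Y k) x *\<^sub>R (indicator X x *\<^sub>R \<phi> x *\<^sub>R h x)" for x
            by (auto simp: indicator_def Y_def)
          show ?thesis unfolding * by (rule borel_measurable_scaleR[OF YM 1])
        qed
        show "integrable M (\<lambda>x. norm (indicator X x *\<^sub>R \<phi> x *\<^sub>R h x))" using True unfolding set_integrable_def by (rule integrable_norm)
        show "AE x in M. (\<lambda>k. indicator (Y k) x *\<^sub>R \<phi> x *\<^sub>R h x) \<longlonglongrightarrow> indicator X x *\<^sub>R \<phi> x *\<^sub>R h x"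
        proof (rule AE_I2)
          fix x
          show "(\<lambda>k. indicator (Y k) x *\<^sub>R \<phi> x *\<^sub>R h x) \<longlonglongrightarrow> indicator X x *\<^sub>R \<phi> x *\<^sub>R h x"
          proof (cases "x \<in> X \<and> \<phi> x \<noteq> 0")
            case True
            then obtain N where N: "1 / (real N + 1) < \<bar>\<phi> x\<bar>" by (metis nat_approx_posE of_nat_Suc add.commute zero_less_abs_iff)
            have "x \<in> Y k" if "k \<ge> N" for k
            proof -
              have "1 / (real k + 1) \<le> 1 / (real N + 1)" using that by (simp add: field_simps)
              then show ?thesis using N True by (auto simp: Y_def)
            qed
            then have "\<forall>k\<ge>N. indicator (Y k) x *\<^sub>R \<phi> x *\<^sub>R h x = indicator X x *\<^sub>R \<phi> x *\<^sub>R h x"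
              using True by simp
            then show ?thesis by (intro tendsto_eventually) (auto simp: eventually_sequentially)
          next
            case False
            then have "indicator (Y k) x *\<^sub>R \<phi> x *\<^sub>R h x = 0" "indicator X x *\<^sub>R \<phi> x *\<^sub>R h x = 0" for k
              by (auto simp: Y_def indicator_def)
            then show ?thesis by (simp only: tendsto_const)
          qed
        qed
        show "AE x in M. norm (indicator (Y k) x *\<^sub>R \<phi> x *\<^sub>R h x) \<le> norm (indicator X x *\<^sub>R \<phi> x *\<^sub>R h x)" for k
          by (auto simp: indicator_def Y_def)
      qed
      then show ?thesis unfolding zk by (simp add: LIMSEQ_const_iff)
    qed (rule not_set_integrable_integral)
    then show ?thesis using lhs by simp
  qed
qed

section \<open>Recession functions and convexification\<close>

text \<open>For an integrand that does not depend on x, the recession function is the positively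
  1-homogeneous extension of the boundary values of Tf on the unit sphere. Reading it off at one
  point x1 yields a single Borel function that serves all x in the closure.\<close>

lemma recession_representation:
  fixes F :: "'a::euclidean_space \<Rightarrow> real"
  assumes F: "(\<lambda>x. F) \<in> integrands \<Omega>" and ne: "\<Omega> \<noteq> {}"
  obtains \<psi> C where "\<psi> \<in> borel_measurable borel" "\<And>\<eta>. \<eta> \<in> sphere 0 1 \<Longrightarrow> \<bar>\<psi> \<eta>\<bar> \<le> C"
    "\<And>x \<eta>. x \<in> closure \<Omega> \<Longrightarrow> \<eta> \<noteq> 0 \<Longrightarrow> recession \<Omega> (\<lambda>x. F) x \<eta> = \<psi> \<eta>"
proof -
  obtain g where g: "continuous_on (closure (\<Omega> \<times> ball 0 1)) g" 
    "\<And>x A. x \<in> closure \<Omega> \<Longrightarrow> A \<in> ball 0 1 \<Longrightarrow> g (x, A) = (1 - norm A) * F (A /\<^sub>R (1 - norm A))"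
    using F by (auto simp: integrands_def)
  obtain x1 where x1: "x1 \<in> \<Omega>" using ne by blast
  then have x1': "x1 \<in> closure \<Omega>" using closure_subset by blast
  define h where "h = (\<lambda>A. g (x1, A))"
  have hc: "continuous_on (cball 0 1) h"
    unfolding h_def
    by (rule continuous_on_compose2[OF g(1)]) (use x1' in \<open>auto simp: closure_Times intro!: continuous_intros\<close>)
  have hg: "h A = (1 - norm A) * F (A /\<^sub>R (1 - norm A))" if "norm A < 1" for A
    using g(2)[OF x1', of A] that by (simp add: h_def)
  \<comment> \<open>The origin is set apart because \<eta>/|\<eta>| is not continuous there; the
    recession function is identified with \<psi> away from 0 only.\<close>
  define \<psi> where "\<psi> = (\<lambda>\<eta>::'a. if \<eta> \<in> {0} then 0 else norm \<eta> * h (\<eta> /\<^sub>R norm \<eta>))"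
  have "bounded (h ` cball 0 1)" by (rule compact_imp_bounded[OF compact_continuous_image[OF hc compact_cball]])
  then obtain C where "\<forall>y\<in>h ` cball 0 1. norm y \<le> C" unfolding bounded_iff by blast
  then have C: "\<And>A. A \<in> cball 0 1 \<Longrightarrow> \<bar>h A\<bar> \<le> C" by auto
  show thesis
  proof (rule that[of \<psi> C])
    show "\<psi> \<in> borel_measurable borel"
      unfolding \<psi>_def
    proof (rule borel_measurable_continuous_on_if)
      show "continuous_on (- {0}) (\<lambda>\<eta>. norm \<eta> * h (\<eta> /\<^sub>R norm \<eta>))"
        by (intro continuous_on_mult continuous_on_norm continuous_on_id continuous_on_compose2[OF hc])
          (auto intro!: continuous_intros, metis left_inverse norm_eq_zero order_refl)
    qed auto
    show "\<bar>\<psi> \<eta>\<bar> \<le> C" if "\<eta> \<in> sphere 0 1" for \<eta>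
      using that C[of "\<eta> /\<^sub>R norm \<eta>"] by (auto simp: \<psi>_def)
    fix x \<eta> assume x: "x \<in> closure \<Omega>" and \<eta>: "\<eta> \<noteq> (0::'a)"
    let ?G = "nhds \<eta> \<times>\<^sub>F (at_top :: real filter)"
    let ?X = "inf (nhds x) (principal (closure \<Omega>))"
    \<comment> \<open>With p = (A', t) these satisfy 1 - |\<beta>| = 1/(t \<alpha>) and \<beta>/(1 -
      |\<beta>|) = t A', hence F(t A')/t = \<alpha> h(\<beta>). As A' -> \<eta> and t ->
      \<infinity>, \<alpha> tends to |\<eta>| and \<beta> to the sphere, where h is still
      continuous.\<close>
    define \<alpha> where "\<alpha> = (\<lambda>p::'a \<times> real. inverse (snd p) + norm (fst p))"
    define \<beta> where "\<beta> = (\<lambda>p. fst p /\<^sub>R \<alpha> p)"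
    have f1: "(fst \<longlongrightarrow> \<eta>) ?G" by (rule filterlim_fst)
    have f2: "filterlim snd at_top ?G" by (rule filterlim_snd)
    have \<alpha>: "(\<alpha> \<longlongrightarrow> 0 + norm \<eta>) ?G"
      unfolding \<alpha>_def by (intro tendsto_add tendsto_norm f1 tendsto_inverse_0_at_top f2)
    have \<beta>: "(\<beta> \<longlongrightarrow> \<eta> /\<^sub>R norm \<eta>) ?G"
      unfolding \<beta>_def using \<alpha> \<eta> by (intro tendsto_scaleR tendsto_inverse f1) auto
    have pos: "\<forall>\<^sub>F p in ?G. snd p > 0" 
      using f2 eventually_gt_at_top[of "0::real"] by (simp add: filterlim_iff)
    have lt: "norm (\<beta> p) < 1" if "snd p > 0" for p
      using that norm_ge_zero[of "fst p"] by (simp add: \<beta>_def \<alpha>_def divide_simps add_pos_nonneg)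
    have "((\<lambda>p. h (\<beta> p)) \<longlongrightarrow> h (\<eta> /\<^sub>R norm \<eta>)) ?G"
    proof (rule continuous_on_tendsto_compose[OF hc \<beta>])
      show "\<forall>\<^sub>F p in ?G. \<beta> p \<in> cball 0 1" using pos by eventually_elim (simp add: less_imp_le[OF lt])
    qed (use \<eta> in auto)
    then have "((\<lambda>p. \<alpha> p * h (\<beta> p)) \<longlongrightarrow> \<psi> \<eta>) ?G"
      using tendsto_mult[OF \<alpha>] \<eta> by (simp add: \<psi>_def)
    moreover have "\<forall>\<^sub>F p in ?G. \<alpha> p * h (\<beta> p) = F (snd p *\<^sub>R fst p) / snd p"
      using pos
    proof eventually_elim
      case (elim p)
      have \<alpha>p: "\<alpha> p > 0" using elim by (simp add: \<alpha>_def add_pos_nonneg)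
      have 1: "1 - norm (\<beta> p) = inverse (snd p) / \<alpha> p"
        using \<alpha>p by (simp add: \<beta>_def divide_simps) (simp add: \<alpha>_def)
      have "\<beta> p /\<^sub>R (1 - norm (\<beta> p)) = snd p *\<^sub>R fst p"
        unfolding 1 using \<alpha>p elim by (simp add: \<beta>_def divide_inverse)
      then show ?case using hg[OF lt[OF elim]] 1 \<alpha>p elim by (simp add: divide_simps) (simp add: mult_ac)
    qed
    ultimately have G: "((\<lambda>p. F (snd p *\<^sub>R fst p) / snd p) \<longlongrightarrow> \<psi> \<eta>) ?G"
      by (rule Lim_transform_eventually)
    have lim: "((\<lambda>(x', A', t). F (t *\<^sub>R A') / t) \<longlongrightarrow> \<psi> \<eta>) (?X \<times>\<^sub>F ?G)"
      using filterlim_compose[OF G filterlim_snd[of ?G ?X]] by (simp add: case_prod_beta')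
    have "?X \<noteq> bot"
      using x by (simp add: trivial_limit_def eventually_inf_principal eventually_nhds)
         (metis)
    then have "?X \<times>\<^sub>F ?G \<noteq> bot" by (simp add: prod_filter_eq_bot)
    then show "recession \<Omega> (\<lambda>x. F) x \<eta> = \<psi> \<eta>"
      unfolding recession_def by (rule tendsto_Lim[OF _ lim])
  qed
qed

text \<open>The constant c is a convex minorant, so the real supremum runs over a nonempty set, and
  \<Phi> A bounds it from above. A supremum of convex functions is convex.\<close>

lemma
  fixes \<Phi> :: "'a::euclidean_space \<Rightarrow> real"
  assumes "\<And>A. c \<le> \<Phi> A"
  shows convexification_le: "convexification \<Phi> A \<le> \<Phi> A"
    and convex_on_convexification: "convex_on UNIV (convexification \<Phi>)"
proof -
  let ?S = "{f. convex_on UNIV f \<and> (\<forall>B. f B \<le> \<Phi> B)}"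
  have ne: "?S \<noteq> {}" using assms by (auto intro!: exI[of _ "\<lambda>x. c"] simp: convex_on_const)
  have bdd: "bdd_above ((\<lambda>f. f A) ` ?S)" for A by (auto simp: bdd_above_def)
  show "convexification \<Phi> A \<le> \<Phi> A"
    unfolding convexification_def by (rule cSUP_least[OF ne]) auto
  show "convex_on UNIV (convexification \<Phi>)"
  proof (rule convex_onI)
    fix t :: real and x y :: 'a assume t: "0 < t" "t < 1"
    show "convexification \<Phi> ((1 - t) *\<^sub>R x + t *\<^sub>R y) \<le> (1 - t) * convexification \<Phi> x + t * convexification \<Phi> y"
      unfolding convexification_def[of \<Phi> "(1 - t) *\<^sub>R x + t *\<^sub>R y"]
    proof (rule cSUP_least[OF ne])
      fix f assume f: "f \<in> ?S"
      have "f ((1 - t) *\<^sub>R x + t *\<^sub>R y) \<le> (1 - t) * f x + t * f y"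
        using f t convex_onD[of UNIV f t x y] by auto
      also have "\<dots> \<le> (1 - t) * convexification \<Phi> x + t * convexification \<Phi> y"
        unfolding convexification_def using t f
        by (intro add_mono mult_left_mono cSUP_upper bdd) auto
      finally show "f ((1 - t) *\<^sub>R x + t *\<^sub>R y) \<le> \<dots>" .
    qed
  qed simp
qed

text \<open>No differentiability of the convexification enters. Along the ray from A away from B,
  convexity through the contact point A bounds the one-sided difference quotient of \<Phi> itself
  from below, and this quotient converges to - q . (B - A).\<close>

lemma gradient_subgradient_convexification:
  fixes \<Phi> :: "'a::euclidean_space \<Rightarrow> real"
  assumes lb: "\<And>A. c \<le> \<Phi> A" and q: "GDERIV \<Phi> A :> q" and A: "\<Phi> A = convexification \<Phi> A"
  shows "q \<bullet> (B - A) \<le> convexification \<Phi> B - \<Phi> A"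
proof -
  let ?C = "convexification \<Phi>" and ?d = "B - A"
  have "((\<lambda>s. A - s *\<^sub>R ?d) has_derivative (\<lambda>s. - (s *\<^sub>R ?d))) (at (0::real))"
    by (auto intro!: derivative_eq_intros)
  moreover have "(\<Phi> has_derivative (\<lambda>h. h \<bullet> q)) (at (A - 0 *\<^sub>R ?d))"
    using q by (simp add: gderiv_def)
  ultimately have "((\<lambda>s. \<Phi> (A - s *\<^sub>R ?d)) has_derivative (\<lambda>s. (- (s *\<^sub>R ?d)) \<bullet> q)) (at 0)"
    by (rule has_derivative_compose)
  then have "((\<lambda>s. \<Phi> (A - s *\<^sub>R ?d)) has_real_derivative - (q \<bullet> ?d)) (at 0)"
  proof -
    have "(\<lambda>s. (- (s *\<^sub>R ?d)) \<bullet> q) = (*) (- (q \<bullet> ?d))" by (auto simp: fun_eq_iff inner_commute)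
    with \<open>((\<lambda>s. \<Phi> (A - s *\<^sub>R ?d)) has_derivative (\<lambda>s. (- (s *\<^sub>R ?d)) \<bullet> q)) (at 0)\<close> show ?thesis
      unfolding has_field_derivative_def by (simp only:)
  qed
  then have "((\<lambda>s. (\<Phi> (A - s *\<^sub>R ?d) - \<Phi> A) / s) \<longlongrightarrow> - (q \<bullet> ?d)) (at 0)"
    by (simp add: DERIV_def)
  then have "((\<lambda>s. (\<Phi> (A - s *\<^sub>R ?d) - \<Phi> A) / s) \<longlongrightarrow> - (q \<bullet> ?d)) (at_right 0)"
    by (rule filterlim_mono) (simp_all add: at_le)
  moreover have "\<forall>\<^sub>F s in at_right (0::real). \<Phi> A - ?C B \<le> (\<Phi> (A - s *\<^sub>R ?d) - \<Phi> A) / s"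
    using eventually_at_right_less[of "0::real"]
  proof eventually_elim
    case (elim s)
    \<comment> \<open>The weight is chosen so that A is the convex combination of A - s (B - A) and
      B; at A the convexification may be replaced by \<Phi> with equality.\<close>
    define t where "t = s / (1 + s)"
    have t: "0 < t" "t < 1" "1 - t = 1 / (1 + s)" using elim by (auto simp: t_def field_simps)
    have comb: "(1 - t) *\<^sub>R (A - s *\<^sub>R ?d) + t *\<^sub>R B = A"
    proof -
      have "(1 + s) *\<^sub>R ((1 - t) *\<^sub>R (A - s *\<^sub>R ?d) + t *\<^sub>R B) = (A - s *\<^sub>R ?d) + s *\<^sub>R B"
        using elim by (simp add: t(3) scaleR_add_right) (simp add: t_def)
      also have "\<dots> = (1 + s) *\<^sub>R A" by (simp add: algebra_simps)
      finally show ?thesis using elim by simp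
    qed
    have "?C A \<le> (1 - t) * ?C (A - s *\<^sub>R ?d) + t * ?C B"
      using convex_onD[OF convex_on_convexification[OF lb], of t "A - s *\<^sub>R ?d" B] t comb by simp
    also have "\<dots> \<le> (1 - t) * \<Phi> (A - s *\<^sub>R ?d) + t * ?C B"
      using t elim convexification_le[of c \<Phi>, OF lb] by (intro add_mono mult_left_mono) auto
    finally have "(1 + s) * \<Phi> A \<le> (1 + s) * ((1 - t) * \<Phi> (A - s *\<^sub>R ?d) + t * ?C B)"
      using A elim by simp
    also have "\<dots> = \<Phi> (A - s *\<^sub>R ?d) + s * ?C B"
      using elim by (simp add: t(3) distrib_left) (simp add: t_def)
    finally show ?case using elim by (simp add: field_simps)
  qed
  ultimately have "\<Phi> A - ?C B \<le> - (q \<bullet> ?d)"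
    by (rule tendsto_lowerbound) simp
  then show ?thesis by simp
qed

lemma gradient_monotone_convexification:
  fixes \<Phi> :: "'a::euclidean_space \<Rightarrow> real"
  assumes "\<And>A. c \<le> \<Phi> A" "\<And>A. GDERIV \<Phi> A :> q A" "\<Phi> A = convexification \<Phi> A" "\<Phi> B = convexification \<Phi> B"
  shows "0 \<le> (q A - q B) \<bullet> (A - B)"
proof -
  have "q A \<bullet> (B - A) \<le> convexification \<Phi> B - \<Phi> A" "q B \<bullet> (A - B) \<le> convexification \<Phi> A - \<Phi> B"
    using gradient_subgradient_convexification[OF assms(1,2)] assms(3,4) by auto
  then show ?thesis using assms(3,4) by (simp add: inner_diff_left inner_diff_right)
qed

text \<open>Cutoffs equal to 1 on \<Omega> have no gradient there, so all of them give the same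
  value for the pairing. Letting them shrink to the closure turns this value into the measure of the
  closure.\<close>

lemma pairing_measure_closure:
  fixes \<Omega> :: "'a::euclidean_space set"
  assumes m: "is_pairing_measure \<Omega> \<Omega>' z d u m" 
    and \<Omega>: "open \<Omega>" "bounded \<Omega>" "open \<Omega>'" "closure \<Omega> \<subseteq> \<Omega>'" and ne: "\<Omega> \<noteq> {}"
  shows "m (closure \<Omega>) = - (LINT x:\<Omega>|lebesgue. u x * d x)"
proof -
  have vm: "vmeasure \<Omega>' m" and pair: "\<And>\<phi>. \<phi> \<in> test_functions \<Omega>' \<Longrightarrow> vintegral \<Omega>' m \<phi> =
        - (LINT x:\<Omega>|lebesgue. u x * \<phi> x * d x) - (LINT x:\<Omega>|lebesgue. u x * (z x \<bullet> grad \<phi> x))"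
    using m by (auto simp: is_pairing_measure_def)
  obtain \<mu> \<sigma> where rep: "vmeasure_rep \<Omega>' m \<mu> \<sigma>" using vm by (auto simp: vmeasure_def)
  then have \<mu>: "sets \<mu> = sets borel" "integrable \<mu> \<sigma>" "\<And>A. A \<in> sets borel \<Longrightarrow> A \<subseteq> \<Omega>' \<Longrightarrow> m A = (LINT x:A|\<mu>. \<sigma> x)"
    by (auto simp: vmeasure_rep_def)
  have id: "(\<lambda>x. x) \<in> \<mu> \<rightarrow>\<^sub>M borel" using \<mu>(1) by (simp add: measurable_def sets_eq_imp_space_eq[OF \<mu>(1)])
  have compact_cl: "compact (closure \<Omega>)" using \<Omega> by simp
  \<comment> \<open>Points outside the closure have positive distance from it and leave U n
    eventually; the intersection keeps the cutoffs admissible on the larger domain.\<close>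
  define U where "U = (\<lambda>n::nat. \<Omega>' \<inter> {x. infdist x (closure \<Omega>) < 1 / (real n + 1)})"
  have "\<exists>\<phi>. \<phi> \<in> test_functions (U n) \<and> (\<forall>x. 0 \<le> \<phi> x \<and> \<phi> x \<le> 1) \<and> (\<forall>x\<in>closure \<Omega>. \<phi> x = 1)" for n
  proof (rule cutoff_exists[OF compact_cl, of "U n"])
    show "open (U n)" unfolding U_def
      by (intro open_Int \<Omega> open_Collect_less continuous_on_infdist continuous_on_id continuous_on_const)
    show "closure \<Omega> \<subseteq> U n" using \<Omega>(4) by (auto simp: U_def)
  qed blast
  then obtain \<phi> where \<phi>: "\<And>n. \<phi> n \<in> test_functions (U n)" "\<And>n x. 0 \<le> \<phi> n x" "\<And>n x. \<phi> n x \<le> 1" "\<And>n x. x \<in> closure \<Omega> \<Longrightarrow> \<phi> n x = 1"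
    by metis
  have test: "\<phi> n \<in> test_functions \<Omega>'" for n
    using \<phi>(1)[of n] by (auto simp: test_functions_def U_def)
  have v1: "vintegral \<Omega>' m (\<phi> n) = - (LINT x:\<Omega>|lebesgue. u x * d x)" for n
  proof -
    have one: "\<phi> n x = 1" if "x \<in> \<Omega>" for x using \<phi>(4) that closure_subset by blast
    then have g: "grad (\<phi> n) x = 0" if "x \<in> \<Omega>" for x using grad_zero[OF \<Omega>(1) that] by blast
    have *: "indicator \<Omega> x *\<^sub>R (u x * \<phi> n x * d x) = indicator \<Omega> x *\<^sub>R (u x * d x)" 
      "indicator \<Omega> x *\<^sub>R (u x * (z x \<bullet> grad (\<phi> n) x)) = 0" for x
      using one g by (auto simp: indicator_def)
    show ?thesis unfolding pair[OF test] set_lebesgue_integral_def * by simp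
  qed
  have v2: "vintegral \<Omega>' m (\<phi> n) = (LINT x:\<Omega>'|\<mu>. \<phi> n x *\<^sub>R \<sigma> x)" for n
  proof -
    have "vintegral \<Omega>' m (\<phi> n) = (LINT x:\<Omega>'|\<mu>. \<phi> n x *\<^sub>R \<sigma> x) + (LINT x:\<Omega>'|\<mu>. \<phi> n x *\<^sub>R 0)"
    proof (rule vintegral_eqI[OF vm _ id id])
      show "set_integrable \<mu> \<Omega>' \<sigma>" unfolding set_integrable_def
        using \<mu> \<Omega>(3) by (intro integrable_mult_indicator) auto
      show "\<bar>\<phi> n x\<bar> \<le> 1" for x using \<phi>(2,3) by simp
      show "m B = (LINT x:B|\<mu>. \<sigma> x) + (LINT x:B|\<mu>. 0)" if "B \<in> sets borel" "B \<subseteq> \<Omega>'" for B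
        using \<mu>(3)[OF that] by (simp add: set_lebesgue_integral_def)
    qed (use \<Omega>(3) smooth_borel[OF test_functionsD(1)[OF test]] in \<open>auto simp: set_integrable_def\<close>)
    then show ?thesis by (simp add: set_lebesgue_integral_def)
  qed
  have \<sigma>m: "\<sigma> \<in> borel_measurable \<mu>" using \<mu>(2) by (rule borel_measurable_integrable)
  have "(\<lambda>n. LINT x:\<Omega>'|\<mu>. \<phi> n x *\<^sub>R \<sigma> x) \<longlonglongrightarrow> (LINT x:closure \<Omega>|\<mu>. \<sigma> x)"
    unfolding set_lebesgue_integral_def
  proof (rule integral_dominated_convergence[where w="\<lambda>x. norm (\<sigma> x)"])
    have [measurable]: "closure \<Omega> \<in> sets \<mu>" "\<Omega>' \<in> sets \<mu>" using \<mu>(1) \<Omega>(3) by auto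
    have [measurable]: "\<phi> n \<in> borel_measurable \<mu>" for n
      using measurable_compose[OF id smooth_borel[OF test_functionsD(1)[OF test]]] .
    show "(\<lambda>x. indicator (closure \<Omega>) x *\<^sub>R \<sigma> x) \<in> borel_measurable \<mu>" using \<sigma>m by measurable
    show "(\<lambda>x. indicator \<Omega>' x *\<^sub>R \<phi> n x *\<^sub>R \<sigma> x) \<in> borel_measurable \<mu>" for n using \<sigma>m by measurable
    show "integrable \<mu> (\<lambda>x. norm (\<sigma> x))" using \<mu>(2) by simp
    show "AE x in \<mu>. norm (indicator \<Omega>' x *\<^sub>R \<phi> n x *\<^sub>R \<sigma> x) \<le> norm (\<sigma> x)" for n
      using \<phi>(2,3) by (intro AE_I2) (auto simp: indicator_def abs_mult intro!: mult_left_le_one_le)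
    show "AE x in \<mu>. (\<lambda>n. indicator \<Omega>' x *\<^sub>R \<phi> n x *\<^sub>R \<sigma> x) \<longlonglongrightarrow> indicator (closure \<Omega>) x *\<^sub>R \<sigma> x"
    proof (rule AE_I2)
      fix x
      show "(\<lambda>n. indicator \<Omega>' x *\<^sub>R \<phi> n x *\<^sub>R \<sigma> x) \<longlonglongrightarrow> indicator (closure \<Omega>) x *\<^sub>R \<sigma> x"
      proof (cases "x \<in> closure \<Omega>")
        case True
        then have "indicator \<Omega>' x *\<^sub>R \<phi> n x *\<^sub>R \<sigma> x = indicator (closure \<Omega>) x *\<^sub>R \<sigma> x" for n
          using \<phi>(4) \<Omega>(4) True by auto
        then show ?thesis by (simp only: tendsto_const)
      next
        case False
        then have "infdist x (closure \<Omega>) > 0" using False ne in_closed_iff_infdist_zero[of "closure \<Omega>" x] infdist_nonneg[of x "closure \<Omega>"] by auto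
        then obtain N where N: "1 / (real N + 1) < infdist x (closure \<Omega>)" by (metis nat_approx_posE of_nat_Suc add.commute)
        have "\<phi> n x = 0" if "n \<ge> N" for n
        proof -
          have "1 / (real n + 1) \<le> 1 / (real N + 1)" using that by (simp add: field_simps)
          then have "x \<notin> U n" using N by (auto simp: U_def)
          then show ?thesis using test_functionsD(3)[OF \<phi>(1)] by blast
        qed
        then show ?thesis using False by (intro tendsto_eventually) (auto simp: eventually_sequentially)
      qed
    qed
  qed
  then have "(LINT x:closure \<Omega>|\<mu>. \<sigma> x) = - (LINT x:\<Omega>|lebesgue. u x * d x)"
    unfolding v2[symmetric] v1 by (simp add: LIMSEQ_const_iff)
  then show ?thesis using \<mu>(3)[of "closure \<Omega>"] \<Omega>(4) by simp
qed

section \<open>Young measures at a fixed time\<close>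

text \<open>The data of one solution at one time, as Borel functions and one finite measure. Of the
  concentration angle measure only its barycentre b, the average \<Psi> of \<psi> and the
  implication \<open>b_le\<close> are kept: a linear function below \<psi> on the sphere stays below
  it after averaging. \<open>energy\<close> is the JF inequality on the whole closure, and G is the
  set where \<Phi> meets its convexification.\<close>

locale young_slice =
  fixes \<Omega> :: "'a::euclidean_space set" and q :: "'a \<Rightarrow> 'a" and \<psi> :: "'a \<Rightarrow> real" and G :: "'a set"
    and \<nu> :: "'a \<Rightarrow> 'a measure" and u v :: "'a \<Rightarrow> real" and z a :: "'a \<Rightarrow> 'a" and Q :: "'a \<Rightarrow> real"
    and K :: "'a measure" and b :: "'a \<Rightarrow> 'a" and \<Psi> :: "'a \<Rightarrow> real" and C :: real
  assumes \<Omega>: "open \<Omega>" "bounded \<Omega>" "lipschitz_boundary \<Omega>"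
    and u: "u \<in> borel_measurable borel" "\<And>x. x \<notin> \<Omega> \<Longrightarrow> u x = 0" "integrable lborel u" "integrable lborel (\<lambda>x. (u x)\<^sup>2)"
    and v: "v \<in> borel_measurable borel" "\<And>x. x \<notin> \<Omega> \<Longrightarrow> v x = 0" "integrable lborel v" "integrable lborel (\<lambda>x. (v x)\<^sup>2)"
    and a: "a \<in> borel_measurable borel" "\<And>x. x \<notin> \<Omega> \<Longrightarrow> a x = 0" "integrable lborel a"
    and z: "z \<in> borel_measurable borel" "\<And>x. x \<notin> \<Omega> \<Longrightarrow> z x = 0" "integrable lborel z" "\<And>x. norm (z x) \<le> C"
    and Q: "Q \<in> borel_measurable borel" "\<And>x. x \<notin> \<Omega> \<Longrightarrow> Q x = 0" "integrable lborel Q"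
    and K: "finite_measure K" "(\<lambda>x. x) \<in> K \<rightarrow>\<^sub>M borel"
    and b: "integrable K b" "\<And>x. x \<notin> closure \<Omega> \<Longrightarrow> b x = 0"
    and \<Psi>: "integrable K \<Psi>" "\<And>x. x \<notin> closure \<Omega> \<Longrightarrow> \<Psi> x = 0"
    and Gauss_Green: "\<And>\<phi>. Ck 1 \<phi> \<Longrightarrow> (LINT x|lborel. u x *\<^sub>R grad \<phi> x) = - (LINT x|lborel. \<phi> x *\<^sub>R a x) - (LINT x|K. \<phi> x *\<^sub>R b x)"
    and div: "\<And>\<phi>. \<phi> \<in> test_functions \<Omega> \<Longrightarrow> (LINT x|lborel. v x * \<phi> x) = - (LINT x|lborel. z x \<bullet> grad \<phi> x)"
    and b_le: "\<And>w y. (\<And>\<eta>. \<eta> \<in> sphere 0 1 \<Longrightarrow> w \<bullet> \<eta> \<le> \<psi> \<eta>) \<Longrightarrow> w \<bullet> b y \<le> \<Psi> y"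
    and z_le: "AE x in lborel. x \<in> \<Omega> \<longrightarrow> (\<forall>\<eta>\<in>sphere 0 1. z x \<bullet> \<eta> \<le> \<psi> \<eta>)"
    and \<nu>: "AE x in lborel. x \<in> \<Omega> \<longrightarrow> prob_space (\<nu> x) \<and> integrable (\<nu> x) (\<lambda>A. A) \<and> integrable (\<nu> x) q \<and>
      integrable (\<nu> x) (\<lambda>A. q A \<bullet> A) \<and> (AE A in \<nu> x. A \<in> G) \<and>
      z x = (LINT A|\<nu> x. q A) \<and> a x = (LINT A|\<nu> x. A) \<and> Q x = (LINT A|\<nu> x. q A \<bullet> A)"
    and energy: "(LINT x|lborel. Q x) + (LINT y|K. \<Psi> y) \<le> - (LINT x|lborel. v x * u x)"

text \<open>The monotonicity inequality is integrated first in A, for fixed B in G, and then in B.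
  Expanding the product before integrating leaves only moments of each measure, so no product
  measure appears.\<close>

lemma prob_kernel_cross_monotone:
  fixes q :: "'a::euclidean_space \<Rightarrow> 'a"
  assumes mono: "\<And>A B. A \<in> G \<Longrightarrow> B \<in> G \<Longrightarrow> 0 \<le> (q A - q B) \<bullet> (A - B)"
    and p1: "prob_space \<mu>" "integrable \<mu> (\<lambda>A. A)" "integrable \<mu> q" "integrable \<mu> (\<lambda>A. q A \<bullet> A)" "AE A in \<mu>. A \<in> G"
    and p2: "prob_space \<nu>" "integrable \<nu> (\<lambda>A. A)" "integrable \<nu> q" "integrable \<nu> (\<lambda>A. q A \<bullet> A)" "AE A in \<nu>. A \<in> G"
  shows "(LINT A|\<mu>. q A) \<bullet> (LINT A|\<nu>. A) + (LINT A|\<nu>. q A) \<bullet> (LINT A|\<mu>. A) \<le> (LINT A|\<mu>. q A \<bullet> A) + (LINT A|\<nu>. q A \<bullet> A)"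
proof -
  interpret \<mu>: prob_space \<mu> by fact
  interpret \<nu>: prob_space \<nu> by fact
  have 1: "0 \<le> (LINT A|\<mu>. q A \<bullet> A) - (LINT A|\<mu>. q A) \<bullet> B - q B \<bullet> (LINT A|\<mu>. A) + q B \<bullet> B" if B: "B \<in> G" for B
  proof -
    have "AE A in \<mu>. 0 \<le> q A \<bullet> A - q A \<bullet> B - q B \<bullet> A + q B \<bullet> B"
      using p1(5) 
    proof eventually_elim
      case (elim A)
      then show ?case using mono[OF elim B] by (simp add: inner_diff_left inner_diff_right)
    qed
    then have "0 \<le> (LINT A|\<mu>. q A \<bullet> A - q A \<bullet> B - q B \<bullet> A + q B \<bullet> B)" by (rule integral_nonneg_AE)
    also have "\<dots> = (LINT A|\<mu>. q A \<bullet> A) - (LINT A|\<mu>. q A \<bullet> B) - (LINT A|\<mu>. q B \<bullet> A) + q B \<bullet> B"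
      using p1 by (simp add: \<mu>.prob_space)
    also have "(LINT A|\<mu>. q A \<bullet> B) = (LINT A|\<mu>. q A) \<bullet> B" by (rule integral_inner_left) (rule p1(3))
    also have "(LINT A|\<mu>. q B \<bullet> A) = q B \<bullet> (LINT A|\<mu>. A)" by (rule integral_inner_right) (rule p1(2))
    finally show ?thesis .
  qed
  have "AE B in \<nu>. 0 \<le> (LINT A|\<mu>. q A \<bullet> A) - (LINT A|\<mu>. q A) \<bullet> B - q B \<bullet> (LINT A|\<mu>. A) + q B \<bullet> B"
    using p2(5) by eventually_elim (rule 1)
  then have "0 \<le> (LINT B|\<nu>. (LINT A|\<mu>. q A \<bullet> A) - (LINT A|\<mu>. q A) \<bullet> B - q B \<bullet> (LINT A|\<mu>. A) + q B \<bullet> B)"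
    by (rule integral_nonneg_AE)
  also have "\<dots> = (LINT A|\<mu>. q A \<bullet> A) - (LINT B|\<nu>. (LINT A|\<mu>. q A) \<bullet> B) - (LINT B|\<nu>. q B \<bullet> (LINT A|\<mu>. A)) + (LINT B|\<nu>. q B \<bullet> B)"
    using p2 by (simp add: \<nu>.prob_space)
  also have "(LINT B|\<nu>. (LINT A|\<mu>. q A) \<bullet> B) = (LINT A|\<mu>. q A) \<bullet> (LINT B|\<nu>. B)" by (rule integral_inner_right) (rule p2(2))
  also have "(LINT B|\<nu>. q B \<bullet> (LINT A|\<mu>. A)) = (LINT B|\<nu>. q B) \<bullet> (LINT A|\<mu>. A)" by (rule integral_inner_left) (rule p2(3))
  finally show ?thesis by simp
qed

text \<open>The bound of z2 by \<psi> involves the second slice only; \<open>b_le\<close> of the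
  first slice turns it into the domination of the concentration density b1 that
  \<open>bv_pairing\<close> asks for.\<close>

lemma young_slice_cross:
  assumes "young_slice \<Omega> q \<psi> G \<nu>1 u1 v1 z1 a1 Q1 K1 b1 \<Psi>1 C1" "young_slice \<Omega> q \<psi> G \<nu>2 u2 v2 z2 a2 Q2 K2 b2 \<Psi>2 C2"
  shows "- (LINT x|lborel. v2 x * u1 x) \<le> (LINT x|lborel. z2 x \<bullet> a1 x) + (LINT y|K1. \<Psi>1 y)"
    and "integrable lborel (\<lambda>x. z2 x \<bullet> a1 x)"
proof -
  interpret s1: young_slice \<Omega> q \<psi> G \<nu>1 u1 v1 z1 a1 Q1 K1 b1 \<Psi>1 C1 by fact
  interpret s2: young_slice \<Omega> q \<psi> G \<nu>2 u2 v2 z2 a2 Q2 K2 b2 \<Psi>2 C2 by fact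
  have dom: "AE x in lborel. \<forall>y. x \<in> \<Omega> \<longrightarrow> z2 x \<bullet> b1 y \<le> \<Psi>1 y"
    using s2.z_le by eventually_elim (use s1.b_le in blast)
  interpret bv_pairing \<Omega> u1 v2 a1 z2 b1 K1 \<Psi>1 C2
    by (rule bv_pairing.intro[OF s1.\<Omega> s1.u s2.v s1.a s2.z s1.K s1.b s1.\<Psi> s1.Gauss_Green s2.div dom])
  show "- (LINT x|lborel. v2 x * u1 x) \<le> (LINT x|lborel. z2 x \<bullet> a1 x) + (LINT y|K1. \<Psi>1 y)"
    by (rule minus_pairing_le)
  have "grad (\<lambda>x::'a. 1) x = 0" for x by (rule grad_zero[of UNIV]) auto
  then show "integrable lborel (\<lambda>x. z2 x \<bullet> a1 x)" using integrable_weighted(3)[OF smooth_const[of 1]] by simp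
qed

text \<open>The integrals of \<Psi>1 and \<Psi>2 appear in the energy inequalities with one sign and
  in the mixed bounds with the other and cancel exactly. What remains is the pointwise inequality
  between the moments.\<close>

lemma young_slice_dissipation:
  assumes s: "young_slice \<Omega> q \<psi> G \<nu>1 u1 v1 z1 a1 Q1 K1 b1 \<Psi>1 C1" "young_slice \<Omega> q \<psi> G \<nu>2 u2 v2 z2 a2 Q2 K2 b2 \<Psi>2 C2"
    and mono: "\<And>A B. A \<in> G \<Longrightarrow> B \<in> G \<Longrightarrow> 0 \<le> (q A - q B) \<bullet> (A - B)"
  shows "(LINT x|lborel. (u1 x - u2 x) * (v1 x - v2 x)) \<le> 0"
proof -
  interpret s1: young_slice \<Omega> q \<psi> G \<nu>1 u1 v1 z1 a1 Q1 K1 b1 \<Psi>1 C1 by fact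
  interpret s2: young_slice \<Omega> q \<psi> G \<nu>2 u2 v2 z2 a2 Q2 K2 b2 \<Psi>2 C2 by fact
  note c12 = young_slice_cross[OF s] and c21 = young_slice_cross[OF s(2,1)]
  have "(LINT x|lborel. z2 x \<bullet> a1 x + z1 x \<bullet> a2 x) \<le> (LINT x|lborel. Q1 x + Q2 x)"
  proof (rule integral_mono_AE)
    show "AE x in lborel. z2 x \<bullet> a1 x + z1 x \<bullet> a2 x \<le> Q1 x + Q2 x"
      using s1.\<nu> s2.\<nu>
    proof eventually_elim
      case (elim x)
      show ?case
      proof (cases "x \<in> \<Omega>")
        case True
        then show ?thesis
          using prob_kernel_cross_monotone[OF mono, where \<mu>="\<nu>1 x" and \<nu>="\<nu>2 x"] elim by (simp add: add.commute)
      qed (simp add: s1.z s2.z s1.Q s2.Q)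
    qed
  qed (use c12 c21 s1.Q s2.Q in auto)
  then have le: "(LINT x|lborel. z2 x \<bullet> a1 x) + (LINT x|lborel. z1 x \<bullet> a2 x) \<le> (LINT x|lborel. Q1 x) + (LINT x|lborel. Q2 x)"
    using c12 c21 s1.Q s2.Q by simp
  have i: "integrable lborel (\<lambda>x. v1 x * u1 x)" "integrable lborel (\<lambda>x. v2 x * u2 x)" 
    "integrable lborel (\<lambda>x. v1 x * u2 x)" "integrable lborel (\<lambda>x. v2 x * u1 x)"
    using integrable_mult_L2[OF _ _ s1.v(4) s1.u(4)] integrable_mult_L2[OF _ _ s1.v(4) s2.u(4)]
      integrable_mult_L2[OF _ _ s2.v(4) s1.u(4)] integrable_mult_L2[OF _ _ s2.v(4) s2.u(4)] s1.u(1) s2.u(1) s1.v(1) s2.v(1)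
    by auto
  have "(LINT x|lborel. (u1 x - u2 x) * (v1 x - v2 x)) = (LINT x|lborel. v1 x * u1 x + v2 x * u2 x - v1 x * u2 x - v2 x * u1 x)"
    by (intro Bochner_Integration.integral_cong refl) (simp add: algebra_simps)
  also have "\<dots> = (LINT x|lborel. v1 x * u1 x) + (LINT x|lborel. v2 x * u2 x) - (LINT x|lborel. v1 x * u2 x) - (LINT x|lborel. v2 x * u1 x)"
    using i by simp
  also have "\<dots> \<le> 0" using s1.energy s2.energy c12(1) c21(1) le by linarith
  finally show ?thesis .
qed

section \<open>From Young measures to Borel data at a fixed time\<close>

lemma finite_measure_completion:
  assumes "finite_measure M"
  shows "finite_measure (completion M)"
proof (rule finite_measureI)
  interpret finite_measure M by fact
  show "emeasure (completion M) (space (completion M)) \<noteq> \<infinity>"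
    using emeasure_finite[of "space M"] by simp
qed

lemma young_measuresD:
  assumes "(\<nu>, \<kappa>, \<nu>') \<in> young_measures \<Omega>"
  shows "\<And>x. x \<in> \<Omega> \<Longrightarrow> prob_space (\<nu> x) \<and> sets (\<nu> x) = sets borel"
    and "\<nu> \<in> lebesgue_on \<Omega> \<rightarrow>\<^sub>M subprob_algebra borel"
    and "finite_measure \<kappa>" "sets \<kappa> = sets borel"
    and "\<And>x. x \<in> closure \<Omega> \<Longrightarrow> prob_space (\<nu>' x) \<and> sets (\<nu>' x) = sets borel"
    and "\<And>x. x \<in> closure \<Omega> \<Longrightarrow> AE A in \<nu>' x. A \<in> sphere 0 1"
    and "\<nu>' \<in> restrict_space (completion \<kappa>) (closure \<Omega>) \<rightarrow>\<^sub>M subprob_algebra borel"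
    and "(\<integral>\<^sup>+x. (\<integral>\<^sup>+A. ennreal (norm A) \<partial>\<nu> x) \<partial>lebesgue_on \<Omega>) < \<infinity>"
proof -
  note Y = assms[unfolded young_measures_def, simplified]
  have Y\<nu>: "(\<lambda>x. LINT A|\<nu> x. f (x, A)) \<in> borel_measurable (lebesgue_on \<Omega>)"
    and Y\<nu>': "(\<lambda>x. LINT A|\<nu>' x. f (x, A)) \<in> borel_measurable (completion \<kappa>)"
    if "f \<in> borel_measurable borel" "bounded (range f)" for f :: "'a \<times> 'a \<Rightarrow> real"
    using Y that by blast+
  show p: "\<And>x. x \<in> \<Omega> \<Longrightarrow> prob_space (\<nu> x) \<and> sets (\<nu> x) = sets borel" using Y by blast
  show p': "\<And>x. x \<in> closure \<Omega> \<Longrightarrow> prob_space (\<nu>' x) \<and> sets (\<nu>' x) = sets borel" using Y by blast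
  show "finite_measure \<kappa>" "sets \<kappa> = sets borel" using Y by blast+
  show "(\<integral>\<^sup>+x. (\<integral>\<^sup>+A. ennreal (norm A) \<partial>\<nu> x) \<partial>lebesgue_on \<Omega>) < \<infinity>" using Y by (simp add: top.not_eq_extremum)
  have bdd: "bounded (range (\<lambda>p::'a \<times> 'a. f (snd p)))" if "bounded (range f)" for f :: "'a \<Rightarrow> real"
    using that by (rule bounded_subset) auto
  have bm: "(\<lambda>p::'a \<times> 'a. f (snd p)) \<in> borel_measurable borel" if "f \<in> borel_measurable borel" for f :: "'a \<Rightarrow> real"
    by (rule measurable_compose[OF borel_measurable_continuous_onI that]) (intro continuous_intros)
  show "\<nu> \<in> lebesgue_on \<Omega> \<rightarrow>\<^sub>M subprob_algebra borel"
  proof (rule prob_kernel_measurable)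
    fix f :: "'a \<Rightarrow> real" assume f: "f \<in> borel_measurable borel" "bounded (range f)"
    have "(\<lambda>p::'a \<times> 'a. f (snd p)) \<in> borel_measurable borel" by (rule bm[OF f(1)])
    from Y\<nu>[OF this bdd[OF f(2)]]
    show "(\<lambda>x. LINT A|\<nu> x. f A) \<in> borel_measurable (lebesgue_on \<Omega>)" by simp
  qed (use p in simp)
  show "\<nu>' \<in> restrict_space (completion \<kappa>) (closure \<Omega>) \<rightarrow>\<^sub>M subprob_algebra borel"
  proof (rule prob_kernel_measurable)
    fix f :: "'a \<Rightarrow> real" assume f: "f \<in> borel_measurable borel" "bounded (range f)"
    have "(\<lambda>p::'a \<times> 'a. f (snd p)) \<in> borel_measurable borel" by (rule bm[OF f(1)])
    from Y\<nu>'[OF this bdd[OF f(2)]]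
    have "(\<lambda>x. LINT A|\<nu>' x. f A) \<in> borel_measurable (completion \<kappa>)" by simp
    then show "(\<lambda>x. LINT A|\<nu>' x. f A) \<in> borel_measurable (restrict_space (completion \<kappa>) (closure \<Omega>))"
      by (rule measurable_restrict_space1)
  qed (use p' in \<open>simp add: space_restrict_space\<close>)
  fix x assume x: "x \<in> closure \<Omega>"
  have "- sphere 0 1 \<in> null_sets (\<nu>' x)"
    using Y x p'[OF x] by (auto simp: null_sets_def)
  then show "AE A in \<nu>' x. A \<in> sphere 0 1"
    by (rule AE_I') auto
qed

text \<open>The first moment N(x), integrable over \<Omega> by the definition of a Young measure,
  controls |A| and, q being bounded, also |q(A) . A|. It is finite for almost every x, which gives
  integrability for each such measure.\<close>

lemma young_interior:
  assumes Y: "(\<nu>, \<kappa>, \<nu>') \<in> young_measures \<Omega>" and \<Omega>: "open \<Omega>" "bounded \<Omega>"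
    and q: "continuous_on UNIV q" "\<And>A. norm (q A) \<le> \<Lambda>"
  obtains z a Q where
    "z \<in> borel_measurable borel" "\<And>x. x \<notin> \<Omega> \<Longrightarrow> z x = 0" "integrable lborel z" "\<And>x. norm (z x) \<le> \<Lambda>"
    "a \<in> borel_measurable borel" "\<And>x. x \<notin> \<Omega> \<Longrightarrow> a x = 0" "integrable lborel a"
    "Q \<in> borel_measurable borel" "\<And>x. x \<notin> \<Omega> \<Longrightarrow> Q x = 0" "integrable lborel Q"
    "AE x in lborel. x \<in> \<Omega> \<longrightarrow> z x = (LINT A|\<nu> x. q A)"
    "AE x in lborel. x \<in> \<Omega> \<longrightarrow> a x = (LINT A|\<nu> x. A)"
    "AE x in lborel. x \<in> \<Omega> \<longrightarrow> Q x = (LINT A|\<nu> x. q A \<bullet> A)"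
    "AE x in lborel. x \<in> \<Omega> \<longrightarrow> integrable (\<nu> x) (\<lambda>A. A) \<and> integrable (\<nu> x) q \<and> integrable (\<nu> x) (\<lambda>A. q A \<bullet> A)"
proof -
  let ?M = "lebesgue_on \<Omega>"
  note D = young_measuresD[OF Y]
  have \<Omega>b: "\<Omega> \<in> sets borel" using \<Omega> by simp
  have qm [measurable]: "q \<in> borel_measurable borel" using q(1) by (rule borel_measurable_continuous_onI)
  have \<Lambda>: "\<Lambda> \<ge> 0" using q(2)[of 0] norm_ge_zero[of "q 0"] by linarith
  have spM: "space ?M = \<Omega>" by simp
  have meas: "(\<lambda>x. LINT A|\<nu> x. f A) \<in> borel_measurable ?M" if "f \<in> borel_measurable borel" for f :: "'a \<Rightarrow> 'c::euclidean_space"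
    using measurable_compose[OF D(2) integral_measurable_subprob_algebra[OF that]] .
  have sets\<nu>: "sets (\<nu> x) = sets borel" if "x \<in> \<Omega>" for x using D(1)[OF that] by simp
  have m\<nu>: "f \<in> borel_measurable (\<nu> x)" if "x \<in> \<Omega>" "f \<in> borel_measurable borel" for x and f :: "'a \<Rightarrow> 'c::topological_space"
    using that(2) measurable_cong_sets[OF sets\<nu>[OF that(1)] refl] by blast
  define N where "N = (\<lambda>x. \<integral>\<^sup>+A. ennreal (norm A) \<partial>\<nu> x)"
  have Nm: "N \<in> borel_measurable ?M"
    unfolding N_def by (rule measurable_compose[OF D(2) nn_integral_measurable_subprob_algebra]) simp
  have Nfin: "(\<integral>\<^sup>+x. N x \<partial>?M) < \<infinity>" using D(8) by (simp add: N_def)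
  have iq: "integrable (\<nu> x) q" if "x \<in> \<Omega>" for x
  proof -
    interpret prob_space "\<nu> x" using D(1)[OF that] by simp
    show ?thesis using q(2) m\<nu>[OF that qm] by (intro integrable_const_bound[of _ \<Lambda>]) auto
  qed
  have zb: "norm (LINT A|\<nu> x. q A) \<le> \<Lambda>" if "x \<in> \<Omega>" for x
  proof -
    interpret prob_space "\<nu> x" using D(1)[OF that] by simp
    have "norm (LINT A|\<nu> x. q A) \<le> (LINT A|\<nu> x. norm (q A))" by (rule integral_norm_bound)
    also have "\<dots> \<le> (LINT A|\<nu> x. \<Lambda>)" using iq[OF that] q(2) by (intro integral_mono) auto
    finally show ?thesis by (simp add: prob_space)
  qed
  have Ni: "integrable (\<nu> x) (\<lambda>A. A)" "integrable (\<nu> x) (\<lambda>A. q A \<bullet> A)" if x: "x \<in> \<Omega>" and "N x < \<infinity>" for x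
  proof -
    show i: "integrable (\<nu> x) (\<lambda>A. A)"
      using that m\<nu>[OF x, of "\<lambda>A. A"] by (intro integrableI_bounded) (auto simp: N_def)
    show "integrable (\<nu> x) (\<lambda>A. q A \<bullet> A)"
    proof (rule Bochner_Integration.integrable_bound)
      show "integrable (\<nu> x) (\<lambda>A. \<Lambda> *\<^sub>R A)" using i by simp
      have "norm (q A \<bullet> A) \<le> norm (\<Lambda> *\<^sub>R A)" for A
        using Cauchy_Schwarz_ineq2[of "q A" A] mult_right_mono[OF q(2), of "norm A" A] \<Lambda> by simp
      then show "AE A in \<nu> x. norm (q A \<bullet> A) \<le> norm (\<Lambda> *\<^sub>R A)" by simp
    qed (rule m\<nu>[OF x], measurable)
  qed
  have bound: "integrable ?M (\<lambda>x. LINT A|\<nu> x. f A)" 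
    if f: "f \<in> borel_measurable borel" "\<And>A. norm (f A) \<le> c * norm A" and c: "c \<ge> 0" for f :: "'a \<Rightarrow> 'c::euclidean_space" and c
  proof (rule integrableI_bounded[OF meas[OF f(1)]])
    have le: "ennreal (norm (LINT A|\<nu> x. f A)) \<le> ennreal c * N x" if "x \<in> \<Omega>" for x
    \<comment> \<open>Without integrability the integral is 0 by convention and the bound is
      trivial, so no exceptional set has to be carried along.\<close>
    proof (cases "integrable (\<nu> x) f")
      case True
      have "ennreal (norm (LINT A|\<nu> x. f A)) \<le> (\<integral>\<^sup>+A. norm (f A) \<partial>\<nu> x)" by (rule integral_norm_bound_ennreal[OF True])
      also have "\<dots> \<le> (\<integral>\<^sup>+A. ennreal c * ennreal (norm A) \<partial>\<nu> x)"
        using f(2) c by (intro nn_integral_mono) (simp add: ennreal_mult[symmetric] ennreal_leI)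
      also have "\<dots> = ennreal c * N x" unfolding N_def by (rule nn_integral_cmult) (rule m\<nu>[OF that], simp)
      finally show ?thesis .
    qed (simp add: not_integrable_integral_eq)
    have "(\<integral>\<^sup>+x. ennreal (norm (LINT A|\<nu> x. f A)) \<partial>?M) \<le> (\<integral>\<^sup>+x. ennreal c * N x \<partial>?M)"
      using le by (intro nn_integral_mono) (simp add: spM)
    also have "\<dots> = ennreal c * (\<integral>\<^sup>+x. N x \<partial>?M)" by (rule nn_integral_cmult[OF Nm])
    also have "\<dots> < \<infinity>" using Nfin by (simp add: ennreal_mult_less_top)
    finally show "(\<integral>\<^sup>+x. ennreal (norm (LINT A|\<nu> x. f A)) \<partial>?M) < \<infinity>" .
  qed
  obtain z0 where z0: "z0 \<in> borel_measurable borel" "\<And>x. x \<notin> \<Omega> \<Longrightarrow> z0 x = 0" "AE x in lborel. x \<in> \<Omega> \<longrightarrow> z0 x = (LINT A|\<nu> x. q A)"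
    using borel_representative[OF meas[of q] \<Omega>b] by auto
  obtain a where a: "a \<in> borel_measurable borel" "\<And>x. x \<notin> \<Omega> \<Longrightarrow> a x = 0" "AE x in lborel. x \<in> \<Omega> \<longrightarrow> a x = (LINT A|\<nu> x. A)"
    using borel_representative[OF meas[of "\<lambda>A. A"] \<Omega>b] by auto
  have qA [measurable]: "(\<lambda>A. q A \<bullet> A) \<in> borel_measurable borel" by measurable
  obtain Q where Q: "Q \<in> borel_measurable borel" "\<And>x. x \<notin> \<Omega> \<Longrightarrow> Q x = 0" "AE x in lborel. x \<in> \<Omega> \<longrightarrow> Q x = (LINT A|\<nu> x. q A \<bullet> A)"
    using borel_representative[OF meas[OF qA] \<Omega>b] by auto
  \<comment> \<open>The bound by \<Lambda> holds for z0 almost everywhere in \<Omega>; the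
    truncation makes it hold at every point and changes z0 only on a null set.\<close>
  define z where "z = (\<lambda>x. if norm (z0 x) \<le> \<Lambda> then z0 x else 0)"
  have zm: "z \<in> borel_measurable borel" unfolding z_def using z0(1) by measurable
  have z0': "z x = 0" if "x \<notin> \<Omega>" for x using z0(2)[OF that] by (simp add: z_def)
  have zn: "norm (z x) \<le> \<Lambda>" for x using \<Lambda> by (simp add: z_def)
  show thesis
  proof (rule that[of z a Q, OF zm z0' _ zn a(1,2) _ Q(1,2)])
    show "integrable lborel z"
    proof (rule Bochner_Integration.integrable_bound)
      show "integrable lborel (\<lambda>x. \<Lambda> * indicator \<Omega> x :: real)"
        using \<Omega> emeasure_bounded_finite[OF \<Omega>(2)] by (intro integrable_mult_right integrable_real_indicator) auto
      show "AE x in lborel. norm (z x) \<le> norm (\<Lambda> * indicator \<Omega> x :: real)"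
        using zn z0' \<Lambda> by (intro AE_I2) (auto simp: indicator_def)
    qed (use zm in simp)
    show "integrable lborel a"
      using bound[of "\<lambda>A. A" 1] integrable_lebesgue_on_iff[OF a \<Omega>b] by simp
    show "integrable lborel Q"
    proof -
      have "norm (q A \<bullet> A) \<le> \<Lambda> * norm A" for A
        using Cauchy_Schwarz_ineq2[of "q A" A] mult_right_mono[OF q(2), of "norm A" A] by simp
      then show ?thesis
        using bound[OF qA _ \<Lambda>] integrable_lebesgue_on_iff[OF Q \<Omega>b] by simp
    qed
    show "AE x in lborel. x \<in> \<Omega> \<longrightarrow> z x = (LINT A|\<nu> x. q A)"
      using z0(3) by eventually_elim (use zb in \<open>auto simp: z_def\<close>)
    have "AE x in ?M. N x \<noteq> \<infinity>" using nn_integral_PInf_AE[OF Nm] Nfin by auto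
    then have "AE x in lborel. x \<in> \<Omega> \<longrightarrow> N x \<noteq> \<infinity>" by (simp add: AE_lebesgue_on_iff[OF \<Omega>b])
    then show "AE x in lborel. x \<in> \<Omega> \<longrightarrow> integrable (\<nu> x) (\<lambda>A. A) \<and> integrable (\<nu> x) q \<and> integrable (\<nu> x) (\<lambda>A. q A \<bullet> A)"
      by eventually_elim (use Ni iq in \<open>auto simp: top.not_eq_extremum\<close>)
  qed (assumption | rule a(3) Q(3))+
qed

text \<open>The angle measures live on the unit sphere, where the identity and \<psi> are bounded;
  so b and \<Psi> are bounded and integrable for the finite measure. The last inequality is the
  integral of w . \<eta> <= \<psi>(\<eta>).\<close>

lemma young_boundary:
  assumes Y: "(\<nu>, \<kappa>, \<nu>') \<in> young_measures \<Omega>"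
    and \<psi>: "\<psi> \<in> borel_measurable borel" "\<And>\<eta>. \<eta> \<in> sphere 0 1 \<Longrightarrow> \<bar>\<psi> \<eta>\<bar> \<le> (C::real)"
  defines "b \<equiv> \<lambda>y. indicator (closure \<Omega>) y *\<^sub>R (LINT A|\<nu>' y. A)" 
    and "\<Psi> \<equiv> \<lambda>y. indicator (closure \<Omega>) y * (LINT A|\<nu>' y. \<psi> A)"
  shows "finite_measure (completion \<kappa>)" "(\<lambda>x. x) \<in> completion \<kappa> \<rightarrow>\<^sub>M borel" 
    "integrable (completion \<kappa>) b" "integrable (completion \<kappa>) \<Psi>"
    "\<And>w y. (\<And>\<eta>. \<eta> \<in> sphere 0 1 \<Longrightarrow> w \<bullet> \<eta> \<le> \<psi> \<eta>) \<Longrightarrow> w \<bullet> b y \<le> \<Psi> y"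
proof -
  note D = young_measuresD[OF Y]
  let ?K = "completion \<kappa>"
  show fin: "finite_measure ?K" by (rule finite_measure_completion[OF D(3)])
  show id: "(\<lambda>x. x) \<in> ?K \<rightarrow>\<^sub>M borel"
    using measurable_completion[of "\<lambda>x. x" \<kappa> borel] D(4) by (simp add: measurable_ident_sets)
  interpret K: finite_measure ?K by (rule fin)
  have cl: "closure \<Omega> \<in> sets ?K" using D(4) by auto
  have sp: "space ?K = UNIV" using sets_eq_imp_space_eq[OF D(4)] by simp
  have meas: "(\<lambda>y. indicator (closure \<Omega>) y *\<^sub>R (LINT A|\<nu>' y. f A)) \<in> borel_measurable ?K" if "f \<in> borel_measurable borel" for f :: "'a \<Rightarrow> 'c::euclidean_space"
    using measurable_compose[OF D(7) integral_measurable_subprob_algebra[OF that]] cl sp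
    by (subst (asm) borel_measurable_restrict_space_iff) auto
  have m: "f \<in> borel_measurable (\<nu>' y)" if "y \<in> closure \<Omega>" "f \<in> borel_measurable borel" for y and f :: "'a \<Rightarrow> 'c::topological_space"
    using that D(5)[OF that(1)] measurable_cong_sets[of "\<nu>' y" borel borel borel] by auto
  have i: "integrable (\<nu>' y) f" "norm (LINT A|\<nu>' y. f A) \<le> c" 
    if y: "y \<in> closure \<Omega>" and f: "f \<in> borel_measurable borel" "\<And>\<eta>. \<eta> \<in> sphere 0 1 \<Longrightarrow> norm (f \<eta>) \<le> c" for y c and f :: "'a \<Rightarrow> 'c::euclidean_space"
  proof -
    interpret prob_space "\<nu>' y" using D(5)[OF y] by simp
    have ae: "AE A in \<nu>' y. norm (f A) \<le> c" using D(6)[OF y] by eventually_elim (rule f(2))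
    show *: "integrable (\<nu>' y) f" using ae m[OF y f(1)] by (rule integrable_const_bound)
    have "norm (LINT A|\<nu>' y. f A) \<le> (LINT A|\<nu>' y. norm (f A))" by (rule integral_norm_bound)
    also have "\<dots> \<le> (LINT A|\<nu>' y. c)" using * ae by (intro integral_mono_AE) auto
    finally show "norm (LINT A|\<nu>' y. f A) \<le> c" by (simp add: prob_space)
  qed
  have id1: "norm \<eta> \<le> 1" if "\<eta> \<in> sphere 0 1" for \<eta> :: 'a using that by simp
  have \<psi>1: "norm (\<psi> \<eta>) \<le> \<bar>C\<bar>" if "\<eta> \<in> sphere 0 1" for \<eta> using \<psi>(2)[OF that] by simp
  show "integrable ?K b"
    by (rule K.integrable_const_bound[of _ 1])
      (use i(2)[OF _ measurable_ident_sets id1] meas[of "\<lambda>A. A"] in \<open>auto simp: b_def indicator_def\<close>)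
  show "integrable ?K \<Psi>"
    by (rule K.integrable_const_bound[of _ "\<bar>C\<bar>"])
      (use i(2)[OF _ \<psi>(1) \<psi>1] meas[OF \<psi>(1)] in \<open>auto simp: \<Psi>_def indicator_def\<close>)
  fix w y assume w: "\<And>\<eta>. \<eta> \<in> sphere 0 1 \<Longrightarrow> w \<bullet> \<eta> \<le> \<psi> \<eta>"
  show "w \<bullet> b y \<le> \<Psi> y"
  proof (cases "y \<in> closure \<Omega>")
    case True
    have iA: "integrable (\<nu>' y) (\<lambda>A. A)" by (rule i(1)[OF True _ id1]) simp
    have "w \<bullet> b y = (LINT A|\<nu>' y. w \<bullet> A)"
      using True integral_inner_right[of w "\<nu>' y" "\<lambda>A. A"] iA by (simp add: b_def)
    also have "\<dots> \<le> (LINT A|\<nu>' y. \<psi> A)"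
    proof (rule integral_mono_AE)
      show "integrable (\<nu>' y) (\<lambda>A. w \<bullet> A)" using iA by simp
      show "integrable (\<nu>' y) \<psi>" by (rule i(1)[OF True \<psi>(1) \<psi>1])
      show "AE A in \<nu>' y. w \<bullet> A \<le> \<psi> A" using D(6)[OF True] by eventually_elim (rule w)
    qed
    finally show ?thesis using True by (simp add: \<Psi>_def)
  qed (simp add: b_def \<Psi>_def)
qed

text \<open>R and \<psi> may differ at the origin, which is a null set for measures on the sphere.
  For the same reason R is a Borel function, being \<psi> changed at one point.\<close>

lemma young_recession_integral:
  assumes Y: "(\<nu>, \<kappa>, \<nu>') \<in> young_measures \<Omega>" and y: "y \<in> closure \<Omega>"
    and \<psi>: "\<psi> \<in> borel_measurable borel" "\<And>\<eta>. \<eta> \<noteq> 0 \<Longrightarrow> R \<eta> = (\<psi> \<eta> :: real)"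
  shows "(LINT A|\<nu>' y. R A) = (LINT A|\<nu>' y. \<psi> A)"
proof (rule integral_cong_AE)
  note D = young_measuresD[OF Y]
  have R: "R = (\<lambda>A. if A = 0 then R 0 else \<psi> A)" using \<psi>(2) by auto
  have "(\<lambda>A. if A = 0 then R 0 else \<psi> A) \<in> borel_measurable borel" using \<psi>(1) by measurable
  then show "R \<in> borel_measurable (\<nu>' y)" "\<psi> \<in> borel_measurable (\<nu>' y)"
    using \<psi>(1) R measurable_cong_sets[of "\<nu>' y" borel borel borel] D(5)[OF y] by auto
  show "AE A in \<nu>' y. R A = \<psi> A" using D(6)[OF y] by eventually_elim (rule \<psi>(2), auto)
qed

text \<open>The sigma algebra of \<open>measure_of\<close> is the generated one for any set
  function; here this is the Borel algebra.\<close>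

lemma hausdorff_measure_id: "(\<lambda>x. x) \<in> hausdorff_measure k \<rightarrow>\<^sub>M borel"
proof -
  have "sets (hausdorff_measure k :: 'a measure) = sets borel"
    unfolding hausdorff_measure_def using sets.sigma_sets_eq[of "borel :: 'a measure"] by (subst sets_measure_of) auto
  then show ?thesis by (rule measurable_ident_sets)
qed

text \<open>The trace identity supplies a boundary integral of g times the normal. Condition (3),
  which is known on sets only, is tested with \<phi> and replaces it by the concentration measure on
  the frontier; together with the part in \<Omega> this gives one integral over the closure.\<close>

lemma young_Gauss_Green:
  fixes \<Omega> :: "'a::euclidean_space set"
  assumes \<Omega>: "open \<Omega>" "bounded \<Omega>" and u: "u \<in> BV \<Omega>" 
    and u': "u' \<in> borel_measurable borel" "\<And>x. x \<notin> \<Omega> \<Longrightarrow> u' x = 0" "AE x in lborel. x \<in> \<Omega> \<longrightarrow> u' x = u x"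
    and a: "a \<in> borel_measurable borel" "\<And>x. x \<notin> \<Omega> \<Longrightarrow> a x = 0" "AE x in lborel. x \<in> \<Omega> \<longrightarrow> a x = a0 x" "integrable lborel a"
    and K: "(\<lambda>x. x) \<in> K \<rightarrow>\<^sub>M borel" and b: "integrable K (\<lambda>y. indicator (closure \<Omega>) y *\<^sub>R b0 y)"
    and Du: "\<And>B. B \<in> sets borel \<Longrightarrow> B \<subseteq> \<Omega> \<Longrightarrow> BV_deriv \<Omega> u B = (LINT x:B|lebesgue. a0 x) + (LINT x:B|K. b0 x)"
    and g: "is_trace \<Omega> u g" 
    and bd: "\<And>B. B \<in> sets borel \<Longrightarrow> B \<subseteq> closure \<Omega> \<Longrightarrow> (LINT x:B \<inter> frontier \<Omega>|K. b0 x) =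
           - (LINT x:B \<inter> frontier \<Omega>|hausdorff_measure (DIM('a) - 1). g x *\<^sub>R outer_normal \<Omega> x)"
    and \<phi>: "Ck 1 \<phi>"
  shows "(LINT x|lborel. u' x *\<^sub>R grad \<phi> x) = - (LINT x|lborel. \<phi> x *\<^sub>R a x) - (LINT x|K. \<phi> x *\<^sub>R (indicator (closure \<Omega>) x *\<^sub>R b0 x))"
proof -
  let ?H = "hausdorff_measure (DIM('a) - 1) :: 'a measure"
  let ?I = "\<lambda>S x. indicator S x :: real"
  have c: "continuous_on UNIV \<phi>" "continuous_on UNIV (grad \<phi>)" using Ck_continuous[OF \<phi>] continuous_grad[OF \<phi>] .
  have \<phi>m [measurable]: "\<phi> \<in> borel_measurable borel" "grad \<phi> \<in> borel_measurable borel"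
    using c by (auto intro: borel_measurable_continuous_onI)
  have compact_cl: "compact (closure \<Omega>)" using \<Omega> by simp
  have "bounded (\<phi> ` closure \<Omega>)" 
    by (rule compact_imp_bounded[OF compact_continuous_image[OF continuous_on_subset[OF c(1)] compact_cl]]) simp
  then obtain C where "\<forall>y\<in>\<phi> ` closure \<Omega>. norm y \<le> C" unfolding bounded_iff by blast
  then have C: "\<bar>\<phi> x\<bar> \<le> C" if "x \<in> closure \<Omega>" for x using that by auto
  have sub: "\<Omega> \<subseteq> closure \<Omega>" "frontier \<Omega> \<subseteq> closure \<Omega>" by (auto simp: closure_subset frontier_def)
  have Sb: "\<Omega> \<in> sets borel" "frontier \<Omega> \<in> sets borel" "closed (frontier \<Omega>)" using \<Omega>(1) by auto
  have ib: "integrable K (\<lambda>y. ?I S y *\<^sub>R b0 y)" if S: "S \<in> sets borel" "S \<subseteq> closure \<Omega>" for S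
  proof -
    have m: "?I S \<in> borel_measurable K" using measurable_compose[OF K borel_measurable_indicator[OF S(1)]] .
    have "integrable K (\<lambda>y. ?I S y *\<^sub>R (?I (closure \<Omega>) y *\<^sub>R b0 y))"
    proof (rule Bochner_Integration.integrable_bound[OF b])
      show "(\<lambda>y. ?I S y *\<^sub>R (?I (closure \<Omega>) y *\<^sub>R b0 y)) \<in> borel_measurable K"
        by (rule borel_measurable_scaleR[OF m borel_measurable_integrable[OF b]])
      show "AE y in K. norm (?I S y *\<^sub>R (?I (closure \<Omega>) y *\<^sub>R b0 y)) \<le> norm (?I (closure \<Omega>) y *\<^sub>R b0 y)"
        by (intro AE_I2) (simp add: indicator_def)
    qed
    moreover have "?I S y *\<^sub>R (?I (closure \<Omega>) y *\<^sub>R b0 y) = ?I S y *\<^sub>R b0 y" for y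
      using S(2) by (auto simp: indicator_def)
    ultimately show ?thesis by (simp only:)
  qed
  have ex: "has_BV_deriv \<Omega> u (BV_deriv \<Omega> u)"
  proof -
    obtain m where "has_BV_deriv \<Omega> u m" using u by (auto simp: BV_def)
    then show ?thesis unfolding BV_deriv_def by (rule someI[of "has_BV_deriv \<Omega> u"])
  qed
  then have vm: "vmeasure \<Omega> (BV_deriv \<Omega> u)" by (simp add: has_BV_deriv_def)
  have v: "vintegral \<Omega> (BV_deriv \<Omega> u) \<phi> = (LINT x:\<Omega>|lebesgue. \<phi> x *\<^sub>R a0 x) + (LINT x:\<Omega>|K. \<phi> x *\<^sub>R b0 x)"
  proof (rule vintegral_eqI[OF vm Sb(1) _ K _ _ Du \<phi>m(1)])
    show "(\<lambda>x. x) \<in> lebesgue \<rightarrow>\<^sub>M borel" by (simp add: measurable_completion)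
    show "set_integrable lebesgue \<Omega> a0" using set_integrable_lebesgue_iff[OF a(1-3)] a(4) by simp
    show "set_integrable K \<Omega> b0" using ib[OF Sb(1) sub(1)] by (simp add: set_integrable_def)
    show "\<bar>\<phi> x\<bar> \<le> C" if "x \<in> \<Omega>" for x using C that sub by blast
  qed
  \<comment> \<open>The indicator makes the test function bounded on the whole space; \<phi> alone
    is only known to be bounded on the compact closure.\<close>
  have tr: "(LINT x:frontier \<Omega>|K. (?I (frontier \<Omega>) x * \<phi> x) *\<^sub>R b0 x) = 
    (LINT x:frontier \<Omega>|?H. (?I (frontier \<Omega>) x * \<phi> x) *\<^sub>R (- (g x *\<^sub>R outer_normal \<Omega> x)))"
  proof (rule integral_transfer_nonintegrable[OF Sb(3) K hausdorff_measure_id])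
    show "set_integrable K (frontier \<Omega>) b0" using ib[OF Sb(2) sub(2)] by (simp add: set_integrable_def)
    show "(LINT x:B|K. b0 x) = (LINT x:B|?H. - (g x *\<^sub>R outer_normal \<Omega> x))" if "B \<in> sets borel" "B \<subseteq> frontier \<Omega>" for B
    proof -
      have "B \<subseteq> closure \<Omega>" "B \<inter> frontier \<Omega> = B" using that sub by auto
      then show ?thesis using bd[of B] that(1) by (simp add: set_lebesgue_integral_def)
    qed
    show "(\<lambda>x. ?I (frontier \<Omega>) x * \<phi> x) \<in> borel_measurable borel" using Sb(2) by measurable
    show "\<bar>?I (frontier \<Omega>) x * \<phi> x\<bar> \<le> \<bar>C\<bar>" for x
      using C[of x] sub(2) by (cases "x \<in> frontier \<Omega>") auto
  qed
  have *: "?I (frontier \<Omega>) x *\<^sub>R (?I (frontier \<Omega>) x * \<phi> x) *\<^sub>R y = ?I (frontier \<Omega>) x *\<^sub>R \<phi> x *\<^sub>R y" for x and y :: 'a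
    by (auto simp: indicator_def)
  have "(LINT x:frontier \<Omega>|K. \<phi> x *\<^sub>R b0 x) = (LINT x:frontier \<Omega>|?H. \<phi> x *\<^sub>R (- (g x *\<^sub>R outer_normal \<Omega> x)))"
    using tr unfolding set_lebesgue_integral_def * .
  also have "\<dots> = - (LINT x:frontier \<Omega>|?H. (\<phi> x * g x) *\<^sub>R outer_normal \<Omega> x)"
    by (simp add: set_lebesgue_integral_def)
  finally have H: "(LINT x:frontier \<Omega>|K. \<phi> x *\<^sub>R b0 x) = - (LINT x:frontier \<Omega>|?H. (\<phi> x * g x) *\<^sub>R outer_normal \<Omega> x)" .
  have eq: "(LINT x:\<Omega>|lebesgue. u x *\<^sub>R grad \<phi> x) = - vintegral \<Omega> (BV_deriv \<Omega> u) \<phi> +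
          (LINT x:frontier \<Omega>|?H. (\<phi> x * g x) *\<^sub>R outer_normal \<Omega> x)"
    using g \<phi> by (simp add: is_trace_def)
  have e1: "(LINT x:\<Omega>|lebesgue. u x *\<^sub>R grad \<phi> x) = (LINT x|lborel. u' x *\<^sub>R grad \<phi> x)"
  proof (rule set_integral_lebesgue_eq)
    show "AE x in lborel. x \<in> \<Omega> \<longrightarrow> u' x *\<^sub>R grad \<phi> x = u x *\<^sub>R grad \<phi> x" using u'(3) by eventually_elim auto
  qed (use u' in auto)
  have e2: "(LINT x:\<Omega>|lebesgue. \<phi> x *\<^sub>R a0 x) = (LINT x|lborel. \<phi> x *\<^sub>R a x)"
  proof (rule set_integral_lebesgue_eq)
    show "AE x in lborel. x \<in> \<Omega> \<longrightarrow> \<phi> x *\<^sub>R a x = \<phi> x *\<^sub>R a0 x" using a(3) by eventually_elim auto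
  qed (use a in auto)
  have ip: "integrable K (\<lambda>x. \<phi> x *\<^sub>R (?I S x *\<^sub>R b0 x))" if S: "S \<in> sets borel" "S \<subseteq> closure \<Omega>" for S
    by (rule integrable_continuous_mult_left[OF K ib[OF S] _ compact_cl c(1)]) (use S(2) in \<open>auto simp: indicator_def\<close>)
  have split: "?I (closure \<Omega>) x = ?I \<Omega> x + ?I (frontier \<Omega>) x" for x
    using \<Omega>(1) sub by (auto simp: indicator_def frontier_def interior_open)
  have "(LINT x|K. \<phi> x *\<^sub>R (?I (closure \<Omega>) x *\<^sub>R b0 x)) = (LINT x|K. \<phi> x *\<^sub>R (?I \<Omega> x *\<^sub>R b0 x) + \<phi> x *\<^sub>R (?I (frontier \<Omega>) x *\<^sub>R b0 x))"
    unfolding split by (simp add: scaleR_add_left scaleR_add_right distrib_left)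
  also have "\<dots> = (LINT x|K. \<phi> x *\<^sub>R (?I \<Omega> x *\<^sub>R b0 x)) + (LINT x|K. \<phi> x *\<^sub>R (?I (frontier \<Omega>) x *\<^sub>R b0 x))"
    by (rule Bochner_Integration.integral_add[OF ip[OF Sb(1) sub(1)] ip[OF Sb(2) sub(2)]])
  also have "\<dots> = (LINT x:\<Omega>|K. \<phi> x *\<^sub>R b0 x) + (LINT x:frontier \<Omega>|K. \<phi> x *\<^sub>R b0 x)"
    by (simp add: set_lebesgue_integral_def mult.commute)
  finally have e3: "(LINT x|K. \<phi> x *\<^sub>R (?I (closure \<Omega>) x *\<^sub>R b0 x)) = (LINT x:\<Omega>|K. \<phi> x *\<^sub>R b0 x) + (LINT x:frontier \<Omega>|K. \<phi> x *\<^sub>R b0 x)" .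
  show ?thesis unfolding e3 H using eq unfolding e1 v e2 by simp
qed

text \<open>All conditions on a solution at a fixed time enter here and are rewritten for the
  representatives; afterwards only \<open>young_slice\<close> is used.\<close>

lemma young_slice_exists:
  fixes \<Omega> \<Omega>' :: "'a::euclidean_space set"
  assumes \<Omega>: "bounded_domain \<Omega>" "lipschitz_boundary \<Omega>" and \<Omega>': "bounded_domain \<Omega>'" "closure \<Omega> \<subseteq> \<Omega>'"
    and q: "continuous_on UNIV q" "\<And>A. norm (q A) \<le> \<Lambda>"
    and \<psi>: "\<psi> \<in> borel_measurable borel" "\<And>\<eta>. \<eta> \<in> sphere 0 1 \<Longrightarrow> \<bar>\<psi> \<eta>\<bar> \<le> C"
      "\<And>x \<eta>. x \<in> closure \<Omega> \<Longrightarrow> \<eta> \<noteq> 0 \<Longrightarrow> recession \<Omega> (\<lambda>x A. q A \<bullet> A) x \<eta> = \<psi> \<eta>"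
    and q_le: "\<And>\<eta> \<xi>. \<eta> \<in> sphere 0 1 \<Longrightarrow> \<Phi> \<xi> = convexification \<Phi> \<xi> \<Longrightarrow> q \<xi> \<bullet> \<eta> \<le> \<psi> \<eta>"
    and u: "u \<in> BV \<Omega>" "u \<in> L2 \<Omega>"
    and Y: "(\<nu>, \<kappa>, \<nu>') \<in> young_measures \<Omega>" and yc: "young_conditions \<Omega> \<Omega>' \<Phi> q u v (\<nu>, \<kappa>, \<nu>')"
    and u': "u' \<in> borel_measurable borel" "\<And>x. x \<notin> \<Omega> \<Longrightarrow> u' x = 0" "AE x in lborel. x \<in> \<Omega> \<longrightarrow> u' x = u x"
    and v': "v' \<in> borel_measurable borel" "\<And>x. x \<notin> \<Omega> \<Longrightarrow> v' x = 0" "AE x in lborel. x \<in> \<Omega> \<longrightarrow> v' x = v x"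
      "integrable lborel v'" "integrable lborel (\<lambda>x. (v' x)\<^sup>2)"
  shows "\<exists>z a Q K b \<Psi>. young_slice \<Omega> q \<psi> {A. \<Phi> A = convexification \<Phi> A} \<nu> u' v' z a Q K b \<Psi> \<Lambda>"
proof -
  have \<Omega>o: "open \<Omega>" "bounded \<Omega>" "\<Omega> \<noteq> {}" and \<Omega>'o: "open \<Omega>'" using \<Omega> \<Omega>' by (auto simp: bounded_domain_def)
  have \<Omega>b: "\<Omega> \<in> sets borel" using \<Omega>o by simp
  note D = young_measuresD[OF Y]
  let ?G = "{A. \<Phi> A = convexification \<Phi> A}" and ?K = "completion \<kappa>"
  obtain z a Q where
    z: "z \<in> borel_measurable borel" "\<And>x. x \<notin> \<Omega> \<Longrightarrow> z x = 0" "integrable lborel z" "\<And>x. norm (z x) \<le> \<Lambda>" and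
    a: "a \<in> borel_measurable borel" "\<And>x. x \<notin> \<Omega> \<Longrightarrow> a x = 0" "integrable lborel a" and
    Q: "Q \<in> borel_measurable borel" "\<And>x. x \<notin> \<Omega> \<Longrightarrow> Q x = 0" "integrable lborel Q" and
    rep: "AE x in lborel. x \<in> \<Omega> \<longrightarrow> z x = (LINT A|\<nu> x. q A)"
    "AE x in lborel. x \<in> \<Omega> \<longrightarrow> a x = (LINT A|\<nu> x. A)"
    "AE x in lborel. x \<in> \<Omega> \<longrightarrow> Q x = (LINT A|\<nu> x. q A \<bullet> A)"
    "AE x in lborel. x \<in> \<Omega> \<longrightarrow> integrable (\<nu> x) (\<lambda>A. A) \<and> integrable (\<nu> x) q \<and> integrable (\<nu> x) (\<lambda>A. q A \<bullet> A)"
    by (rule young_interior[OF Y \<Omega>o(1,2) q]) (rule that)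
  define b where "b = (\<lambda>y. indicator (closure \<Omega>) y *\<^sub>R (LINT A|\<nu>' y. A))"
  define \<Psi> where "\<Psi> = (\<lambda>y. indicator (closure \<Omega>) y * (LINT A|\<nu>' y. \<psi> A))"
  have bd1: "finite_measure ?K" by (rule young_boundary(1)[OF Y \<psi>(1,2)])
  have bd2: "(\<lambda>x. x) \<in> ?K \<rightarrow>\<^sub>M borel" by (rule young_boundary(2)[OF Y \<psi>(1,2)])
  have bd3: "integrable ?K b" unfolding b_def by (rule young_boundary(3)[OF Y \<psi>(1,2)])
  have bd4: "integrable ?K \<Psi>" unfolding \<Psi>_def by (rule young_boundary(4)[OF Y \<psi>(1,2)])
  have bd5: "w \<bullet> b y \<le> \<Psi> y" if "\<And>\<eta>. \<eta> \<in> sphere 0 1 \<Longrightarrow> w \<bullet> \<eta> \<le> \<psi> \<eta>" for w y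
    unfolding b_def \<Psi>_def by (rule young_boundary(5)[OF Y \<psi>(1,2) that])
  note yc1 = yc[unfolded young_conditions_def prod.case, THEN conjunct1]
  note yc2' = yc[unfolded young_conditions_def prod.case, THEN conjunct2]
  note yc2 = yc2'[THEN conjunct1] and yc3' = yc2'[THEN conjunct2]
  note yc3 = yc3'[THEN conjunct1] and yc4' = yc3'[THEN conjunct2]
  note yc4 = yc4'[THEN conjunct1] and yc5 = yc4'[THEN conjunct2]
  have y1: "(LINT x:\<Omega>|lebesgue. v x * \<phi> x) = - (LINT x:\<Omega>|lebesgue. (LINT A|\<nu> x. q A) \<bullet> grad \<phi> x)" if "\<phi> \<in> test_functions \<Omega>" for \<phi>
    using yc1 that by blast
  have y2: "BV_deriv \<Omega> u B = (LINT x:B|lebesgue. LINT A|\<nu> x. A) + (LINT x:B|?K. LINT A|\<nu>' x. A)" if "B \<in> sets borel" "B \<subseteq> \<Omega>" for B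
    using yc2 that by blast
  obtain g where g: "is_trace \<Omega> u g" "\<And>B. B \<in> sets borel \<Longrightarrow> B \<subseteq> closure \<Omega> \<Longrightarrow>
          (LINT x:B \<inter> frontier \<Omega>|?K. LINT A|\<nu>' x. A) =
           - (LINT x:B \<inter> frontier \<Omega>|hausdorff_measure (DIM('a) - 1). g x *\<^sub>R outer_normal \<Omega> x)"
    using yc3 by blast
  have y4: "AE x in lebesgue_on \<Omega>. msupport (\<nu> x) \<subseteq> ?G"
    by (rule yc4)
  obtain m where m: "is_pairing_measure \<Omega> \<Omega>' (\<lambda>x. LINT A|\<nu> x. q A) v u m" "\<And>B. B \<in> sets borel \<Longrightarrow> B \<subseteq> closure \<Omega> \<Longrightarrow> m B \<ge>
           (LINT x:B \<inter> \<Omega>|lebesgue. LINT A|\<nu> x. q A \<bullet> A) +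
           (LINT x:B|?K. LINT A|\<nu>' x. recession \<Omega> (\<lambda>x A. q A \<bullet> A) x A)"
    using yc5 by blast
  have supp: "AE x in lborel. x \<in> \<Omega> \<longrightarrow> (AE A in \<nu> x. A \<in> ?G)"
  proof -
    have "AE x in lborel. x \<in> \<Omega> \<longrightarrow> msupport (\<nu> x) \<subseteq> ?G" using y4 by (simp add: AE_lebesgue_on_iff[OF \<Omega>b])
    then show ?thesis
    proof eventually_elim
      case (elim x)
      show ?case
      proof
        assume x: "x \<in> \<Omega>"
        then have "AE A in \<nu> x. A \<in> msupport (\<nu> x)" using D(1)[OF x] by (intro AE_msupport) simp
        then show "AE A in \<nu> x. A \<in> ?G" by eventually_elim (use elim x in blast)
      qed
    qed
  qed
  have \<nu>: "AE x in lborel. x \<in> \<Omega> \<longrightarrow> prob_space (\<nu> x) \<and> integrable (\<nu> x) (\<lambda>A. A) \<and> integrable (\<nu> x) q \<and>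
      integrable (\<nu> x) (\<lambda>A. q A \<bullet> A) \<and> (AE A in \<nu> x. A \<in> ?G) \<and>
      z x = (LINT A|\<nu> x. q A) \<and> a x = (LINT A|\<nu> x. A) \<and> Q x = (LINT A|\<nu> x. q A \<bullet> A)"
    using rep supp by eventually_elim (use D(1) in auto)
  \<comment> \<open>Almost every A for \<open>\<nu> x\<close> is a contact point, so (SH4) can be
    averaged over \<open>\<nu> x\<close>, a probability measure.\<close>
  have z_le: "AE x in lborel. x \<in> \<Omega> \<longrightarrow> (\<forall>\<eta>\<in>sphere 0 1. z x \<bullet> \<eta> \<le> \<psi> \<eta>)"
    using \<nu>
  proof eventually_elim
    case (elim x)
    show ?case
    proof (intro impI ballI)
      fix \<eta> :: 'a assume x: "x \<in> \<Omega>" and \<eta>: "\<eta> \<in> sphere 0 1"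
      interpret prob_space "\<nu> x" using elim x by simp
      have i: "integrable (\<nu> x) q" using elim x by simp
      have "z x \<bullet> \<eta> = (LINT A|\<nu> x. q A) \<bullet> \<eta>" using elim x by simp
      also have "\<dots> = (LINT A|\<nu> x. q A \<bullet> \<eta>)" by (rule integral_inner_left[symmetric]) (rule i)
      also have "\<dots> \<le> (LINT A|\<nu> x. \<psi> \<eta>)"
      proof (rule integral_mono_AE)
        have "AE A in \<nu> x. A \<in> ?G" using elim x by simp
        then show "AE A in \<nu> x. q A \<bullet> \<eta> \<le> \<psi> \<eta>" by eventually_elim (use q_le[OF \<eta>] in simp)
      qed (use i in auto)
      finally show "z x \<bullet> \<eta> \<le> \<psi> \<eta>" by (simp add: prob_space)
    qed
  qed
  have iu: "integrable lborel u'" "integrable lborel (\<lambda>x. (u' x)\<^sup>2)"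
  proof -
    show "integrable lborel u'" using u(1) integrable_lebesgue_on_iff[OF u' \<Omega>b] by (simp add: BV_def)
    have "integrable (lebesgue_on \<Omega>) (\<lambda>x. (u x)\<^sup>2)" using u(2) by (simp add: L2_def)
    moreover have "AE x in lborel. x \<in> \<Omega> \<longrightarrow> (u' x)\<^sup>2 = (u x)\<^sup>2" using u'(3) by eventually_elim auto
    ultimately show "integrable lborel (\<lambda>x. (u' x)\<^sup>2)"
      using integrable_lebesgue_on_iff[of "\<lambda>x. (u' x)\<^sup>2" \<Omega> "\<lambda>x. (u x)\<^sup>2"] u'(1,2) \<Omega>b by simp
  qed
  have GG: "(LINT x|lborel. u' x *\<^sub>R grad \<phi> x) = - (LINT x|lborel. \<phi> x *\<^sub>R a x) - (LINT x|?K. \<phi> x *\<^sub>R b x)" if "Ck 1 \<phi>" for \<phi>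
    unfolding b_def
    by (rule young_Gauss_Green[OF \<Omega>o(1,2) u(1) u' a(1,2) rep(2) a(3) bd2 bd3[unfolded b_def] y2 g that])
  have div: "(LINT x|lborel. v' x * \<phi> x) = - (LINT x|lborel. z x \<bullet> grad \<phi> x)" if \<phi>: "\<phi> \<in> test_functions \<Omega>" for \<phi>
  proof -
    have s: "smooth \<phi>" by (rule test_functionsD(1)[OF \<phi>])
    have [measurable]: "\<phi> \<in> borel_measurable borel" "grad \<phi> \<in> borel_measurable borel"
      using smooth_borel[OF s] borel_measurable_continuous_onI[OF continuous_grad[OF smooth_Ck[OF s]]] .
    have "(LINT x:\<Omega>|lebesgue. v x * \<phi> x) = (LINT x|lborel. v' x * \<phi> x)"
    proof (rule set_integral_lebesgue_eq)
      show "AE x in lborel. x \<in> \<Omega> \<longrightarrow> v' x * \<phi> x = v x * \<phi> x" using v'(3) by eventually_elim auto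
    qed (use v' in auto)
    moreover have "(LINT x:\<Omega>|lebesgue. (LINT A|\<nu> x. q A) \<bullet> grad \<phi> x) = (LINT x|lborel. z x \<bullet> grad \<phi> x)"
    proof (rule set_integral_lebesgue_eq)
      show "AE x in lborel. x \<in> \<Omega> \<longrightarrow> z x \<bullet> grad \<phi> x = (LINT A|\<nu> x. q A) \<bullet> grad \<phi> x" using rep(1) by eventually_elim auto
    qed (use z in auto)
    ultimately show ?thesis using y1[OF \<phi>] by simp
  qed
  \<comment> \<open>The JF inequality is evaluated on the single set B = closure \<Omega>, where the
    pairing measure equals minus the integral of u v.\<close>
  have energy: "(LINT x|lborel. Q x) + (LINT y|?K. \<Psi> y) \<le> - (LINT x|lborel. v' x * u' x)"
  proof -
    have sub: "closure \<Omega> \<inter> \<Omega> = \<Omega>" using closure_subset by blast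
    have "(LINT x:\<Omega>|lebesgue. LINT A|\<nu> x. q A \<bullet> A) = (LINT x|lborel. Q x)"
      by (rule set_integral_lebesgue_eq[OF Q(1,2) rep(3)])
    moreover have "(LINT x:closure \<Omega>|?K. LINT A|\<nu>' x. recession \<Omega> (\<lambda>x A. q A \<bullet> A) x A) = (LINT y|?K. \<Psi> y)"
      unfolding set_lebesgue_integral_def \<Psi>_def
    proof (intro Bochner_Integration.integral_cong refl)
      fix y
      show "indicator (closure \<Omega>) y *\<^sub>R (LINT A|\<nu>' y. recession \<Omega> (\<lambda>x A. q A \<bullet> A) y A) = indicator (closure \<Omega>) y * (LINT A|\<nu>' y. \<psi> A)"
        using young_recession_integral[OF Y, of y \<psi> "recession \<Omega> (\<lambda>x A. q A \<bullet> A) y"] \<psi>(1,3) by (cases "y \<in> closure \<Omega>") auto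
    qed
    moreover have "m (closure \<Omega>) = - (LINT x:\<Omega>|lebesgue. u x * v x)"
      by (rule pairing_measure_closure[OF m(1) \<Omega>o(1,2) \<Omega>'o \<Omega>'(2) \<Omega>o(3)])
    moreover have "(LINT x:\<Omega>|lebesgue. u x * v x) = (LINT x|lborel. v' x * u' x)"
    proof (rule set_integral_lebesgue_eq)
      show "AE x in lborel. x \<in> \<Omega> \<longrightarrow> v' x * u' x = u x * v x" using u'(3) v'(3) by eventually_elim (auto simp: mult.commute)
    qed (use u' v' in auto)
    ultimately show ?thesis using m(2)[of "closure \<Omega>"] sub by simp
  qed
  have off: "b x = 0" "\<Psi> x = 0" if "x \<notin> closure \<Omega>" for x using that by (auto simp: b_def \<Psi>_def)
  have "young_slice \<Omega> q \<psi> ?G \<nu> u' v' z a Q ?K b \<Psi> \<Lambda>"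
    by (rule young_slice.intro[OF \<Omega>o(1,2) \<Omega>(2) u'(1,2) iu v'(1,2,4,5) a z Q bd1 bd2 bd3 off(1) bd4 off(2) GG div bd5 z_le \<nu> energy])
  then show ?thesis by blast
qed

section \<open>Weak time derivatives\<close>

text \<open>The kernel is the derivative of S(c (\<tau> - a)); it lives on [a, a + 1/c] and has mass
  S(1) - S(0) = 1. Averaging g with it therefore sees only values to the right of a.\<close>

lemma step_kernel_approx:
  fixes g \<sigma> S :: "real \<Rightarrow> real"
  assumes S: "\<And>x. (S has_real_derivative \<sigma> x) (at x)" "\<And>x. x \<le> 0 \<Longrightarrow> S x = 0" "\<And>x. 1 \<le> x \<Longrightarrow> S x = 1"
    and \<sigma>: "continuous_on UNIV \<sigma>" "\<And>x. 0 \<le> \<sigma> x" "\<And>x. x \<le> 0 \<or> 1 \<le> x \<Longrightarrow> \<sigma> x = 0"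
    and c: "c > 0" and g: "continuous_on UNIV g" and e: "\<And>\<tau>. a \<le> \<tau> \<Longrightarrow> \<tau> \<le> a + 1 / c \<Longrightarrow> \<bar>g \<tau> - g a\<bar> \<le> e"
  shows "integrable lborel (\<lambda>\<tau>. g \<tau> * (c * \<sigma> (c * (\<tau> - a))))"
    and "\<bar>(LINT \<tau>|lborel. g \<tau> * (c * \<sigma> (c * (\<tau> - a)))) - g a\<bar> \<le> e"
proof -
  let ?k = "\<lambda>\<tau>. c * \<sigma> (c * (\<tau> - a))"
  have kc: "continuous_on UNIV ?k"
    by (intro continuous_intros continuous_on_compose2[OF \<sigma>(1)]) auto
  have k0: "?k \<tau> = 0" if "\<tau> \<notin> {a..a + 1/c}" for \<tau>
  proof -
    have "c * (\<tau> - a) \<le> 0 \<or> 1 \<le> c * (\<tau> - a)"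
    proof (cases "\<tau> < a")
      case True
      then have "c * (\<tau> - a) \<le> 0" using c by (intro mult_nonneg_nonpos) auto
      then show ?thesis ..
    next
      case False
      then have "a + 1/c \<le> \<tau>" using that by auto
      then show ?thesis using c by (simp add: field_simps)
    qed
    then show ?thesis using \<sigma>(3) by simp
  qed
  have bi: "has_bochner_integral lborel (\<lambda>\<tau>. ?k \<tau> * indicator {a..a + 1/c} \<tau>) (S (c * (a + 1/c - a)) - S (c * (a - a)))"
  proof (rule has_bochner_integral_FTC_Icc_real)
    show "((\<lambda>\<tau>. S (c * (\<tau> - a))) has_real_derivative ?k \<tau>) (at \<tau>)" for \<tau>
      by (rule DERIV_chain'[where f="\<lambda>\<tau>. c * (\<tau> - a)" and g=S and D=c, THEN DERIV_cong]) (auto intro!: derivative_eq_intros S(1))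
    show "isCont ?k \<tau>" for \<tau> using kc by (simp add: continuous_on_eq_continuous_at)
  qed (use c in simp)
  have eqk: "?k \<tau> * indicator {a..a + 1/c} \<tau> = ?k \<tau>" for \<tau> using k0[of \<tau>] by (cases "\<tau> \<in> {a..a + 1/c}") auto
  have ik: "integrable lborel ?k" "(LINT \<tau>|lborel. ?k \<tau>) = 1"
    using bi c S(2)[of 0] S(3)[of 1] unfolding eqk has_bochner_integral_iff by auto
  have [measurable]: "g \<in> borel_measurable borel" "?k \<in> borel_measurable borel"
    using g kc by (auto intro: borel_measurable_continuous_onI)
  have knn: "0 \<le> ?k \<tau>" for \<tau> using c \<sigma>(2) by simp
  have le: "\<bar>(g \<tau> - g a) * ?k \<tau>\<bar> \<le> e * ?k \<tau>" for \<tau>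
  proof (cases "\<tau> \<in> {a..a + 1/c}")
    case True
    then show ?thesis
      using mult_right_mono[OF e knn, of \<tau> \<tau>] unfolding abs_mult[of _ "?k \<tau>"] abs_of_nonneg[OF knn] by simp
  next
    case False
    then show ?thesis unfolding k0[OF False] by simp
  qed
  have i: "integrable lborel (\<lambda>\<tau>. (g \<tau> - g a) * ?k \<tau>)"
    by (rule Bochner_Integration.integrable_bound[of _ "\<lambda>\<tau>. e * ?k \<tau>"])
      (use ik le in \<open>auto intro!: order_trans[OF _ abs_ge_self]\<close>)
  have "integrable lborel (\<lambda>\<tau>. (g \<tau> - g a) * ?k \<tau> + g a * ?k \<tau>)" using i ik(1) by simp
  then show int: "integrable lborel (\<lambda>\<tau>. g \<tau> * ?k \<tau>)" by (simp add: algebra_simps)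
  have "(LINT \<tau>|lborel. g \<tau> * ?k \<tau>) - g a = (LINT \<tau>|lborel. g \<tau> * ?k \<tau>) - (LINT \<tau>|lborel. g a * ?k \<tau>)"
    using ik(2) by (simp only: integral_mult_right_zero mult_1_right)
  also have "\<dots> = (LINT \<tau>|lborel. g \<tau> * ?k \<tau> - g a * ?k \<tau>)"
    by (rule Bochner_Integration.integral_diff[symmetric, OF int]) (use ik(1) in simp)
  also have "\<dots> = (LINT \<tau>|lborel. (g \<tau> - g a) * ?k \<tau>)" by (simp only: left_diff_distrib)
  also have "\<bar>\<dots>\<bar> \<le> (LINT \<tau>|lborel. e * ?k \<tau>)"
    by (rule integral_abs_bound[THEN order_trans], rule integral_mono) (use i ik le in auto)
  also have "\<dots> = e" using ik(2) by (simp only: integral_mult_right_zero mult_1_right)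
  finally show "\<bar>(LINT \<tau>|lborel. g \<tau> * ?k \<tau>) - g a\<bar> \<le> e" .
qed

text \<open>The test functions approximate the indicator of an interval by smooth steps of width 1/n
  at s and at t. Their derivatives are two one-sided approximate deltas, which pick out g s and g t
  by continuity.\<close>

lemma weak_derivative_imp_integral:
  fixes g h :: "real \<Rightarrow> real"
  assumes g: "continuous_on UNIV g" and h: "integrable lborel h"
    and weak: "\<And>\<eta>. \<eta> \<in> test_functions {0<..<T} \<Longrightarrow> (LINT \<tau>|lborel. g \<tau> * frechet_derivative \<eta> (at \<tau>) 1) = - (LINT \<tau>|lborel. h \<tau> * \<eta> \<tau>)"
    and st: "0 < s" "s < t" "t < T"
  shows "g t - g s = (LINT \<tau>|lborel. indicator {s<..t} \<tau> * h \<tau>)"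
proof -
  obtain S \<sigma> :: "real \<Rightarrow> real" where S: "smooth S" "smooth \<sigma>" "\<And>x. (S has_real_derivative \<sigma> x) (at x)"
    "\<And>x. 0 \<le> \<sigma> x" "\<And>x. x \<le> 0 \<Longrightarrow> S x = 0" "\<And>x. 1 \<le> x \<Longrightarrow> S x = 1" "\<And>x. 0 \<le> S x" "\<And>x. S x \<le> 1"
    "\<And>x. x \<le> 0 \<or> 1 \<le> x \<Longrightarrow> \<sigma> x = 0" by (rule smooth_step_exists) (rule that)
  have \<sigma>c: "continuous_on UNIV \<sigma>" by (rule Ck_continuous[OF smooth_Ck[OF S(2)]])
  have [measurable]: "S \<in> borel_measurable borel" "h \<in> borel_measurable borel"
    using smooth_borel[OF S(1)] h by auto
  define \<eta> where "\<eta> = (\<lambda>n::nat. \<lambda>\<tau>. S (real n * (\<tau> - s)) - S (real n * (\<tau> - t)))"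
  define k where "k = (\<lambda>n::nat. \<lambda>a \<tau>. real n * \<sigma> (real n * (\<tau> - a)))"
  \<comment> \<open>The step at t ends at t + 1/n; from n = M on it ends before T, as a test
    function on the open interval requires.\<close>
  obtain M where M: "M > 0" "1 / real M < T - t"
    using nat_approx_posE[of "T - t"] st by (metis diff_gt_0_iff_gt of_nat_Suc zero_less_Suc)
  have der: "((\<lambda>\<tau>. S (real n * (\<tau> - a))) has_real_derivative k n a \<tau>) (at \<tau>)" for n a \<tau>
    unfolding k_def
    by (rule DERIV_chain'[where f="\<lambda>\<tau>. real n * (\<tau> - a)" and g=S and D="real n", THEN DERIV_cong]) (auto intro!: derivative_eq_intros S(3))
  have fd: "frechet_derivative (\<eta> n) (at \<tau>) 1 = k n s \<tau> - k n t \<tau>" for n \<tau>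
  proof -
    have "(\<eta> n has_real_derivative k n s \<tau> - k n t \<tau>) (at \<tau>)"
      unfolding \<eta>_def by (rule DERIV_diff[OF der der])
    then have "frechet_derivative (\<eta> n) (at \<tau>) = (*) (k n s \<tau> - k n t \<tau>)"
      unfolding has_field_derivative_def by (rule frechet_derivative_at[symmetric])
    then show ?thesis by simp
  qed
  have test: "\<eta> n \<in> test_functions {0<..<T}" if n: "n \<ge> M" for n
  proof (rule test_functionsI)
    have "smooth (\<lambda>\<tau>. S (real n * (\<tau> - a)))" for a
      unfolding smooth_def
    proof
      fix j show "Ck j (\<lambda>\<tau>. S (real n * (\<tau> - a)))"
        using Ck_affine[OF bounded_linear_mult_right[of "real n"] smooth_Ck[OF S(1)], of j "- real n * a"] 
        by (simp add: right_diff_distrib)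
    qed
    then show "smooth (\<eta> n)" unfolding \<eta>_def by (intro smooth_diff)
    have n0: "real n > 0" using n M(1) by simp
    show "{\<tau>. \<eta> n \<tau> \<noteq> 0} \<subseteq> {s..t + 1 / real n}"
    proof clarify
      fix \<tau> assume ne: "\<eta> n \<tau> \<noteq> 0"
      show "\<tau> \<in> {s..t + 1 / real n}"
      proof (rule ccontr)
        assume "\<tau> \<notin> {s..t + 1 / real n}"
        then consider "\<tau> < s" | "t + 1 / real n < \<tau>" by force
        then have "\<eta> n \<tau> = 0"
        proof cases
          case 1
          then have "real n * (\<tau> - s) \<le> 0" "real n * (\<tau> - t) \<le> 0" using n0 st by (auto intro!: mult_nonneg_nonpos)
          then show ?thesis using S(5) by (simp add: \<eta>_def)
        next
          case 2
          then have "1 \<le> real n * (\<tau> - t)" using n0 by (simp add: field_simps)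
          moreover have "real n * (\<tau> - t) \<le> real n * (\<tau> - s)" using n0 st by (intro mult_left_mono) auto
          ultimately show ?thesis using S(6)[of "real n * (\<tau> - t)"] S(6)[of "real n * (\<tau> - s)"] by (simp add: \<eta>_def)
        qed
        then show False using ne by simp
      qed
    qed
    have "1 / real n \<le> 1 / real M" using n M(1) by (simp add: frac_le)
    then show "{s..t + 1 / real n} \<subseteq> {0<..<T}" using M st by auto
  qed simp
  have glim: "(\<lambda>n. LINT \<tau>|lborel. g \<tau> * k n a \<tau>) \<longlonglongrightarrow> g a" for a
  proof (rule LIMSEQ_I)
    fix e :: real assume e: "e > 0"
    have "isCont g a" using g by (simp add: continuous_on_eq_continuous_at)
    then obtain d where d: "d > 0" "\<And>\<tau>. \<bar>\<tau> - a\<bar> < d \<Longrightarrow> \<bar>g \<tau> - g a\<bar> < e / 2"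
      using e unfolding continuous_at_eps_delta dist_real_def by (metis half_gt_zero)
    obtain N where N: "N > 0" "1 / real N < d" using nat_approx_posE[OF d(1)] by (metis of_nat_Suc zero_less_Suc)
    show "\<exists>N. \<forall>n\<ge>N. norm ((LINT \<tau>|lborel. g \<tau> * k n a \<tau>) - g a) < e"
    proof (intro exI[of _ N] allI impI)
      fix n assume n: "n \<ge> N"
      have "1 / real n \<le> 1 / real N" using n N(1) by (simp add: frac_le)
      then have "\<bar>(LINT \<tau>|lborel. g \<tau> * k n a \<tau>) - g a\<bar> \<le> e / 2"
        unfolding k_def using n N
        by (intro step_kernel_approx(2)[OF S(3,5,6) \<sigma>c S(4,9) _ g] less_imp_le[OF d(2)]) auto
      then show "norm ((LINT \<tau>|lborel. g \<tau> * k n a \<tau>) - g a) < e" using e by simp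
    qed
  qed
  have gint: "integrable lborel (\<lambda>\<tau>. g \<tau> * k n a \<tau>)" if "n > 0" for n a
  proof -
    have "compact (g ` {a..a + 1 / real n})" using g by (intro compact_continuous_image) (auto intro: continuous_on_subset)
    then have "bounded (g ` {a..a + 1 / real n})" by (rule compact_imp_bounded)
    then obtain B where "\<forall>y\<in>g ` {a..a + 1 / real n}. norm y \<le> B" unfolding bounded_iff by blast
    then have B: "\<And>\<tau>. \<tau> \<in> {a..a + 1 / real n} \<Longrightarrow> \<bar>g \<tau>\<bar> \<le> B" by auto
    \<comment> \<open>Here the approximation lemma serves integrability alone, so any finite
      oscillation bound will do.\<close>
    have "\<bar>g \<tau> - g a\<bar> \<le> 2 * B" if "a \<le> \<tau>" "\<tau> \<le> a + 1 / real n" for \<tau>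
      using B[of \<tau>] B[of a] that by (auto simp: abs_le_iff)
    then show ?thesis unfolding k_def using that
      by (intro step_kernel_approx(1)[OF S(3,5,6) \<sigma>c S(4,9) _ g]) auto
  qed
  have "(\<lambda>n. (LINT \<tau>|lborel. g \<tau> * k n s \<tau>) - (LINT \<tau>|lborel. g \<tau> * k n t \<tau>)) \<longlonglongrightarrow> g s - g t"
    by (intro tendsto_diff glim)
  moreover have "\<forall>\<^sub>F n in sequentially. (LINT \<tau>|lborel. g \<tau> * k n s \<tau>) - (LINT \<tau>|lborel. g \<tau> * k n t \<tau>) = - (LINT \<tau>|lborel. h \<tau> * \<eta> n \<tau>)"
    using eventually_ge_at_top[of M]
  proof eventually_elim
    case (elim n)
    then have "n > 0" using M by simp
    then have "(LINT \<tau>|lborel. g \<tau> * (k n s \<tau> - k n t \<tau>)) = (LINT \<tau>|lborel. g \<tau> * k n s \<tau>) - (LINT \<tau>|lborel. g \<tau> * k n t \<tau>)"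
      unfolding right_diff_distrib by (intro Bochner_Integration.integral_diff gint)
    then show ?case using weak[OF test[OF elim]] unfolding fd by simp
  qed
  ultimately have l1: "(\<lambda>n. - (LINT \<tau>|lborel. h \<tau> * \<eta> n \<tau>)) \<longlonglongrightarrow> g s - g t" by (rule Lim_transform_eventually)
  have "(\<lambda>n. LINT \<tau>|lborel. h \<tau> * \<eta> n \<tau>) \<longlonglongrightarrow> (LINT \<tau>|lborel. indicator {s<..t} \<tau> * h \<tau>)"
  proof (rule integral_dominated_convergence[where w="\<lambda>\<tau>. norm (h \<tau>)"])
    show "AE \<tau> in lborel. (\<lambda>n. h \<tau> * \<eta> n \<tau>) \<longlonglongrightarrow> indicator {s<..t} \<tau> * h \<tau>"
    proof (rule AE_I2)
      fix \<tau>
      \<comment> \<open>At \<tau> = a the limit is 0 because S 0 = 0. This is why the limit interval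
        is open at s and closed at t.\<close>
      have Sl: "(\<lambda>n. S (real n * (\<tau> - a))) \<longlonglongrightarrow> (if a < \<tau> then 1 else 0)" for a
      proof (cases "a < \<tau>")
        case True
        then obtain N where N: "1 / (\<tau> - a) \<le> real N" using real_arch_simple by blast
        have "S (real n * (\<tau> - a)) = 1" if "n \<ge> N" for n
        proof (rule S(6))
          have "1 / (\<tau> - a) \<le> real n" using N that by linarith
          then show "1 \<le> real n * (\<tau> - a)" using True by (simp add: field_simps)
        qed
        then show ?thesis using True by (intro tendsto_eventually) (auto simp: eventually_sequentially)
      next
        case False
        then have "S (real n * (\<tau> - a)) = 0" for n by (intro S(5) mult_nonneg_nonpos) auto
        then show ?thesis using False by simp
      qed
      have "(\<lambda>n. h \<tau> * \<eta> n \<tau>) \<longlonglongrightarrow> h \<tau> * ((if s < \<tau> then 1 else 0) - (if t < \<tau> then 1 else 0))"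
        unfolding \<eta>_def by (intro tendsto_mult tendsto_diff tendsto_const Sl)
      moreover have "h \<tau> * ((if s < \<tau> then 1 else 0) - (if t < \<tau> then 1 else 0)) = indicator {s<..t} \<tau> * h \<tau>"
        using st by (auto simp: indicator_def)
      ultimately show "(\<lambda>n. h \<tau> * \<eta> n \<tau>) \<longlonglongrightarrow> indicator {s<..t} \<tau> * h \<tau>" by simp
    qed
    show "AE \<tau> in lborel. norm (h \<tau> * \<eta> n \<tau>) \<le> norm (h \<tau>)" for n
    proof (rule AE_I2)
      fix \<tau>
      have "\<bar>\<eta> n \<tau>\<bar> \<le> 1"
        using S(7)[of "real n * (\<tau> - s)"] S(8)[of "real n * (\<tau> - s)"] S(7)[of "real n * (\<tau> - t)"] S(8)[of "real n * (\<tau> - t)"]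
        unfolding \<eta>_def by linarith
      then show "norm (h \<tau> * \<eta> n \<tau>) \<le> norm (h \<tau>)" by (simp add: abs_mult mult_left_le)
    qed
    show "integrable lborel (\<lambda>\<tau>. norm (h \<tau>))" using h by simp
    show "(\<lambda>\<tau>. h \<tau> * \<eta> n \<tau>) \<in> borel_measurable lborel" for n unfolding \<eta>_def by measurable
  qed measurable
  from tendsto_minus[OF this] l1 have "g s - g t = - (LINT \<tau>|lborel. indicator {s<..t} \<tau> * h \<tau>)"
    using LIMSEQ_unique by blast
  then show ?thesis by simp
qed

lemma test_function_product:
  fixes \<phi> :: "'a::euclidean_space \<Rightarrow> real" and \<eta> :: "real \<Rightarrow> real"
  assumes \<phi>: "\<phi> \<in> test_functions \<Omega>" and \<eta>: "\<eta> \<in> test_functions I"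
  shows "(\<lambda>p. \<phi> (fst p) * \<eta> (snd p)) \<in> test_functions (\<Omega> \<times> I)"
    and "frechet_derivative (\<lambda>p. \<phi> (fst p) * \<eta> (snd p)) (at p) (0, 1) = \<phi> (fst p) * frechet_derivative \<eta> (at (snd p)) 1"
proof -
  show "(\<lambda>p. \<phi> (fst p) * \<eta> (snd p)) \<in> test_functions (\<Omega> \<times> I)"
  proof (rule test_functionsI)
    have "smooth (\<lambda>p::'a \<times> real. \<phi> (fst p))" "smooth (\<lambda>p::'a \<times> real. \<eta> (snd p))"
      unfolding smooth_def
      using Ck_affine[OF bounded_linear_fst smooth_Ck[OF test_functionsD(1)[OF \<phi>]], of _ 0] 
        Ck_affine[OF bounded_linear_snd smooth_Ck[OF test_functionsD(1)[OF \<eta>]], of _ 0] by auto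
    then show "smooth (\<lambda>p. \<phi> (fst p) * \<eta> (snd p))" by (intro smooth_mult)
    show "{p. \<phi> (fst p) * \<eta> (snd p) \<noteq> 0} \<subseteq> closure {x. \<phi> x \<noteq> 0} \<times> closure {x. \<eta> x \<noteq> 0}"
      using closure_subset[of "{x. \<phi> x \<noteq> 0}"] closure_subset[of "{x. \<eta> x \<noteq> 0}"] by auto
  qed (use \<phi> \<eta> in \<open>auto simp: test_functions_def intro: compact_Times\<close>)
  have d\<phi>: "(\<phi> has_derivative frechet_derivative \<phi> (at (fst p))) (at (fst p))"
    using smooth_differentiable[OF test_functionsD(1)[OF \<phi>]] frechet_derivative_works by blast
  have d\<eta>: "(\<eta> has_derivative frechet_derivative \<eta> (at (snd p))) (at (snd p))"
    using smooth_differentiable[OF test_functionsD(1)[OF \<eta>]] frechet_derivative_works by blast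
  have "((\<lambda>p. \<phi> (fst p) * \<eta> (snd p)) has_derivative
     (\<lambda>h. \<phi> (fst p) * frechet_derivative \<eta> (at (snd p)) (snd h) + frechet_derivative \<phi> (at (fst p)) (fst h) * \<eta> (snd p))) (at p)"
    by (intro has_derivative_mult has_derivative_compose[OF has_derivative_fst[OF has_derivative_ident] d\<phi>]
        has_derivative_compose[OF has_derivative_snd[OF has_derivative_ident] d\<eta>])
  from frechet_derivative_at[OF this, symmetric]
  have "frechet_derivative (\<lambda>p. \<phi> (fst p) * \<eta> (snd p)) (at p) (0, 1) =
    \<phi> (fst p) * frechet_derivative \<eta> (at (snd p)) 1 + frechet_derivative \<phi> (at (fst p)) 0 * \<eta> (snd p)" by simp
  then show "frechet_derivative (\<lambda>p. \<phi> (fst p) * \<eta> (snd p)) (at p) (0, 1) = \<phi> (fst p) * frechet_derivative \<eta> (at (snd p)) 1"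
    using linear_0[OF has_derivative_linear[OF d\<phi>]] by simp
qed

section \<open>Decay of the energy\<close>

definition norm2 :: "('a::euclidean_space \<Rightarrow> real) \<Rightarrow> real" where
  "norm2 f = sqrt (LINT x|lborel. (f x)\<^sup>2)"

text \<open>L2 functions as Borel functions extended by 0, so that differences, pairings and slices
  are all taken over \<open>lborel\<close> on the whole space.\<close>

definition sq_int :: "'a::euclidean_space set \<Rightarrow> ('a \<Rightarrow> real) \<Rightarrow> bool" where
  "sq_int \<Omega> f \<longleftrightarrow> f \<in> borel_measurable borel \<and> (\<forall>x. x \<notin> \<Omega> \<longrightarrow> f x = 0) \<and> integrable lborel (\<lambda>x. (f x)\<^sup>2)"

lemma norm2_nonneg: "0 \<le> norm2 f" by (simp add: norm2_def)

lemma norm2_square: "(norm2 f)\<^sup>2 = (LINT x|lborel. (f x)\<^sup>2)" by (simp add: norm2_def)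

lemma sq_intD:
  assumes "sq_int \<Omega> f"
  shows "f \<in> borel_measurable borel" "x \<notin> \<Omega> \<Longrightarrow> f x = 0" "integrable lborel (\<lambda>x. (f x)\<^sup>2)"
  using assms by (auto simp: sq_int_def)

lemma sq_int_integrable_mult:
  assumes "sq_int \<Omega> f" "sq_int \<Omega> g"
  shows "integrable lborel (\<lambda>x. f x * g x)" "\<bar>LINT x|lborel. f x * g x\<bar> \<le> norm2 f * norm2 g"
    "(LINT x|lborel. \<bar>f x * g x\<bar>) \<le> norm2 f * norm2 g"
proof -
  have [measurable]: "f \<in> borel_measurable lborel" "g \<in> borel_measurable lborel" and i: "integrable lborel (\<lambda>x. (f x)\<^sup>2)" "integrable lborel (\<lambda>x. (g x)\<^sup>2)"
    using assms by (auto simp: sq_int_def)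
  show "integrable lborel (\<lambda>x. f x * g x)" by (rule integrable_mult_L2[OF _ _ i]) auto
  have "(LINT x|lborel. f x * g x)\<^sup>2 \<le> (norm2 f * norm2 g)\<^sup>2" "(LINT x|lborel. \<bar>f x * g x\<bar>)\<^sup>2 \<le> (norm2 f * norm2 g)\<^sup>2"
    unfolding power_mult_distrib norm2_square 
    by (rule Cauchy_Schwarz_integral[OF _ _ i] Cauchy_Schwarz_integral_abs[OF _ _ i]; simp)+
  then show "\<bar>LINT x|lborel. f x * g x\<bar> \<le> norm2 f * norm2 g" "(LINT x|lborel. \<bar>f x * g x\<bar>) \<le> norm2 f * norm2 g"
    using norm2_nonneg[of f] norm2_nonneg[of g] abs_le_square_iff[of _ "norm2 f * norm2 g"]
    by (auto intro: power2_le_imp_le)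
qed

lemma sq_int_add: "sq_int \<Omega> f \<Longrightarrow> sq_int \<Omega> g \<Longrightarrow> sq_int \<Omega> (\<lambda>x. f x + g x)"
  and sq_int_diff: "sq_int \<Omega> f \<Longrightarrow> sq_int \<Omega> g \<Longrightarrow> sq_int \<Omega> (\<lambda>x. f x - g x)"
proof -
  assume fg: "sq_int \<Omega> f" "sq_int \<Omega> g"
  have i: "integrable lborel (\<lambda>x. f x * g x)" by (rule sq_int_integrable_mult[OF fg])
  have "(f x + g x)\<^sup>2 = (f x)\<^sup>2 + (g x)\<^sup>2 + 2 * (f x * g x)" "(f x - g x)\<^sup>2 = (f x)\<^sup>2 + (g x)\<^sup>2 - 2 * (f x * g x)" for x
    by (simp_all add: power2_eq_square algebra_simps)
  then show "sq_int \<Omega> (\<lambda>x. f x + g x)" "sq_int \<Omega> (\<lambda>x. f x - g x)"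
    using fg i by (auto simp: sq_int_def)
qed

lemma sq_int_integrable:
  assumes "sq_int \<Omega> f" "open \<Omega>" "bounded \<Omega>"
  shows "integrable lborel f"
proof (rule Bochner_Integration.integrable_bound)
  show "integrable lborel (\<lambda>x. indicator \<Omega> x + (f x)\<^sup>2 :: real)"
    using assms emeasure_bounded_finite[OF assms(3)]
    by (intro Bochner_Integration.integrable_add integrable_real_indicator) (auto simp: sq_int_def)
  have "\<bar>f x\<bar> \<le> 1 + (f x)\<^sup>2" for x
  proof (cases "\<bar>f x\<bar> \<le> 1")
    case False
    then have "\<bar>f x\<bar> * 1 \<le> \<bar>f x\<bar> * \<bar>f x\<bar>" by (intro mult_left_mono) auto
    then show ?thesis by (simp add: power2_eq_square)
  qed (auto intro: order_trans)
  then have "\<bar>f x\<bar> \<le> indicator \<Omega> x + (f x)\<^sup>2" for x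
    using assms(1) by (cases "x \<in> \<Omega>") (auto simp: sq_int_def)
  then show "AE x in lborel. norm (f x) \<le> norm (indicator \<Omega> x + (f x)\<^sup>2 :: real)"
    by (intro AE_I2) (auto intro: order_trans[OF _ abs_ge_self])
qed (use assms in \<open>auto simp: sq_int_def\<close>)

lemma test_function_sq_int:
  assumes \<phi>: "\<phi> \<in> test_functions \<Omega>" and \<Omega>: "open \<Omega>" "bounded \<Omega>"
  shows "sq_int \<Omega> \<phi>"
proof -
  obtain B where B: "\<And>x. \<bar>\<phi> x\<bar> \<le> B" using test_functions_bounded[OF \<phi>] by metis
  have [measurable]: "\<phi> \<in> borel_measurable borel" by (rule smooth_borel[OF test_functionsD(1)[OF \<phi>]])
  have off: "\<phi> x = 0" if "x \<notin> \<Omega>" for x using test_functionsD(3)[OF \<phi>] that by blast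
  have "integrable lborel (\<lambda>x. (\<phi> x)\<^sup>2)"
  proof (rule Bochner_Integration.integrable_bound)
    show "integrable lborel (\<lambda>x. B\<^sup>2 * indicator \<Omega> x :: real)"
      using \<Omega> emeasure_bounded_finite[OF \<Omega>(2)] by (intro integrable_mult_right integrable_real_indicator) auto
    have "(\<phi> x)\<^sup>2 \<le> B\<^sup>2" for x using power_mono[OF B[of x], of 2] by simp
    then show "AE x in lborel. norm ((\<phi> x)\<^sup>2) \<le> norm (B\<^sup>2 * indicator \<Omega> x :: real)"
      using off by (intro AE_I2) (auto simp: indicator_def)
  qed measurable
  then show ?thesis using off by (auto simp: sq_int_def)
qed

lemma slice_measurable:
  fixes F :: "'a::euclidean_space \<times> real \<Rightarrow> real"
  assumes "F \<in> borel_measurable borel"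
  shows "(\<lambda>x. F (x, t)) \<in> borel_measurable borel"
  by (rule measurable_compose[OF _ assms]) (auto intro!: borel_measurable_continuous_onI continuous_intros)

lemma product_lborel:
  fixes F :: "'a::euclidean_space \<times> real \<Rightarrow> real"
  assumes F: "integrable lborel F"
  shows "AE t in lborel. integrable lborel (\<lambda>x. F (x, t))" "integrable lborel (\<lambda>t. LINT x|lborel. F (x, t))"
    "(LINT p|lborel. F p) = (LINT t|lborel. LINT x|lborel. F (x, t))"
proof -
  have "integrable (lborel \<Otimes>\<^sub>M lborel) (case_prod (\<lambda>x t. F (x, t)))" using F by (simp add: lborel_prod)
  note lborel_pair.AE_integrable_snd[OF this] lborel_pair.integrable_snd[OF this] lborel_pair.integral_snd[OF this]
  then show "AE t in lborel. integrable lborel (\<lambda>x. F (x, t))" "integrable lborel (\<lambda>t. LINT x|lborel. F (x, t))"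
    "(LINT p|lborel. F p) = (LINT t|lborel. LINT x|lborel. F (x, t))" by (simp_all add: lborel_prod)
qed

text \<open>W is the difference of two solutions and V its time derivative, both fixed up to null
  sets only. \<open>w\<close> is the representative with values at every time; it is continuous into
  L2 at every real s, so that scalar pairings with it are continuous on the whole line.\<close>

locale evolution =
  fixes \<Omega> :: "'a::euclidean_space set" and T :: real and W V :: "'a \<times> real \<Rightarrow> real" and w :: "real \<Rightarrow> 'a \<Rightarrow> real"
  assumes \<Omega>: "open \<Omega>" "bounded \<Omega>" "lipschitz_boundary \<Omega>" and T: "T > 0"
    and W: "W \<in> borel_measurable borel" "\<And>p. p \<notin> \<Omega> \<times> {0<..<T} \<Longrightarrow> W p = 0" "integrable lborel W"
    and V: "V \<in> borel_measurable borel" "\<And>p. p \<notin> \<Omega> \<times> {0<..<T} \<Longrightarrow> V p = 0" "integrable lborel V" "integrable lborel (\<lambda>p. (V p)\<^sup>2)"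
    and w: "\<And>t. sq_int \<Omega> (w t)" and w_cont: "\<And>s. ((\<lambda>t. norm2 (\<lambda>x. w t x - w s x)) \<longlongrightarrow> 0) (at s)"
    and wW: "AE t in lborel. t \<in> {0<..<T} \<longrightarrow> (AE x in lborel. w t x = W (x, t))"
    and w0: "AE x in lborel. w 0 x = 0"
    and weak: "\<And>\<phi>. \<phi> \<in> test_functions (\<Omega> \<times> {0<..<T}) \<Longrightarrow>
      (LINT p|lborel. W p * frechet_derivative \<phi> (at p) (0, 1)) = - (LINT p|lborel. V p * \<phi> p)"
    and diss: "AE t in lborel. t \<in> {0<..<T} \<longrightarrow> (LINT x|lborel. W (x, t) * V (x, t)) \<le> 0"
begin

definition E :: "real \<Rightarrow> real" where "E t = (LINT x|lborel. (V (x, t))\<^sup>2)"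
definition N :: "real \<Rightarrow> real" where "N t = norm2 (\<lambda>x. V (x, t))"

lemma E_integrable: "integrable lborel E"
  using product_lborel(2)[OF V(4)] by (simp add: E_def[abs_def])

lemma N_square: "(N t)\<^sup>2 = E t" by (simp add: N_def E_def norm2_square)

lemma E_nonneg: "0 \<le> E t" by (simp add: E_def)

lemma V_slice: "AE t in lborel. sq_int \<Omega> (\<lambda>x. V (x, t))"
  using product_lborel(1)[OF V(4)]
  by eventually_elim (use V slice_measurable[OF V(1)] in \<open>auto simp: sq_int_def\<close>)

lemma N_integrable: "integrable lborel N"
proof (rule Bochner_Integration.integrable_bound)
  show "integrable lborel (\<lambda>t. indicator {0<..<T} t + E t)"
    using E_integrable T by (intro Bochner_Integration.integrable_add integrable_real_indicator) auto
  have "N = (\<lambda>t. sqrt (E t))" by (simp add: fun_eq_iff N_def E_def norm2_def)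
  then show "N \<in> borel_measurable lborel" using E_integrable by simp
  have "\<bar>N t\<bar> \<le> indicator {0<..<T} t + E t" for t
  proof (cases "t \<in> {0<..<T}")
    case True
    have "0 \<le> (N t - 1)\<^sup>2" by simp
    then have "2 * N t \<le> 1 + E t" unfolding N_square[symmetric] by (simp add: power2_eq_square algebra_simps)
    then show ?thesis using True norm2_nonneg[of "\<lambda>x. V (x, t)"] E_nonneg[of t] by (simp add: N_def)
  next
    case False
    then have "V (x, t) = 0" for x using V(2) by auto
    then show ?thesis using False by (simp add: N_def norm2_def E_def)
  qed
  then show "AE t in lborel. norm (N t) \<le> norm (indicator {0<..<T} t + E t)"
    by (intro AE_I2) (auto intro: order_trans[OF _ abs_ge_self])
qed

lemma pairing_measurable:
  assumes "f \<in> borel_measurable borel"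
  shows "(\<lambda>t. LINT x|lborel. V (x, t) * f x) \<in> borel_measurable lborel"
proof -
  have f [measurable]: "f \<in> borel_measurable lborel" using assms by simp
  have [measurable]: "V \<in> borel_measurable (borel \<Otimes>\<^sub>M borel)" using V(1) by (simp add: borel_prod)
  have "(\<lambda>(t, x). V (x, t)) \<in> borel_measurable (lborel \<Otimes>\<^sub>M lborel)" by measurable
  then have "(\<lambda>(t, x). V (x, t) * f x) \<in> borel_measurable (lborel \<Otimes>\<^sub>M lborel)"
    by (simp add: case_prod_beta')
  then show ?thesis by (rule lborel.borel_measurable_lebesgue_integral)
qed

lemma pairing_bound: 
  assumes "sq_int \<Omega> f"
  shows "AE t in lborel. \<bar>LINT x|lborel. V (x, t) * f x\<bar> \<le> N t * norm2 f"
  using V_slice by eventually_elim (unfold N_def, rule sq_int_integrable_mult(2)[OF _ assms])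

lemma pairing_integrable:
  assumes "sq_int \<Omega> f"
  shows "integrable lborel (\<lambda>t. LINT x|lborel. V (x, t) * f x)"
proof (rule Bochner_Integration.integrable_bound)
  show "integrable lborel (\<lambda>t. N t * norm2 f)" using N_integrable by simp
  show "(\<lambda>t. LINT x|lborel. V (x, t) * f x) \<in> borel_measurable lborel" using assms by (intro pairing_measurable) (simp add: sq_int_def)
  show "AE t in lborel. norm (LINT x|lborel. V (x, t) * f x) \<le> norm (N t * norm2 f)"
    using pairing_bound[OF assms] by eventually_elim auto
qed

text \<open>Testing with products \<phi>(x) \<eta>(\<tau>) reduces the weak time derivative to that
  of the scalar function t -> integral of w(t) \<phi>, which is continuous.\<close>

lemma increment_test:
  assumes \<phi>: "\<phi> \<in> test_functions \<Omega>" and st: "0 < s" "s < t" "t < T"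
  shows "(LINT x|lborel. (w t x - w s x) * \<phi> x) = (LINT \<tau>|lborel. indicator {s<..t} \<tau> * (LINT x|lborel. V (x, \<tau>) * \<phi> x))"
proof -
  define g where "g = (\<lambda>t. LINT x|lborel. w t x * \<phi> x)"
  have sq: "sq_int \<Omega> \<phi>" by (rule test_function_sq_int[OF \<phi> \<Omega>(1,2)])
  have gd: "g t - g s = (LINT x|lborel. (w t x - w s x) * \<phi> x)" for s t
    unfolding g_def using sq_int_integrable_mult(1)[OF w sq, of t] sq_int_integrable_mult(1)[OF w sq, of s] by (simp add: left_diff_distrib)
  have gc: "continuous_on UNIV g"
  proof -
    have "(g \<longlongrightarrow> g s) (at s)" for s
    proof -
      have "((\<lambda>t. norm2 (\<lambda>x. w t x - w s x) * norm2 \<phi>) \<longlongrightarrow> 0) (at s)"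
        using tendsto_mult_right[OF w_cont, of s "norm2 \<phi>"] by simp
      then have "((\<lambda>t. g t - g s) \<longlongrightarrow> 0) (at s)"
        by (rule Lim_null_comparison[rotated]) 
          (auto simp: gd intro!: always_eventually sq_int_integrable_mult(2)[OF sq_int_diff[OF w w] sq])
      then show ?thesis by (simp add: Lim_null[symmetric])
    qed
    then show ?thesis by (simp add: continuous_on_eq_continuous_at isCont_def)
  qed
  obtain B where B: "\<And>x. \<bar>\<phi> x\<bar> \<le> B" using test_functions_bounded[OF \<phi>] by metis
  have \<phi>m: "\<phi> \<in> borel_measurable borel" by (rule smooth_borel[OF test_functionsD(1)[OF \<phi>]])
  have weak': "(LINT \<tau>|lborel. g \<tau> * frechet_derivative \<eta> (at \<tau>) 1) = - (LINT \<tau>|lborel. (LINT x|lborel. V (x, \<tau>) * \<phi> x) * \<eta> \<tau>)"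
    if \<eta>: "\<eta> \<in> test_functions {0<..<T}" for \<eta>
  proof -
    let ?d = "\<lambda>\<tau>. frechet_derivative \<eta> (at \<tau>) 1"
    have s\<eta>: "smooth \<eta>" by (rule test_functionsD(1)[OF \<eta>])
    have sd: "smooth ?d" using smooth_partial[OF s\<eta>, of 1] by simp
    obtain B1 where B1: "\<And>x. \<bar>?d x\<bar> \<le> B1"
      using bounded_of_support[OF Ck_continuous[OF smooth_Ck[OF sd]] bounded_support_partial[OF test_functionsD(2)[OF \<eta>]]] by metis
    obtain B2 where B2: "\<And>x. \<bar>\<eta> x\<bar> \<le> B2" using test_functions_bounded[OF \<eta>] by metis
    have off: "?d \<tau> = 0" if "\<tau> \<notin> {0<..<T}" for \<tau>
    proof -
      have "closure {x. \<eta> x \<noteq> 0} \<subseteq> {0<..<T}" using \<eta> by (simp add: test_functions_def)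
      then show ?thesis using support_partial[of \<eta> 1] that by blast
    qed
    have m1: "(\<lambda>p::'a \<times> real. \<phi> (fst p) * ?d (snd p)) \<in> borel_measurable borel"
      "(\<lambda>p::'a \<times> real. \<phi> (fst p) * \<eta> (snd p)) \<in> borel_measurable borel"
      by (intro borel_measurable_times measurable_compose[OF borel_measurable_continuous_onI \<phi>m] 
          measurable_compose[OF borel_measurable_continuous_onI smooth_borel[OF sd]]
          measurable_compose[OF borel_measurable_continuous_onI smooth_borel[OF s\<eta>]] continuous_intros)+
    have b1: "\<bar>\<phi> x * ?d \<tau>\<bar> \<le> B * B1" "\<bar>\<phi> x * \<eta> \<tau>\<bar> \<le> B * B2" for x \<tau>
      unfolding abs_mult using B[of x] B1[of \<tau>] B2[of \<tau>] by (auto intro!: mult_mono)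
    have i1: "integrable lborel (\<lambda>p. (\<phi> (fst p) * ?d (snd p)) * W p)"
      by (rule integrable_bounded_mult[OF W(3) _ b1(1)]) (use m1 in simp)
    have i2: "integrable lborel (\<lambda>p. (\<phi> (fst p) * \<eta> (snd p)) * V p)"
      by (rule integrable_bounded_mult[OF V(3) _ b1(2)]) (use m1 in simp)
    have "(LINT p|lborel. (\<phi> (fst p) * ?d (snd p)) * W p) = - (LINT p|lborel. (\<phi> (fst p) * \<eta> (snd p)) * V p)"
      using weak[OF test_function_product(1)[OF \<phi> \<eta>]] unfolding test_function_product(2)[OF \<phi> \<eta>]
      by (simp add: mult.commute)
    moreover have "(LINT p|lborel. (\<phi> (fst p) * ?d (snd p)) * W p) = (LINT \<tau>|lborel. g \<tau> * ?d \<tau>)"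
    proof -
      have "(LINT p|lborel. (\<phi> (fst p) * ?d (snd p)) * W p) = (LINT \<tau>|lborel. LINT x|lborel. (\<phi> x * ?d \<tau>) * W (x, \<tau>))"
        using product_lborel(3)[OF i1] by simp
      also have "\<dots> = (LINT \<tau>|lborel. g \<tau> * ?d \<tau>)"
      proof (rule integral_cong_AE)
        show "(\<lambda>\<tau>. LINT x|lborel. (\<phi> x * ?d \<tau>) * W (x, \<tau>)) \<in> borel_measurable lborel"
          using product_lborel(2)[OF i1] by (simp add: borel_measurable_integrable)
        show "(\<lambda>\<tau>. g \<tau> * ?d \<tau>) \<in> borel_measurable lborel"
          using borel_measurable_continuous_onI[OF gc] smooth_borel[OF sd] by simp
        show "AE \<tau> in lborel. (LINT x|lborel. (\<phi> x * ?d \<tau>) * W (x, \<tau>)) = g \<tau> * ?d \<tau>"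
          using wW
        proof eventually_elim
          case (elim \<tau>)
          show ?case
          proof (cases "\<tau> \<in> {0<..<T}")
            case True
            have "(LINT x|lborel. \<phi> x * W (x, \<tau>)) = (LINT x|lborel. \<phi> x * w \<tau> x)"
            proof (rule integral_cong_AE)
              show "AE x in lborel. \<phi> x * W (x, \<tau>) = \<phi> x * w \<tau> x" using elim True by auto
            qed (use \<phi>m slice_measurable[OF W(1)] w[of \<tau>] in \<open>auto simp: sq_int_def\<close>)
            moreover have "(LINT x|lborel. (\<phi> x * ?d \<tau>) * W (x, \<tau>)) = ?d \<tau> * (LINT x|lborel. \<phi> x * W (x, \<tau>))"
              by (subst integral_mult_right_zero[symmetric]) (simp add: mult_ac)
            ultimately show ?thesis by (simp add: g_def mult.commute)
          qed (simp add: off)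
        qed
      qed
      finally show ?thesis .
    qed
    moreover have "(LINT p|lborel. (\<phi> (fst p) * \<eta> (snd p)) * V p) = (LINT \<tau>|lborel. (LINT x|lborel. V (x, \<tau>) * \<phi> x) * \<eta> \<tau>)"
    proof -
      have "(LINT x|lborel. (\<phi> x * \<eta> \<tau>) * V (x, \<tau>)) = (LINT x|lborel. V (x, \<tau>) * \<phi> x) * \<eta> \<tau>" for \<tau>
        by (subst integral_mult_left_zero[symmetric]) (simp add: mult_ac)
      then show ?thesis using product_lborel(3)[OF i2] by simp
    qed
    ultimately show ?thesis by simp
  qed
  show ?thesis
    using weak_derivative_imp_integral[OF gc pairing_integrable[OF sq] weak' st] by (simp add: gd)
qed

text \<open>The formula is needed for f = w(t) - w(s) and f = w(t) + w(s), which are not test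
  functions. Weak approximation handles each time slice, and its uniform bound gives the integrable
  majorant |C| N in time.\<close>

lemma increment:
  assumes f: "sq_int \<Omega> f" and st: "0 < s" "s < t" "t < T"
  shows "(LINT x|lborel. (w t x - w s x) * f x) = (LINT \<tau>|lborel. indicator {s<..t} \<tau> * (LINT x|lborel. V (x, \<tau>) * f x))"
proof -
  have "weakly_approximable \<Omega> f"
    using f sq_int_integrable[OF f \<Omega>(1,2)] by (intro mollification_weakly_approximable[OF \<Omega>]) (auto simp: sq_int_def)
  then obtain \<phi> C where \<phi>: "\<And>n. \<phi> n \<in> test_functions \<Omega>" 
    and approx: "\<And>v. v \<in> borel_measurable borel \<Longrightarrow> integrable lborel v \<Longrightarrow> integrable lborel (\<lambda>x. (v x)\<^sup>2) \<Longrightarrow>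
       (\<lambda>n. LINT x|lborel. v x * \<phi> n x) \<longlonglongrightarrow> (LINT x|lborel. v x * f x) \<and>
       (\<forall>n. \<bar>LINT x|lborel. v x * \<phi> n x\<bar> \<le> C * sqrt (LINT x|lborel. (v x)\<^sup>2))"
    unfolding weakly_approximable_def by blast
  have approx': "(\<lambda>n. LINT x|lborel. v x * \<phi> n x) \<longlonglongrightarrow> (LINT x|lborel. v x * f x)" 
     "\<bar>LINT x|lborel. v x * \<phi> n x\<bar> \<le> C * norm2 v" if "sq_int \<Omega> v" for v n
    using approx[of v] that sq_int_integrable[OF that \<Omega>(1,2)] by (auto simp: sq_int_def norm2_def)
  have l1: "(\<lambda>n. LINT x|lborel. (w t x - w s x) * \<phi> n x) \<longlonglongrightarrow> (LINT x|lborel. (w t x - w s x) * f x)"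
    by (rule approx'(1)[OF sq_int_diff[OF w w]])
  have "(\<lambda>n. LINT \<tau>|lborel. indicator {s<..t} \<tau> * (LINT x|lborel. V (x, \<tau>) * \<phi> n x)) \<longlonglongrightarrow> 
     (LINT \<tau>|lborel. indicator {s<..t} \<tau> * (LINT x|lborel. V (x, \<tau>) * f x))"
  proof (rule integral_dominated_convergence[where w="\<lambda>\<tau>. \<bar>C\<bar> * N \<tau>"])
    show "(\<lambda>\<tau>. indicator {s<..t} \<tau> * (LINT x|lborel. V (x, \<tau>) * f x)) \<in> borel_measurable lborel"
      using pairing_measurable[of f] f by (auto simp: sq_int_def)
    show "(\<lambda>\<tau>. indicator {s<..t} \<tau> * (LINT x|lborel. V (x, \<tau>) * \<phi> n x)) \<in> borel_measurable lborel" for n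
      using pairing_measurable[of "\<phi> n"] smooth_borel[OF test_functionsD(1)[OF \<phi>]] by auto
    show "integrable lborel (\<lambda>\<tau>. \<bar>C\<bar> * N \<tau>)" using N_integrable by simp
    show "AE \<tau> in lborel. (\<lambda>n. indicator {s<..t} \<tau> * (LINT x|lborel. V (x, \<tau>) * \<phi> n x)) \<longlonglongrightarrow> 
       indicator {s<..t} \<tau> * (LINT x|lborel. V (x, \<tau>) * f x)"
      using V_slice by eventually_elim (intro tendsto_mult tendsto_const approx'(1))
    show "AE \<tau> in lborel. norm (indicator {s<..t} \<tau> * (LINT x|lborel. V (x, \<tau>) * \<phi> n x)) \<le> \<bar>C\<bar> * N \<tau>" for n
      using V_slice
    proof eventually_elim
      case (elim \<tau>)
      have "\<bar>LINT x|lborel. V (x, \<tau>) * \<phi> n x\<bar> \<le> C * N \<tau>" using approx'(2)[OF elim] by (simp add: N_def)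
      also have "\<dots> \<le> \<bar>C\<bar> * N \<tau>" using norm2_nonneg by (intro mult_right_mono) (auto simp: N_def)
      finally show ?case using norm2_nonneg by (auto simp: indicator_def N_def)
    qed
  qed
  moreover have "(LINT x|lborel. (w t x - w s x) * \<phi> n x) = (LINT \<tau>|lborel. indicator {s<..t} \<tau> * (LINT x|lborel. V (x, \<tau>) * \<phi> n x))" for n
    by (rule increment_test[OF \<phi> st])
  ultimately show ?thesis using l1 LIMSEQ_unique by simp
qed

lemma integrable_indicator_N: "integrable lborel (\<lambda>\<tau>. indicator {s<..t} \<tau> * N \<tau>)"
  using integrable_mult_indicator[OF _ N_integrable, of "{s<..t}"] by simp

text \<open>The increment is paired with itself, and one factor of its norm is divided out.\<close>

lemma increment_norm:
  assumes st: "0 < s" "s < t" "t < T"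
  shows "norm2 (\<lambda>x. w t x - w s x) \<le> (LINT \<tau>|lborel. indicator {s<..t} \<tau> * N \<tau>)"
proof -
  let ?f = "\<lambda>x. w t x - w s x"
  have f: "sq_int \<Omega> ?f" by (rule sq_int_diff[OF w w])
  let ?I = "LINT \<tau>|lborel. indicator {s<..t} \<tau> * N \<tau>"
  have "norm2 ?f * norm2 ?f = (LINT x|lborel. ?f x * ?f x)"
    using norm2_square[of ?f] by (simp add: power2_eq_square)
  also have "\<dots> = (LINT \<tau>|lborel. indicator {s<..t} \<tau> * (LINT x|lborel. V (x, \<tau>) * ?f x))"
    by (rule increment[OF f st])
  also have "\<dots> \<le> (LINT \<tau>|lborel. norm2 ?f * (indicator {s<..t} \<tau> * N \<tau>))"
  proof (rule integral_mono_AE)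
    show "integrable lborel (\<lambda>\<tau>. indicator {s<..t} \<tau> * (LINT x|lborel. V (x, \<tau>) * ?f x))"
      using integrable_mult_indicator[OF _ pairing_integrable[OF f], of "{s<..t}"] by simp
    show "integrable lborel (\<lambda>\<tau>. norm2 ?f * (indicator {s<..t} \<tau> * N \<tau>))"
      by (intro integrable_mult_right integrable_indicator_N)
    show "AE \<tau> in lborel. indicator {s<..t} \<tau> * (LINT x|lborel. V (x, \<tau>) * ?f x) \<le> norm2 ?f * (indicator {s<..t} \<tau> * N \<tau>)"
      using pairing_bound[OF f] by eventually_elim (auto simp: indicator_def mult.commute)
  qed
  also have "\<dots> = norm2 ?f * ?I" by simp
  finally have le: "norm2 ?f * norm2 ?f \<le> norm2 ?f * ?I" .
  have "0 \<le> ?I" using norm2_nonneg by (intro integral_nonneg_AE AE_I2) (auto simp: N_def indicator_def)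
  then show ?thesis using le norm2_nonneg[of ?f] by (cases "norm2 ?f = 0") auto
qed

text \<open>The left side pairs the increment with w(t) + w(s). For each \<tau> this sum is 2
  w(\<tau>) + (w(t) - w(\<tau>)) - (w(\<tau>) - w(s)): the first term is dissipative, and the other
  two are bounded by the integrals of N over (\<tau>, t] and (s, \<tau>]. The result is the square
  of the integral of N over (s, t], to which Cauchy-Schwarz applies.\<close>

lemma energy_increment:
  assumes st: "0 < s" "s < t" "t < T"
  shows "(norm2 (w t))\<^sup>2 - (norm2 (w s))\<^sup>2 \<le> (t - s) * (LINT \<tau>|lborel. indicator {s<..t} \<tau> * E \<tau>)"
proof -
  let ?f = "\<lambda>x. w t x + w s x" and ?J = "\<lambda>a b. LINT \<tau>|lborel. indicator {a<..b} \<tau> * N \<tau>"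
  have f: "sq_int \<Omega> ?f" by (rule sq_int_add[OF w w])
  have Nn: "0 \<le> N \<tau>" for \<tau> by (simp add: N_def norm2_nonneg)
  have wi: "integrable lborel (\<lambda>x. (w t x)\<^sup>2)" for t using w by (simp add: sq_int_def)
  have "(norm2 (w t))\<^sup>2 - (norm2 (w s))\<^sup>2 = (LINT x|lborel. (w t x - w s x) * ?f x)"
    unfolding norm2_square Bochner_Integration.integral_diff[OF wi wi, symmetric]
    by (intro Bochner_Integration.integral_cong refl) (simp add: power2_eq_square algebra_simps)
  also have "\<dots> = (LINT \<tau>|lborel. indicator {s<..t} \<tau> * (LINT x|lborel. V (x, \<tau>) * ?f x))"
    by (rule increment[OF f st])
  also have "\<dots> \<le> (LINT \<tau>|lborel. ?J s t * (indicator {s<..t} \<tau> * N \<tau>))"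
  proof (rule integral_mono_AE)
    show "integrable lborel (\<lambda>\<tau>. indicator {s<..t} \<tau> * (LINT x|lborel. V (x, \<tau>) * ?f x))"
      using integrable_mult_indicator[OF _ pairing_integrable[OF f], of "{s<..t}"] by simp
    show "integrable lborel (\<lambda>\<tau>. ?J s t * (indicator {s<..t} \<tau> * N \<tau>))"
      by (intro integrable_mult_right integrable_indicator_N)
    show "AE \<tau> in lborel. indicator {s<..t} \<tau> * (LINT x|lborel. V (x, \<tau>) * ?f x) \<le> ?J s t * (indicator {s<..t} \<tau> * N \<tau>)"
      \<comment> \<open>The endpoint \<tau> = t is discarded as a null set, so that
        \<open>increment_norm\<close> applies on both sides of \<tau> with strict
        inequalities.\<close>
      using V_slice wW diss AE_lborel_singleton[of t]
    proof eventually_elim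
      case (elim \<tau>)
      show ?case
      proof (cases "\<tau> \<in> {s<..t}")
        case True
        then have \<tau>: "0 < \<tau>" "s < \<tau>" "\<tau> < t" "\<tau> < T" using st elim(4) by auto
        have d: "sq_int \<Omega> (\<lambda>x. w t x - w \<tau> x)" "sq_int \<Omega> (\<lambda>x. w \<tau> x - w s x)" by (intro sq_int_diff w)+
        note i = sq_int_integrable_mult(1)[OF elim(1)]
        have "(LINT x|lborel. V (x, \<tau>) * ?f x) = (LINT x|lborel. 2 * (V (x, \<tau>) * w \<tau> x) + V (x, \<tau>) * (w t x - w \<tau> x) - V (x, \<tau>) * (w \<tau> x - w s x))"
          by (intro Bochner_Integration.integral_cong refl) (simp add: algebra_simps)
        also have "\<dots> = 2 * (LINT x|lborel. V (x, \<tau>) * w \<tau> x) + (LINT x|lborel. V (x, \<tau>) * (w t x - w \<tau> x)) - (LINT x|lborel. V (x, \<tau>) * (w \<tau> x - w s x))"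
          using i[OF w, of \<tau>] i[OF d(1)] i[OF d(2)] 
          by (simp only: Bochner_Integration.integral_diff Bochner_Integration.integral_add integrable_mult_right integral_mult_right_zero Bochner_Integration.integrable_add)
        also have "(LINT x|lborel. V (x, \<tau>) * w \<tau> x) = (LINT x|lborel. W (x, \<tau>) * V (x, \<tau>))"
        proof (rule integral_cong_AE)
          have "AE x in lborel. w \<tau> x = W (x, \<tau>)" using elim(2) \<tau> by auto
          then show "AE x in lborel. V (x, \<tau>) * w \<tau> x = W (x, \<tau>) * V (x, \<tau>)" by eventually_elim simp
        qed (use w[of \<tau>] slice_measurable[OF W(1)] slice_measurable[OF V(1)] in \<open>auto simp: sq_int_def\<close>)
        also have "2 * (LINT x|lborel. W (x, \<tau>) * V (x, \<tau>)) + (LINT x|lborel. V (x, \<tau>) * (w t x - w \<tau> x)) - (LINT x|lborel. V (x, \<tau>) * (w \<tau> x - w s x))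
            \<le> N \<tau> * ?J \<tau> t + N \<tau> * ?J s \<tau>"
        proof -
          have "(LINT x|lborel. W (x, \<tau>) * V (x, \<tau>)) \<le> 0" using elim(3) \<tau> by auto
          moreover have "\<bar>LINT x|lborel. V (x, \<tau>) * (w t x - w \<tau> x)\<bar> \<le> N \<tau> * ?J \<tau> t"
            using sq_int_integrable_mult(2)[OF elim(1) d(1)] mult_left_mono[OF increment_norm[of \<tau> t] Nn[of \<tau>]] \<tau> st
            unfolding N_def by linarith
          moreover have "\<bar>LINT x|lborel. V (x, \<tau>) * (w \<tau> x - w s x)\<bar> \<le> N \<tau> * ?J s \<tau>"
            using sq_int_integrable_mult(2)[OF elim(1) d(2)] mult_left_mono[OF increment_norm[of s \<tau>] Nn[of \<tau>]] \<tau> st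
            unfolding N_def by linarith
          ultimately show ?thesis by linarith
        qed
        also have "\<dots> = N \<tau> * ?J s t"
        proof -
          have "indicator {s<..t} x * N x = indicator {\<tau><..t} x * N x + indicator {s<..\<tau>} x * N x" for x
            using \<tau> by (auto simp: indicator_def)
          then have "?J s t = ?J \<tau> t + ?J s \<tau>"
            using Bochner_Integration.integral_add[OF integrable_indicator_N integrable_indicator_N, of \<tau> t s \<tau>] by simp
          then show ?thesis by (simp add: distrib_left)
        qed
        finally show ?thesis using True by (simp add: mult.commute)
      qed simp
    qed
  qed
  also have "\<dots> = (?J s t)\<^sup>2" by (simp add: power2_eq_square)
  also have "\<dots> \<le> (t - s) * (LINT \<tau>|lborel. indicator {s<..t} \<tau> * E \<tau>)"
  proof -
    have sqI: "(indicator {s<..t} x * N x)\<^sup>2 = indicator {s<..t} x * E x" for x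
      by (simp add: power_mult_distrib N_square indicator_def)
    have "integrable lborel (\<lambda>\<tau>. indicator {s<..t} \<tau> * E \<tau>)"
      using integrable_mult_indicator[OF _ E_integrable, of "{s<..t}"] by simp
    then have i: "integrable lborel (\<lambda>x. (indicator {s<..t} x * N x)\<^sup>2)" unfolding sqI .
    have i': "integrable lborel (\<lambda>x. (indicator {s<..t} x :: real)\<^sup>2)" 
      using st by (simp add: power2_eq_square flip: indicator_inter_arith)
    have "(LINT x|lborel. indicator {s<..t} x * (indicator {s<..t} x * N x))\<^sup>2 \<le> (LINT x|lborel. (indicator {s<..t} x)\<^sup>2) * (LINT x|lborel. (indicator {s<..t} x * N x)\<^sup>2)"
      using borel_measurable_integrable[OF N_integrable] by (intro Cauchy_Schwarz_integral[OF _ _ i' i]) auto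
    moreover have "(LINT x|lborel. (indicator {s<..t} x :: real)\<^sup>2) = t - s"
      using st by (simp add: power2_eq_square flip: indicator_inter_arith)
    moreover have "indicator {s<..t} x * (indicator {s<..t} x * N x) = indicator {s<..t} x * N x" for x by (simp add: indicator_def)
    ultimately show ?thesis unfolding sqI by simp
  qed
  finally show ?thesis .
qed

text \<open>On n equal pieces the increment bounds add up to (t - s)/n times the integral of E,
  since the integrals over the pieces are additive. This tends to 0, so only the sign of the
  dissipation survives.\<close>

lemma energy_nonincreasing:
  assumes st: "0 < s" "s < t" "t < T"
  shows "(norm2 (w t))\<^sup>2 \<le> (norm2 (w s))\<^sup>2"
proof -
  let ?e = "\<lambda>t. (norm2 (w t))\<^sup>2"
  define I where "I = (LINT \<tau>|lborel. E \<tau>)"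
  have iE: "integrable lborel (\<lambda>\<tau>. indicator {a<..b} \<tau> * E \<tau>)" for a b
    using integrable_mult_indicator[OF _ E_integrable, of "{a<..b}"] by simp
  have le: "?e t - ?e s \<le> (t - s) / real n * I" if n: "n > 0" for n :: nat
  proof -
    define d where "d = (t - s) / real n"
    define p where "p = (\<lambda>i::nat. s + real i * d)"
    have d: "d > 0" using st n by (simp add: d_def)
    have p: "p 0 = s" "p n = t" using n by (auto simp: p_def d_def)
    have pi: "?e (p k) - ?e s \<le> d * (LINT \<tau>|lborel. indicator {s<..p k} \<tau> * E \<tau>)" if "k \<le> n" for k
      using that
    proof (induction k)
      case 0
      then show ?case using p by simp
    next
      case (Suc k)
      have pk: "s \<le> p k" "p k < p (Suc k)" "p (Suc k) - p k = d" using d by (auto simp: p_def algebra_simps)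
      have "p (Suc k) \<le> p n" using Suc.prems d by (simp add: p_def)
      then have "?e (p (Suc k)) - ?e (p k) \<le> d * (LINT \<tau>|lborel. indicator {p k<..p (Suc k)} \<tau> * E \<tau>)"
        using energy_increment[of "p k" "p (Suc k)"] pk p st by simp
      moreover have "(LINT \<tau>|lborel. indicator {s<..p (Suc k)} \<tau> * E \<tau>) = 
        (LINT \<tau>|lborel. indicator {s<..p k} \<tau> * E \<tau>) + (LINT \<tau>|lborel. indicator {p k<..p (Suc k)} \<tau> * E \<tau>)"
        unfolding Bochner_Integration.integral_add[OF iE iE, symmetric]
        using pk by (intro Bochner_Integration.integral_cong refl) (auto simp: indicator_def)
      ultimately show ?case using Suc by (simp add: distrib_left)
    qed
    have "(LINT \<tau>|lborel. indicator {s<..t} \<tau> * E \<tau>) \<le> I"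
      unfolding I_def using E_nonneg by (intro integral_mono iE E_integrable) (auto simp: indicator_def)
    then have "d * (LINT \<tau>|lborel. indicator {s<..t} \<tau> * E \<tau>) \<le> d * I" using d by (intro mult_left_mono) auto
    then show ?thesis using pi[of n] p by (simp add: d_def)
  qed
  have "(\<lambda>n. (t - s) / real n * I) \<longlonglongrightarrow> 0 * I"
    by (intro tendsto_mult lim_const_over_n tendsto_const)
  then have "?e t - ?e s \<le> 0 * I"
    by (rule tendsto_lowerbound) (use le in \<open>auto simp: eventually_sequentially intro!: exI[of _ 1]\<close>)
  then show ?thesis by simp
qed

text \<open>The energy is known to decrease only between interior times, so time 0 is reached by
  continuity: the norm at t is at most the norm at s, and the latter tends to 0 as s decreases to
  0.\<close>

lemma norm2_zero:
  assumes t: "0 < t" "t < T"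
  shows "norm2 (w t) = 0"
proof -
  have w0n: "norm2 (\<lambda>x. w s x - w 0 x) = norm2 (w s)" for s
  proof -
    have "(LINT x|lborel. (w s x - w 0 x)\<^sup>2) = (LINT x|lborel. (w s x)\<^sup>2)"
    proof (rule integral_cong_AE)
      show "AE x in lborel. (w s x - w 0 x)\<^sup>2 = (w s x)\<^sup>2" using w0 by eventually_elim simp
    qed (use w[of s] w[of 0] in \<open>auto simp: sq_int_def\<close>)
    then show ?thesis by (simp add: norm2_def)
  qed
  have "((\<lambda>s. norm2 (w s)) \<longlongrightarrow> 0) (at_right 0)"
    using w_cont[of 0] unfolding w0n by (rule filterlim_mono) (simp_all add: at_le)
  then have "((\<lambda>s. (norm2 (w s))\<^sup>2) \<longlongrightarrow> 0\<^sup>2) (at_right 0)" by (rule tendsto_power)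
  moreover have "\<forall>\<^sub>F s in at_right 0. (norm2 (w t))\<^sup>2 \<le> (norm2 (w s))\<^sup>2"
    using eventually_at_right_less[of "0::real"] eventually_at_right_real[OF t(1)]
    by eventually_elim (use energy_nonincreasing t in auto)
  ultimately have "(norm2 (w t))\<^sup>2 \<le> 0\<^sup>2" by (rule tendsto_lowerbound) simp
  then show ?thesis by simp
qed

lemma evolution_zero: "AE p in lborel. W p = 0"
proof -
  have "AE t in lborel. AE x in lborel. W (x, t) = 0"
    using wW
  proof eventually_elim
    case (elim t)
    show ?case
    proof (cases "t \<in> {0<..<T}")
      case True
      have wt: "integrable lborel (\<lambda>x. (w t x)\<^sup>2)" using w[of t] by (simp add: sq_int_def)
      have "(LINT x|lborel. (w t x)\<^sup>2) = 0" using norm2_zero[of t] True norm2_square[of "w t"] by simp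
      then have "AE x in lborel. (w t x)\<^sup>2 = 0" using integral_nonneg_eq_0_iff_AE[OF wt] by simp
      moreover have "AE x in lborel. w t x = W (x, t)" using elim True by simp
      ultimately show ?thesis by eventually_elim simp
    next
      case False
      then show ?thesis using W(2) by (intro AE_I2) auto
    qed
  qed
  \<comment> \<open>Vanishing of almost all slices is passed to the product space through the
    integral of |W|.\<close>
  then have "(LINT t|lborel. LINT x|lborel. \<bar>W (x, t)\<bar>) = 0"
  proof -
    assume ae: "AE t in lborel. AE x in lborel. W (x, t) = 0"
    have "AE t in lborel. (LINT x|lborel. \<bar>W (x, t)\<bar>) = 0"
      using ae
    proof eventually_elim
      case (elim t)
      have "(LINT x|lborel. \<bar>W (x, t)\<bar>) = (LINT x|(lborel::'a measure). 0)"
        by (rule integral_cong_AE) (use elim slice_measurable[OF W(1)] in auto)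
      then show ?case by simp
    qed
    then show ?thesis by (rule integral_eq_zero_AE)
  qed
  then have "(LINT p|lborel. \<bar>W p\<bar>) = 0"
    using product_lborel(3)[OF integrable_abs[OF W(3)]] by simp
  then have "AE p in lborel. \<bar>W p\<bar> = 0"
    using integral_nonneg_eq_0_iff_AE[OF integrable_abs[OF W(3)]] by simp
  then show ?thesis by simp
qed

end

section \<open>Uniqueness\<close>

lemma AE_lborel_slices:
  fixes P :: "'a::euclidean_space \<times> real \<Rightarrow> bool"
  assumes "AE p in lborel. P p"
  shows "AE t in lborel. AE x in lborel. P (x, t)"
proof -
  obtain Z where Z: "{p. \<not> P p} \<subseteq> Z" "emeasure lborel Z = 0" "Z \<in> sets lborel" using AE_E[OF assms] by auto
  have m: "(indicator Z :: _ \<Rightarrow> real) \<in> borel_measurable borel" using Z(3) by auto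
  have i: "integrable lborel (indicator Z :: _ \<Rightarrow> real)" using Z by (intro integrable_real_indicator) auto
  have "(LINT t|lborel. LINT x|lborel. indicator Z (x, t)) = (0::real)"
    using product_lborel(3)[OF i] Z by (simp add: measure_def)
  then have "AE t in lborel. (LINT x|lborel. indicator Z (x, t)) = (0::real)"
    using integral_nonneg_eq_0_iff_AE[OF product_lborel(2)[OF i]] by simp
  with product_lborel(1)[OF i] show ?thesis
  proof eventually_elim
    case (elim t)
    then have "AE x in lborel. indicator Z (x, t) = (0::real)" using integral_nonneg_eq_0_iff_AE[OF elim(1)] by simp
    then show ?case by eventually_elim (use Z(1) in \<open>auto simp: indicator_def split: if_splits\<close>)
  qed
qed

lemma L2_representative:
  fixes f :: "'a::euclidean_space \<Rightarrow> real"
  assumes f: "f \<in> L2 S" and S: "open S"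
  obtains f' where "sq_int S f'" "AE x in lborel. x \<in> S \<longrightarrow> f' x = f x"
proof -
  have Sb: "S \<in> sets borel" using S by simp
  have fm: "f \<in> borel_measurable (lebesgue_on S)" using f by (simp add: L2_def)
  obtain f' where f': "f' \<in> borel_measurable borel" "\<And>x. x \<notin> S \<Longrightarrow> f' x = 0" "AE x in lborel. x \<in> S \<longrightarrow> f' x = f x"
    by (rule borel_representative[OF fm Sb]) (rule that)
  have "AE x in lborel. x \<in> S \<longrightarrow> (f' x)\<^sup>2 = (f x)\<^sup>2" using f'(3) by eventually_elim auto
  then have "integrable lborel (\<lambda>x. (f' x)\<^sup>2)"
    using integrable_lebesgue_on_iff[of "\<lambda>x. (f' x)\<^sup>2" S "\<lambda>x. (f x)\<^sup>2"] f f'(1,2) Sb by (simp add: L2_def)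
  then show thesis using f' by (intro that[of f']) (auto simp: sq_int_def)
qed

text \<open>Clamping the time to [0, T] extends the representative by constants in time, so that
  continuity within [0, T] becomes continuity at every real time.\<close>

lemma initial_value_representative:
  assumes init: "has_initial_value \<Omega> T u u0" and \<Omega>: "open \<Omega>" and T: "T > 0"
  obtains w where "\<And>t. sq_int \<Omega> (w t)" "\<And>s. ((\<lambda>t. LINT x|lborel. (w t x - w s x)\<^sup>2) \<longlongrightarrow> 0) (at s)"
    "AE t in lborel. t \<in> {0<..<T} \<longrightarrow> (AE x in lborel. x \<in> \<Omega> \<longrightarrow> w t x = u (x, t))"
    "AE x in lborel. x \<in> \<Omega> \<longrightarrow> w 0 x = u0 x"
proof -
  have \<Omega>b: "\<Omega> \<in> sets borel" using \<Omega> by simp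
  obtain w0 where w0: "\<And>t. t \<in> {0..T} \<Longrightarrow> w0 t \<in> L2 \<Omega>"
     "\<And>s. s \<in> {0..T} \<Longrightarrow> ((\<lambda>t. LINT x:\<Omega>|lebesgue. (w0 t x - w0 s x)\<^sup>2) \<longlongrightarrow> 0) (at s within {0..T})"
     "AE t in lebesgue_on {0<..<T}. AE x in lebesgue_on \<Omega>. w0 t x = u (x, t)"
     "AE x in lebesgue_on \<Omega>. w0 0 x = u0 x"
    using init unfolding has_initial_value_def by blast
  have "\<exists>f'. sq_int \<Omega> f' \<and> (AE x in lborel. x \<in> \<Omega> \<longrightarrow> f' x = w0 t x)" if "t \<in> {0..T}" for t
    by (rule L2_representative[OF w0(1)[OF that] \<Omega>]) blast
  then obtain w1 where w1: "\<And>t. t \<in> {0..T} \<Longrightarrow> sq_int \<Omega> (w1 t)" 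
    "\<And>t. t \<in> {0..T} \<Longrightarrow> AE x in lborel. x \<in> \<Omega> \<longrightarrow> w1 t x = w0 t x" by metis
  define cl where "cl = (\<lambda>t. max 0 (min T t))"
  have cl: "cl t \<in> {0..T}" "t \<in> {0..T} \<Longrightarrow> cl t = t" for t using T by (auto simp: cl_def)
  have clc: "(cl \<longlongrightarrow> cl s) (at s)" for s unfolding cl_def by (intro tendsto_intros)
  define D where "D = (\<lambda>s t. LINT x|lborel. (w1 t x - w1 s x)\<^sup>2)"
  have D: "D s t = (LINT x:\<Omega>|lebesgue. (w0 t x - w0 s x)\<^sup>2)" if "s \<in> {0..T}" "t \<in> {0..T}" for s t
    unfolding D_def
  proof (rule set_integral_lebesgue_eq[symmetric])
    show "AE x in lborel. x \<in> \<Omega> \<longrightarrow> (w1 t x - w1 s x)\<^sup>2 = (w0 t x - w0 s x)\<^sup>2"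
      using w1(2)[OF that(1)] w1(2)[OF that(2)] by eventually_elim auto
  qed (use w1(1)[OF that(1)] w1(1)[OF that(2)] in \<open>auto simp: sq_int_def\<close>)
  show thesis
  proof (rule that[of "\<lambda>t. w1 (cl t)"])
    show "sq_int \<Omega> (w1 (cl t))" for t using w1(1)[OF cl(1)] .
    show "((\<lambda>t. LINT x|lborel. (w1 (cl t) x - w1 (cl s) x)\<^sup>2) \<longlongrightarrow> 0) (at s)" for s
    proof -
      let ?s = "cl s"
      have "(D ?s \<longlongrightarrow> 0) (at ?s within {0..T})"
        using w0(2)[OF cl(1)[of s]]
        by (rule Lim_transform_eventually) (auto simp: eventually_at_filter D[OF cl(1)])
      \<comment> \<open>The hypothesis is a punctured limit, but the clamped time can equal
        \<open>?s\<close> for t different from s. The value 0 at \<open>?s\<close> upgrades the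
        limit to continuity, which is preserved by composition with \<open>cl\<close>.\<close>
      moreover have "D ?s ?s = 0" by (simp add: D_def)
      ultimately have "continuous (at ?s within {0..T}) (D ?s)" by (simp add: continuous_within)
      then have "((\<lambda>t. D ?s (cl t)) \<longlongrightarrow> D ?s ?s) (at s)"
        by (rule continuous_within_tendsto_compose[OF _ _ clc]) (use cl(1) in auto)
      then show ?thesis using \<open>D ?s ?s = 0\<close> by (simp add: D_def)
    qed
    have "AE t in lborel. t \<in> {0<..<T} \<longrightarrow> (AE x in lborel. x \<in> \<Omega> \<longrightarrow> w0 t x = u (x, t))"
      using w0(3) by (simp add: AE_lebesgue_on_iff[OF \<Omega>b] AE_lebesgue_on_iff)
    then show "AE t in lborel. t \<in> {0<..<T} \<longrightarrow> (AE x in lborel. x \<in> \<Omega> \<longrightarrow> w1 (cl t) x = u (x, t))"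
    proof eventually_elim
      case (elim t)
      show ?case
      proof
        assume t: "t \<in> {0<..<T}"
        then have t': "t \<in> {0..T}" by auto
        from t elim have "AE x in lborel. x \<in> \<Omega> \<longrightarrow> w0 t x = u (x, t)" by blast
        then show "AE x in lborel. x \<in> \<Omega> \<longrightarrow> w1 (cl t) x = u (x, t)"
          using w1(2)[OF t'] unfolding cl(2)[OF t'] by eventually_elim auto
      qed
    qed
    have z: "0 \<in> {0..T}" using T by simp
    have "AE x in lborel. x \<in> \<Omega> \<longrightarrow> w0 0 x = u0 x" using w0(4) by (simp add: AE_lebesgue_on_iff[OF \<Omega>b])
    then show "AE x in lborel. x \<in> \<Omega> \<longrightarrow> w1 (cl 0) x = u0 x"
      using w1(2)[OF z] unfolding cl(2)[OF z] by eventually_elim auto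
  qed
qed

lemma bounded_slices_sq_int:
  fixes U :: "'a::euclidean_space \<times> real \<Rightarrow> real"
  assumes U: "U \<in> borel_measurable borel" "\<And>p. p \<notin> \<Omega> \<times> {0<..<T} \<Longrightarrow> U p = 0"
    and b: "AE t in lborel. t \<in> {0<..<T} \<longrightarrow> integrable lborel (\<lambda>x. (U (x, t))\<^sup>2) \<and> (LINT x|lborel. (U (x, t))\<^sup>2) \<le> C"
  shows "sq_int (\<Omega> \<times> {0<..<T}) U"
proof -
  have m: "(\<lambda>p. ennreal ((U p)\<^sup>2)) \<in> borel_measurable (lborel \<Otimes>\<^sub>M lborel)" using U(1) by (simp add: lborel_prod)
  have "(\<integral>\<^sup>+p. ennreal ((U p)\<^sup>2) \<partial>lborel) = (\<integral>\<^sup>+t. (\<integral>\<^sup>+x. ennreal ((U (x, t))\<^sup>2) \<partial>lborel) \<partial>lborel)"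
    using lborel_pair.nn_integral_snd[OF m] by (simp add: lborel_prod)
  also have "\<dots> \<le> (\<integral>\<^sup>+t. ennreal C * indicator {0<..<T} t \<partial>lborel)"
  proof (rule nn_integral_mono_AE)
    show "AE t in lborel. (\<integral>\<^sup>+x. ennreal ((U (x, t))\<^sup>2) \<partial>lborel) \<le> ennreal C * indicator {0<..<T} t"
      using b
    proof eventually_elim
      case (elim t)
      show ?case
      proof (cases "t \<in> {0<..<T}")
        case True
        then show ?thesis using elim by (simp add: nn_integral_eq_integral ennreal_leI)
      next
        case False
        then show ?thesis using U(2) by simp
      qed
    qed
  qed
  also have "\<dots> = ennreal C * emeasure lborel {0<..<T}" by (rule nn_integral_cmult_indicator) simp
  also have "\<dots> < \<infinity>" by (cases "0 \<le> T") (auto simp: ennreal_mult_less_top)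
  finally have "integrable lborel (\<lambda>p. (U p)\<^sup>2)" using U(1) by (intro integrableI_bounded) auto
  then show ?thesis using U by (auto simp: sq_int_def)
qed

text \<open>U and V are chosen once on the product space. By Fubini their slices agree with those of
  u and v for almost every time, and at such times the conditions on the slice carry over.\<close>

lemma young_solution_representatives:
  fixes \<Omega> \<Omega>' :: "'a::euclidean_space set"
  assumes \<Omega>: "bounded_domain \<Omega>" "lipschitz_boundary \<Omega>" and \<Omega>': "bounded_domain \<Omega>'" "closure \<Omega> \<subseteq> \<Omega>'"
    and q: "continuous_on UNIV q" "\<And>A. norm (q A) \<le> \<Lambda>"
    and \<psi>: "\<psi> \<in> borel_measurable borel" "\<And>\<eta>. \<eta> \<in> sphere 0 1 \<Longrightarrow> \<bar>\<psi> \<eta>\<bar> \<le> C"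
      "\<And>x \<eta>. x \<in> closure \<Omega> \<Longrightarrow> \<eta> \<noteq> 0 \<Longrightarrow> recession \<Omega> (\<lambda>x A. q A \<bullet> A) x \<eta> = \<psi> \<eta>"
    and q_le: "\<And>\<eta> \<xi>. \<eta> \<in> sphere 0 1 \<Longrightarrow> \<Phi> \<xi> = convexification \<Phi> \<xi> \<Longrightarrow> q \<xi> \<bullet> \<eta> \<le> \<psi> \<eta>"
    and T: "T > 0" and sol: "young_solution \<Omega> \<Omega>' T \<Phi> q u0 u Y"
  obtains U V where "sq_int (\<Omega> \<times> {0<..<T}) U" "sq_int (\<Omega> \<times> {0<..<T}) V"
    "AE p in lborel. p \<in> \<Omega> \<times> {0<..<T} \<longrightarrow> U p = u p"
    "\<And>\<phi>. \<phi> \<in> test_functions (\<Omega> \<times> {0<..<T}) \<Longrightarrow>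
      (LINT p|lborel. U p * frechet_derivative \<phi> (at p) (0, 1)) = - (LINT p|lborel. V p * \<phi> p)"
    "AE t in lborel. t \<in> {0<..<T} \<longrightarrow> (\<exists>\<nu> z a Q K b \<Psi>. 
      young_slice \<Omega> q \<psi> {A. \<Phi> A = convexification \<Phi> A} \<nu> (\<lambda>x. U (x, t)) (\<lambda>x. V (x, t)) z a Q K b \<Psi> \<Lambda>)"
proof -
  let ?S = "\<Omega> \<times> {0<..<T}"
  have \<Omega>o: "open \<Omega>" "bounded \<Omega>" using \<Omega> by (auto simp: bounded_domain_def)
  have So: "open ?S" "bounded ?S" using \<Omega>o by (auto intro: open_Times bounded_Times)
  have Sb: "?S \<in> sets borel" using So(1) by simp
  have \<Omega>b: "\<Omega> \<in> sets borel" using \<Omega>o(1) by simp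
  note AE_time = AE_lebesgue_on_iff[of "{0<..<T}", simplified]
  obtain M v where um: "u \<in> borel_measurable (lebesgue_on ?S)" 
    and bd: "AE t in lebesgue_on {0<..<T}. (\<lambda>x. u (x, t)) \<in> BV \<Omega> \<inter> L2 \<Omega> \<and>
        BV_norm \<Omega> (\<lambda>x. u (x, t)) \<le> ennreal M \<and> (LINT x:\<Omega>|lebesgue. (u (x, t))\<^sup>2) \<le> M"
    and Y: "AE t in lebesgue_on {0<..<T}. Y t \<in> young_measures \<Omega>"
    and v: "v \<in> L2 ?S" "weak_time_deriv \<Omega> T u v"
    and yc: "AE t in lebesgue_on {0<..<T}. young_conditions \<Omega> \<Omega>' \<Phi> q (\<lambda>x. u (x, t)) (\<lambda>x. v (x, t)) (Y t)"
    using sol unfolding young_solution_def by blast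
  obtain U where U: "U \<in> borel_measurable borel" "\<And>p. p \<notin> ?S \<Longrightarrow> U p = 0" "AE p in lborel. p \<in> ?S \<longrightarrow> U p = u p"
    by (rule borel_representative[OF um Sb]) (rule that)
  obtain V where V: "sq_int ?S V" "AE p in lborel. p \<in> ?S \<longrightarrow> V p = v p"
    by (rule L2_representative[OF v(1) So(1)]) (rule that)
  have Uae: "AE t in lborel. AE x in lborel. t \<in> {0<..<T} \<longrightarrow> x \<in> \<Omega> \<longrightarrow> U (x, t) = u (x, t)"
    using AE_lborel_slices[OF U(3)] by eventually_elim (auto elim: eventually_mono)
  have Vae: "AE t in lborel. AE x in lborel. t \<in> {0<..<T} \<longrightarrow> x \<in> \<Omega> \<longrightarrow> V (x, t) = v (x, t)"
    using AE_lborel_slices[OF V(2)] by eventually_elim (auto elim: eventually_mono)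
  have iV: "integrable lborel V" "integrable lborel (\<lambda>p. (V p)\<^sup>2)"
    using sq_int_integrable[OF V(1) So] V(1) by (auto simp: sq_int_def)
  have Uint: "integrable lborel (\<lambda>x. (U (x, t))\<^sup>2) \<and> (LINT x|lborel. (U (x, t))\<^sup>2) \<le> M"
    if ae: "AE x in lborel. x \<in> \<Omega> \<longrightarrow> U (x, t) = u (x, t)" and L: "(\<lambda>x. u (x, t)) \<in> L2 \<Omega>" "(LINT x:\<Omega>|lebesgue. (u (x, t))\<^sup>2) \<le> M" for t
  proof -
    have m: "(\<lambda>x. (U (x, t))\<^sup>2) \<in> borel_measurable borel" using slice_measurable[OF U(1)] by measurable
    have off: "(U (x, t))\<^sup>2 = 0" if "x \<notin> \<Omega>" for x using U(2) that by simp
    have ae': "AE x in lborel. x \<in> \<Omega> \<longrightarrow> (U (x, t))\<^sup>2 = (u (x, t))\<^sup>2" using ae by eventually_elim auto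
    show ?thesis
      using integrable_lebesgue_on_iff[OF m off ae' \<Omega>b] set_integral_lebesgue_eq[OF m off ae'] L by (simp add: L2_def)
  qed
  have Usq: "sq_int ?S U"
  proof (rule bounded_slices_sq_int[OF U(1,2)])
    show "AE t in lborel. t \<in> {0<..<T} \<longrightarrow> integrable lborel (\<lambda>x. (U (x, t))\<^sup>2) \<and> (LINT x|lborel. (U (x, t))\<^sup>2) \<le> M"
      using bd[unfolded AE_time] Uae
    proof eventually_elim
      case (elim t)
      show ?case
      proof
        assume t: "t \<in> {0<..<T}"
        then have "AE x in lborel. x \<in> \<Omega> \<longrightarrow> U (x, t) = u (x, t)" using elim(2) by (auto elim: eventually_mono)
        then show "integrable lborel (\<lambda>x. (U (x, t))\<^sup>2) \<and> (LINT x|lborel. (U (x, t))\<^sup>2) \<le> M"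
          using elim(1) t by (intro Uint) auto
      qed
    qed
  qed
  show thesis
  proof (rule that[OF Usq V(1) U(3)])
    fix \<phi> assume \<phi>: "\<phi> \<in> test_functions ?S"
    have s: "smooth \<phi>" by (rule test_functionsD(1)[OF \<phi>])
    have e1: "(0, 1) \<in> (Basis :: ('a \<times> real) set)" by (simp add: Basis_prod_def)
    have [measurable]: "\<phi> \<in> borel_measurable borel" "(\<lambda>p. frechet_derivative \<phi> (at p) (0, 1)) \<in> borel_measurable borel"
      using smooth_borel[OF s] smooth_borel[OF smooth_partial[OF s e1]] .
    have "(LINT p:?S|lebesgue. u p * frechet_derivative \<phi> (at p) (0, 1)) = (LINT p|lborel. U p * frechet_derivative \<phi> (at p) (0, 1))"
    proof (rule set_integral_lebesgue_eq)
      show "AE p in lborel. p \<in> ?S \<longrightarrow> U p * frechet_derivative \<phi> (at p) (0, 1) = u p * frechet_derivative \<phi> (at p) (0, 1)"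
        using U(3) by eventually_elim auto
      show "(\<lambda>p. U p * frechet_derivative \<phi> (at p) (0, 1)) \<in> borel_measurable borel" using U(1) by measurable
    qed (simp add: U(2))
    moreover have "(LINT p:?S|lebesgue. v p * \<phi> p) = (LINT p|lborel. V p * \<phi> p)"
    proof (rule set_integral_lebesgue_eq)
      show "AE p in lborel. p \<in> ?S \<longrightarrow> V p * \<phi> p = v p * \<phi> p"
        using V(2) by eventually_elim auto
      have "V \<in> borel_measurable borel" using V(1) by (simp add: sq_int_def)
      then show "(\<lambda>p. V p * \<phi> p) \<in> borel_measurable borel" by measurable
      show "V p * \<phi> p = 0" if "p \<notin> ?S" for p
      proof -
        have "V p = 0" using V(1) that unfolding sq_int_def by blast
        then show ?thesis by simp
      qed
    qed
    ultimately show "(LINT p|lborel. U p * frechet_derivative \<phi> (at p) (0, 1)) = - (LINT p|lborel. V p * \<phi> p)"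
      using v(2) \<phi> by (simp add: weak_time_deriv_def)
  next
    show "AE t in lborel. t \<in> {0<..<T} \<longrightarrow> (\<exists>\<nu> z a Q K b \<Psi>. 
      young_slice \<Omega> q \<psi> {A. \<Phi> A = convexification \<Phi> A} \<nu> (\<lambda>x. U (x, t)) (\<lambda>x. V (x, t)) z a Q K b \<Psi> \<Lambda>)"
      using bd[unfolded AE_time] Y[unfolded AE_time] yc[unfolded AE_time] Uae Vae product_lborel(1)[OF iV(1)] product_lborel(1)[OF iV(2)]
    proof eventually_elim
      case (elim t)
      show ?case
      proof
        assume t: "t \<in> {0<..<T}"
        obtain \<nu> \<kappa> \<nu>' where Yt: "Y t = (\<nu>, \<kappa>, \<nu>')" by (cases "Y t") auto
        have aeU: "AE x in lborel. x \<in> \<Omega> \<longrightarrow> U (x, t) = u (x, t)" using elim(4) t by (auto elim: eventually_mono)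
        have aeV: "AE x in lborel. x \<in> \<Omega> \<longrightarrow> V (x, t) = v (x, t)" using elim(5) t by (auto elim: eventually_mono)
        have offU: "U (x, t) = 0" if "x \<notin> \<Omega>" for x using U(2) that by simp
        have offV: "V (x, t) = 0" if "x \<notin> \<Omega>" for x using V(1) that by (simp add: sq_int_def)
        have Vm: "V \<in> borel_measurable borel" using V(1) by (simp add: sq_int_def)
        have BV: "(\<lambda>x. u (x, t)) \<in> BV \<Omega>" "(\<lambda>x. u (x, t)) \<in> L2 \<Omega>" using elim(1) t by auto
        have Y': "(\<nu>, \<kappa>, \<nu>') \<in> young_measures \<Omega>" using elim(2) t Yt by simp
        have yc': "young_conditions \<Omega> \<Omega>' \<Phi> q (\<lambda>x. u (x, t)) (\<lambda>x. v (x, t)) (\<nu>, \<kappa>, \<nu>')" using elim(3) t Yt by simp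
        have "\<exists>z a Q K b \<Psi>. young_slice \<Omega> q \<psi> {A. \<Phi> A = convexification \<Phi> A} \<nu> (\<lambda>x. U (x, t)) (\<lambda>x. V (x, t)) z a Q K b \<Psi> \<Lambda>"
          by (rule young_slice_exists[OF \<Omega> \<Omega>' q \<psi> q_le BV Y' yc' slice_measurable[OF U(1)] offU aeU
                slice_measurable[OF Vm] offV aeV elim(6,7)])
        then show "\<exists>\<nu> z a Q K b \<Psi>. 
          young_slice \<Omega> q \<psi> {A. \<Phi> A = convexification \<Phi> A} \<nu> (\<lambda>x. U (x, t)) (\<lambda>x. V (x, t)) z a Q K b \<Psi> \<Lambda>" by blast
      qed
    qed
  qed
qed

theorem theorem2:
  fixes \<Omega> \<Omega>' :: "'a::euclidean_space set"
    and \<Phi> :: "'a \<Rightarrow> real" and q :: "'a \<Rightarrow> 'a"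
    and u\<^sub>0 :: "'a \<Rightarrow> real" and T l\<^sub>0 \<Lambda> :: real
    and u\<^sub>1 u\<^sub>2 :: "'a \<times> real \<Rightarrow> real" and Y\<^sub>1 Y\<^sub>2 :: "real \<Rightarrow> 'a gym"
  assumes domain: "bounded_domain \<Omega>" "lipschitz_boundary \<Omega>"
    and larger_domain: "bounded_domain \<Omega>'" "smooth_boundary \<Omega>'" "closure \<Omega> \<subseteq> \<Omega>'"
    and gradient: "\<And>A. GDERIV \<Phi> A :> q A"
    and SH1: "continuous_on UNIV q" "\<And>A. \<Phi> 0 \<le> \<Phi> A" "(\<lambda>x. \<Phi>) \<in> integrands \<Omega>"
    and SH2: "0 < l\<^sub>0" "l\<^sub>0 \<le> \<Lambda>" "\<And>A. max (l\<^sub>0 * norm A - 1) 0 \<le> \<Phi> A"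
      "\<And>A. \<Phi> A \<le> \<Lambda> * norm A + 1" "\<And>A. norm (q A) \<le> \<Lambda>"
    and SH3: "(\<lambda>x A. q A \<bullet> A) \<in> integrands \<Omega>"
      "\<And>x A. x \<in> closure \<Omega> \<Longrightarrow> recession \<Omega> (\<lambda>x A. q A \<bullet> A) x A = recession \<Omega> (\<lambda>x. \<Phi>) x A"
      "\<And>x A. x \<in> closure \<Omega> \<Longrightarrow> recession \<Omega> (\<lambda>x. \<Phi>) x A = recession \<Omega> (\<lambda>x. convexification \<Phi>) x A"
    and SH4: "\<And>x \<eta> \<xi>. x \<in> closure \<Omega> \<Longrightarrow> \<eta> \<in> sphere 0 1 \<Longrightarrow> convexification \<Phi> \<xi> = \<Phi> \<xi> \<Longrightarrow>
      q \<xi> \<bullet> \<eta> \<le> recession \<Omega> (\<lambda>x A. q A \<bullet> A) x \<eta>"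
    and initial: "u\<^sub>0 \<in> BV \<Omega>" "u\<^sub>0 \<in> Linf \<Omega>" "is_trace \<Omega> u\<^sub>0 (\<lambda>x. 0)"
    and T: "T > 0"
    and solution1: "young_solution \<Omega> \<Omega>' T \<Phi> q u\<^sub>0 u\<^sub>1 Y\<^sub>1"
    and solution2: "young_solution \<Omega> \<Omega>' T \<Phi> q u\<^sub>0 u\<^sub>2 Y\<^sub>2"
  shows "AE p in lebesgue_on (\<Omega> \<times> {0<..<T}). u\<^sub>1 p = u\<^sub>2 p"
proof -
  let ?S = "\<Omega> \<times> {0<..<T}" and ?G = "{A. \<Phi> A = convexification \<Phi> A}"
  have \<Omega>: "open \<Omega>" "bounded \<Omega>" "\<Omega> \<noteq> {}" using domain by (auto simp: bounded_domain_def)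
  have S: "open ?S" "bounded ?S" using \<Omega> by (auto intro: open_Times bounded_Times)
  have Sb: "?S \<in> sets borel" using S(1) by simp
  obtain x0 where x0: "x0 \<in> closure \<Omega>" using \<Omega>(3) closure_subset by blast
  obtain \<psi> C where \<psi>: "\<psi> \<in> borel_measurable borel" "\<And>\<eta>. \<eta> \<in> sphere 0 1 \<Longrightarrow> \<bar>\<psi> \<eta>\<bar> \<le> C"
    "\<And>x \<eta>. x \<in> closure \<Omega> \<Longrightarrow> \<eta> \<noteq> 0 \<Longrightarrow> recession \<Omega> (\<lambda>x A. q A \<bullet> A) x \<eta> = \<psi> \<eta>"
    by (rule recession_representation[OF SH3(1) \<Omega>(3)]) (rule that)
  \<comment> \<open>One point x0 suffices in (SH4) because \<psi> does not depend on x; on the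
    sphere \<eta> is nonzero, so the recession value is \<psi> \<eta>.\<close>
  have q_le: "q \<xi> \<bullet> \<eta> \<le> \<psi> \<eta>" if "\<eta> \<in> sphere 0 1" "\<Phi> \<xi> = convexification \<Phi> \<xi>" for \<eta> \<xi>
    using SH4[OF x0 that(1) that(2)[symmetric]] \<psi>(3)[OF x0, of \<eta>] that(1) by fastforce
  have mono: "0 \<le> (q A - q B) \<bullet> (A - B)" if "A \<in> ?G" "B \<in> ?G" for A B
    using gradient_monotone_convexification[OF SH1(2) gradient] that by simp
  obtain U1 V1 where s1: "sq_int ?S U1" "sq_int ?S V1" "AE p in lborel. p \<in> ?S \<longrightarrow> U1 p = u\<^sub>1 p"
    "\<And>\<phi>. \<phi> \<in> test_functions ?S \<Longrightarrow> (LINT p|lborel. U1 p * frechet_derivative \<phi> (at p) (0, 1)) = - (LINT p|lborel. V1 p * \<phi> p)"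
    "AE t in lborel. t \<in> {0<..<T} \<longrightarrow> (\<exists>\<nu> z a Q K b \<Psi>. young_slice \<Omega> q \<psi> ?G \<nu> (\<lambda>x. U1 (x, t)) (\<lambda>x. V1 (x, t)) z a Q K b \<Psi> \<Lambda>)"
    by (rule young_solution_representatives[OF domain larger_domain(1,3) SH1(1) SH2(5) \<psi> q_le T solution1]) (assumption | rule that)+
  obtain U2 V2 where s2: "sq_int ?S U2" "sq_int ?S V2" "AE p in lborel. p \<in> ?S \<longrightarrow> U2 p = u\<^sub>2 p"
    "\<And>\<phi>. \<phi> \<in> test_functions ?S \<Longrightarrow> (LINT p|lborel. U2 p * frechet_derivative \<phi> (at p) (0, 1)) = - (LINT p|lborel. V2 p * \<phi> p)"
    "AE t in lborel. t \<in> {0<..<T} \<longrightarrow> (\<exists>\<nu> z a Q K b \<Psi>. young_slice \<Omega> q \<psi> ?G \<nu> (\<lambda>x. U2 (x, t)) (\<lambda>x. V2 (x, t)) z a Q K b \<Psi> \<Lambda>)"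
    by (rule young_solution_representatives[OF domain larger_domain(1,3) SH1(1) SH2(5) \<psi> q_le T solution2]) (assumption | rule that)+
  have "has_initial_value \<Omega> T u\<^sub>1 u\<^sub>0" "has_initial_value \<Omega> T u\<^sub>2 u\<^sub>0"
    using solution1 solution2 by (auto simp: young_solution_def)
  note init = this
  obtain w1 where w1: "\<And>t. sq_int \<Omega> (w1 t)" "\<And>s. ((\<lambda>t. LINT x|lborel. (w1 t x - w1 s x)\<^sup>2) \<longlongrightarrow> 0) (at s)"
    "AE t in lborel. t \<in> {0<..<T} \<longrightarrow> (AE x in lborel. x \<in> \<Omega> \<longrightarrow> w1 t x = u\<^sub>1 (x, t))"
    "AE x in lborel. x \<in> \<Omega> \<longrightarrow> w1 0 x = u\<^sub>0 x"
    by (rule initial_value_representative[OF init(1) \<Omega>(1) T]) (rule that)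
  obtain w2 where w2: "\<And>t. sq_int \<Omega> (w2 t)" "\<And>s. ((\<lambda>t. LINT x|lborel. (w2 t x - w2 s x)\<^sup>2) \<longlongrightarrow> 0) (at s)"
    "AE t in lborel. t \<in> {0<..<T} \<longrightarrow> (AE x in lborel. x \<in> \<Omega> \<longrightarrow> w2 t x = u\<^sub>2 (x, t))"
    "AE x in lborel. x \<in> \<Omega> \<longrightarrow> w2 0 x = u\<^sub>0 x"
    by (rule initial_value_representative[OF init(2) \<Omega>(1) T]) (rule that)
  define W where "W = (\<lambda>p. U1 p - U2 p)"
  define V where "V = (\<lambda>p. V1 p - V2 p)"
  define w where "w = (\<lambda>t x. w1 t x - w2 t x)"
  have Wsq: "sq_int ?S W" "sq_int ?S V" unfolding W_def V_def by (intro sq_int_diff s1 s2)+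
  have wsq: "sq_int \<Omega> (w t)" for t unfolding w_def by (intro sq_int_diff w1 w2)
  \<comment> \<open>Both representatives are continuous into L2, and the square of a difference is
    at most twice the sum of the squares.\<close>
  have w_cont: "((\<lambda>t. norm2 (\<lambda>x. w t x - w s x)) \<longlongrightarrow> 0) (at s)" for s
  proof -
    have le: "(LINT x|lborel. (w t x - w s x)\<^sup>2) \<le> 2 * (LINT x|lborel. (w1 t x - w1 s x)\<^sup>2) + 2 * (LINT x|lborel. (w2 t x - w2 s x)\<^sup>2)" for t
    proof -
      have i: "integrable lborel (\<lambda>x. (w1 t x - w1 s x)\<^sup>2)" "integrable lborel (\<lambda>x. (w2 t x - w2 s x)\<^sup>2)" "integrable lborel (\<lambda>x. (w t x - w s x)\<^sup>2)"
        using sq_int_diff[OF w1(1)[of t] w1(1)[of s]] sq_int_diff[OF w2(1)[of t] w2(1)[of s]] sq_int_diff[OF wsq[of t] wsq[of s]] 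
        by (auto simp: sq_int_def)
      have pt: "(w t x - w s x)\<^sup>2 \<le> 2 * (w1 t x - w1 s x)\<^sup>2 + 2 * (w2 t x - w2 s x)\<^sup>2" for x
      proof -
        have "0 \<le> ((w1 t x - w1 s x) + (w2 t x - w2 s x))\<^sup>2" by simp
        then show ?thesis by (simp add: w_def power2_eq_square algebra_simps)
      qed
      have "(LINT x|lborel. (w t x - w s x)\<^sup>2) \<le> (LINT x|lborel. 2 * (w1 t x - w1 s x)\<^sup>2 + 2 * (w2 t x - w2 s x)\<^sup>2)"
        using i pt by (intro integral_mono) auto
      then show ?thesis using i by simp
    qed
    have "((\<lambda>t. 2 * (LINT x|lborel. (w1 t x - w1 s x)\<^sup>2) + 2 * (LINT x|lborel. (w2 t x - w2 s x)\<^sup>2)) \<longlongrightarrow> 2 * 0 + 2 * 0) (at s)"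
      by (intro tendsto_intros w1(2) w2(2))
    then have "((\<lambda>t. 2 * (LINT x|lborel. (w1 t x - w1 s x)\<^sup>2) + 2 * (LINT x|lborel. (w2 t x - w2 s x)\<^sup>2)) \<longlongrightarrow> 0) (at s)" by simp
    then have "((\<lambda>t. LINT x|lborel. (w t x - w s x)\<^sup>2) \<longlongrightarrow> 0) (at s)"
      by (rule Lim_null_comparison[rotated]) (use le in \<open>auto intro!: always_eventually\<close>)
    then have "((\<lambda>t. sqrt (LINT x|lborel. (w t x - w s x)\<^sup>2)) \<longlongrightarrow> sqrt 0) (at s)" by (rule tendsto_real_sqrt)
    then show ?thesis by (simp add: norm2_def)
  qed
  have off: "w t x = 0" if "x \<notin> \<Omega>" for t x using wsq that by (simp add: sq_int_def)
  have wW: "AE t in lborel. t \<in> {0<..<T} \<longrightarrow> (AE x in lborel. w t x = W (x, t))"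
    using w1(3) w2(3) AE_lborel_slices[OF s1(3)] AE_lborel_slices[OF s2(3)]
  proof eventually_elim
    case (elim t)
    show ?case
    proof
      assume t: "t \<in> {0<..<T}"
      with elim(1,2) have "AE x in lborel. x \<in> \<Omega> \<longrightarrow> w1 t x = u\<^sub>1 (x, t)" "AE x in lborel. x \<in> \<Omega> \<longrightarrow> w2 t x = u\<^sub>2 (x, t)" by auto
      with elim(3,4) show "AE x in lborel. w t x = W (x, t)"
      proof eventually_elim
        case (elim x)
        show ?case
        proof (cases "x \<in> \<Omega>")
          case True
          then show ?thesis using elim t by (simp add: w_def W_def)
        next
          case False
          then show ?thesis using off[OF False] Wsq(1) by (simp add: sq_int_def)
        qed
      qed
    qed
  qed
  have w0: "AE x in lborel. w 0 x = 0"
    using w1(4) w2(4)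
  proof eventually_elim
    case (elim x)
    then show ?case using off[of x 0] by (cases "x \<in> \<Omega>") (auto simp: w_def)
  qed
  have weak: "(LINT p|lborel. W p * frechet_derivative \<phi> (at p) (0, 1)) = - (LINT p|lborel. V p * \<phi> p)"
    if \<phi>: "\<phi> \<in> test_functions ?S" for \<phi>
  proof -
    have s: "smooth \<phi>" by (rule test_functionsD(1)[OF \<phi>])
    have e1: "(0, 1) \<in> (Basis :: ('a \<times> real) set)" by (simp add: Basis_prod_def)
    let ?d = "\<lambda>p. frechet_derivative \<phi> (at p) (0, 1)"
    have sd: "smooth ?d" by (rule smooth_partial[OF s e1])
    obtain B1 where B1: "\<And>x. \<bar>?d x\<bar> \<le> B1"
      using bounded_of_support[OF Ck_continuous[OF smooth_Ck[OF sd]] bounded_support_partial[OF test_functionsD(2)[OF \<phi>]]] by metis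
    have i: "integrable lborel (\<lambda>p. U p * ?d p)" if "sq_int ?S U" for U
      using integrable_bounded_mult[OF sq_int_integrable[OF that S] _ B1] smooth_borel[OF sd] by (simp add: mult.commute)
    have j: "integrable lborel (\<lambda>p. U p * \<phi> p)" if "sq_int ?S U" for U
      by (rule sq_int_integrable_mult(1)[OF that test_function_sq_int[OF \<phi> S]])
    have "(LINT p|lborel. W p * ?d p) = (LINT p|lborel. U1 p * ?d p) - (LINT p|lborel. U2 p * ?d p)"
      unfolding W_def left_diff_distrib by (rule Bochner_Integration.integral_diff[OF i[OF s1(1)] i[OF s2(1)]])
    moreover have "(LINT p|lborel. V p * \<phi> p) = (LINT p|lborel. V1 p * \<phi> p) - (LINT p|lborel. V2 p * \<phi> p)"
      unfolding V_def left_diff_distrib by (rule Bochner_Integration.integral_diff[OF j[OF s1(2)] j[OF s2(2)]])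
    ultimately show ?thesis using s1(4)[OF \<phi>] s2(4)[OF \<phi>] by simp
  qed
  have diss: "AE t in lborel. t \<in> {0<..<T} \<longrightarrow> (LINT x|lborel. W (x, t) * V (x, t)) \<le> 0"
    using s1(5) s2(5)
  proof eventually_elim
    case (elim t)
    show ?case
    proof
      assume t: "t \<in> {0<..<T}"
      obtain \<nu>1 z1 a1 Q1 K1 b1 \<Psi>1 where y1: "young_slice \<Omega> q \<psi> ?G \<nu>1 (\<lambda>x. U1 (x, t)) (\<lambda>x. V1 (x, t)) z1 a1 Q1 K1 b1 \<Psi>1 \<Lambda>"
        using elim(1) t by blast
      obtain \<nu>2 z2 a2 Q2 K2 b2 \<Psi>2 where y2: "young_slice \<Omega> q \<psi> ?G \<nu>2 (\<lambda>x. U2 (x, t)) (\<lambda>x. V2 (x, t)) z2 a2 Q2 K2 b2 \<Psi>2 \<Lambda>"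
        using elim(2) t by blast
      show "(LINT x|lborel. W (x, t) * V (x, t)) \<le> 0"
        unfolding W_def V_def by (rule young_slice_dissipation[OF y1 y2 mono])
    qed
  qed
  interpret evolution \<Omega> T W V w
    by (rule evolution.intro[OF \<Omega>(1,2) domain(2) T sq_intD(1,2)[OF Wsq(1)] sq_int_integrable[OF Wsq(1) S]
          sq_intD(1,2)[OF Wsq(2)] sq_int_integrable[OF Wsq(2) S] sq_intD(3)[OF Wsq(2)] wsq w_cont wW w0 weak diss])
  have "AE p in lborel. p \<in> ?S \<longrightarrow> u\<^sub>1 p = u\<^sub>2 p"
    using evolution_zero s1(3) s2(3) by eventually_elim (auto simp: W_def)
  then show ?thesis by (simp add: AE_lebesgue_on_iff[OF Sb])
qed

end
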